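(* Let $d\ge3$ be odd and $\mu=\frac{d-1}{2}$. Let $G_-$ be a smooth function on $\mathbb{R}\times\mathbb{S}^{d-1}$ with $\mathrm{supp}\,G_-\subset[-R,R]\times\mathbb{S}^{d-1}$ (for some $R>0$). Then $(u_0,u_1)=\mathbf{T}_-^{-1}G_-$ satisfies $$u_0(x)=\frac{1}{(2\pi)^{\frac{d-1}{2}}}\int_{\mathbb{S}^{d-1}}G_-^{(\mu-1)}(x\cdot\omega,\omega)\,d\omega,\qquad u_1(x)=\frac{1}{(2\pi)^{\frac{d-1}{2}}}\int_{\mathbb{S}^{d-1}}G_-^{(\mu)}(x\cdot\omega,\omega)\,d\omega ,$$ where $G_-^{(k)}(s,\theta)=\dfrac{\partial^kG_-(s,\theta)}{\partial s^k}$.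
   Context: For $(u_0,u_1)\in\dot H^1\times L^2(\mathbb{R}^d)$ let $u$ solve $\partial_t^2u-\Delta u=0$ on $\mathbb{R}^d\times\mathbb{R}$ with $u|_{t=0}=u_0$, $u_t|_{t=0}=u_1$. It is known that there is a unique $G_-\in L^2(\mathbb{R}\times\mathbb{S}^{d-1})$ (the radiation profile as $t\to-\infty$) with $$\lim_{t\to-\infty}\int_0^\infty\!\!\int_{\mathbb{S}^{d-1}}\Big(\big|r^{\frac{d-1}{2}}\partial_tu(r\theta,t)-G_-(r+t,\theta)\big|^2+\big|r^{\frac{d-1}{2}}\partial_ru(r\theta,t)-G_-(r+t,\theta)\big|^2\Big)d\theta\,dr=0 .$$ $\mathbf{T}_-:(u_0,u_1)\mapsto G_-$; it is known that $\sqrt2\,\mathbf{T}_-$ is a bijective linear isometry from $\dot H^1\times L^2(\mathbb{R}^d)$ onto $L^2(\mathbb{R}\times\mathbb{S}^{d-1})$. *)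

theory Defs
  imports "HOL-Analysis.Analysis"
begin

section \<open>Smooth functions and test functions\<close>

text \<open>Only meant for open sets \<open>U\<close>, where the derivative \<open>f'\<close> is uniquely determined by \<open>f\<close>.\<close>

primrec Ck_on :: "nat \<Rightarrow> 'a::euclidean_space set \<Rightarrow> ('a \<Rightarrow> real) \<Rightarrow> bool" where
  "Ck_on 0 U f \<longleftrightarrow> continuous_on U f"
| "Ck_on (Suc k) U f \<longleftrightarrow>
     (\<exists>f'. (\<forall>x\<in>U. (f has_derivative f' x) (at x)) \<and> (\<forall>i\<in>Basis. Ck_on k U (\<lambda>x. f' x i)))"

definition smooth_on :: "'a::euclidean_space set \<Rightarrow> ('a \<Rightarrow> real) \<Rightarrow> bool" where
  "smooth_on U f \<longleftrightarrow> (\<forall>k. Ck_on k U f)"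

text \<open>Smoothness on the embedded submanifold \<open>\<real> \<times> S\<close> with \<open>S\<close> the unit sphere: every point has a
  neighbourhood in the ambient space on which the function extends to a smooth one. Values of the
  function off \<open>\<real> \<times> S\<close> play no role.\<close>

definition smooth_on_cylinder :: "(real \<times> 'a::euclidean_space \<Rightarrow> real) \<Rightarrow> bool" where
  "smooth_on_cylinder G \<longleftrightarrow>
     (\<forall>p\<in>UNIV \<times> sphere 0 1. \<exists>U F. open U \<and> p \<in> U \<and> smooth_on U F \<and>
        (\<forall>q\<in>U \<inter> (UNIV \<times> sphere 0 1). F q = G q))"

definition test_function :: "('a::euclidean_space \<Rightarrow> real) \<Rightarrow> bool" where
  "test_function \<phi> \<longleftrightarrow> smooth_on UNIV \<phi> \<and> compact (closure {x. \<phi> x \<noteq> 0})"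


section \<open>Surface measure on the unit sphere\<close>

text \<open>The usual (unnormalised) surface measure \<open>\<sigma>\<close>, given by
  \<open>\<sigma> A = d * vol {x. 0 < |x| < 1 \<and> x / |x| \<in> A}\<close>; it is the measure of the polar coordinate
  formula \<open>dx = r\<^sup>d\<^sup>-\<^sup>1 dr d\<sigma>\<close>.\<close>

definition sphere_measure :: "'a::euclidean_space measure" where
  "sphere_measure = density
     (distr (restrict_space lborel (ball 0 1 - {0})) (restrict_space borel (sphere 0 1)) sgn)
     (\<lambda>_. ennreal (real DIM('a)))"


section \<open>Function spaces\<close>

text \<open>Elements of the spaces below are represented by Borel functions, which stand for their
  classes modulo equality almost everywhere.\<close>

definition mem_Lp :: "real \<Rightarrow> 'b measure \<Rightarrow> ('b \<Rightarrow> 'c::euclidean_space) \<Rightarrow> bool" where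
  "mem_Lp p M f \<longleftrightarrow> f \<in> borel_measurable M \<and> integrable M (\<lambda>x. norm (f x) powr p)"

definition weak_gradient :: "('a::euclidean_space \<Rightarrow> real) \<Rightarrow> ('a \<Rightarrow> 'a) \<Rightarrow> bool" where
  "weak_gradient f g \<longleftrightarrow>
     (\<forall>\<phi>. test_function \<phi> \<longrightarrow> (\<forall>i\<in>Basis.
        (\<integral>x. f x * frechet_derivative \<phi> (at x) i \<partial>lborel) = - (\<integral>x. (g x \<bullet> i) * \<phi> x \<partial>lborel)))"

text \<open>The homogeneous Sobolev space of order 1, i.e. the completion of the test functions in the
  \<open>L\<^sup>2\<close> norm of the gradient. In dimension \<open>d \<ge> 3\<close> (the only case in which it is used) the Sobolev
  inequality realises it as the space of all \<open>f\<close> in \<open>L\<^sup>p\<close>, \<open>p = 2d / (d - 2)\<close>, with weak gradient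
  in \<open>L\<^sup>2\<close>. The predicate carries the weak gradient \<open>g\<close> of \<open>f\<close> along.\<close>

definition H1dot_grad :: "('a::euclidean_space \<Rightarrow> real) \<Rightarrow> ('a \<Rightarrow> 'a) \<Rightarrow> bool" where
  "H1dot_grad f g \<longleftrightarrow>
     mem_Lp (2 * real DIM('a) / (real DIM('a) - 2)) lborel f \<and> mem_Lp 2 lborel g \<and> weak_gradient f g"

definition mem_H1dot :: "('a::euclidean_space \<Rightarrow> real) \<Rightarrow> bool" where
  "mem_H1dot f \<longleftrightarrow> (\<exists>g. H1dot_grad f g)"


section \<open>Finite energy solutions of the wave equation and radiation profiles\<close>

text \<open>\<open>u\<close> is a finite energy solution of \<open>\<partial>\<^sub>t\<^sup>2 u - \<Delta> u = 0\<close> on \<open>\<real>\<^sup>d \<times> \<real>\<close>, with gradient \<open>g = \<nabla>u\<close> and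
  time derivative \<open>v = \<partial>\<^sub>t u\<close>: the pair \<open>(u, v)\<close> is continuous in time with values in the energy space
  (first four lines), and \<open>\<partial>\<^sub>t u = v\<close>, \<open>\<partial>\<^sub>t v = \<Delta> u\<close> hold weakly (last two lines). Note that
  \<open>frechet_derivative \<phi> (at x) (g t x)\<close> is \<open>\<nabla>\<phi>(x) \<bullet> \<nabla>u(x,t)\<close>.\<close>

definition wave_solution ::
  "(real \<Rightarrow> 'a::euclidean_space \<Rightarrow> real) \<Rightarrow> (real \<Rightarrow> 'a \<Rightarrow> 'a) \<Rightarrow> (real \<Rightarrow> 'a \<Rightarrow> real) \<Rightarrow> bool" where
  "wave_solution u g v \<longleftrightarrow>
     (\<forall>t. H1dot_grad (u t) (g t)) \<and>
     (\<forall>t. mem_Lp 2 lborel (v t)) \<and>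
     (\<forall>t. ((\<lambda>s. \<integral>x. (norm (g s x - g t x))\<^sup>2 \<partial>lborel) \<longlongrightarrow> 0) (at t)) \<and>
     (\<forall>t. ((\<lambda>s. \<integral>x. (v s x - v t x)\<^sup>2 \<partial>lborel) \<longlongrightarrow> 0) (at t)) \<and>
     (\<forall>\<phi> t. test_function \<phi> \<longrightarrow>
        ((\<lambda>s. \<integral>x. u s x * \<phi> x \<partial>lborel) has_real_derivative (\<integral>x. v t x * \<phi> x \<partial>lborel)) (at t) \<and>
        ((\<lambda>s. \<integral>x. v s x * \<phi> x \<partial>lborel) has_real_derivative
            - (\<integral>x. frechet_derivative \<phi> (at x) (g t x) \<partial>lborel)) (at t))"

text \<open>\<open>T_minus u0 u1 G\<close> says that \<open>(u0, u1)\<close> lies in the energy space, that \<open>G\<close> lies in \<open>L\<^sup>2(\<real> \<times> S)\<close>,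
  and that \<open>G\<close> is the radiation profile, as \<open>t \<rightarrow> -\<infinity>\<close>, of the solution with data \<open>(u0, u1)\<close>. It is the
  graph of the operator \<open>\<^bold>T\<^sub>-\<close> at the level of representatives, so \<open>(u0, u1)\<close> represents \<open>\<^bold>T\<^sub>-\<^sup>-\<^sup>1 G\<close> iff
  \<open>T_minus u0 u1 G\<close>. The radial derivative of \<open>u\<close> at \<open>r\<theta>\<close> is \<open>\<theta> \<bullet> \<nabla>u(r\<theta>)\<close>.\<close>

definition T_minus ::
  "('a::euclidean_space \<Rightarrow> real) \<Rightarrow> ('a \<Rightarrow> real) \<Rightarrow> (real \<times> 'a \<Rightarrow> real) \<Rightarrow> bool" where
  "T_minus u0 u1 G \<longleftrightarrow>
     mem_H1dot u0 \<and> mem_Lp 2 lborel u1 \<and> mem_Lp 2 (lborel \<Otimes>\<^sub>M sphere_measure) G \<and>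
     (\<exists>u g v. wave_solution u g v \<and>
        (AE x in lborel. u 0 x = u0 x) \<and> (AE x in lborel. v 0 x = u1 x) \<and>
        ((\<lambda>t. \<integral>\<^sup>+ r\<in>{0<..}. (\<integral>\<^sup>+ \<theta>. ennreal (
            \<bar>r powr ((real DIM('a) - 1) / 2) * v t (r *\<^sub>R \<theta>) - G (r + t, \<theta>)\<bar>\<^sup>2 +
            \<bar>r powr ((real DIM('a) - 1) / 2) * (\<theta> \<bullet> g t (r *\<^sub>R \<theta>)) - G (r + t, \<theta>)\<bar>\<^sup>2)
            \<partial>sphere_measure) \<partial>lborel) \<longlongrightarrow> 0) at_bot)"

end

theory Submission
  imports Defs
begin

text \<open>For a profile \<open>F\<close> that is smooth on \<open>\<real> \<times> S\<close>, compactly supported in \<open>s\<close> and extended to be homogeneous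
  of degree 0 in \<open>\<omega>\<close>, the superposition \<open>Phi F x t = \<integral> F (x \<bullet> \<omega> + t, \<omega>) d\<sigma>(\<omega>)\<close> of plane waves solves
  the wave equation. Its integrand lives where \<open>x \<bullet> \<omega>\<close> is close to \<open>-t\<close>. Near the cone \<open>|x| = -t\<close> this is
  a cap of radius \<open>O(1 / sqrt |x|)\<close> around \<open>x / |x|\<close>, so that \<open>F\<close> may be frozen in \<open>\<omega>\<close>. What remains is,
  up to a constant, the integral of \<open>F\<^sup>(\<^sup>\<mu>\<^sup>)\<close> against \<open>(1 - s\<^sup>2)\<^sup>m\<close>, \<open>m = \<mu> - 1\<close>, and \<open>\<mu>\<close> integrations by parts
  turn it into \<open>(2 \<pi> / |x|)\<^sup>\<mu> F\<close>. Away from the cone, the Lorentz boosts and the scaling field express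
  \<open>(|x|\<^sup>2 - t\<^sup>2) \<partial>\<^sub>t u\<close> through functions of the same kind, which yields the decay needed for finite energy
  and for the convergence to the profile.

  Conversely, if two solutions have the same profile, the difference \<open>z(t)\<close> of their time derivatives
  tends to 0 in \<open>L\<^sup>2\<close> as \<open>t \<rightarrow> -\<infinity>\<close>. Paired with spherical test waves \<open>\<chi>(s)\<close> it satisfies d'Alembert's
  identity \<open>\<langle>z(t + s), \<chi>(0)\<rangle> + \<langle>z(t - s), \<chi>(0)\<rangle> = 2 \<langle>z(t), \<chi>(s)\<rangle>\<close>, and \<open>\<chi>(s)\<close> is bounded in \<open>L\<^sup>2\<close> by the strong Huygens
  principle, so all \<open>\<langle>z(t), \<chi>(0)\<rangle>\<close> vanish. Dilates and translates of one \<open>\<chi>(0)\<close> form an approximate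
  identity, hence \<open>z = 0\<close>. The difference \<open>w\<close> of the solutions is then constant in time, its pairings with
  odd test waves are linear in \<open>s\<close>, and such growth is incompatible with \<open>w \<in> L\<^sup>p\<close>, \<open>p = 2 d / (d - 2)\<close>.\<close>

section \<open>Smooth functions\<close>

text \<open>Throughout, \<open>d = 2 * m + 3\<close> and \<open>\<mu> = Suc m\<close>. Odd dimension
  enters through one fact: under the surface measure \<open>\<theta> \<bullet> \<omega>\<close> has
  density \<open>zonal_const m * (1 - s^2) ^ m\<close>, a polynomial. Its zero of order
  \<open>m\<close> at the pole is used up by the \<open>\<mu>\<close> integrations by parts; its
  degree \<open>2 * m\<close> is the number of derivatives that a spherical profile must exceed for
  its wave to vanish outside the cone. The constant is a product: the area
  \<open>zonal_const m\<close> of the unit sphere of dimension \<open>d - 2\<close>,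
  \<open>2 ^ m\<close> from the factor \<open>(1 + s) ^ m\<close> at the pole, and
  \<open>fact m\<close> from the integrations by parts, together \<open>(2 \<pi>)^\<mu>\<close>.
  Decay is governed by one rate, \<open>|x|^(m + 1) |Phi ((dS ^^ j) F) x t| \<le> C (|x| - |t|)^(m -
  j)\<close> outside the cone: \<open>j = m\<close> and \<open>j = Suc m\<close> put the solution in
  the energy space, and \<open>j = Suc m\<close> also bounds the tail of the radiation integral. The
  claim concerns every pair related to \<open>G\<close>, so uniqueness has to be shown among weak
  solutions; the test functions used for it are again superpositions \<open>Phi\<close>, chosen to
  have compact support at each time.\<close>

lemma Ck_on_cong:
  assumes "open U" "\<And>x. x \<in> U \<Longrightarrow> f x = g x" "Ck_on k U f"
  shows "Ck_on k U g"
proof (cases k)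
  case 0
  with assms show ?thesis by (metis Ck_on.simps(1) continuous_on_cong)
next
  case (Suc j)
  with assms obtain f' where f': "\<And>x. x \<in> U \<Longrightarrow> (f has_derivative f' x) (at x)"
      "\<And>i. i \<in> Basis \<Longrightarrow> Ck_on j U (\<lambda>x. f' x i)"
    by auto
  have "(g has_derivative f' x) (at x)" if "x \<in> U" for x
    using f'(1)[OF that] assms(1) that assms(2) by (rule has_derivative_transform_within_open)
  with f' Suc show ?thesis by auto
qed

lemma Ck_on_imp_continuous_on: "Ck_on k U f \<Longrightarrow> continuous_on U f"
  by (cases k) (auto intro!: continuous_at_imp_continuous_on dest!: has_derivative_continuous)

lemma Ck_on_SucD: "Ck_on (Suc k) U f \<Longrightarrow> Ck_on k U f"
proof (induction k arbitrary: f)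
  case 0
  then show ?case using Ck_on_imp_continuous_on by fastforce
next
  case (Suc k)
  from Suc.prems obtain f' where "\<forall>x\<in>U. (f has_derivative f' x) (at x)"
      "\<forall>i\<in>Basis. Ck_on (Suc k) U (\<lambda>x. f' x i)"
    by (subst (asm) Ck_on.simps(2)) blast
  with Suc.IH show ?case by (subst Ck_on.simps(2)) blast
qed

text \<open>On an open set the derivative is unique, so the existential \<open>f'\<close> of
  \<open>Ck_on\<close> can be replaced by \<open>frechet_derivative\<close>. A canonical derivative
  is what lets statements from different neighbourhoods be glued in
  \<open>Ck_on_local\<close>.\<close>

lemma Ck_on_Suc_iff:
  assumes "open U"
  shows "Ck_on (Suc k) U f \<longleftrightarrow> (\<forall>x\<in>U. f differentiable at x) \<and>
    (\<forall>i\<in>Basis. Ck_on k U (\<lambda>x. frechet_derivative f (at x) i))"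
proof
  assume "Ck_on (Suc k) U f"
  then obtain f' where f': "\<And>x. x \<in> U \<Longrightarrow> (f has_derivative f' x) (at x)"
      "\<And>i. i \<in> Basis \<Longrightarrow> Ck_on k U (\<lambda>x. f' x i)"
    by auto
  have "f' x = frechet_derivative f (at x)" if "x \<in> U" for x
    using frechet_derivative_at[OF f'(1)[OF that]] .
  then have "Ck_on k U (\<lambda>x. frechet_derivative f (at x) i)" if "i \<in> Basis" for i
    using Ck_on_cong[OF assms _ f'(2)[OF that]] by auto
  moreover have "f differentiable at x" if "x \<in> U" for x
    using f'(1)[OF that] by (auto simp: differentiable_def)
  ultimately show "(\<forall>x\<in>U. f differentiable at x) \<and>
    (\<forall>i\<in>Basis. Ck_on k U (\<lambda>x. frechet_derivative f (at x) i))"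
    by auto
next
  assume *: "(\<forall>x\<in>U. f differentiable at x) \<and>
    (\<forall>i\<in>Basis. Ck_on k U (\<lambda>x. frechet_derivative f (at x) i))"
  then have "\<forall>x\<in>U. (f has_derivative frechet_derivative f (at x)) (at x)"
    by (simp add: frechet_derivative_works)
  with * show "Ck_on (Suc k) U f" by auto
qed

lemma Ck_on_subset: "Ck_on k U f \<Longrightarrow> V \<subseteq> U \<Longrightarrow> Ck_on k V f"
proof (induction k arbitrary: f)
  case 0
  then show ?case by (auto intro: continuous_on_subset)
next
  case (Suc k)
  then show ?case by fastforce
qed

lemma Ck_on_local:
  assumes "open U" "\<And>p. p \<in> U \<Longrightarrow> \<exists>N. open N \<and> p \<in> N \<and> Ck_on k N f"
  shows "Ck_on k U f"
  using assms(2)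
proof (induction k arbitrary: f)
  case 0
  have "isCont f p" if "p \<in> U" for p
    using 0[OF that] by (metis Ck_on.simps(1) continuous_on_eq_continuous_at)
  then show ?case by (simp add: continuous_at_imp_continuous_on)
next
  case (Suc k)
  have "f differentiable at p" if "p \<in> U" for p
    using Suc.prems[OF that] Ck_on_Suc_iff by blast
  moreover have "Ck_on k U (\<lambda>x. frechet_derivative f (at x) i)" if i: "i \<in> Basis" for i
  proof (rule Suc.IH)
    fix p assume "p \<in> U"
    from Suc.prems[OF this] obtain N where N: "open N" "p \<in> N" "Ck_on (Suc k) N f" by blast
    then have "Ck_on k N (\<lambda>x. frechet_derivative f (at x) i)"
      using i Ck_on_Suc_iff by blast
    with N show "\<exists>N. open N \<and> p \<in> N \<and> Ck_on k N (\<lambda>x. frechet_derivative f (at x) i)" by blast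
  qed
  ultimately show ?case using Ck_on_Suc_iff[OF assms(1)] by blast
qed

lemma Ck_on_const: "Ck_on k U (\<lambda>x. c)"
proof (induction k arbitrary: c)
  case (Suc k)
  have "\<forall>x\<in>U. ((\<lambda>x. c) has_derivative (\<lambda>h. 0)) (at x)" by simp
  with Suc[of 0] show ?case
    by (subst Ck_on.simps(2)) (rule exI[of _ "\<lambda>x h. 0"], simp)
qed simp

lemma Ck_on_bounded_linear:
  assumes "bounded_linear f" shows "Ck_on k U f"
proof (cases k)
  case 0
  then show ?thesis using assms by (simp add: linear_continuous_on)
next
  case (Suc j)
  have "\<forall>x\<in>U. (f has_derivative f) (at x)"
    using bounded_linear_imp_has_derivative[OF assms] by blast
  then show ?thesis unfolding Suc Ck_on.simps(2)
    by (intro exI[of _ "\<lambda>x. f"]) (auto intro: Ck_on_const)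
qed

lemma Ck_on_add: "Ck_on k U f \<Longrightarrow> Ck_on k U g \<Longrightarrow> Ck_on k U (\<lambda>x. f x + g x)"
proof (induction k arbitrary: f g)
  case 0
  then show ?case by (auto intro: continuous_on_add)
next
  case (Suc k)
  obtain f' where f': "\<And>x. x \<in> U \<Longrightarrow> (f has_derivative f' x) (at x)"
      "\<And>i. i \<in> Basis \<Longrightarrow> Ck_on k U (\<lambda>x. f' x i)"
    using Suc.prems(1) by auto
  obtain g' where g': "\<And>x. x \<in> U \<Longrightarrow> (g has_derivative g' x) (at x)"
      "\<And>i. i \<in> Basis \<Longrightarrow> Ck_on k U (\<lambda>x. g' x i)"
    using Suc.prems(2) by auto
  show ?case unfolding Ck_on.simps(2)
  proof (intro exI[of _ "\<lambda>x h. f' x h + g' x h"] conjI ballI)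
    show "((\<lambda>x. f x + g x) has_derivative (\<lambda>h. f' x h + g' x h)) (at x)" if "x \<in> U" for x
      using f'(1)[OF that] g'(1)[OF that] by (rule has_derivative_add)
    show "Ck_on k U (\<lambda>x. f' x i + g' x i)" if "i \<in> Basis" for i
      using f'(2)[OF that] g'(2)[OF that] by (rule Suc.IH)
  qed
qed

lemma Ck_on_mult: "Ck_on k U f \<Longrightarrow> Ck_on k U g \<Longrightarrow> Ck_on k U (\<lambda>x. f x * g x)"
proof (induction k arbitrary: f g)
  case 0
  then show ?case by (auto intro: continuous_on_mult)
next
  case (Suc k)
  have fg: "Ck_on k U f" "Ck_on k U g" using Suc.prems Ck_on_SucD by blast+
  obtain f' where f': "\<And>x. x \<in> U \<Longrightarrow> (f has_derivative f' x) (at x)"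
      "\<And>i. i \<in> Basis \<Longrightarrow> Ck_on k U (\<lambda>x. f' x i)"
    using Suc.prems(1) by auto
  obtain g' where g': "\<And>x. x \<in> U \<Longrightarrow> (g has_derivative g' x) (at x)"
      "\<And>i. i \<in> Basis \<Longrightarrow> Ck_on k U (\<lambda>x. g' x i)"
    using Suc.prems(2) by auto
  show ?case unfolding Ck_on.simps(2)
  proof (intro exI[of _ "\<lambda>x h. f x * g' x h + f' x h * g x"] conjI ballI)
    show "((\<lambda>x. f x * g x) has_derivative (\<lambda>h. f x * g' x h + f' x h * g x)) (at x)" if "x \<in> U" for x
      using f'(1)[OF that] g'(1)[OF that] by (rule has_derivative_mult)
    show "Ck_on k U (\<lambda>x. f x * g' x i + f' x i * g x)" if "i \<in> Basis" for i
      by (rule Ck_on_add) (auto intro!: Suc.IH f'(2) g'(2) fg that)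
  qed
qed

lemma Ck_on_sum: "(\<And>a. a \<in> A \<Longrightarrow> Ck_on k U (f a)) \<Longrightarrow> Ck_on k U (\<lambda>x. \<Sum>a\<in>A. f a x)"
  by (induction A rule: infinite_finite_induct) (auto intro: Ck_on_const Ck_on_add)

text \<open>By the chain rule a partial derivative of the composite is a sum of products of partials
  of the components of \<open>\<Phi>\<close> with functions
  \<open>\<lambda>x. f' (\<Phi> x) b\<close>, which are composites again; the induction therefore
  runs over all \<open>f\<close>.\<close>

lemma Ck_on_compose:
  fixes \<Phi> :: "'a::euclidean_space \<Rightarrow> 'b::euclidean_space"
  assumes "open U" "\<And>b. b \<in> Basis \<Longrightarrow> Ck_on k U (\<lambda>x. \<Phi> x \<bullet> b)" "\<Phi> ` U \<subseteq> V" "Ck_on k V f"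
  shows "Ck_on k U (\<lambda>x. f (\<Phi> x))"
  using assms(2-)
proof (induction k arbitrary: f)
  case 0
  then have "continuous_on U \<Phi>"
    by (subst continuous_on_componentwise) auto
  with 0 show ?case by (auto intro: continuous_on_compose2)
next
  case (Suc k)
  have "\<forall>b\<in>Basis. \<exists>d. (\<forall>x\<in>U. ((\<lambda>x. \<Phi> x \<bullet> b) has_derivative d x) (at x)) \<and>
      (\<forall>i\<in>Basis. Ck_on k U (\<lambda>x. d x i))"
    using Suc.prems(1) by simp
  then obtain d where d: "\<And>b x. b \<in> Basis \<Longrightarrow> x \<in> U \<Longrightarrow> ((\<lambda>x. \<Phi> x \<bullet> b) has_derivative d b x) (at x)"
      "\<And>b i. b \<in> Basis \<Longrightarrow> i \<in> Basis \<Longrightarrow> Ck_on k U (\<lambda>x. d b x i)"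
    using bchoice[of Basis "\<lambda>b d. (\<forall>x\<in>U. ((\<lambda>x. \<Phi> x \<bullet> b) has_derivative d x) (at x)) \<and>
      (\<forall>i\<in>Basis. Ck_on k U (\<lambda>x. d x i))"] by blast
  obtain f' where f': "\<And>x. x \<in> V \<Longrightarrow> (f has_derivative f' x) (at x)"
      "\<And>i. i \<in> Basis \<Longrightarrow> Ck_on k V (\<lambda>x. f' x i)"
    using Suc.prems(3) by auto
  define \<Phi>' where "\<Phi>' x h = (\<Sum>b\<in>Basis. d b x h *\<^sub>R b)" for x h
  have \<Phi>': "(\<Phi> has_derivative \<Phi>' x) (at x)" if "x \<in> U" for x
    using d(1)[OF _ that]
    by (subst has_derivative_componentwise_within) (simp add: \<Phi>'_def)
  have chain: "((\<lambda>x. f (\<Phi> x)) has_derivative (\<lambda>h. f' (\<Phi> x) (\<Phi>' x h))) (at x)" if "x \<in> U" for x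
    using has_derivative_compose[OF \<Phi>'[OF that], of f "f' (\<Phi> x)"] f'(1)[of "\<Phi> x"] Suc.prems(2) that
    by auto
  have lin: "f' y (\<Sum>b\<in>Basis. c b *\<^sub>R b) = (\<Sum>b\<in>Basis. c b * f' y b)" if "y \<in> V" for y and c :: "'b \<Rightarrow> real"
  proof -
    interpret linear "f' y" using f'(1)[OF that] has_derivative_linear by blast
    show ?thesis by (simp add: sum scaleR)
  qed
  have low: "\<And>b. b \<in> Basis \<Longrightarrow> Ck_on k U (\<lambda>x. \<Phi> x \<bullet> b)"
    using Suc.prems(1) Ck_on_SucD by blast
  have "Ck_on k U (\<lambda>x. f' (\<Phi> x) (\<Phi>' x i))" if i: "i \<in> Basis" for i
  proof -
    have "Ck_on k U (\<lambda>x. \<Sum>b\<in>Basis. d b x i * f' (\<Phi> x) b)"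
      using d(2) i Suc.IH[OF low Suc.prems(2)] f'(2) by (intro Ck_on_sum Ck_on_mult) auto
    then show ?thesis
    proof (rule Ck_on_cong[OF assms(1), rotated])
      show "(\<Sum>b\<in>Basis. d b x i * f' (\<Phi> x) b) = f' (\<Phi> x) (\<Phi>' x i)" if "x \<in> U" for x
        using lin[of "\<Phi> x" "\<lambda>b. d b x i"] Suc.prems(2) that by (auto simp: \<Phi>'_def)
    qed
  qed
  then show ?case unfolding Ck_on.simps(2)
    using chain by (intro exI[of _ "\<lambda>x h. f' (\<Phi> x) (\<Phi>' x h)"]) simp
qed

text \<open>Over all \<open>n\<close> the family is closed under differentiation up to linear
  factors: the derivative of \<open>|x|^-n\<close> along \<open>h\<close> is
  \<open>- n (x \<bullet> h) |x|^-(n + 2)\<close>. For a single \<open>n\<close> the induction would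
  not close.\<close>

lemma Ck_on_inverse_norm_power: "Ck_on k (- {0}) (\<lambda>x::'a::euclidean_space. inverse (norm x) ^ n)"
proof (induction k arbitrary: n)
  case 0
  then show ?case by (auto intro!: continuous_intros)
next
  case (Suc k)
  define d where "d x h = - real n * ((x \<bullet> h) * inverse (norm x) ^ (n + 2))" for x h :: 'a
  have "((\<lambda>x. inverse (norm x) ^ n) has_derivative d x) (at x)" if "x \<noteq> 0" for x
  proof -
    have "((\<lambda>x. inverse (norm x) ^ n) has_derivative
        (\<lambda>h. real n * inverse (norm x) ^ (n - 1) * - (inverse (norm x) * (h \<bullet> sgn x) * inverse (norm x)))) (at x)"
      using that by (auto intro!: derivative_eq_intros has_derivative_norm simp: fun_eq_iff algebra_simps)
    also have "(\<lambda>h. real n * inverse (norm x) ^ (n - 1) * - (inverse (norm x) * (h \<bullet> sgn x) * inverse (norm x))) = d x"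
    proof
      fix h
      show "real n * inverse (norm x) ^ (n - 1) * - (inverse (norm x) * (h \<bullet> sgn x) * inverse (norm x)) = d x h"
        using that by (cases n) (simp_all add: d_def sgn_div_norm inner_commute field_simps)
    qed
    finally show ?thesis .
  qed
  moreover have "Ck_on k (- {0}) (\<lambda>x. d x i)" for i
    unfolding d_def
    by (intro Ck_on_mult Ck_on_const Suc.IH Ck_on_bounded_linear bounded_linear_inner_left)
  ultimately show ?case unfolding Ck_on.simps(2) by (intro exI[of _ d]) simp
qed

lemma smooth_on_cong:
  assumes "open U" "\<And>x. x \<in> U \<Longrightarrow> f x = g x" "smooth_on U f" shows "smooth_on U g"
  unfolding smooth_on_def
proof
  show "Ck_on k U g" for k
    by (rule Ck_on_cong[OF assms(1,2)]) (use assms(3) in \<open>simp_all add: smooth_on_def\<close>)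
qed

lemma smooth_on_subset: "smooth_on U f \<Longrightarrow> V \<subseteq> U \<Longrightarrow> smooth_on V f"
  using Ck_on_subset unfolding smooth_on_def by blast

lemma smooth_on_const: "smooth_on U (\<lambda>x. c)"
  by (simp add: smooth_on_def Ck_on_const)

lemma smooth_on_bounded_linear: "bounded_linear f \<Longrightarrow> smooth_on U f"
  by (simp add: smooth_on_def Ck_on_bounded_linear)

lemma smooth_on_add: "smooth_on U f \<Longrightarrow> smooth_on U g \<Longrightarrow> smooth_on U (\<lambda>x. f x + g x)"
  by (simp add: smooth_on_def Ck_on_add)

lemma smooth_on_mult: "smooth_on U f \<Longrightarrow> smooth_on U g \<Longrightarrow> smooth_on U (\<lambda>x. f x * g x)"
  by (simp add: smooth_on_def Ck_on_mult)

lemma smooth_on_sum: "(\<And>a. a \<in> A \<Longrightarrow> smooth_on U (f a)) \<Longrightarrow> smooth_on U (\<lambda>x. \<Sum>a\<in>A. f a x)"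
  by (simp add: smooth_on_def Ck_on_sum)

lemma smooth_on_compose:
  fixes \<Phi> :: "'a::euclidean_space \<Rightarrow> 'b::euclidean_space"
  assumes "open U" "\<And>b. b \<in> Basis \<Longrightarrow> smooth_on U (\<lambda>x. \<Phi> x \<bullet> b)" "\<Phi> ` U \<subseteq> V" "smooth_on V f"
  shows "smooth_on U (\<lambda>x. f (\<Phi> x))"
  using assms Ck_on_compose[OF assms(1) _ assms(3)] unfolding smooth_on_def by simp

lemma smooth_on_local:
  assumes "open U" "\<And>p. p \<in> U \<Longrightarrow> \<exists>N. open N \<and> p \<in> N \<and> smooth_on N f"
  shows "smooth_on U f"
  unfolding smooth_on_def
proof
  show "Ck_on k U f" for k
    by (rule Ck_on_local[OF assms(1)]) (use assms(2) in \<open>unfold smooth_on_def, blast\<close>)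
qed

lemma smooth_on_imp_continuous_on: "smooth_on U f \<Longrightarrow> continuous_on U f"
  using Ck_on_imp_continuous_on unfolding smooth_on_def by blast

lemma smooth_on_differentiable: "open U \<Longrightarrow> smooth_on U f \<Longrightarrow> x \<in> U \<Longrightarrow> f differentiable at x"
  using Ck_on_Suc_iff unfolding smooth_on_def by blast

lemma smooth_on_has_derivative:
  "open U \<Longrightarrow> smooth_on U f \<Longrightarrow> x \<in> U \<Longrightarrow> (f has_derivative frechet_derivative f (at x)) (at x)"
  using smooth_on_differentiable frechet_derivative_works by blast

lemma frechet_derivative_Basis:
  fixes f :: "'a::euclidean_space \<Rightarrow> real"
  assumes "f differentiable at x"
  shows "frechet_derivative f (at x) v = (\<Sum>i\<in>Basis. (v \<bullet> i) * frechet_derivative f (at x) i)"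
proof -
  interpret linear "frechet_derivative f (at x)" by (rule linear_frechet_derivative[OF assms])
  have "frechet_derivative f (at x) (\<Sum>i\<in>Basis. (v \<bullet> i) *\<^sub>R i) =
      (\<Sum>i\<in>Basis. (v \<bullet> i) * frechet_derivative f (at x) i)"
    by (simp add: sum scaleR)
  then show ?thesis by (simp add: euclidean_representation)
qed

lemma smooth_on_frechet_derivative:
  fixes f :: "'a::euclidean_space \<Rightarrow> real"
  assumes "open U" "smooth_on U f"
  shows "smooth_on U (\<lambda>x. frechet_derivative f (at x) v)"
proof (rule smooth_on_cong[OF assms(1)])
  show "(\<Sum>i\<in>Basis. (v \<bullet> i) * frechet_derivative f (at x) i) = frechet_derivative f (at x) v" if "x \<in> U" for x
    by (rule frechet_derivative_Basis[OF smooth_on_differentiable[OF assms that], symmetric])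
  have "smooth_on U (\<lambda>x. frechet_derivative f (at x) i)" if "i \<in> Basis" for i
    using assms(2) Ck_on_Suc_iff[OF assms(1)] that unfolding smooth_on_def by blast
  then show "smooth_on U (\<lambda>x. \<Sum>i\<in>Basis. (v \<bullet> i) * frechet_derivative f (at x) i)"
    by (intro smooth_on_sum smooth_on_mult smooth_on_const)
qed

text \<open>Induction on the order, with the class \<open>P\<close> as invariant: closure under
  partial derivatives already forces smoothness. With \<open>P\<close> the waves
  \<open>Phi F\<close> at a fixed time, no formula for higher derivatives is needed.\<close>

lemma smooth_onI_derivative:
  fixes P :: "('a::euclidean_space \<Rightarrow> real) \<Rightarrow> bool"
  assumes "P f"
    and "\<And>f. P f \<Longrightarrow> \<exists>f'. (\<forall>x\<in>U. (f has_derivative f' x) (at x)) \<and> (\<forall>i\<in>Basis. P (\<lambda>x. f' x i))"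
  shows "smooth_on U f"
  unfolding smooth_on_def
proof
  fix k show "Ck_on k U f"
    using assms(1)
  proof (induction k arbitrary: f)
    case 0
    from assms(2)[OF 0] obtain f' where "\<forall>x\<in>U. (f has_derivative f' x) (at x)" by blast
    then show ?case
      by (auto intro!: continuous_at_imp_continuous_on dest!: has_derivative_continuous)
  next
    case (Suc k)
    from assms(2)[OF Suc.prems] obtain f' where
      "\<forall>x\<in>U. (f has_derivative f' x) (at x)" "\<forall>i\<in>Basis. P (\<lambda>x. f' x i)" by blast
    with Suc.IH show ?case unfolding Ck_on.simps(2) by (intro exI[of _ f']) simp
  qed
qed

lemma smooth_on_inverse_norm: "smooth_on (- {0}) (\<lambda>x::'a::euclidean_space. inverse (norm x))"
  unfolding smooth_on_def
  using Ck_on_inverse_norm_power[where ?'a='a and n=1] by simp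

lemma smooth_on_norm: "smooth_on (- {0}) (\<lambda>x::'a::euclidean_space. norm x)"
proof (rule smooth_on_cong)
  \<comment> \<open>\<open>|x|\<close> is written as \<open>|x|^2 / |x|\<close>, a polynomial times
    a function already known to be smooth.\<close>
  show "smooth_on (- {0}) (\<lambda>x::'a. (\<Sum>i\<in>Basis. (x \<bullet> i) * (x \<bullet> i)) * inverse (norm x))"
    by (intro smooth_on_mult smooth_on_sum smooth_on_inverse_norm smooth_on_bounded_linear bounded_linear_inner_left)
  show "(\<Sum>i\<in>Basis. (x \<bullet> i) * (x \<bullet> i)) * inverse (norm x) = norm x" if "x \<in> - {0}" for x :: 'a
    using that by (simp add: euclidean_inner[symmetric] power2_norm_eq_inner[symmetric] power2_eq_square field_simps)
qed (simp add: open_Compl)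

text \<open>The second difference of \<open>f\<close> over the parallelogram spanned by
  \<open>h v\<close> and \<open>h w\<close> is symmetric in \<open>v\<close> and \<open>w\<close>.
  Two mean value steps, taken in either order, turn it into \<open>h^2\<close> times a mixed
  derivative at a nearby point, and both expressions converge as \<open>h\<close> tends to 0. Needed
  to commute \<open>dS\<close> with \<open>dX\<close>.\<close>

lemma frechet_derivative_symmetric:
  fixes f :: "'a::euclidean_space \<Rightarrow> real"
  assumes U: "open U" and f: "smooth_on U f" and x: "x \<in> U"
  shows "frechet_derivative (\<lambda>y. frechet_derivative f (at y) v) (at x) w =
    frechet_derivative (\<lambda>y. frechet_derivative f (at y) w) (at x) v"
proof -
  define D where "D v w y = frechet_derivative (\<lambda>y. frechet_derivative f (at y) v) (at y) w" for v w y
  from U x obtain e where e: "e > 0" "ball x e \<subseteq> U" by (meson openE)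
  \<comment> \<open>The summand 1 keeps \<open>N\<close> positive when \<open>v\<close> and
    \<open>w\<close> both vanish; \<open>h < e / N\<close> keeps the whole parallelogram inside
    \<open>ball x e\<close>.\<close>
  define N where "N = norm v + norm w + 1"
  have N: "N > 0" "norm v \<le> N" "norm w \<le> N" by (auto simp: N_def add_nonneg_pos)
  have inU: "x + a *\<^sub>R v + b *\<^sub>R w \<in> U" if "0 \<le> a" "a \<le> h" "0 \<le> b" "b \<le> h" "h < e / N" for a b h
  proof -
    have "norm (a *\<^sub>R v + b *\<^sub>R w) \<le> a * norm v + b * norm w"
      using norm_triangle_ineq[of "a *\<^sub>R v" "b *\<^sub>R w"] that by simp
    also have "\<dots> \<le> h * norm v + h * norm w" using that by (intro add_mono mult_right_mono) auto
    also have "\<dots> \<le> h * N" using that by (simp add: N_def algebra_simps)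
    also have "\<dots> < e" using that N by (simp add: field_simps)
    finally have "dist (x + (a *\<^sub>R v + b *\<^sub>R w)) x < e" by (simp add: dist_norm)
    then show ?thesis using e by (auto simp: add.assoc dist_commute)
  qed
  have mvt: "\<exists>a b. 0 \<le> a \<and> a \<le> h \<and> 0 \<le> b \<and> b \<le> h \<and>
     f (x + h *\<^sub>R v + h *\<^sub>R w) - f (x + h *\<^sub>R v) - f (x + h *\<^sub>R w) + f x
       = h * h * D v w (x + a *\<^sub>R v + b *\<^sub>R w)"
    if h: "0 < h" and inU: "\<And>a b. 0 \<le> a \<Longrightarrow> a \<le> h \<Longrightarrow> 0 \<le> b \<Longrightarrow> b \<le> h \<Longrightarrow> x + a *\<^sub>R v + b *\<^sub>R w \<in> U"
    for h v w
  proof -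
    have g1: "((\<lambda>a. f (x + a *\<^sub>R v + b *\<^sub>R w)) has_real_derivative
        frechet_derivative f (at (x + a *\<^sub>R v + b *\<^sub>R w)) v) (at a)"
      if "0 \<le> a" "a \<le> h" "0 \<le> b" "b \<le> h" for a b
    proof -
      let ?y = "x + a *\<^sub>R v + b *\<^sub>R w"
      have "((\<lambda>a. x + a *\<^sub>R v + b *\<^sub>R w) has_derivative (\<lambda>d. d *\<^sub>R v)) (at a)"
        by (auto intro!: derivative_eq_intros)
      from has_derivative_compose[OF this smooth_on_has_derivative[OF U f inU[OF that]]]
      have "((\<lambda>a. f (x + a *\<^sub>R v + b *\<^sub>R w)) has_derivative (\<lambda>d. frechet_derivative f (at ?y) (d *\<^sub>R v))) (at a)" .
      moreover have "(\<lambda>d. frechet_derivative f (at ?y) (d *\<^sub>R v)) = (*) (frechet_derivative f (at ?y) v)"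
        using linear_scale[OF linear_frechet_derivative[OF smooth_on_differentiable[OF U f inU[OF that]]]]
        by (auto simp: fun_eq_iff)
      ultimately show ?thesis by (simp add: has_field_derivative_def)
    qed
    have g2: "((\<lambda>b. frechet_derivative f (at (x + a *\<^sub>R v + b *\<^sub>R w)) v) has_real_derivative
        D v w (x + a *\<^sub>R v + b *\<^sub>R w)) (at b)"
      if "0 \<le> a" "a \<le> h" "0 \<le> b" "b \<le> h" for a b
    proof -
      let ?y = "x + a *\<^sub>R v + b *\<^sub>R w"
      let ?g = "\<lambda>y. frechet_derivative f (at y) v"
      have g: "smooth_on U ?g" by (rule smooth_on_frechet_derivative[OF U f])
      have "((\<lambda>b. x + a *\<^sub>R v + b *\<^sub>R w) has_derivative (\<lambda>d. d *\<^sub>R w)) (at b)"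
        by (auto intro!: derivative_eq_intros)
      from has_derivative_compose[OF this smooth_on_has_derivative[OF U g inU[OF that]]]
      have "((\<lambda>b. ?g (x + a *\<^sub>R v + b *\<^sub>R w)) has_derivative (\<lambda>d. frechet_derivative ?g (at ?y) (d *\<^sub>R w))) (at b)" .
      moreover have "(\<lambda>d. frechet_derivative ?g (at ?y) (d *\<^sub>R w)) = (*) (D v w ?y)"
        using linear_scale[OF linear_frechet_derivative[OF smooth_on_differentiable[OF U g inU[OF that]]]]
        by (auto simp: fun_eq_iff D_def)
      ultimately show ?thesis by (simp add: has_field_derivative_def)
    qed
    have "\<exists>a. a > 0 \<and> a < h \<and> (f (x + h *\<^sub>R v + h *\<^sub>R w) - f (x + h *\<^sub>R v + 0 *\<^sub>R w)) -
        (f (x + 0 *\<^sub>R v + h *\<^sub>R w) - f (x + 0 *\<^sub>R v + 0 *\<^sub>R w)) = (h - 0) *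
        (frechet_derivative f (at (x + a *\<^sub>R v + h *\<^sub>R w)) v - frechet_derivative f (at (x + a *\<^sub>R v + 0 *\<^sub>R w)) v)"
      by (rule MVT2[OF h, of "\<lambda>a. f (x + a *\<^sub>R v + h *\<^sub>R w) - f (x + a *\<^sub>R v + 0 *\<^sub>R w)"])
         (intro DERIV_diff g1, use h in auto)
    then obtain a where a: "a > 0" "a < h" "f (x + h *\<^sub>R v + h *\<^sub>R w) - f (x + h *\<^sub>R v) - f (x + h *\<^sub>R w) + f x
      = h * (frechet_derivative f (at (x + a *\<^sub>R v + h *\<^sub>R w)) v - frechet_derivative f (at (x + a *\<^sub>R v + 0 *\<^sub>R w)) v)"
      by auto
    have "\<exists>b. b > 0 \<and> b < h \<and> frechet_derivative f (at (x + a *\<^sub>R v + h *\<^sub>R w)) v -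
       frechet_derivative f (at (x + a *\<^sub>R v + 0 *\<^sub>R w)) v = (h - 0) * D v w (x + a *\<^sub>R v + b *\<^sub>R w)"
      by (rule MVT2[OF h]) (intro g2, use h a in auto)
    then obtain b where "b > 0" "b < h" "frechet_derivative f (at (x + a *\<^sub>R v + h *\<^sub>R w)) v -
       frechet_derivative f (at (x + a *\<^sub>R v + 0 *\<^sub>R w)) v = h * D v w (x + a *\<^sub>R v + b *\<^sub>R w)"
      by auto
    with a show ?thesis by (intro exI[of _ a] exI[of _ b]) auto
  qed
  have cont: "isCont (D v w) x" for v w
    using smooth_on_imp_continuous_on[OF smooth_on_frechet_derivative[OF U smooth_on_frechet_derivative[OF U f], of v w]]
      U x continuous_on_eq_continuous_at unfolding D_def by blast
  have lim: "((\<lambda>h. D v w (x + p h *\<^sub>R v + q h *\<^sub>R w)) \<longlongrightarrow> D v w x) (at_right 0)"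
    if "\<And>h. h > 0 \<Longrightarrow> h < e / N \<Longrightarrow> 0 \<le> p h \<and> p h \<le> h \<and> 0 \<le> q h \<and> q h \<le> h" for p q :: "real \<Rightarrow> real" and v w
  proof -
    have ev: "\<forall>\<^sub>F h in at_right 0. 0 < h \<and> h < e / N"
      using e(1) N(1) by (auto simp: eventually_at_right_field intro!: exI[of _ "e / N"])
    have "(p \<longlongrightarrow> 0) (at_right 0)"
      by (rule tendsto_sandwich[of "\<lambda>_. 0" _ _ "\<lambda>h. h"]) (use that ev in \<open>auto elim!: eventually_mono\<close>)
    moreover have "(q \<longlongrightarrow> 0) (at_right 0)"
      by (rule tendsto_sandwich[of "\<lambda>_. 0" _ _ "\<lambda>h. h"]) (use that ev in \<open>auto elim!: eventually_mono\<close>)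
    ultimately have "((\<lambda>h. x + p h *\<^sub>R v + q h *\<^sub>R w) \<longlongrightarrow> x + 0 *\<^sub>R v + 0 *\<^sub>R w) (at_right 0)"
      by (intro tendsto_intros)
    then show ?thesis using isCont_tendsto_compose[OF cont] by simp
  qed
  have "\<forall>h. \<exists>a b. 0 < h \<and> h < e / N \<longrightarrow> 0 \<le> a \<and> a \<le> h \<and> 0 \<le> b \<and> b \<le> h \<and>
     f (x + h *\<^sub>R v + h *\<^sub>R w) - f (x + h *\<^sub>R v) - f (x + h *\<^sub>R w) + f x
       = h * h * D v w (x + a *\<^sub>R v + b *\<^sub>R w)"
  proof
    fix h
    show "\<exists>a b. 0 < h \<and> h < e / N \<longrightarrow> 0 \<le> a \<and> a \<le> h \<and> 0 \<le> b \<and> b \<le> h \<and>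
     f (x + h *\<^sub>R v + h *\<^sub>R w) - f (x + h *\<^sub>R v) - f (x + h *\<^sub>R w) + f x
       = h * h * D v w (x + a *\<^sub>R v + b *\<^sub>R w)"
      using mvt[of h v w] inU[of _ h] by (cases "0 < h \<and> h < e / N") blast+
  qed
  then obtain p q where pq: "\<And>h. 0 < h \<Longrightarrow> h < e / N \<Longrightarrow> 0 \<le> p h \<and> p h \<le> h \<and> 0 \<le> q h \<and> q h \<le> h \<and>
     f (x + h *\<^sub>R v + h *\<^sub>R w) - f (x + h *\<^sub>R v) - f (x + h *\<^sub>R w) + f x
       = h * h * D v w (x + p h *\<^sub>R v + q h *\<^sub>R w)"
    unfolding choice_iff by blast
  have inU': "x + a *\<^sub>R w + b *\<^sub>R v \<in> U" if "0 \<le> a" "a \<le> h" "0 \<le> b" "b \<le> h" "h < e / N" for a b h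
    using inU[OF that(3,4,1,2,5)] by (simp add: algebra_simps)
  have "\<forall>h. \<exists>a b. 0 < h \<and> h < e / N \<longrightarrow> 0 \<le> a \<and> a \<le> h \<and> 0 \<le> b \<and> b \<le> h \<and>
     f (x + h *\<^sub>R w + h *\<^sub>R v) - f (x + h *\<^sub>R w) - f (x + h *\<^sub>R v) + f x
       = h * h * D w v (x + a *\<^sub>R w + b *\<^sub>R v)"
  proof
    fix h
    show "\<exists>a b. 0 < h \<and> h < e / N \<longrightarrow> 0 \<le> a \<and> a \<le> h \<and> 0 \<le> b \<and> b \<le> h \<and>
     f (x + h *\<^sub>R w + h *\<^sub>R v) - f (x + h *\<^sub>R w) - f (x + h *\<^sub>R v) + f x
       = h * h * D w v (x + a *\<^sub>R w + b *\<^sub>R v)"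
      using mvt[of h w v] inU'[of _ h] by (cases "0 < h \<and> h < e / N") blast+
  qed
  then obtain p' q' where pq': "\<And>h. 0 < h \<Longrightarrow> h < e / N \<Longrightarrow> 0 \<le> p' h \<and> p' h \<le> h \<and> 0 \<le> q' h \<and> q' h \<le> h \<and>
     f (x + h *\<^sub>R w + h *\<^sub>R v) - f (x + h *\<^sub>R w) - f (x + h *\<^sub>R v) + f x
       = h * h * D w v (x + p' h *\<^sub>R w + q' h *\<^sub>R v)"
    unfolding choice_iff by blast
  have "\<forall>\<^sub>F h in at_right 0. D v w (x + p h *\<^sub>R v + q h *\<^sub>R w) = D w v (x + p' h *\<^sub>R w + q' h *\<^sub>R v)"
  proof -
    have "\<forall>\<^sub>F h in at_right 0. 0 < h \<and> h < e / N"
      using e(1) N(1) by (auto simp: eventually_at_right_field intro!: exI[of _ "e / N"])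
    then show ?thesis
    proof eventually_elim
      case (elim h)
      have comm: "x + h *\<^sub>R w + h *\<^sub>R v = x + h *\<^sub>R v + h *\<^sub>R w" by (simp add: algebra_simps)
      note e1 = pq[OF conjunct1[OF elim] conjunct2[OF elim]] pq'[OF conjunct1[OF elim] conjunct2[OF elim]]
      have "h * h * D v w (x + p h *\<^sub>R v + q h *\<^sub>R w) = h * h * D w v (x + p' h *\<^sub>R w + q' h *\<^sub>R v)"
        using e1[THEN conjunct2, THEN conjunct2, THEN conjunct2, THEN conjunct2] unfolding comm by argo
      then show ?case using elim by simp
    qed
  qed
  moreover have "((\<lambda>h. D v w (x + p h *\<^sub>R v + q h *\<^sub>R w)) \<longlongrightarrow> D v w x) (at_right 0)"
    by (rule lim) (use pq in simp)
  ultimately have "((\<lambda>h. D w v (x + p' h *\<^sub>R w + q' h *\<^sub>R v)) \<longlongrightarrow> D v w x) (at_right 0)"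
    by (rule Lim_transform_eventually[rotated])
  moreover have "((\<lambda>h. D w v (x + p' h *\<^sub>R w + q' h *\<^sub>R v)) \<longlongrightarrow> D w v x) (at_right 0)"
    by (rule lim) (use pq' in simp)
  ultimately have "D v w x = D w v x"
    by (rule tendsto_unique[OF trivial_limit_at_right_real])
  then show ?thesis by (simp add: D_def)
qed

section \<open>The surface measure and polar coordinates\<close>

lemma space_sphere_measure [simp]: "space (sphere_measure :: 'a::euclidean_space measure) = sphere 0 1"
  by (simp add: sphere_measure_def space_restrict_space)

lemma sets_sphere_measure [measurable_cong]:
  "sets (sphere_measure :: 'a::euclidean_space measure) = sets (restrict_space borel (sphere 0 1))"
  by (simp add: sphere_measure_def)

lemma borel_measurable_sphere_measureI:
  "f \<in> borel_measurable borel \<Longrightarrow> f \<in> borel_measurable (sphere_measure :: 'a::euclidean_space measure)"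
  using measurable_cong_sets[OF sets_sphere_measure refl] measurable_restrict_space1 by blast

lemma measurable_ident_sphere_measure:
  "(\<lambda>\<omega>. \<omega>) \<in> (sphere_measure :: 'a::euclidean_space measure) \<rightarrow>\<^sub>M borel"
  using borel_measurable_sphere_measureI[of "\<lambda>x::'a. x"] by simp

lemma continuous_on_borel_measurable_sphere_measure:
  fixes f :: "'a::euclidean_space \<Rightarrow> 'b::{second_countable_topology, metric_space}"
  assumes "continuous_on (sphere 0 1) f"
  shows "f \<in> borel_measurable sphere_measure"
  using borel_measurable_continuous_on_restrict[OF assms]
    measurable_cong_sets[OF sets_sphere_measure refl] by blast

lemma nn_integral_sphere_measure:
  fixes f :: "'a::euclidean_space \<Rightarrow> ennreal"
  assumes [measurable]: "f \<in> borel_measurable borel"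
  shows "(\<integral>\<^sup>+\<omega>. f \<omega> \<partial>sphere_measure) =
    ennreal (real DIM('a)) * (\<integral>\<^sup>+x. f (sgn x) * indicator (ball 0 1 - {0}) x \<partial>lborel)"
proof -
  have s0: "(sgn :: 'a \<Rightarrow> 'a) \<in> borel_measurable borel"
    unfolding sgn_div_norm[abs_def] by measurable
  have s: "(sgn :: 'a \<Rightarrow> 'a) \<in> restrict_space lborel (ball 0 1 - {0}) \<rightarrow>\<^sub>M restrict_space borel (sphere 0 1)"
    by (rule measurable_restrict_space2)
       (auto simp: space_restrict_space norm_sgn intro!: measurable_restrict_space1 s0)
  have f: "f \<in> borel_measurable (restrict_space borel (sphere 0 1))"
    by (intro measurable_restrict_space1 assms)
  show ?thesis
    unfolding sphere_measure_def using s f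
    by (simp add: nn_integral_density nn_integral_cmult nn_integral_distr nn_integral_restrict_space)
qed

lemma emeasure_sphere_measure_space:
  "emeasure sphere_measure (sphere 0 1 :: 'a::euclidean_space set) =
    ennreal (real DIM('a) * measure lborel (ball (0::'a) 1))"
proof -
  have 1: "sphere 0 1 \<in> sets (sphere_measure :: 'a measure)"
    using sets.top[of "sphere_measure :: 'a measure"] by simp
  have "emeasure sphere_measure (sphere 0 1 :: 'a set) = (\<integral>\<^sup>+\<omega>. 1 \<partial>(sphere_measure :: 'a measure))"
    by simp
  also have "\<dots> = ennreal (real DIM('a)) * (\<integral>\<^sup>+x. indicator (ball 0 1 - {0::'a}) x \<partial>lborel)"
    by (subst nn_integral_sphere_measure) auto
  also have "(\<integral>\<^sup>+x. indicator (ball 0 1 - {0::'a}) x \<partial>lborel) = emeasure lborel (ball 0 1 - {0::'a})"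
    by (subst nn_integral_indicator) auto
  also have "\<dots> = emeasure lborel (ball (0::'a) 1)"
    by (intro emeasure_eq_AE) (auto simp: AE_lborel_singleton[of 0, simplified] intro: AE_mp[OF AE_lborel_singleton[of 0]])
  also have "\<dots> = ennreal (measure lborel (ball (0::'a) 1))"
    by (intro emeasure_eq_ennreal_measure) (use emeasure_lborel_ball_finite[of "0::'a" 1] in simp)
  finally show ?thesis by (simp add: ennreal_mult)
qed

lemma finite_measure_sphere_measure: "finite_measure (sphere_measure :: 'a::euclidean_space measure)"
  by (rule finite_measureI) (simp add: emeasure_sphere_measure_space)

interpretation sphere_measure: finite_measure "sphere_measure :: 'a::euclidean_space measure"
  by (rule finite_measure_sphere_measure)

lemma nn_integral_lborel_scaleR:
  fixes f :: "'a::euclidean_space \<Rightarrow> ennreal"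
  assumes [measurable]: "f \<in> borel_measurable borel" and c: "c > 0"
  shows "(\<integral>\<^sup>+x. f x \<partial>lborel) = ennreal (c ^ DIM('a)) * (\<integral>\<^sup>+x. f (c *\<^sub>R x) \<partial>lborel)"
  by (subst lborel_affine[of c 0])
     (use c in \<open>simp_all add: nn_integral_density nn_integral_distr nn_integral_cmult\<close>)

text \<open>The surface measure is given by cones over subsets of the sphere, so the right-hand side
  is a double integral over \<open>r\<close> and a point \<open>y\<close> of the ball. Rescaling
  \<open>r\<close> by \<open>|y|\<close> turns \<open>r sgn y\<close> into \<open>r y\<close>, the
  substitution \<open>x = r y\<close> removes \<open>r\<close> from the argument of
  \<open>f\<close>, and the remaining weight \<open>d |x|^d / r^(d + 1)\<close> on
  \<open>r > |x|\<close> has integral 1.\<close>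

theorem nn_integral_polar:
  fixes f :: "'a::euclidean_space \<Rightarrow> ennreal"
  assumes [measurable]: "f \<in> borel_measurable borel"
  shows "(\<integral>\<^sup>+x. f x \<partial>lborel) =
    (\<integral>\<^sup>+r. indicator {0<..} r * ennreal (r ^ (DIM('a) - 1)) * (\<integral>\<^sup>+\<omega>. f (r *\<^sub>R \<omega>) \<partial>sphere_measure) \<partial>lborel)"
proof -
  let ?d = "DIM('a)" and ?B = "ball 0 1 - {0::'a}"
  have [measurable]: "(sgn :: 'a \<Rightarrow> 'a) \<in> borel_measurable borel"
    unfolding sgn_div_norm[abs_def] by measurable
  have [measurable]: "?B \<in> sets borel" by simp
  have d: "?d = Suc (?d - 1)" using DIM_positive[where 'a='a] by linarith
  have reassoc: "c * (e * (i * p * q)) = e * (i * (c * p) * q)" for c e i p q :: ennreal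
    by (simp add: mult_ac)
  have dpow: "c * c ^ (?d - Suc 0) = c ^ ?d" for c :: real
    using d by (metis One_nat_def power_Suc)
  have "(\<integral>\<^sup>+r. indicator {0<..} r * ennreal (r ^ (?d - 1)) * (\<integral>\<^sup>+\<omega>. f (r *\<^sub>R \<omega>) \<partial>sphere_measure) \<partial>lborel)
     = (\<integral>\<^sup>+r. (\<integral>\<^sup>+y. ennreal ?d * (indicator {0<..} r * ennreal (r ^ (?d - 1)) * (f (r *\<^sub>R sgn y) * indicator ?B y)) \<partial>lborel) \<partial>lborel)"
    by (intro nn_integral_cong, subst nn_integral_sphere_measure)
       (simp_all add: nn_integral_cmult[symmetric] mult_ac)
  also have "\<dots> = (\<integral>\<^sup>+y. (\<integral>\<^sup>+r. ennreal ?d * (indicator {0<..} r * ennreal (r ^ (?d - 1)) * (f (r *\<^sub>R sgn y) * indicator ?B y)) \<partial>lborel) \<partial>lborel)"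
    by (rule lborel_pair.Fubini'[symmetric]) measurable
  also have "\<dots> = (\<integral>\<^sup>+y. (\<integral>\<^sup>+r. ennreal ?d * (indicator {0<..} r * ennreal (r ^ (?d - 1) * norm y ^ ?d) * (f (r *\<^sub>R y) * indicator ?B y)) \<partial>lborel) \<partial>lborel)"
  proof (rule nn_integral_cong)
    fix y :: 'a
    show "(\<integral>\<^sup>+r. ennreal ?d * (indicator {0<..} r * ennreal (r ^ (?d - 1)) * (f (r *\<^sub>R sgn y) * indicator ?B y)) \<partial>lborel)
      = (\<integral>\<^sup>+r. ennreal ?d * (indicator {0<..} r * ennreal (r ^ (?d - 1) * norm y ^ ?d) * (f (r *\<^sub>R y) * indicator ?B y)) \<partial>lborel)"
    proof (cases "y = 0")
      case False
      then have *: "ennreal (norm y) * (ennreal ?d * (indicator {0<..} (0 + norm y * r) * ennreal ((0 + norm y * r) ^ (?d - 1)) * (f ((0 + norm y * r) *\<^sub>R sgn y) * indicator ?B y)))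
        = ennreal ?d * (indicator {0<..} r * ennreal (r ^ (?d - 1) * norm y ^ ?d) * (f (r *\<^sub>R y) * indicator ?B y))" for r
      proof (cases "r > 0")
        case True
        have "(norm y * r) *\<^sub>R sgn y = r *\<^sub>R y" using False by (simp add: sgn_div_norm)
        moreover have "ennreal (norm y) * ennreal ((norm y * r) ^ (?d - 1)) = ennreal (r ^ (?d - 1) * norm y ^ ?d)"
          using True dpow[of "norm y"] by (simp add: ennreal_mult'[symmetric] power_mult_distrib mult_ac)
        ultimately show ?thesis using True False unfolding reassoc
          by (simp add: zero_less_mult_iff)
      qed (use False in \<open>simp add: zero_less_mult_iff\<close>)
      show ?thesis using False
        by (subst nn_integral_real_affine[of _ "norm y" 0])
           (simp_all add: nn_integral_cmult[symmetric] *[unfolded One_nat_def] del: add_0)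
    qed simp
  qed
  also have "\<dots> = (\<integral>\<^sup>+r. (\<integral>\<^sup>+y. ennreal ?d * (indicator {0<..} r * ennreal (r ^ (?d - 1) * norm y ^ ?d) * (f (r *\<^sub>R y) * indicator ?B y)) \<partial>lborel) \<partial>lborel)"
    by (rule lborel_pair.Fubini') measurable
  also have "\<dots> = (\<integral>\<^sup>+r. (\<integral>\<^sup>+x. ennreal ?d * ((if norm x < r then 1 else 0) * ennreal (norm x ^ ?d / r ^ (?d + 1)) * (f x * indicator (- {0}) x)) \<partial>lborel) \<partial>lborel)"
  proof (rule nn_integral_cong)
    fix r :: real
    show "(\<integral>\<^sup>+y. ennreal ?d * (indicator {0<..} r * ennreal (r ^ (?d - 1) * norm y ^ ?d) * (f (r *\<^sub>R y) * indicator ?B y)) \<partial>lborel)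
      = (\<integral>\<^sup>+x. ennreal ?d * ((if norm x < r then 1 else 0) * ennreal (norm x ^ ?d / r ^ (?d + 1)) * (f x * indicator (- {0}) x)) \<partial>lborel)"
    proof (cases "r > 0")
      case True
      have *: "ennreal (r ^ ?d) * (ennreal ?d * ((if norm (r *\<^sub>R x) < r then 1 else 0) * ennreal (norm (r *\<^sub>R x) ^ ?d / r ^ (?d + 1)) * (f (r *\<^sub>R x) * indicator (- {0}) (r *\<^sub>R x))))
        = ennreal ?d * (indicator {0<..} r * ennreal (r ^ (?d - 1) * norm x ^ ?d) * (f (r *\<^sub>R x) * indicator ?B x))" for x :: 'a
      proof -
        have "ennreal (r ^ ?d) * ennreal (norm (r *\<^sub>R x) ^ ?d / r ^ (?d + 1)) = ennreal (r ^ (?d - 1) * norm x ^ ?d)"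
          using True dpow[of r] by (simp add: ennreal_mult'[symmetric] power_mult_distrib field_simps)
        moreover have "(if norm (r *\<^sub>R x) < r then 1 else 0) * c * (f (r *\<^sub>R x) * indicator (- {0}) (r *\<^sub>R x)) =
            c * (f (r *\<^sub>R x) * indicator ?B x)" for c
          using True by (auto simp: indicator_def)
        ultimately show ?thesis using True unfolding reassoc by simp
      qed
      have "(\<integral>\<^sup>+x. ennreal ?d * ((if norm x < r then 1 else 0) * ennreal (norm x ^ ?d / r ^ (?d + 1)) * (f x * indicator (- {0}) x)) \<partial>lborel)
        = (\<integral>\<^sup>+x. ennreal (r ^ ?d) * (ennreal ?d * ((if norm (r *\<^sub>R x) < r then 1 else 0) * ennreal (norm (r *\<^sub>R x) ^ ?d / r ^ (?d + 1)) * (f (r *\<^sub>R x) * indicator (- {0}) (r *\<^sub>R x)))) \<partial>lborel)"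
      proof -
        let ?g = "\<lambda>x. ennreal ?d * ((if norm x < r then 1 else 0) * ennreal (norm x ^ ?d / r ^ (?d + 1)) * (f x * indicator (- {0}) x))"
        have [measurable]: "?g \<in> borel_measurable borel" by measurable
        have "(\<integral>\<^sup>+x. ?g x \<partial>lborel) = ennreal (r ^ ?d) * (\<integral>\<^sup>+x. ?g (r *\<^sub>R x) \<partial>lborel)"
          by (rule nn_integral_lborel_scaleR[OF _ True]) measurable
        also have "\<dots> = (\<integral>\<^sup>+x. ennreal (r ^ ?d) * ?g (r *\<^sub>R x) \<partial>lborel)"
          by (rule nn_integral_cmult[symmetric]) measurable
        finally show ?thesis .
      qed
      then show ?thesis unfolding * by (rule sym)
    next
      case False
      then have "(if norm x < r then 1 else 0) = (0::ennreal)" for x :: 'a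
        by (auto dest: order_le_less_trans[OF norm_ge_zero])
      then show ?thesis using False by simp
    qed
  qed
  also have "\<dots> = (\<integral>\<^sup>+x. (\<integral>\<^sup>+r. ennreal ?d * ((if norm x < r then 1 else 0) * ennreal (norm x ^ ?d / r ^ (?d + 1)) * (f x * indicator (- {0}) x)) \<partial>lborel) \<partial>lborel)"
    by (rule lborel_pair.Fubini'[symmetric]) measurable
  also have "\<dots> = (\<integral>\<^sup>+x. f x \<partial>lborel)"
  proof (rule nn_integral_cong_AE)
    have "(\<integral>\<^sup>+r. ennreal ?d * ((if norm x < r then 1 else 0) * ennreal (norm x ^ ?d / r ^ (?d + 1)) * (f x * indicator (- {0}) x)) \<partial>lborel) = f x"
      if x: "x \<noteq> 0" for x :: 'a
    proof -
      let ?a = "norm x"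
      have a: "?a > 0" using x by simp
      have "(\<integral>\<^sup>+r. ennreal (?d * ?a ^ ?d / r ^ (?d + 1)) * indicator {?a..} r \<partial>lborel) = ennreal (0 - (- (?a ^ ?d) / ?a ^ ?d))"
      proof (rule nn_integral_FTC_atLeast[where F="\<lambda>r. - (?a ^ ?d) / r ^ ?d"])
        show "((\<lambda>r. - (?a ^ ?d) / r ^ ?d) has_real_derivative ?d * ?a ^ ?d / r ^ (?d + 1)) (at r)" if "?a \<le> r" for r
        proof -
          have "r > 0" using that a by linarith
          then show ?thesis using dpow[of r]
            by (auto intro!: derivative_eq_intros simp: field_simps power_add)
        qed
        show "((\<lambda>r. - (?a ^ ?d) / r ^ ?d) \<longlongrightarrow> 0) at_top"
          using DIM_positive[where 'a='a]
          by (intro tendsto_divide_0[OF tendsto_const] filterlim_at_top_imp_at_infinity filterlim_pow_at_top filterlim_ident)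
        show "0 \<le> ?d * ?a ^ ?d / r ^ (?d + 1)" if "?a \<le> r" for r
        proof -
          have "r > 0" using that a by linarith
          then show ?thesis by simp
        qed
      qed measurable
      moreover have "(\<integral>\<^sup>+r. ennreal (?d * ?a ^ ?d / r ^ (?d + 1)) * indicator {?a..} r \<partial>lborel) =
          (\<integral>\<^sup>+r. ennreal ?d * ((if ?a < r then 1 else 0) * ennreal (?a ^ ?d / r ^ (?d + 1))) \<partial>lborel)"
      proof (rule nn_integral_cong_AE)
        show "AE r in lborel. ennreal (?d * ?a ^ ?d / r ^ (?d + 1)) * indicator {?a..} r =
          ennreal ?d * ((if ?a < r then 1 else 0) * ennreal (?a ^ ?d / r ^ (?d + 1)))"
          using AE_lborel_singleton[of ?a]
        proof eventually_elim
          case (elim r)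
          then show ?case
            using a by (auto simp: indicator_def ennreal_mult'[symmetric] mult_ac)
        qed
      qed
      ultimately have 1: "(\<integral>\<^sup>+r. ennreal ?d * ((if ?a < r then 1 else 0) * ennreal (?a ^ ?d / r ^ (?d + 1))) \<partial>lborel) = 1"
        using a by simp
      have "(\<integral>\<^sup>+r. ennreal ?d * ((if ?a < r then 1 else 0) * ennreal (?a ^ ?d / r ^ (?d + 1)) * (f x * indicator (- {0}) x)) \<partial>lborel)
         = (\<integral>\<^sup>+r. ennreal ?d * ((if ?a < r then 1 else 0) * ennreal (?a ^ ?d / r ^ (?d + 1))) * f x \<partial>lborel)"
        using x by (intro nn_integral_cong) (simp add: mult_ac)
      also have "\<dots> = 1 * f x"
        by (subst nn_integral_multc) (simp_all only: 1, measurable)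
      finally show ?thesis by simp
    qed
    then show "AE x in lborel. (\<integral>\<^sup>+r. ennreal ?d * ((if norm x < r then 1 else 0) * ennreal (norm x ^ ?d / r ^ (?d + 1)) * (f x * indicator (- {0}) x)) \<partial>lborel) = f x"
      using AE_lborel_singleton[of "0::'a"] by (auto elim!: AE_mp)
  qed
  finally show ?thesis by simp
qed

text \<open>An identity of measures rather than of integrals: the formula for signed integrands,
  \<open>integral_polar\<close>, then follows by transport and Fubini.\<close>

lemma lborel_polar:
  "(lborel :: 'a::euclidean_space measure) =
    distr (density lborel (\<lambda>r. indicator {0<..} r * ennreal (r ^ (DIM('a) - 1))) \<Otimes>\<^sub>M sphere_measure)
      borel (\<lambda>(r, \<omega>). r *\<^sub>R \<omega>)"
  (is "_ = distr (?M \<Otimes>\<^sub>M _) _ _")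
proof (rule measure_eqI)
  note [measurable] = measurable_ident_sphere_measure
  fix A :: "'a set" assume "A \<in> sets lborel"
  then have A[measurable]: "A \<in> sets borel" by simp
  have m: "(\<lambda>(r, \<omega>). r *\<^sub>R \<omega>) \<in> ?M \<Otimes>\<^sub>M (sphere_measure :: 'a measure) \<rightarrow>\<^sub>M borel"
    by measurable
  have "emeasure (distr (?M \<Otimes>\<^sub>M sphere_measure) borel (\<lambda>(r, \<omega>). r *\<^sub>R \<omega>)) A
     = (\<integral>\<^sup>+p. indicator A (fst p *\<^sub>R snd p) \<partial>(?M \<Otimes>\<^sub>M sphere_measure))"
    using nn_integral_distr[OF m, of "indicator A"] by (simp add: split_beta')
  also have "\<dots> = (\<integral>\<^sup>+r. (\<integral>\<^sup>+\<omega>. indicator A (r *\<^sub>R \<omega>) \<partial>sphere_measure) \<partial>?M)"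
    by (subst sphere_measure.nn_integral_fst[symmetric]) simp_all
  also have "\<dots> = (\<integral>\<^sup>+r. indicator {0<..} r * ennreal (r ^ (DIM('a) - 1)) * (\<integral>\<^sup>+\<omega>. indicator A (r *\<^sub>R \<omega>) \<partial>sphere_measure) \<partial>lborel)"
    by (subst nn_integral_density) simp_all
  also have "\<dots> = (\<integral>\<^sup>+x. indicator A x \<partial>lborel)"
    by (rule nn_integral_polar[symmetric]) measurable
  finally show "emeasure lborel A =
      emeasure (distr (?M \<Otimes>\<^sub>M sphere_measure) borel (\<lambda>(r, \<omega>). r *\<^sub>R \<omega>)) A"
    by simp
qed simp

lemma integral_polar:
  fixes f :: "'a::euclidean_space \<Rightarrow> real"
  assumes f: "integrable lborel f"
  shows "(\<integral>x. f x \<partial>lborel) =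
    (\<integral>r. indicator {0<..} r * r ^ (DIM('a) - 1) * (\<integral>\<omega>. f (r *\<^sub>R \<omega>) \<partial>sphere_measure) \<partial>lborel)"
proof -
  let ?M = "density lborel (\<lambda>r. indicator {0<..} r * ennreal (r ^ (DIM('a) - 1)))"
  note [measurable] = measurable_ident_sphere_measure
  have [measurable]: "f \<in> borel_measurable borel" using f by simp
  have m: "(\<lambda>(r, \<omega>). r *\<^sub>R \<omega>) \<in> ?M \<Otimes>\<^sub>M (sphere_measure :: 'a measure) \<rightarrow>\<^sub>M borel"
    by measurable
  have M: "?M = density lborel (\<lambda>r. ennreal (indicator {0<..} r * r ^ (DIM('a) - 1)))"
    by (intro arg_cong2[where f=density] refl ext) (simp add: indicator_def)
  have "sigma_finite_measure (density lborel (\<lambda>r. ennreal (indicator {0<..} r * r ^ (DIM('a) - 1))))"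
    by (subst sigma_finite_measure.sigma_finite_iff_density_finite[OF sigma_finite_lborel]) auto
  then interpret M: sigma_finite_measure ?M unfolding M .
  interpret P: pair_sigma_finite ?M "sphere_measure :: 'a measure" ..
  have i: "integrable (?M \<Otimes>\<^sub>M sphere_measure) (\<lambda>p. f (fst p *\<^sub>R snd p))"
    using f by (subst (asm) lborel_polar, subst (asm) integrable_distr_eq[OF m]) (simp_all add: split_beta')
  have "(\<integral>x. f x \<partial>lborel) = (\<integral>p. f (fst p *\<^sub>R snd p) \<partial>(?M \<Otimes>\<^sub>M sphere_measure))"
    by (subst lborel_polar, subst integral_distr[OF m]) (simp_all add: split_beta')
  also have "\<dots> = (\<integral>r. (\<integral>\<omega>. f (r *\<^sub>R \<omega>) \<partial>sphere_measure) \<partial>?M)"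
    using P.integral_fst'[OF i] by simp
  also have "\<dots> = (\<integral>r. indicator {0<..} r * r ^ (DIM('a) - 1) * (\<integral>\<omega>. f (r *\<^sub>R \<omega>) \<partial>sphere_measure) \<partial>lborel)"
    unfolding M by (subst integral_density) (simp_all add: mult_ac indicator_def)
  finally show ?thesis .
qed

section \<open>Integration by parts in space and on the sphere\<close>

lemma integrable_continuous_bounded_support:
  fixes f :: "'a::euclidean_space \<Rightarrow> 'b::{banach, second_countable_topology}"
  assumes "continuous_on UNIV f" "\<And>x. norm x > K \<Longrightarrow> f x = 0"
  shows "integrable lborel f"
proof -
  have "integrable lborel (\<lambda>x. indicator (cball 0 K) x *\<^sub>R f x)"
    by (rule borel_integrable_compact) (auto intro: continuous_on_subset[OF assms(1)])
  moreover have "(\<lambda>x. indicator (cball 0 K) x *\<^sub>R f x) = f"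
    using assms(2) by (auto simp: indicator_def fun_eq_iff)
  ultimately show ?thesis by simp
qed

lemma bounded_continuous_bounded_support:
  fixes f :: "'a::euclidean_space \<Rightarrow> real"
  assumes "continuous_on UNIV f" "\<And>x. norm x > K \<Longrightarrow> f x = 0"
  obtains M where "M \<ge> 0" "\<And>x. \<bar>f x\<bar> \<le> M"
proof -
  have "compact (f ` cball 0 K)"
    by (intro compact_continuous_image continuous_on_subset[OF assms(1)]) auto
  then obtain M where M: "\<And>x. x \<in> cball 0 K \<Longrightarrow> norm (f x) \<le> M"
    using compact_imp_bounded bounded_iff by (metis imageI)
  have "\<bar>f x\<bar> \<le> max M 0" for x
    using M[of x] assms(2)[of x] by (cases "norm x \<le> K") auto
  with that[of "max M 0"] show ?thesis by simp
qed

lemma has_derivative_eq_0_outside: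
  fixes \<phi> :: "'a::euclidean_space \<Rightarrow> real"
  assumes "\<And>x. norm x > K \<Longrightarrow> \<phi> x = 0" "(\<phi> has_derivative D) (at x)" "norm x > K"
  shows "D = (\<lambda>h. 0)"
proof -
  have "open {x::'a. norm x > K}" by (intro open_Collect_less continuous_intros)
  then have "(\<phi> has_derivative (\<lambda>h. 0)) (at x)"
    by (rule has_derivative_transform_within_open[of "\<lambda>_. 0", rotated]) (use assms in auto)
  then show ?thesis using assms(2) has_derivative_unique by blast
qed

lemma has_derivative_scaleR_line:
  fixes \<phi> :: "'a::euclidean_space \<Rightarrow> real"
  assumes "(\<phi> has_derivative D) (at (x + t *\<^sub>R e))"
  shows "((\<lambda>t. \<phi> (x + t *\<^sub>R e)) has_real_derivative D e) (at t)"
proof -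
  have "((\<lambda>t. x + t *\<^sub>R e) has_derivative (\<lambda>d. d *\<^sub>R e)) (at t)"
    by (auto intro!: derivative_eq_intros)
  from has_derivative_compose[OF this assms]
  have "((\<lambda>t. \<phi> (x + t *\<^sub>R e)) has_derivative (\<lambda>d. D (d *\<^sub>R e))) (at t)" .
  moreover have "(\<lambda>d. D (d *\<^sub>R e)) = (*) (D e)"
    using linear_scale[OF has_derivative_linear[OF assms]] by (auto simp: fun_eq_iff)
  ultimately show ?thesis by (simp add: has_field_derivative_def)
qed

text \<open>Translation invariance of Lebesgue measure, differentiated.\<close>

lemma integral_directional_derivative_eq_0:
  fixes \<phi> :: "'a::euclidean_space \<Rightarrow> real"
  assumes D: "\<And>x. (\<phi> has_derivative D x) (at x)"
    and cont: "continuous_on UNIV (\<lambda>x. D x e)"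
    and supp: "\<And>x. norm x > K \<Longrightarrow> \<phi> x = 0"
  shows "integrable lborel (\<lambda>x. D x e)" and "(\<integral>x. D x e \<partial>lborel) = 0"
proof -
  have supp': "D x e = 0" if "norm x > K" for x
    using has_derivative_eq_0_outside[OF supp D that] by simp
  obtain M where M: "M \<ge> 0" "\<And>x. \<bar>D x e\<bar> \<le> M"
    using bounded_continuous_bounded_support[OF cont supp'] by blast
  have [measurable]: "(\<lambda>x. D x e) \<in> borel_measurable borel"
    using cont by (rule borel_measurable_continuous_onI)
  have c\<phi>: "continuous_on UNIV \<phi>"
    using D by (auto intro!: continuous_at_imp_continuous_on has_derivative_continuous)
  then have [measurable]: "\<phi> \<in> borel_measurable borel"
    by (rule borel_measurable_continuous_onI)
  have i\<phi>: "integrable lborel \<phi>"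
    by (rule integrable_continuous_bounded_support[OF c\<phi> supp])
  show int: "integrable lborel (\<lambda>x. D x e)"
    by (rule integrable_continuous_bounded_support[OF cont supp'])
  \<comment> \<open>Difference quotients along \<open>e\<close> with step
    \<open>1 / (n + 1)\<close>: each has integral 0 by translation invariance, and they converge to
    \<open>D x e\<close>.\<close>
  define s where "s n x = real (Suc n) * (\<phi> (x + inverse (real (Suc n)) *\<^sub>R e) - \<phi> x)" for n x
  have [measurable]: "s n \<in> borel_measurable borel" for n unfolding s_def by measurable
  have trans: "integrable lborel (\<lambda>x. \<phi> (x + v)) \<and> (\<integral>x. \<phi> (x + v) \<partial>lborel) = (\<integral>x. \<phi> x \<partial>lborel)" for v
  proof -
    have 1: "distr lborel borel (\<lambda>x. x + v) = lborel"
    proof -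
      have "(\<lambda>x. x + v) = (+) v" by (simp add: fun_eq_iff add.commute)
      then show ?thesis using lborel_distr_plus[of v] by simp
    qed
    have "integrable (distr lborel borel (\<lambda>x. x + v)) \<phi>" unfolding 1 by (rule i\<phi>)
    then have "integrable lborel (\<lambda>x. \<phi> (x + v))"
      by (subst (asm) integrable_distr_eq) simp_all
    moreover have "(\<integral>x. \<phi> x \<partial>distr lborel borel (\<lambda>x. x + v)) = (\<integral>x. \<phi> (x + v) \<partial>lborel)"
      by (rule integral_distr) simp_all
    ultimately show ?thesis unfolding 1 by simp
  qed
  have s0: "(\<integral>x. s n x \<partial>lborel) = 0" for n
    unfolding s_def using trans i\<phi> by simp
  \<comment> \<open>The steps have length at most \<open>|e|\<close>, so all quotients vanish
    outside the ball of radius \<open>K + |e|\<close>; this gives one dominating function for all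
    \<open>n\<close>.\<close>
  have mvt: "\<bar>s n x\<bar> \<le> M * indicator (cball 0 (K + norm e)) x" for n x
  proof (cases "norm x \<le> K + norm e")
    case True
    have d: "((\<lambda>t. \<phi> (x + t *\<^sub>R e)) has_real_derivative D (x + t *\<^sub>R e) e) (at t)" for t
      by (rule has_derivative_scaleR_line[OF D])
    obtain z where "\<phi> (x + inverse (real (Suc n)) *\<^sub>R e) - \<phi> (x + 0 *\<^sub>R e) = (inverse (real (Suc n)) - 0) * D (x + z *\<^sub>R e) e"
      using MVT2[of 0 "inverse (real (Suc n))" "\<lambda>t. \<phi> (x + t *\<^sub>R e)" "\<lambda>t. D (x + t *\<^sub>R e) e"] d by auto
    then have "s n x = D (x + z *\<^sub>R e) e" unfolding s_def by (simp del: of_nat_Suc)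
    with M True show ?thesis by simp
  next
    case False
    have "norm (inverse (real (Suc n)) *\<^sub>R e) \<le> 1 * norm e"
      unfolding norm_scaleR by (rule mult_right_mono) (auto simp: field_simps)
    then have "norm (x + inverse (real (Suc n)) *\<^sub>R e) > K"
      using False norm_diff_ineq[of x "inverse (real (Suc n)) *\<^sub>R e"] by linarith
    moreover have "norm x > K" using False norm_ge_zero[of e] by linarith
    ultimately show ?thesis using supp M(1) by (simp add: s_def)
  qed
  have "(\<lambda>n. \<integral>x. s n x \<partial>lborel) \<longlonglongrightarrow> (\<integral>x. D x e \<partial>lborel)"
  proof (rule integral_dominated_convergence[where w="\<lambda>x. M * indicator (cball 0 (K + norm e)) x"])
    show "integrable lborel (\<lambda>x::'a. M * indicator (cball 0 (K + norm e)) x)"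
      by (intro integrable_mult_right integrable_real_indicator)
         (use emeasure_bounded_finite[OF bounded_cball[of "0::'a" "K + norm e"]] in simp_all)
    show "AE x in lborel. (\<lambda>n. s n x) \<longlonglongrightarrow> D x e"
    proof (rule AE_I2)
      fix x
      have "((\<lambda>t. \<phi> (x + t *\<^sub>R e)) has_real_derivative D x e) (at 0)"
        using has_derivative_scaleR_line[of \<phi> "D x" x 0 e] D[of x] by simp
      then have "((\<lambda>h. (\<phi> (x + h *\<^sub>R e) - \<phi> x) / h) \<longlongrightarrow> D x e) (at 0)"
        by (simp add: DERIV_def)
      moreover have "filterlim (\<lambda>n. inverse (real (Suc n))) (at 0) sequentially"
        using LIMSEQ_inverse_real_of_nat by (simp add: filterlim_at del: of_nat_Suc)
      ultimately have "(\<lambda>n. (\<phi> (x + inverse (real (Suc n)) *\<^sub>R e) - \<phi> x) / inverse (real (Suc n))) \<longlonglongrightarrow> D x e"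
        by (rule filterlim_compose)
      then show "(\<lambda>n. s n x) \<longlonglongrightarrow> D x e" by (simp add: s_def field_simps del: of_nat_Suc)
    qed
    show "AE x in lborel. norm (s n x) \<le> M * indicator (cball 0 (K + norm e)) x" for n
      using mvt by simp
  qed measurable
  then have "(\<lambda>n. 0::real) \<longlonglongrightarrow> (\<integral>x. D x e \<partial>lborel)" by (simp add: s0)
  then show "(\<integral>x. D x e \<partial>lborel) = 0" using LIMSEQ_unique tendsto_const by blast
qed

text \<open>The squared positive part is continuously differentiable across 0. It builds the radial
  cutoff of \<open>sphere_integration_by_parts\<close>, which has to be differentiated once.\<close>

lemma has_real_derivative_max_0_square:
  "((\<lambda>u::real. (max 0 u)\<^sup>2) has_real_derivative 2 * max 0 u) (at u)"
proof -
  consider "u > 0" | "u < 0" | "u = 0" by linarith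
  then show ?thesis
  proof cases
    case 1
    have "((\<lambda>u::real. u\<^sup>2) has_real_derivative 2 * max 0 u) (at u)"
      using 1 by (auto intro!: derivative_eq_intros)
    then show ?thesis
      by (rule has_field_derivative_transform_within_open[where S="{0<..}"]) (use 1 in auto)
  next
    case 2
    have "((\<lambda>u::real. 0) has_real_derivative 2 * max 0 u) (at u)"
      using 2 by auto
    then show ?thesis
      by (rule has_field_derivative_transform_within_open[where S="{..<0}"]) (use 2 in auto)
  next
    case 3
    have "((\<lambda>h::real. ((max 0 (0 + h))\<^sup>2 - (max 0 0)\<^sup>2) / h) \<longlongrightarrow> 0) (at 0)"
    proof (rule tendsto_0_le[where K=1])
      show "((\<lambda>h::real. h) \<longlongrightarrow> 0) (at 0)" by (rule tendsto_ident_at)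
      show "\<forall>\<^sub>F h::real in at 0. norm (((max 0 (0 + h))\<^sup>2 - (max 0 0)\<^sup>2) / h) \<le> norm h * 1"
        by (rule always_eventually) (auto simp: max_def power2_eq_square)
    qed
    then show ?thesis using 3 by (simp add: DERIV_def)
  qed
qed

text \<open>Derived from flat space: \<open>f(y) \<eta>(|y|)\<close> has compact support away from
  0, so its derivative along \<open>e\<close> integrates to 0. In polar coordinates this reads
  \<open>B * J + A * I = 0\<close>, where \<open>A\<close> and \<open>B\<close> are the two sphere
  integrals of the claim; the one-dimensional identity \<open>J = - (d - 1) * I\<close> finishes,
  since \<open>I\<close> is nonzero.\<close>

theorem sphere_integration_by_parts:
  fixes f :: "'a::euclidean_space \<Rightarrow> real"
  assumes dim: "DIM('a) \<ge> 2"
    and D: "\<And>y. y \<noteq> 0 \<Longrightarrow> (f has_derivative D y) (at y)"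
    and hom: "\<And>c y. c > 0 \<Longrightarrow> y \<noteq> 0 \<Longrightarrow> f (c *\<^sub>R y) = f y"
    and cont: "continuous_on (- {0}) (\<lambda>y. D y e)"
  shows "(\<integral>\<omega>. D \<omega> e \<partial>sphere_measure) = (real DIM('a) - 1) * (\<integral>\<omega>. (\<omega> \<bullet> e) * f \<omega> \<partial>sphere_measure)"
proof -
  define d where "d = DIM('a)"
  \<comment> \<open>Supported in the shell \<open>1 \<le> |y| \<le> 2\<close>, away from the origin,
    where a function of degree 0 has no limit in general.\<close>
  define \<eta> where "\<eta> r = (max 0 ((r - 1) * (2 - r)))\<^sup>2" for r :: real
  define \<eta>' where "\<eta>' r = 2 * max 0 ((r - 1) * (2 - r)) * (3 - 2 * r)" for r :: real
  have \<eta>: "(\<eta> has_real_derivative \<eta>' r) (at r)" for r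
  proof -
    have "((\<lambda>r. (r - 1) * (2 - r)) has_real_derivative (3 - 2 * r)) (at r)" for r :: real
      by (auto intro!: derivative_eq_intros)
    from DERIV_chain2[OF has_real_derivative_max_0_square this] show ?thesis
      unfolding \<eta>_def[abs_def] \<eta>'_def .
  qed
  have out: "\<eta> r = 0" "\<eta>' r = 0" if "r \<le> 1 \<or> r \<ge> 2" for r
  proof -
    have "(r - 1) * (2 - r) \<le> 0" using that by (auto simp: mult_nonpos_nonneg mult_nonneg_nonpos)
    then show "\<eta> r = 0" "\<eta>' r = 0" by (simp_all add: \<eta>_def \<eta>'_def)
  qed
  have cont\<eta>: "continuous_on UNIV \<eta>" "continuous_on UNIV \<eta>'"
    unfolding \<eta>_def \<eta>'_def by (intro continuous_intros)+
  define \<phi> where "\<phi> y = f y * \<eta> (norm y)" for y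
  define D' where "D' y h = (if y = 0 then 0 else f y * (\<eta>' (norm y) * (h \<bullet> sgn y)) + D y h * \<eta> (norm y))" for y h
  have D': "(\<phi> has_derivative D' y) (at y)" for y
  proof (cases "y = 0")
    case True
    have "((\<lambda>y. 0) has_derivative D' 0) (at (0::'a))" by (simp add: D'_def[abs_def])
    then have "(\<phi> has_derivative D' 0) (at (0::'a))"
      by (rule has_derivative_transform_within_open[where s="ball 0 1"]) (auto simp: \<phi>_def out)
    with True show ?thesis by simp
  next
    case False
    have "((\<lambda>y. \<eta> (norm y)) has_derivative (\<lambda>h. \<eta>' (norm y) * (h \<bullet> sgn y))) (at y)"
      using has_derivative_compose[OF has_derivative_norm[OF False] \<eta>[unfolded has_field_derivative_def]] .
    from has_derivative_mult[OF D[OF False] this]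
    show ?thesis using False unfolding \<phi>_def[abs_def] D'_def[abs_def] by simp
  qed
  have contf: "continuous_on (- {0}) f"
    using D by (auto intro!: continuous_at_imp_continuous_on has_derivative_continuous)
  have cont1: "continuous_on (- {0}) (\<lambda>y. D' y e)"
  proof -
    have "continuous_on (- {0}) (\<lambda>y. f y * (\<eta>' (norm y) * (e \<bullet> sgn y)) + D y e * \<eta> (norm y))"
      by (intro continuous_intros contf cont continuous_on_compose2[OF cont\<eta>(1)] continuous_on_compose2[OF cont\<eta>(2)])
         auto
    then show ?thesis by (rule continuous_on_eq) (simp add: D'_def)
  qed
  have cont2: "continuous_on (ball 0 1) (\<lambda>y. D' y e)"
    by (rule continuous_on_eq[of _ "\<lambda>_. 0"]) (auto simp: D'_def out)
  have "continuous_on (- {0} \<union> ball 0 1) (\<lambda>y. D' y e)"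
    by (rule continuous_on_open_Un[OF _ _ cont1 cont2]) (auto simp: open_Compl)
  moreover have "- {0} \<union> ball 0 1 = (UNIV::'a set)" by auto
  ultimately have contD': "continuous_on UNIV (\<lambda>y. D' y e)" by simp
  have supp\<phi>: "\<phi> y = 0" if "norm y > 2" for y using that by (simp add: \<phi>_def out)
  note zero = integral_directional_derivative_eq_0[OF D' contD' supp\<phi>]
  define A where "A = (\<integral>\<omega>. D \<omega> e \<partial>sphere_measure)"
  define B where "B = (\<integral>\<omega>. (\<omega> \<bullet> e) * f \<omega> \<partial>sphere_measure)"
  have sub: "sphere 0 1 \<subseteq> - {0::'a}" by auto
  have int: "integrable sphere_measure h" if ch: "continuous_on (sphere 0 1) h" for h :: "'a \<Rightarrow> real"
  proof -
    obtain M where M: "\<And>x. x \<in> sphere 0 1 \<Longrightarrow> norm (h x) \<le> M"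
      using compact_imp_bounded[OF compact_continuous_image[OF ch]] bounded_iff
      by (metis compact_sphere imageI)
    then show ?thesis
      by (intro sphere_measure.integrable_const_bound[of _ M] continuous_on_borel_measurable_sphere_measure ch)
         (use M in auto)
  qed
  have iA: "integrable sphere_measure (\<lambda>\<omega>. D \<omega> e)"
    by (intro int continuous_on_subset[OF cont sub])
  have iB: "integrable sphere_measure (\<lambda>\<omega>. (\<omega> \<bullet> e) * f \<omega>)"
    by (intro int continuous_intros continuous_on_subset[OF contf sub])
  \<comment> \<open>The derivative of a function of degree 0 is homogeneous of degree -1; this
    produces the power \<open>r ^ (d - 2)\<close> in \<open>I\<close>.\<close>
  have homD: "D (r *\<^sub>R y) e = D y e / r" if "r > 0" "y \<noteq> 0" for r y
  proof -
    have "((\<lambda>y. f (r *\<^sub>R y)) has_derivative (\<lambda>h. D (r *\<^sub>R y) (r *\<^sub>R h))) (at y)"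
      using has_derivative_compose[OF has_derivative_scaleR_right[OF has_derivative_ident] D[of "r *\<^sub>R y"]] that by simp
    then have "(f has_derivative (\<lambda>h. D (r *\<^sub>R y) (r *\<^sub>R h))) (at y)"
      by (rule has_derivative_transform_within_open[where s="- {0}"]) (use that hom in \<open>auto simp: open_Compl\<close>)
    then have "D y = (\<lambda>h. D (r *\<^sub>R y) (r *\<^sub>R h))"
      using has_derivative_unique D that by blast
    then have "D y e = r * D (r *\<^sub>R y) e"
      using linear_scale[OF has_derivative_linear[OF D[of "r *\<^sub>R y"]]] that by simp
    then show ?thesis using that by simp
  qed
  have inner: "(\<integral>\<omega>. D' (r *\<^sub>R \<omega>) e \<partial>sphere_measure) = \<eta>' r * B + \<eta> r / r * A" if r: "r > 0" for r
  proof -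
    have "(\<integral>\<omega>. D' (r *\<^sub>R \<omega>) e \<partial>sphere_measure) = (\<integral>\<omega>. \<eta>' r * ((\<omega> \<bullet> e) * f \<omega>) + \<eta> r / r * D \<omega> e \<partial>sphere_measure)"
    proof (rule Bochner_Integration.integral_cong[OF refl])
      fix \<omega> :: 'a assume "\<omega> \<in> space sphere_measure"
      then have w: "norm \<omega> = 1" "\<omega> \<noteq> 0" by auto
      then show "D' (r *\<^sub>R \<omega>) e = \<eta>' r * ((\<omega> \<bullet> e) * f \<omega>) + \<eta> r / r * D \<omega> e"
        using r hom homD[OF r w(2)] by (simp add: D'_def sgn_div_norm inner_commute)
    qed
    then show ?thesis using iA iB by (simp add: A_def B_def)
  qed
  define I where "I = (\<integral>r. \<eta> r * r ^ (d - 2) \<partial>lborel)"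
  define J where "J = (\<integral>r. \<eta>' r * r ^ (d - 1) \<partial>lborel)"
  have int1: "integrable lborel (\<lambda>r. \<eta> r * r ^ (d - 2))"
    by (rule integrable_continuous_bounded_support[of _ 2])
       (intro continuous_intros cont\<eta> continuous_on_subset[OF cont\<eta>(1)], auto simp: out abs_if split: if_splits)
  have int2: "integrable lborel (\<lambda>r. \<eta>' r * r ^ (d - 1))"
    by (rule integrable_continuous_bounded_support[of _ 2])
       (intro continuous_intros cont\<eta> continuous_on_subset[OF cont\<eta>(2)], auto simp: out abs_if split: if_splits)
  have d: "d - 1 = Suc (d - 2)" using dim by (simp add: d_def)
  have "0 = (\<integral>x. D' x e \<partial>lborel)" using zero(2) by simp
  also have "\<dots> = (\<integral>r. indicator {0<..} r * r ^ (d - 1) * (\<integral>\<omega>. D' (r *\<^sub>R \<omega>) e \<partial>sphere_measure) \<partial>lborel)"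
    unfolding d_def by (rule integral_polar[OF zero(1)])
  also have "\<dots> = (\<integral>r. B * (\<eta>' r * r ^ (d - 1)) + A * (\<eta> r * r ^ (d - 2)) \<partial>lborel)"
  proof (rule Bochner_Integration.integral_cong[OF refl])
    fix r :: real
    show "indicator {0<..} r * r ^ (d - 1) * (\<integral>\<omega>. D' (r *\<^sub>R \<omega>) e \<partial>sphere_measure)
        = B * (\<eta>' r * r ^ (d - 1)) + A * (\<eta> r * r ^ (d - 2))"
    proof (cases "r > 0")
      case True
      have "r ^ (d - 1) = r * r ^ (d - 2)" unfolding d by simp
      then show ?thesis using True by (simp add: inner field_simps)
    qed (simp add: out)
  qed
  also have "\<dots> = B * J + A * I" using int1 int2 by (simp add: I_def J_def)
  finally have AB: "B * J + A * I = 0" by simp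
  have "(\<integral>r. \<eta>' r * r ^ (d - 1) + \<eta> r * (real (d - 1) * r ^ (d - 2)) \<partial>lborel) = 0"
  proof -
    let ?D = "\<lambda>r h. (\<eta>' r * r ^ (d - 1) + \<eta> r * (real (d - 1) * r ^ (d - 2))) * (h::real)"
    have der: "((\<lambda>r. \<eta> r * r ^ (d - 1)) has_derivative ?D r) (at r)" for r
    proof -
      have "((\<lambda>r. r ^ (d - 1)) has_real_derivative real (d - 1) * r ^ (d - 2)) (at r)"
        using DERIV_pow[of "d - 1" r] by (simp add: numeral_2_eq_2)
      from DERIV_mult[OF \<eta> this] show ?thesis
        unfolding has_field_derivative_def by (simp add: mult.commute[of _ "\<eta> r"])
    qed
    have "continuous_on UNIV (\<lambda>r. ?D r 1)"
      by (intro continuous_intros cont\<eta>)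
    moreover have "\<eta> r * r ^ (d - 1) = 0" if "norm r > 2" for r
      using that by (subst out) (auto simp: abs_if split: if_splits)
    ultimately show ?thesis
      using integral_directional_derivative_eq_0(2)[of _ ?D 1 2, OF der] by simp
  qed
  moreover have "(\<integral>r. \<eta>' r * r ^ (d - 1) + \<eta> r * (real (d - 1) * r ^ (d - 2)) \<partial>lborel) =
      (\<integral>r. \<eta>' r * r ^ (d - 1) + real (d - 1) * (\<eta> r * r ^ (d - 2)) \<partial>lborel)"
    by (simp add: mult.left_commute)
  ultimately have "J + real (d - 1) * I = 0"
    using int1 int2 by (simp add: I_def J_def)
  then have J: "J = - (real d - 1) * I" using dim by (simp add: d_def of_nat_diff algebra_simps)
  have "I \<noteq> 0"
  proof
    assume "I = 0"
    have nn: "\<eta> r * r ^ (d - 2) \<ge> 0" for r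
      by (cases "r \<ge> 0") (simp add: \<eta>_def, simp add: out)
    have "AE r in lborel. \<eta> r * r ^ (d - 2) = 0"
      using integral_nonneg_eq_0_iff_AE[OF int1] nn \<open>I = 0\<close> unfolding I_def by auto
    moreover have "\<eta> r * r ^ (d - 2) \<noteq> 0" if "1 < r" "r < 2" for r
      using that by (auto simp: \<eta>_def)
    ultimately have "AE r in lborel. \<not> (1 < r \<and> r < (2::real))"
      by (auto elim!: eventually_mono)
    then have "emeasure lborel {r::real. 1 < r \<and> r < 2} = 0"
      by (subst (asm) AE_iff_measurable[OF _ refl]) auto
    moreover have "{r::real. 1 < r \<and> r < 2} = {1<..<2}" by auto
    ultimately show False by simp
  qed
  have "(A - (real d - 1) * B) * I = 0" using AB unfolding J by (simp add: algebra_simps)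
  with \<open>I \<noteq> 0\<close> have "A = (real d - 1) * B" by simp
  then show ?thesis by (simp add: A_def B_def d_def)
qed

section \<open>Sphere integrals of functions of \<open>\<theta> \<bullet> \<omega>\<close>\<close>

lemma integrable_continuous_sphere_measure:
  fixes h :: "'a::euclidean_space \<Rightarrow> real"
  assumes "continuous_on (sphere 0 1) h"
  shows "integrable sphere_measure h"
proof -
  obtain M where M: "\<And>x. x \<in> sphere 0 1 \<Longrightarrow> norm (h x) \<le> M"
    using compact_imp_bounded[OF compact_continuous_image[OF assms]] bounded_iff
    by (metis compact_sphere imageI)
  show ?thesis
    by (rule sphere_measure.integrable_const_bound[of _ M])
       (use M in \<open>auto intro: continuous_on_borel_measurable_sphere_measure assms\<close>)
qed

lemma integral_sphere_measure_bound:
  fixes h :: "'a::euclidean_space \<Rightarrow> real"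
  assumes "\<And>\<omega>. norm \<omega> = 1 \<Longrightarrow> \<bar>h \<omega>\<bar> \<le> M"
  shows "\<bar>\<integral>\<omega>. h \<omega> \<partial>sphere_measure\<bar> \<le> M * measure (sphere_measure :: 'a measure) (sphere 0 1)"
proof (cases "integrable sphere_measure h")
  case True
  have "\<bar>\<integral>\<omega>. h \<omega> \<partial>sphere_measure\<bar> \<le> (\<integral>\<omega>. \<bar>h \<omega>\<bar> \<partial>sphere_measure)"
    by (rule integral_abs_bound)
  also have "\<dots> \<le> (\<integral>\<omega>. M \<partial>(sphere_measure :: 'a measure))"
    by (rule integral_mono) (use True assms in auto)
  finally show ?thesis by (simp add: mult.commute)
next
  case False
  \<comment> \<open>The sphere contains a basis vector, hence \<open>M \<ge> 0\<close>; a
    non-integrable \<open>h\<close> has integral 0 by convention.\<close>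
  have "norm (SOME i::'a. i \<in> Basis) = 1" by (simp add: SOME_Basis)
  from assms[OF this] have "M \<ge> 0" by linarith
  with False show ?thesis by (simp add: not_integrable_integral_eq)
qed

text \<open>Integration by parts along \<open>\<theta>\<close> of the degree 0 function
  \<open>(\<theta> \<bullet> y / |y|) ^ n\<close>, whose derivative on the sphere is
  \<open>n s ^ (n - 1) (1 - s^2)\<close> with \<open>s = \<theta> \<bullet> \<omega>\<close>. At
  \<open>n = 0\<close> the truncated exponent is harmless because of the factor \<open>n\<close>,
  and the first moment comes out as 0.\<close>

lemma sphere_moment_recursion:
  fixes \<theta> :: "'a::euclidean_space"
  assumes \<theta>: "norm \<theta> = 1" and dim: "DIM('a) \<ge> 2"
  shows "(real n + real DIM('a) - 1) * (\<integral>\<omega>. (\<theta> \<bullet> \<omega>) ^ Suc n \<partial>sphere_measure) =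
    real n * (\<integral>\<omega>. (\<theta> \<bullet> \<omega>) ^ (n - 1) \<partial>sphere_measure)"
proof -
  define f where "f y = (\<theta> \<bullet> y / norm y) ^ n" for y
  define D where "D y h = real n * (\<theta> \<bullet> y / norm y) ^ (n - 1) *
      ((\<theta> \<bullet> h * norm y - (\<theta> \<bullet> y) * (h \<bullet> sgn y)) / (norm y * norm y))" for y h
  have D: "(f has_derivative D y) (at y)" if "y \<noteq> 0" for y
  proof -
    have "((\<lambda>y. \<theta> \<bullet> y / norm y) has_derivative
        (\<lambda>h. (\<theta> \<bullet> h * norm y - (\<theta> \<bullet> y) * (h \<bullet> sgn y)) / (norm y * norm y))) (at y)"
      using that by (intro has_derivative_divide' has_derivative_norm derivative_intros) auto
    from has_derivative_power[OF this, of n] show ?thesis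
      unfolding f_def[abs_def] D_def[abs_def] by (simp add: mult_ac)
  qed
  have hom: "f (c *\<^sub>R y) = f y" if "c > 0" for c y
    using that by (simp add: f_def)
  have cont: "continuous_on (- {0}) (\<lambda>y. D y \<theta>)"
    unfolding D_def by (intro continuous_intros) auto
  have "(\<integral>\<omega>. D \<omega> \<theta> \<partial>sphere_measure) = (real DIM('a) - 1) * (\<integral>\<omega>. (\<omega> \<bullet> \<theta>) * f \<omega> \<partial>sphere_measure)"
    by (rule sphere_integration_by_parts[OF dim D _ cont]) (use hom in auto)
  also have "(\<integral>\<omega>. (\<omega> \<bullet> \<theta>) * f \<omega> \<partial>sphere_measure) = (\<integral>\<omega>. (\<theta> \<bullet> \<omega>) ^ Suc n \<partial>sphere_measure)"
    by (intro Bochner_Integration.integral_cong) (auto simp: f_def inner_commute)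
  also have "(\<integral>\<omega>. D \<omega> \<theta> \<partial>sphere_measure) =
      (\<integral>\<omega>. real n * (\<theta> \<bullet> \<omega>) ^ (n - 1) - real n * (\<theta> \<bullet> \<omega>) ^ Suc n \<partial>sphere_measure)"
  proof (intro Bochner_Integration.integral_cong refl)
    fix \<omega> :: 'a assume "\<omega> \<in> space sphere_measure"
    moreover have "\<theta> \<bullet> \<theta> = 1" using \<theta> by (simp add: norm_eq_1)
    ultimately show "D \<omega> \<theta> = real n * (\<theta> \<bullet> \<omega>) ^ (n - 1) - real n * (\<theta> \<bullet> \<omega>) ^ Suc n"
      by (cases n) (auto simp: D_def sgn_div_norm inner_commute algebra_simps)
  qed
  also have "\<dots> = real n * (\<integral>\<omega>. (\<theta> \<bullet> \<omega>) ^ (n - 1) \<partial>sphere_measure) - real n * (\<integral>\<omega>. (\<theta> \<bullet> \<omega>) ^ Suc n \<partial>sphere_measure)"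
  proof -
    have "integrable sphere_measure (\<lambda>\<omega>::'a. (\<theta> \<bullet> \<omega>) ^ k)" for k
      by (intro integrable_continuous_sphere_measure continuous_intros)
    then show ?thesis by (subst Bochner_Integration.integral_diff) (simp_all del: power_Suc)
  qed
  finally show ?thesis by (simp add: algebra_simps)
qed

text \<open>For \<open>d = 2 * m + 3\<close> the exponent of the weight is
  \<open>(d - 3) / 2 = m\<close>: up to a constant, the weight is the density of
  \<open>\<theta> \<bullet> \<omega>\<close> under the surface measure.\<close>

definition zonal_moment :: "nat \<Rightarrow> nat \<Rightarrow> real" where
  "zonal_moment m n = integral {-1..1} (\<lambda>s. s ^ n * (1 - s\<^sup>2) ^ m)"

text \<open>The function \<open>s ^ n (1 - s^2) ^ Suc m\<close> vanishes at both ends, so its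
  derivative integrates to 0. With \<open>d - 1 = 2 * m + 2\<close> this is the recursion of
  \<open>sphere_moment_recursion\<close>.\<close>

lemma zonal_moment_recursion:
  "real n * zonal_moment m (n - 1) = real (n + 2 * m + 2) * zonal_moment m (Suc n)"
proof -
  let ?f = "\<lambda>s::real. real n * (s ^ (n - 1) * (1 - s\<^sup>2) ^ m) - real (n + 2 * m + 2) * (s ^ Suc n * (1 - s\<^sup>2) ^ m)"
  have "(?f has_integral (1 ^ n * (1 - 1\<^sup>2) ^ Suc m - (-1) ^ n * (1 - (-1)\<^sup>2) ^ Suc m)) {-1..1}"
  proof (rule fundamental_theorem_of_calculus)
    fix s :: real
    have "((\<lambda>s. s ^ n * (1 - s\<^sup>2) ^ Suc m) has_real_derivative
        s ^ n * (real (Suc m) * (1 - s\<^sup>2) ^ m * (- 2 * s)) + real n * s ^ (n - 1) * (1 - s\<^sup>2) ^ Suc m) (at s)"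
      by (rule derivative_eq_intros refl | simp)+
    moreover have "s ^ n * (real (Suc m) * (1 - s\<^sup>2) ^ m * (- 2 * s)) + real n * s ^ (n - 1) * (1 - s\<^sup>2) ^ Suc m = ?f s"
      by (cases n) (simp_all add: algebra_simps power2_eq_square)
    ultimately show "((\<lambda>s. s ^ n * (1 - s\<^sup>2) ^ Suc m) has_vector_derivative ?f s) (at s within {-1..1})"
      using has_field_derivative_at_within has_real_derivative_iff_has_vector_derivative by fastforce
  qed simp
  then have "integral {-1..1} ?f = 0" by (simp add: integral_unique)
  moreover have "(\<lambda>s::real. s ^ k * (1 - s\<^sup>2) ^ m) integrable_on {-1..1}" for k
    by (intro integrable_continuous_interval continuous_intros)
  ultimately show ?thesis
    unfolding zonal_moment_def
    by (subst (asm) integral_diff) (auto intro!: integrable_on_mult_right simp del: power_Suc)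
qed

lemma zonal_moment_0: "zonal_moment m 0 = 2 ^ (2 * m + 1) * (fact m)\<^sup>2 / fact (2 * m + 1)"
proof (induction m)
  case 0
  show ?case by (simp add: zonal_moment_def)
next
  case (Suc m)
  have i: "(\<lambda>s::real. s ^ k * (1 - s\<^sup>2) ^ m) integrable_on {-1..1}" for k m
    by (intro integrable_continuous_interval continuous_intros)
  have "zonal_moment (Suc m) 0 = zonal_moment m 0 - zonal_moment m 2"
  proof -
    have "zonal_moment m 0 - zonal_moment m 2 =
        integral {-1..1} (\<lambda>s. s ^ 0 * (1 - s\<^sup>2) ^ m - s ^ 2 * (1 - s\<^sup>2) ^ m)"
      unfolding zonal_moment_def by (subst integral_diff[OF i i]) simp
    then show ?thesis by (simp add: zonal_moment_def algebra_simps)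
  qed
  moreover have "zonal_moment m 0 = (2 * real m + 3) * zonal_moment m 2"
    using zonal_moment_recursion[of 1 m] by (simp add: numeral_2_eq_2 algebra_simps)
  ultimately have "zonal_moment (Suc m) 0 * (2 * real m + 3) = zonal_moment m 0 * (2 * real m + 2)"
    by (simp add: algebra_simps)
  then have "zonal_moment (Suc m) 0 = zonal_moment m 0 * (2 * real m + 2) / (2 * real m + 3)"
    by (simp add: field_simps)
  also have "\<dots> = 2 ^ (2 * Suc m + 1) * (fact (Suc m))\<^sup>2 / fact (2 * Suc m + 1)"
    unfolding Suc by (simp add: divide_simps power2_eq_square) (simp add: algebra_simps)
  finally show ?case .
qed

text \<open>The area \<open>2 \<pi>^(m + 1) / m!\<close> of the unit sphere in
  \<open>2 * m + 2\<close> dimensions, the shape of the slices on which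
  \<open>\<theta> \<bullet> \<omega>\<close> is constant; written so that multiplication by
  \<open>2 ^ m * fact m\<close> visibly gives \<open>(2 \<pi>)^\<mu>\<close>.\<close>

definition zonal_const :: "nat \<Rightarrow> real" where
  "zonal_const m = (2 * pi) ^ Suc m / (2 ^ m * fact m)"

lemma zonal_const_pos: "zonal_const m > 0"
  by (simp add: zonal_const_def)

lemma measure_sphere_eq:
  assumes "DIM('a::euclidean_space) = 2 * m + 3"
  shows "measure (sphere_measure :: 'a measure) (sphere 0 1) = zonal_const m * zonal_moment m 0"
proof -
  have "measure (sphere_measure :: 'a measure) (sphere 0 1) = real DIM('a) * measure lborel (ball (0::'a) 1)"
    unfolding measure_def[of sphere_measure] emeasure_sphere_measure_space by simp
  also have "measure lborel (ball (0::'a) 1) = unit_ball_vol (real (2 * Suc m + 1))"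
    using content_ball[of 1 "0::'a"] assms by (simp add: algebra_simps)
  also have "real DIM('a) * \<dots> = zonal_const m * zonal_moment m 0"
    unfolding unit_ball_vol_odd zonal_moment_0 zonal_const_def assms
    by (simp add: divide_simps power2_eq_square) (simp add: algebra_simps)
  finally show ?thesis .
qed

text \<open>Both sides satisfy the same two-step recursion. Moment 0 is the area of the sphere, and
  moment 1 is forced to vanish by the factor \<open>k = 0\<close>.\<close>

lemma sphere_moment:
  fixes \<theta> :: "'a::euclidean_space"
  assumes \<theta>: "norm \<theta> = 1" and dim: "DIM('a) = 2 * m + 3"
  shows "(\<integral>\<omega>. (\<theta> \<bullet> \<omega>) ^ n \<partial>sphere_measure) = zonal_const m * zonal_moment m n"
proof (induction n rule: less_induct)
  case (less n)
  have rec: "(real k + 2 * real m + 2) * (\<integral>\<omega>. (\<theta> \<bullet> \<omega>) ^ Suc k \<partial>sphere_measure) =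
      real k * (\<integral>\<omega>. (\<theta> \<bullet> \<omega>) ^ (k - 1) \<partial>sphere_measure)" for k
    using sphere_moment_recursion[OF \<theta>, of k] dim by (simp add: algebra_simps)
  have rec': "(real k + 2 * real m + 2) * zonal_moment m (Suc k) = real k * zonal_moment m (k - 1)" for k
    using zonal_moment_recursion[of k m] by (simp add: algebra_simps)
  show ?case
  proof (cases n)
    case 0
    then show ?thesis using measure_sphere_eq[OF dim] by simp
  next
    case (Suc k)
    have "real k * (\<integral>\<omega>. (\<theta> \<bullet> \<omega>) ^ (k - 1) \<partial>sphere_measure) = real k * (zonal_const m * zonal_moment m (k - 1))"
      using less[of "k - 1"] Suc by (cases k) auto
    then have "(real k + 2 * real m + 2) * (\<integral>\<omega>. (\<theta> \<bullet> \<omega>) ^ Suc k \<partial>sphere_measure) =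
        (real k + 2 * real m + 2) * (zonal_const m * zonal_moment m (Suc k))"
      unfolding rec using rec'[of k] by (simp add: mult.left_commute)
    moreover have "real k + 2 * real m + 2 \<noteq> 0" by (simp add: add_nonneg_pos)
    ultimately show ?thesis using Suc by (metis mult_left_cancel)
  qed
qed

lemma sphere_measure_inner_abs_le: "norm \<theta> = 1 \<Longrightarrow> norm \<omega> = 1 \<Longrightarrow> \<theta> \<bullet> \<omega> \<in> {-1..1}"
  using Cauchy_Schwarz_ineq2[of \<theta> \<omega>] by auto

text \<open>Both sides are determined by their values on monomials, by Weierstrass' theorem.\<close>

theorem integral_sphere_zonal:
  fixes \<theta> :: "'a::euclidean_space"
  assumes \<theta>: "norm \<theta> = 1" and dim: "DIM('a) = 2 * m + 3" and f: "continuous_on {-1..1} f"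
  shows "(\<integral>\<omega>. f (\<theta> \<bullet> \<omega>) \<partial>sphere_measure) = zonal_const m * integral {-1..1} (\<lambda>s. f s * (1 - s\<^sup>2) ^ m)"
proof -
  define L where "L f = (\<integral>\<omega>. f (\<theta> \<bullet> \<omega>) \<partial>sphere_measure)" for f :: "real \<Rightarrow> real"
  define I where "I f = zonal_const m * integral {-1..1} (\<lambda>s. f s * (1 - s\<^sup>2) ^ m)" for f
  have intL: "integrable sphere_measure (\<lambda>\<omega>. g (\<theta> \<bullet> \<omega>))" if "continuous_on {-1..1} g" for g :: "real \<Rightarrow> real"
    by (intro integrable_continuous_sphere_measure continuous_on_compose2[OF that] continuous_intros)
       (use sphere_measure_inner_abs_le[OF \<theta>] in auto)
  have intI: "(\<lambda>s. g s * (1 - s\<^sup>2) ^ m) integrable_on {-1..1}" if "continuous_on {-1..1} g" for g :: "real \<Rightarrow> real"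
    by (intro integrable_continuous_interval continuous_intros that)
  have poly: "L g = I g" if rp: "real_polynomial_function g" for g
  proof -
    obtain a n where g: "g = (\<lambda>x. \<Sum>i\<le>n. a i * x ^ i)"
      using rp unfolding real_polynomial_function_iff_sum by auto
    have "L g = (\<Sum>i\<le>n. a i * (\<integral>\<omega>. (\<theta> \<bullet> \<omega>) ^ i \<partial>sphere_measure))"
      unfolding L_def g by (subst Bochner_Integration.integral_sum)
        (auto intro!: integrable_continuous_sphere_measure continuous_intros)
    also have "\<dots> = zonal_const m * (\<Sum>i\<le>n. a i * zonal_moment m i)"
      by (simp add: sphere_moment[OF \<theta> dim] sum_distrib_left mult_ac)
    also have "(\<Sum>i\<le>n. a i * zonal_moment m i) = integral {-1..1} (\<lambda>s. \<Sum>i\<le>n. a i * (s ^ i * (1 - s\<^sup>2) ^ m))"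
    proof -
      have "integral {-1..1} (\<lambda>s. \<Sum>i\<le>n. a i * (s ^ i * (1 - s\<^sup>2) ^ m)) =
          (\<Sum>i\<le>n. integral {-1..1} (\<lambda>s. a i * (s ^ i * (1 - s\<^sup>2) ^ m)))"
        by (rule Henstock_Kurzweil_Integration.integral_sum)
           (simp, intro integrable_continuous_interval continuous_intros)
      then show ?thesis by (simp add: zonal_moment_def)
    qed
    finally show ?thesis by (simp add: I_def g sum_distrib_right mult.assoc)
  qed
  \<comment> \<open>A bound for the sum of the norms of the two functionals on continuous functions:
    replacing \<open>f\<close> by a polynomial with uniform error \<open>e\<close> costs at most
    \<open>e * K\<close>.\<close>
  define K where "K = measure (sphere_measure :: 'a measure) (sphere 0 1) + zonal_const m * 2"
  have K: "K \<ge> 0" using zonal_const_pos[of m] by (simp add: K_def)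
  have le: "\<bar>L f - I f\<bar> \<le> e * (K + 1)" if e: "e > 0" for e
  proof -
    obtain g where g: "real_polynomial_function g" "\<And>x. x \<in> {-1..1} \<Longrightarrow> \<bar>f x - g x\<bar> < e"
      using Stone_Weierstrass_real_polynomial_function[OF compact_Icc f e] by blast
    have cg: "continuous_on {-1..1} g"
      using g(1) continuous_on_polymonial_function real_polynomial_function_eq by blast
    have "L f - L g = (\<integral>\<omega>. f (\<theta> \<bullet> \<omega>) - g (\<theta> \<bullet> \<omega>) \<partial>sphere_measure)"
      unfolding L_def using intL[OF f] intL[OF cg] by simp
    also have "\<bar>\<dots>\<bar> \<le> e * measure (sphere_measure :: 'a measure) (sphere 0 1)"
      by (rule integral_sphere_measure_bound) (use g(2) sphere_measure_inner_abs_le[OF \<theta>] in \<open>auto intro: less_imp_le\<close>)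
    finally have 1: "\<bar>L f - L g\<bar> \<le> e * measure (sphere_measure :: 'a measure) (sphere 0 1)" .
    have "I f - I g = zonal_const m * integral {-1..1} (\<lambda>s. f s * (1 - s\<^sup>2) ^ m - g s * (1 - s\<^sup>2) ^ m)"
      unfolding I_def using intI[OF f] intI[OF cg] by (simp add: integral_diff right_diff_distrib)
    moreover have "\<bar>integral {-1..1} (\<lambda>s. f s * (1 - s\<^sup>2) ^ m - g s * (1 - s\<^sup>2) ^ m)\<bar> \<le> e * 2"
    proof -
      have "norm (integral {-1..1} (\<lambda>s. f s * (1 - s\<^sup>2) ^ m - g s * (1 - s\<^sup>2) ^ m)) \<le> e * (1 - (-1))"
      proof (rule integral_bound)
        show "continuous_on {-1..1} (\<lambda>s. f s * (1 - s\<^sup>2) ^ m - g s * (1 - s\<^sup>2) ^ m)"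
          by (intro continuous_intros f cg)
        show "norm (f s * (1 - s\<^sup>2) ^ m - g s * (1 - s\<^sup>2) ^ m) \<le> e" if "s \<in> {-1..1}" for s
        proof -
          have "s\<^sup>2 \<le> 1" using that by (simp add: abs_square_le_1 abs_le_iff)
          then have "0 \<le> (1 - s\<^sup>2) ^ m" "(1 - s\<^sup>2) ^ m \<le> 1" by (auto intro: power_le_one)
          then have "\<bar>f s - g s\<bar> * (1 - s\<^sup>2) ^ m \<le> e * 1"
            using g(2)[OF that] by (intro mult_mono) auto
          then show ?thesis using \<open>0 \<le> (1 - s\<^sup>2) ^ m\<close>
            by (simp add: left_diff_distrib[symmetric] abs_mult)
        qed
      qed simp
      then show ?thesis by simp
    qed
    ultimately have "\<bar>I f - I g\<bar> \<le> zonal_const m * (e * 2)"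
      using zonal_const_pos[of m] by (simp add: abs_mult)
    with 1 poly[OF g(1)] have "\<bar>L f - I f\<bar> \<le> e * K" by (simp add: K_def algebra_simps)
    also have "\<dots> \<le> e * (K + 1)" using e by simp
    finally show ?thesis .
  qed
  have "L f = I f"
  proof (rule ccontr)
    assume "L f \<noteq> I f"
    with K have "\<bar>L f - I f\<bar> / (2 * (K + 1)) > 0" by simp
    note le[OF this]
    also have "\<bar>L f - I f\<bar> / (2 * (K + 1)) * (K + 1) = \<bar>L f - I f\<bar> / 2"
      using K by (simp add: divide_simps)
    finally show False using \<open>L f \<noteq> I f\<close> by simp
  qed
  then show ?thesis by (simp add: L_def I_def)
qed

section \<open>Plane wave superpositions\<close>

text \<open>A function of degree 0 is determined by its values on the sphere, and its tangential
  derivatives become ordinary Frechet derivatives on an open set. Nothing is prescribed at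
  \<open>x = 0\<close>, which is why identities between profiles are claimed on
  \<open>cyl\<close>.\<close>

definition profile :: "real \<Rightarrow> (real \<times> 'a::euclidean_space \<Rightarrow> real) \<Rightarrow> bool" where
  "profile R F \<longleftrightarrow> smooth_on (UNIV \<times> - {0}) F \<and>
     (\<forall>s x c. x \<noteq> 0 \<longrightarrow> c > 0 \<longrightarrow> F (s, c *\<^sub>R x) = F (s, x)) \<and>
     (\<forall>s x. x \<noteq> 0 \<longrightarrow> \<bar>s\<bar> > R \<longrightarrow> F (s, x) = 0)"

definition dS :: "(real \<times> 'a::euclidean_space \<Rightarrow> real) \<Rightarrow> real \<times> 'a \<Rightarrow> real" where
  "dS F p = frechet_derivative F (at p) (1, 0)"

text \<open>A derivative in \<open>x\<close> lowers the homogeneity by one; the factor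
  \<open>norm (snd p)\<close> restores degree 0, so that profiles are closed under the
  operation.\<close>

definition dX :: "'a \<Rightarrow> (real \<times> 'a::euclidean_space \<Rightarrow> real) \<Rightarrow> real \<times> 'a \<Rightarrow> real" where
  "dX i F p = norm (snd p) * frechet_derivative F (at p) (0, i)"

definition mS :: "(real \<times> 'a::euclidean_space \<Rightarrow> real) \<Rightarrow> real \<times> 'a \<Rightarrow> real" where
  "mS F p = fst p * F p"

text \<open>Multiplication by the coordinate \<open>\<omega> \<bullet> i\<close>, in a form of
  degree 0. The partial derivative of a wave along \<open>i\<close> has the profile
  \<open>mW i (dS F)\<close>.\<close>

definition mW :: "'a \<Rightarrow> (real \<times> 'a::euclidean_space \<Rightarrow> real) \<Rightarrow> real \<times> 'a \<Rightarrow> real" where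
  "mW i F p = (snd p \<bullet> i) * inverse (norm (snd p)) * F p"

abbreviation cyl :: "(real \<times> 'a::euclidean_space) set" where
  "cyl \<equiv> UNIV \<times> - {0}"

lemma open_cyl: "open cyl"
  by (intro open_Times) (auto simp: open_Compl)

lemma profile_smooth: "profile R F \<Longrightarrow> smooth_on cyl F"
  by (simp add: profile_def)

lemma profile_hom: "profile R F \<Longrightarrow> x \<noteq> 0 \<Longrightarrow> c > 0 \<Longrightarrow> F (s, c *\<^sub>R x) = F (s, x)"
  by (simp add: profile_def)

lemma profile_support: "profile R F \<Longrightarrow> x \<noteq> 0 \<Longrightarrow> \<bar>s\<bar> > R \<Longrightarrow> F (s, x) = 0"
  by (simp add: profile_def)

lemma profile_has_derivative:
  "profile R F \<Longrightarrow> x \<noteq> 0 \<Longrightarrow> (F has_derivative frechet_derivative F (at (s, x))) (at (s, x))"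
  by (rule smooth_on_has_derivative[OF open_cyl profile_smooth]) auto

lemma profile_add: "profile R F \<Longrightarrow> profile R G \<Longrightarrow> profile R (\<lambda>p. F p + G p)"
  unfolding profile_def by (auto intro: smooth_on_add)

lemma profile_scale: "profile R F \<Longrightarrow> profile R (\<lambda>p. c * F p)"
  unfolding profile_def by (auto intro: smooth_on_mult smooth_on_const)

lemma profile_mS:
  assumes "profile R F" shows "profile R (mS F)"
proof -
  have "smooth_on cyl (mS F)"
    unfolding mS_def[abs_def]
    by (rule smooth_on_mult[OF smooth_on_bounded_linear[OF bounded_linear_fst] profile_smooth[OF assms]])
  with assms show ?thesis unfolding profile_def by (simp add: mS_def)
qed

lemma smooth_on_cyl_compose_snd:
  fixes f :: "'a::euclidean_space \<Rightarrow> real"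
  assumes "smooth_on (- {0}) f" shows "smooth_on cyl (\<lambda>p::real \<times> 'a. f (snd p))"
proof (rule smooth_on_compose[OF open_cyl _ _ assms])
  show "smooth_on cyl (\<lambda>p::real \<times> 'a. snd p \<bullet> b)" for b
    by (rule smooth_on_bounded_linear) (intro bounded_linear_compose[OF bounded_linear_inner_left] bounded_linear_snd)
qed auto

lemma profile_mW:
  assumes "profile R F" shows "profile R (mW i F)"
proof -
  have "smooth_on cyl (mW i F)"
    unfolding mW_def[abs_def]
    by (intro smooth_on_mult smooth_on_cyl_compose_snd[OF smooth_on_inverse_norm] profile_smooth[OF assms]
      smooth_on_cyl_compose_snd[OF smooth_on_bounded_linear[OF bounded_linear_inner_left]])
  with assms show ?thesis unfolding profile_def by (simp add: mW_def)
qed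

lemma profile_frechet_derivative_hom:
  assumes "profile R F" "x \<noteq> 0" "c > 0"
  shows "frechet_derivative F (at (s, x)) (a, h) = frechet_derivative F (at (s, c *\<^sub>R x)) (a, c *\<^sub>R h)"
proof -
  let ?A = "\<lambda>p::real \<times> 'a. (fst p, c *\<^sub>R snd p)"
  have A: "(?A has_derivative ?A) (at p)" for p
    by (intro has_derivative_Pair has_derivative_scaleR_right has_derivative_fst has_derivative_snd has_derivative_ident)
  have "((\<lambda>p. F (?A p)) has_derivative (\<lambda>h. frechet_derivative F (at (s, c *\<^sub>R x)) (?A h))) (at (s, x))"
    using has_derivative_compose[OF A, of F _ "(s, x)"] profile_has_derivative[OF assms(1), of "c *\<^sub>R x" s] assms(2,3)
    by simp
  then have "(F has_derivative (\<lambda>h. frechet_derivative F (at (s, c *\<^sub>R x)) (?A h))) (at (s, x))"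
  proof (rule has_derivative_transform_within_open[OF _ open_cyl])
    show "F (?A p) = F p" if "p \<in> cyl" for p
      using profile_hom[OF assms(1) _ assms(3), of "snd p" "fst p"] that by (cases p) simp
  qed (use assms in auto)
  from fun_cong[OF frechet_derivative_at[OF this], of "(a, h)"] show ?thesis by simp
qed

lemma profile_frechet_derivative_support:
  assumes "profile R F" "x \<noteq> 0" "\<bar>s\<bar> > R"
  shows "frechet_derivative F (at (s, x)) v = 0"
proof -
  have "((\<lambda>p. 0) has_derivative (\<lambda>h. 0)) (at (s, x))" by simp
  then have "(F has_derivative (\<lambda>h. 0)) (at (s, x))"
  proof (rule has_derivative_transform_within_open)
    show "open ({s. \<bar>s\<bar> > R} \<times> - {0::'a})"
      by (intro open_Times open_Collect_less continuous_intros open_Compl closed_singleton)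
  qed (use assms profile_support in auto)
  from fun_cong[OF frechet_derivative_at[OF this], of v] show ?thesis by simp
qed

lemma profile_dS:
  fixes F :: "real \<times> 'a::euclidean_space \<Rightarrow> real"
  assumes F: "profile R F" shows "profile R (dS F)"
  unfolding profile_def
proof (intro conjI allI impI)
  show "smooth_on cyl (dS F)"
    using smooth_on_frechet_derivative[OF open_cyl profile_smooth[OF F], of "(1, 0)"]
    by (simp add: dS_def[abs_def])
  show "dS F (s, c *\<^sub>R x) = dS F (s, x)" if "x \<noteq> 0" "c > 0" for s x c
    using profile_frechet_derivative_hom[OF F that, of s 1 0] by (simp add: dS_def)
  show "dS F (s, x) = 0" if "x \<noteq> 0" "\<bar>s\<bar> > R" for s x
    using profile_frechet_derivative_support[OF F that] by (simp add: dS_def)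
qed

lemma profile_dX:
  fixes F :: "real \<times> 'a::euclidean_space \<Rightarrow> real"
  assumes F: "profile R F" shows "profile R (dX i F)"
  unfolding profile_def
proof (intro conjI allI impI)
  show "smooth_on cyl (dX i F)"
    using smooth_on_frechet_derivative[OF open_cyl profile_smooth[OF F], of "(0, i)"]
    unfolding dX_def[abs_def] by (intro smooth_on_mult smooth_on_cyl_compose_snd smooth_on_norm)
  show "dX i F (s, c *\<^sub>R x) = dX i F (s, x)" if "x \<noteq> 0" "c > 0" for s x c
  proof -
    interpret linear "frechet_derivative F (at (s, c *\<^sub>R x))"
      using profile_has_derivative[OF F, of "c *\<^sub>R x" s] that has_derivative_linear by auto
    have "frechet_derivative F (at (s, c *\<^sub>R x)) (0, c *\<^sub>R i) = c * frechet_derivative F (at (s, c *\<^sub>R x)) (0, i)"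
      using scaleR[of c "(0, i)"] by simp
    then show ?thesis
      using profile_frechet_derivative_hom[OF F that, of s 0 i] that by (simp add: dX_def)
  qed
  show "dX i F (s, x) = 0" if "x \<noteq> 0" "\<bar>s\<bar> > R" for s x
    using profile_frechet_derivative_support[OF F that] by (simp add: dX_def)
qed

lemma profile_funpow_dS: "profile R F \<Longrightarrow> profile R ((dS ^^ j) F)"
  by (induction j) (auto intro: profile_dS)

lemma profile_has_real_derivative:
  assumes "profile R F" "x \<noteq> 0"
  shows "((\<lambda>s. F (s, x)) has_real_derivative dS F (s, x)) (at s)"
  using has_derivative_scaleR_line[of F "frechet_derivative F (at (s, x))" "(0, x)" s "(1, 0)"]
    profile_has_derivative[OF assms, of s] by (simp add: dS_def)

lemma profile_continuous_on: "profile R F \<Longrightarrow> continuous_on cyl F"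
  using profile_smooth smooth_on_imp_continuous_on by blast

lemma profile_bounded:
  fixes F :: "real \<times> 'a::euclidean_space \<Rightarrow> real"
  assumes F: "profile R F"
  obtains M where "M \<ge> 0" "\<And>s x. x \<noteq> 0 \<Longrightarrow> \<bar>F (s, x)\<bar> \<le> M"
proof -
  have "compact (F ` ({-R..R} \<times> sphere 0 1))"
    by (intro compact_continuous_image continuous_on_subset[OF profile_continuous_on[OF F]] compact_Times) auto
  then obtain M where M: "\<And>p. p \<in> {-R..R} \<times> sphere 0 1 \<Longrightarrow> norm (F p) \<le> M"
    using compact_imp_bounded bounded_iff by (metis imageI)
  have "\<bar>F (s, x)\<bar> \<le> max M 0" if x: "x \<noteq> 0" for s x
  proof (cases "\<bar>s\<bar> \<le> R")
    case True
    have "F (s, x) = F (s, inverse (norm x) *\<^sub>R x)" using profile_hom[OF F x] x by simp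
    moreover have "(s, inverse (norm x) *\<^sub>R x) \<in> {-R..R} \<times> sphere 0 1" using True x by auto
    ultimately show ?thesis using M by fastforce
  next
    case False
    then show ?thesis using profile_support[OF F x] by simp
  qed
  then show ?thesis by (intro that[of "max M 0"]) auto
qed

text \<open>One constant serves all directions and base points, because \<open>dS (dS F)\<close> is
  bounded. Integrated over the sphere, the estimate differentiates \<open>Phi\<close> with an
  explicit quadratic remainder instead of a limit theorem.\<close>

lemma profile_taylor:
  fixes F :: "real \<times> 'a::euclidean_space \<Rightarrow> real"
  assumes F: "profile R F"
  obtains M where "M \<ge> 0" "\<And>a \<delta> x. x \<noteq> 0 \<Longrightarrow> \<bar>F (a + \<delta>, x) - F (a, x) - \<delta> * dS F (a, x)\<bar> \<le> M * \<delta>\<^sup>2"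
proof -
  have lip: "\<bar>G (b, x) - G (a, x)\<bar> \<le> M * \<bar>b - a\<bar>"
    if "profile R G" "x \<noteq> 0" "\<And>s. \<bar>dS G (s, x)\<bar> \<le> M" for G a b M and x :: 'a
  proof -
    have "norm (G (b, x) - G (a, x)) \<le> M * norm (b - a)"
      by (rule field_differentiable_bound[where S=UNIV and f'="\<lambda>s. dS G (s, x)"])
         (use that profile_has_real_derivative[OF that(1,2)] in auto)
    then show ?thesis by simp
  qed
  obtain M where M: "M \<ge> 0" "\<And>s x. x \<noteq> 0 \<Longrightarrow> \<bar>dS (dS F) (s, x)\<bar> \<le> M"
    using profile_bounded[OF profile_dS[OF profile_dS[OF F]]] by blast
  have "\<bar>F (a + \<delta>, x) - F (a, x) - \<delta> * dS F (a, x)\<bar> \<le> M * \<delta>\<^sup>2" if x: "x \<noteq> 0" for a \<delta> x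
  proof -
    let ?g = "\<lambda>s. F (s, x) - s * dS F (a, x)"
    have "norm (?g (a + \<delta>) - ?g a) \<le> M * \<bar>\<delta>\<bar> * norm (a + \<delta> - a)"
    proof (rule field_differentiable_bound[where S="cball a \<bar>\<delta>\<bar>" and f'="\<lambda>s. dS F (s, x) - dS F (a, x)"])
      show "(?g has_field_derivative dS F (s, x) - dS F (a, x)) (at s within cball a \<bar>\<delta>\<bar>)" for s
        by (auto intro!: derivative_eq_intros has_field_derivative_at_within[OF profile_has_real_derivative[OF F x]])
      show "norm (dS F (s, x) - dS F (a, x)) \<le> M * \<bar>\<delta>\<bar>" if "s \<in> cball a \<bar>\<delta>\<bar>" for s
      proof -
        have "\<bar>dS F (s, x) - dS F (a, x)\<bar> \<le> M * \<bar>s - a\<bar>"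
          by (rule lip[OF profile_dS[OF F] x M(2)[OF x]])
        also have "\<dots> \<le> M * \<bar>\<delta>\<bar>"
          using that M(1) by (intro mult_left_mono) (auto simp: dist_real_def)
        finally show ?thesis by simp
      qed
    qed (auto simp: dist_real_def)
    then show ?thesis by (simp add: algebra_simps power2_eq_square abs_mult_self_eq)
  qed
  with M(1) that show ?thesis by blast
qed

text \<open>\<open>dS\<close> sees only values near the point, and \<open>cyl\<close> is open. This
  carries identities that hold on \<open>cyl\<close> alone through iterated
  \<open>dS\<close>.\<close>

lemma dS_cong:
  assumes "\<And>p. p \<in> cyl \<Longrightarrow> F p = G p" "profile R F" "p \<in> cyl"
  shows "dS F p = dS G p"
proof -
  obtain s x where p: "p = (s, x)" "x \<noteq> 0" using assms(3) by auto
  have "(G has_derivative frechet_derivative F (at p)) (at p)"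
    using profile_has_derivative[OF assms(2) p(2), of s] unfolding p(1)
    by (rule has_derivative_transform_within_open[OF _ open_cyl]) (use p assms(1) in auto)
  from frechet_derivative_at[OF this] show ?thesis by (simp add: dS_def)
qed

lemma dS_add:
  assumes "profile R F" "profile R G" "p \<in> cyl"
  shows "dS (\<lambda>p. F p + G p) p = dS F p + dS G p"
proof -
  obtain s x where p: "p = (s, x)" "x \<noteq> 0" using assms(3) by auto
  show ?thesis
    using fun_cong[OF frechet_derivative_at[OF has_derivative_add[OF profile_has_derivative[OF assms(1) p(2), of s]
      profile_has_derivative[OF assms(2) p(2), of s]]], of "(1, 0)"] unfolding dS_def p(1) by simp
qed

lemma dS_scale:
  assumes "profile R F" "p \<in> cyl"
  shows "dS (\<lambda>p. c * F p) p = c * dS F p"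
proof -
  obtain s x where p: "p = (s, x)" "x \<noteq> 0" using assms(2) by auto
  show ?thesis
    using fun_cong[OF frechet_derivative_at[OF has_derivative_mult_right[OF profile_has_derivative[OF assms(1) p(2), of s], of c]],
      of "(1, 0)"] unfolding dS_def p(1) by simp
qed

lemma dS_mS:
  assumes "profile R F" "p \<in> cyl"
  shows "dS (mS F) p = F p + mS (dS F) p"
proof -
  obtain s x where p: "p = (s, x)" "x \<noteq> 0" using assms(2) by auto
  have "(fst has_derivative fst) (at p)" by (rule bounded_linear_imp_has_derivative[OF bounded_linear_fst])
  from fun_cong[OF frechet_derivative_at[OF has_derivative_mult[OF this[unfolded p(1)]
      profile_has_derivative[OF assms(1) p(2), of s]]], of "(1, 0)"]
  show ?thesis unfolding dS_def mS_def[abs_def] p(1) by simp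
qed

lemma dS_mW:
  assumes "profile R F" "p \<in> cyl"
  shows "dS (mW i F) p = mW i (dS F) p"
proof -
  obtain s x where p: "p = (s, x)" "x \<noteq> 0" using assms(2) by auto
  have "((\<lambda>s. mW i F (s, x)) has_real_derivative dS (mW i F) (s, x)) (at s)"
    by (rule profile_has_real_derivative[OF profile_mW[OF assms(1)] p(2)])
  moreover have "((\<lambda>s. mW i F (s, x)) has_real_derivative mW i (dS F) (s, x)) (at s)"
    unfolding mW_def using DERIV_cmult[OF profile_has_real_derivative[OF assms(1) p(2)]] by simp
  ultimately show ?thesis using DERIV_unique p(1) by blast
qed

lemma dS_dX:
  assumes "profile R F" "p \<in> cyl"
  shows "dS (dX i F) p = dX i (dS F) p"
proof -
  obtain s x where p: "p = (s, x)" "x \<noteq> 0" using assms(2) by auto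
  let ?g = "\<lambda>p. frechet_derivative F (at p) (0, i)"
  have sm: "smooth_on cyl F" by (rule profile_smooth[OF assms(1)])
  have "(?g has_derivative frechet_derivative ?g (at (s, x))) (at (s, x))"
    by (rule smooth_on_has_derivative[OF open_cyl smooth_on_frechet_derivative[OF open_cyl sm]]) (use p in auto)
  then have "((\<lambda>s. ?g (s, x)) has_real_derivative frechet_derivative ?g (at (s, x)) (1, 0)) (at s)"
    using has_derivative_scaleR_line[of ?g _ "(0, x)" s "(1, 0)"] by simp
  then have "((\<lambda>s. dX i F (s, x)) has_real_derivative norm x * frechet_derivative ?g (at (s, x)) (1, 0)) (at s)"
    unfolding dX_def using DERIV_cmult by simp
  moreover have "((\<lambda>s. dX i F (s, x)) has_real_derivative dS (dX i F) (s, x)) (at s)"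
    by (rule profile_has_real_derivative[OF profile_dX[OF assms(1)] p(2)])
  ultimately have "dS (dX i F) (s, x) = norm x * frechet_derivative ?g (at (s, x)) (1, 0)"
    using DERIV_unique by blast
  also have "\<dots> = dX i (dS F) (s, x)"
    using frechet_derivative_symmetric[OF open_cyl sm, of "(s, x)" "(0, i)" "(1, 0)"] p
    by (simp add: dX_def dS_def[abs_def])
  finally show ?thesis by (simp add: p)
qed

lemma funpow_dS_add:
  assumes "profile R F" "profile R G" "p \<in> cyl"
  shows "(dS ^^ j) (\<lambda>p. F p + G p) p = (dS ^^ j) F p + (dS ^^ j) G p"
  using assms(3)
proof (induction j arbitrary: p)
  case (Suc j)
  have "dS ((dS ^^ j) (\<lambda>p. F p + G p)) p = dS (\<lambda>p. (dS ^^ j) F p + (dS ^^ j) G p) p"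
    by (rule dS_cong[OF Suc.IH profile_funpow_dS[OF profile_add[OF assms(1,2)]] Suc.prems])
  then show ?case
    using dS_add[OF profile_funpow_dS[OF assms(1)] profile_funpow_dS[OF assms(2)] Suc.prems] by simp
qed simp

lemma funpow_dS_scale:
  assumes "profile R F" "p \<in> cyl"
  shows "(dS ^^ j) (\<lambda>p. c * F p) p = c * (dS ^^ j) F p"
  using assms(2)
proof (induction j arbitrary: p)
  case (Suc j)
  have "dS ((dS ^^ j) (\<lambda>p. c * F p)) p = dS (\<lambda>p. c * (dS ^^ j) F p) p"
    by (rule dS_cong[OF Suc.IH profile_funpow_dS[OF profile_scale[OF assms(1)]] Suc.prems])
  then show ?case using dS_scale[OF profile_funpow_dS[OF assms(1)] Suc.prems] by simp
qed simp

lemma funpow_dS_mW: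
  assumes "profile R F" "p \<in> cyl"
  shows "(dS ^^ j) (mW i F) p = mW i ((dS ^^ j) F) p"
  using assms(2)
proof (induction j arbitrary: p)
  case (Suc j)
  have "dS ((dS ^^ j) (mW i F)) p = dS (mW i ((dS ^^ j) F)) p"
    by (rule dS_cong[OF Suc.IH profile_funpow_dS[OF profile_mW[OF assms(1)]] Suc.prems])
  then show ?case using dS_mW[OF profile_funpow_dS[OF assms(1)] Suc.prems] by simp
qed simp

lemma funpow_dS_dX:
  assumes "profile R F" "p \<in> cyl"
  shows "(dS ^^ j) (dX i F) p = dX i ((dS ^^ j) F) p"
  using assms(2)
proof (induction j arbitrary: p)
  case (Suc j)
  have "dS ((dS ^^ j) (dX i F)) p = dS (dX i ((dS ^^ j) F)) p"
    by (rule dS_cong[OF Suc.IH profile_funpow_dS[OF profile_dX[OF assms(1)]] Suc.prems])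
  then show ?case using dS_dX[OF profile_funpow_dS[OF assms(1)] Suc.prems] by simp
qed simp

text \<open>The Leibniz commutator of multiplication by \<open>s\<close> with \<open>j\<close>
  derivatives. It pulls all \<open>j\<close> derivatives to the outside, where the induction
  hypothesis of \<open>Phi_decay\<close> can use them.\<close>

lemma mS_funpow_dS:
  assumes F: "profile R F" and "p \<in> cyl"
  shows "mS ((dS ^^ Suc j) F) p = (dS ^^ j) (\<lambda>p. mS (dS F) p + - real j * F p) p"
  using assms(2)
proof (induction j arbitrary: p)
  case (Suc j)
  let ?N = "\<lambda>p. mS (dS F) p + - real j * F p"
  have N: "profile R ?N" by (intro profile_add profile_scale profile_mS profile_dS F)
  have "dS (mS ((dS ^^ Suc j) F)) p = dS ((dS ^^ j) ?N) p"
    by (rule dS_cong[OF Suc.IH profile_mS[OF profile_funpow_dS[OF F]] Suc.prems])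
  moreover have "dS (mS ((dS ^^ Suc j) F)) p = (dS ^^ Suc j) F p + mS ((dS ^^ Suc (Suc j)) F) p"
    using dS_mS[OF profile_funpow_dS[OF F, of "Suc j"] Suc.prems] by simp
  ultimately have "mS ((dS ^^ Suc (Suc j)) F) p = (dS ^^ Suc j) ?N p + (dS ^^ Suc j) (\<lambda>p. - 1 * F p) p"
    using funpow_dS_scale[OF F Suc.prems, of "Suc j" "-1"] by simp
  also have "\<dots> = (dS ^^ Suc j) (\<lambda>p. ?N p + - 1 * F p) p"
    by (rule funpow_dS_add[OF N profile_scale[OF F] Suc.prems, symmetric])
  finally show ?case by (simp add: algebra_simps)
qed simp

section \<open>Superpositions of plane waves and their derivatives\<close>

definition Phi :: "(real \<times> 'a::euclidean_space \<Rightarrow> real) \<Rightarrow> 'a \<Rightarrow> real \<Rightarrow> real" where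
  "Phi F x t = (\<integral>\<omega>. F (x \<bullet> \<omega> + t, \<omega>) \<partial>sphere_measure)"

lemma Phi_continuous:
  fixes F :: "real \<times> 'a::euclidean_space \<Rightarrow> real"
  assumes "profile R F"
  shows "continuous_on (sphere 0 1) (\<lambda>\<omega>. F (x \<bullet> \<omega> + t, \<omega>))"
  by (intro continuous_on_compose2[OF profile_continuous_on[OF assms]] continuous_intros) auto

lemma Phi_integrable:
  fixes F :: "real \<times> 'a::euclidean_space \<Rightarrow> real"
  shows "profile R F \<Longrightarrow> integrable sphere_measure (\<lambda>\<omega>. F (x \<bullet> \<omega> + t, \<omega>))"
  by (rule integrable_continuous_sphere_measure[OF Phi_continuous])

lemma Phi_cong:
  fixes F :: "real \<times> 'a::euclidean_space \<Rightarrow> real"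
  assumes "\<And>p. p \<in> cyl \<Longrightarrow> F p = G p"
  shows "Phi F x t = Phi G x t"
  unfolding Phi_def
proof (intro Bochner_Integration.integral_cong refl assms)
  fix \<omega> :: 'a assume "\<omega> \<in> space sphere_measure"
  then have "\<omega> \<noteq> 0" by auto
  then show "(x \<bullet> \<omega> + t, \<omega>) \<in> cyl" by simp
qed

lemma Phi_scale: "Phi (\<lambda>p. c * F p) x t = c * Phi F x t"
  unfolding Phi_def by simp

lemma Phi_bound:
  fixes F :: "real \<times> 'a::euclidean_space \<Rightarrow> real"
  assumes "\<And>s \<omega>. norm \<omega> = 1 \<Longrightarrow> \<bar>F (s, \<omega>)\<bar> \<le> M"
  shows "\<bar>Phi F x t\<bar> \<le> M * measure (sphere_measure :: 'a measure) (sphere 0 1)"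
  unfolding Phi_def by (rule integral_sphere_measure_bound) (use assms in auto)

lemma Phi_bounded:
  fixes F :: "real \<times> 'a::euclidean_space \<Rightarrow> real"
  assumes "profile R F"
  obtains M where "M \<ge> 0" "\<And>x t. \<bar>Phi F x t\<bar> \<le> M"
proof -
  obtain M where M: "M \<ge> 0" "\<And>s x. x \<noteq> 0 \<Longrightarrow> \<bar>F (s, x)\<bar> \<le> M"
    using profile_bounded[OF assms] by blast
  have "\<bar>Phi F x t\<bar> \<le> M * measure (sphere_measure :: 'a measure) (sphere 0 1)" for x t
  proof (rule Phi_bound)
    show "\<bar>F (s, \<omega>)\<bar> \<le> M" if "norm \<omega> = 1" for s \<omega>
    proof -
      from that have "\<omega> \<noteq> 0" by auto
      then show ?thesis by (rule M(2))
    qed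
  qed
  with M(1) show ?thesis by (intro that[of "M * measure (sphere_measure :: 'a measure) (sphere 0 1)"]) auto
qed

text \<open>\<open>|x \<bullet> \<omega> + t| \<ge> |t| - |x| > R\<close> for every
  \<open>\<omega>\<close>, so the integrand vanishes on the whole sphere.\<close>

lemma Phi_eq_0_inside:
  fixes F :: "real \<times> 'a::euclidean_space \<Rightarrow> real"
  assumes F: "profile R F" and t: "\<bar>t\<bar> - norm x > R"
  shows "Phi F x t = 0"
proof -
  have "Phi F x t = (\<integral>\<omega>. 0 \<partial>(sphere_measure :: 'a measure))"
    unfolding Phi_def
  proof (intro Bochner_Integration.integral_cong refl)
    fix \<omega> :: 'a assume "\<omega> \<in> space sphere_measure"
    then have w: "norm \<omega> = 1" "\<omega> \<noteq> 0" by auto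
    have "\<bar>x \<bullet> \<omega>\<bar> \<le> norm x" using Cauchy_Schwarz_ineq2[of x \<omega>] w by simp
    then have "\<bar>x \<bullet> \<omega> + t\<bar> > R" using t by linarith
    then show "F (x \<bullet> \<omega> + t, \<omega>) = 0" by (rule profile_support[OF F w(2)])
  qed
  then show ?thesis by simp
qed

text \<open>The plane wave in direction \<open>\<omega>\<close> sees the increment
  \<open>(h, \<tau>)\<close> only through \<open>h \<bullet> \<omega> + \<tau>\<close>, of size at
  most \<open>|h| + |\<tau>|\<close>; the scalar expansion is then integrated over the
  sphere.\<close>

lemma Phi_taylor:
  fixes F :: "real \<times> 'a::euclidean_space \<Rightarrow> real"
  assumes F: "profile R F"
  obtains C where "C \<ge> 0"
    "\<And>x h t \<tau>. \<bar>Phi F (x + h) (t + \<tau>) - Phi F x t -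
       ((\<Sum>i\<in>Basis. (h \<bullet> i) * Phi (mW i (dS F)) x t) + \<tau> * Phi (dS F) x t)\<bar> \<le> C * (norm h + \<bar>\<tau>\<bar>)\<^sup>2"
proof -
  obtain M where M: "M \<ge> 0"
    "\<And>a \<delta> x. x \<noteq> 0 \<Longrightarrow> \<bar>F (a + \<delta>, x) - F (a, x) - \<delta> * dS F (a, x)\<bar> \<le> M * \<delta>\<^sup>2"
    using profile_taylor[OF F] by blast
  let ?C = "M * measure (sphere_measure :: 'a measure) (sphere 0 1)"
  have "\<bar>Phi F (x + h) (t + \<tau>) - Phi F x t -
       ((\<Sum>i\<in>Basis. (h \<bullet> i) * Phi (mW i (dS F)) x t) + \<tau> * Phi (dS F) x t)\<bar> \<le> ?C * (norm h + \<bar>\<tau>\<bar>)\<^sup>2"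
    for x h t \<tau>
  proof -
    note int = Phi_integrable[OF F] Phi_integrable[OF profile_mW[OF profile_dS[OF F]]] Phi_integrable[OF profile_dS[OF F]]
    have "Phi F (x + h) (t + \<tau>) - Phi F x t -
       ((\<Sum>i\<in>Basis. (h \<bullet> i) * Phi (mW i (dS F)) x t) + \<tau> * Phi (dS F) x t) =
      (\<integral>\<omega>. F ((x + h) \<bullet> \<omega> + (t + \<tau>), \<omega>) - F (x \<bullet> \<omega> + t, \<omega>) -
        ((\<Sum>i\<in>Basis. (h \<bullet> i) * mW i (dS F) (x \<bullet> \<omega> + t, \<omega>)) + \<tau> * dS F (x \<bullet> \<omega> + t, \<omega>)) \<partial>sphere_measure)"
      unfolding Phi_def using int by simp
    also have "\<bar>\<dots>\<bar> \<le> (M * (norm h + \<bar>\<tau>\<bar>)\<^sup>2) * measure (sphere_measure :: 'a measure) (sphere 0 1)"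
    proof (rule integral_sphere_measure_bound)
      fix \<omega> :: 'a assume w: "norm \<omega> = 1"
      then have w0: "\<omega> \<noteq> 0" by auto
      let ?\<delta> = "h \<bullet> \<omega> + \<tau>"
      have "(\<Sum>i\<in>Basis. (h \<bullet> i) * mW i (dS F) (x \<bullet> \<omega> + t, \<omega>)) = (h \<bullet> \<omega>) * dS F (x \<bullet> \<omega> + t, \<omega>)"
        unfolding euclidean_inner[of h \<omega>] using w by (simp add: mW_def sum_distrib_right mult.assoc)
      then have "\<bar>F ((x + h) \<bullet> \<omega> + (t + \<tau>), \<omega>) - F (x \<bullet> \<omega> + t, \<omega>) -
        ((\<Sum>i\<in>Basis. (h \<bullet> i) * mW i (dS F) (x \<bullet> \<omega> + t, \<omega>)) + \<tau> * dS F (x \<bullet> \<omega> + t, \<omega>))\<bar> =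
        \<bar>F ((x \<bullet> \<omega> + t) + ?\<delta>, \<omega>) - F (x \<bullet> \<omega> + t, \<omega>) - ?\<delta> * dS F (x \<bullet> \<omega> + t, \<omega>)\<bar>"
        by (simp add: inner_add_left algebra_simps)
      also have "\<dots> \<le> M * ?\<delta>\<^sup>2" by (rule M(2)[OF w0])
      also have "?\<delta>\<^sup>2 \<le> (norm h + \<bar>\<tau>\<bar>)\<^sup>2"
      proof (rule abs_le_square_iff[THEN iffD1])
        have "\<bar>h \<bullet> \<omega>\<bar> \<le> norm h" using Cauchy_Schwarz_ineq2[of h \<omega>] w by simp
        then show "\<bar>?\<delta>\<bar> \<le> \<bar>norm h + \<bar>\<tau>\<bar>\<bar>" by linarith
      qed
      finally show "\<bar>F ((x + h) \<bullet> \<omega> + (t + \<tau>), \<omega>) - F (x \<bullet> \<omega> + t, \<omega>) -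
        ((\<Sum>i\<in>Basis. (h \<bullet> i) * mW i (dS F) (x \<bullet> \<omega> + t, \<omega>)) + \<tau> * dS F (x \<bullet> \<omega> + t, \<omega>))\<bar> \<le> M * (norm h + \<bar>\<tau>\<bar>)\<^sup>2"
        using M(1) by (simp add: mult_left_mono)
    qed
    finally show ?thesis by (simp add: mult_ac)
  qed
  with M(1) show ?thesis by (intro that[of ?C]) auto
qed

lemma has_derivative_quadratic:
  fixes f :: "'a::real_normed_vector \<Rightarrow> real"
  assumes L: "bounded_linear L" and C: "\<And>h. \<bar>f (x + h) - f x - L h\<bar> \<le> C * (norm h)\<^sup>2"
  shows "(f has_derivative L) (at x)"
  unfolding has_derivative_at
proof
  have "((\<lambda>h::'a. C * norm h) \<longlongrightarrow> C * norm (0::'a)) (at 0)"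
    by (intro tendsto_intros)
  then have 1: "((\<lambda>h::'a. C * norm h) \<longlongrightarrow> 0) (at 0)" by simp
  show "(\<lambda>h. norm (f (x + h) - f x - L h) / norm h) \<midarrow>0\<rightarrow> 0"
  proof (rule Lim_null_comparison[OF _ 1])
    show "\<forall>\<^sub>F h in at 0. norm (norm (f (x + h) - f x - L h) / norm h) \<le> C * norm h"
      unfolding eventually_at_filter
    proof (rule always_eventually, safe)
      fix h :: 'a assume "h \<noteq> 0"
      then show "norm (norm (f (x + h) - f x - L h) / norm h) \<le> C * norm h"
        using C[of h] by (simp add: divide_le_eq power2_eq_square mult.assoc)
    qed
  qed
qed (rule L)

lemma Phi_has_derivative:
  fixes F :: "real \<times> 'a::euclidean_space \<Rightarrow> real"
  assumes F: "profile R F"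
  shows "((\<lambda>x. Phi F x t) has_derivative (\<lambda>h. \<Sum>i\<in>Basis. (h \<bullet> i) * Phi (mW i (dS F)) x t)) (at x)"
proof -
  obtain C where "C \<ge> 0" and C: "\<And>x h t \<tau>. \<bar>Phi F (x + h) (t + \<tau>) - Phi F x t -
       ((\<Sum>i\<in>Basis. (h \<bullet> i) * Phi (mW i (dS F)) x t) + \<tau> * Phi (dS F) x t)\<bar> \<le> C * (norm h + \<bar>\<tau>\<bar>)\<^sup>2"
    by (rule Phi_taylor[OF F]) (rule that)
  show ?thesis
  proof (rule has_derivative_quadratic)
    show "bounded_linear (\<lambda>h. \<Sum>i\<in>Basis. (h \<bullet> i) * Phi (mW i (dS F)) x t)"
      by (intro bounded_linear_sum bounded_linear_mult_const bounded_linear_inner_left)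
    show "\<bar>Phi F (x + h) t - Phi F x t - (\<Sum>i\<in>Basis. (h \<bullet> i) * Phi (mW i (dS F)) x t)\<bar> \<le> C * (norm h)\<^sup>2" for h
      using C[where \<tau>=0] by simp
  qed
qed

lemma Phi_has_real_derivative:
  fixes F :: "real \<times> 'a::euclidean_space \<Rightarrow> real"
  assumes F: "profile R F"
  shows "((\<lambda>t. Phi F x t) has_real_derivative Phi (dS F) x t) (at t)"
proof -
  obtain C where "C \<ge> 0" and C: "\<And>x h t \<tau>. \<bar>Phi F (x + h) (t + \<tau>) - Phi F x t -
       ((\<Sum>i\<in>Basis. (h \<bullet> i) * Phi (mW i (dS F)) x t) + \<tau> * Phi (dS F) x t)\<bar> \<le> C * (norm h + \<bar>\<tau>\<bar>)\<^sup>2"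
    by (rule Phi_taylor[OF F]) (rule that)
  show ?thesis unfolding has_field_derivative_def
  proof (rule has_derivative_quadratic)
    show "\<bar>Phi F x (t + h) - Phi F x t - Phi (dS F) x t * h\<bar> \<le> C * (norm h)\<^sup>2" for h
      using C[where h=0] by (simp add: mult.commute)
  qed (rule bounded_linear_mult_right)
qed

lemma Phi_continuous_on: "profile R F \<Longrightarrow> continuous_on UNIV (\<lambda>x. Phi F x t)"
  using Phi_has_derivative by (blast intro: continuous_at_imp_continuous_on has_derivative_continuous)

lemma Phi_borel_measurable [measurable]: "profile R F \<Longrightarrow> (\<lambda>x. Phi F x t) \<in> borel_measurable borel"
  by (rule borel_measurable_continuous_onI[OF Phi_continuous_on])

lemma Phi_smooth: "profile R F \<Longrightarrow> smooth_on UNIV (\<lambda>x. Phi F x t)"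
proof (rule smooth_onI_derivative[where P="\<lambda>f. \<exists>F. profile R F \<and> f = (\<lambda>x. Phi F x t)"])
  fix f :: "'a \<Rightarrow> real" assume "\<exists>F. profile R F \<and> f = (\<lambda>x. Phi F x t)"
  then obtain F where F: "profile R F" "f = (\<lambda>x. Phi F x t)" by blast
  show "\<exists>f'. (\<forall>x\<in>UNIV. (f has_derivative f' x) (at x)) \<and>
      (\<forall>i\<in>Basis. \<exists>F. profile R F \<and> (\<lambda>x. f' x i) = (\<lambda>x. Phi F x t))"
  proof (intro exI conjI ballI)
    show "(f has_derivative (\<lambda>h. \<Sum>i\<in>Basis. (h \<bullet> i) * Phi (mW i (dS F)) x t)) (at x)" for x
      unfolding F(2) by (rule Phi_has_derivative[OF F(1)])
    show "profile R (mW i (dS F))" for i by (intro profile_mW profile_dS F)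
    show "(\<lambda>x. \<Sum>j\<in>Basis. (i \<bullet> j) * Phi (mW j (dS F)) x t) = (\<lambda>x. Phi (mW i (dS F)) x t)" if "i \<in> Basis" for i
      using that by (simp add: inner_Basis if_distrib[of "\<lambda>u. u * _"] cong: if_cong)
  qed
qed blast

text \<open>This is \<open>|\<omega>| = 1\<close>. It turns the sum of the second spatial
  derivatives of a wave into its second time derivative.\<close>

lemma Phi_mW_square_sum:
  fixes F :: "real \<times> 'a::euclidean_space \<Rightarrow> real"
  assumes F: "profile R F"
  shows "(\<Sum>i\<in>Basis. Phi (mW i (mW i F)) x t) = Phi F x t"
proof -
  have "(\<Sum>i\<in>Basis. Phi (mW i (mW i F)) x t) = (\<integral>\<omega>. (\<Sum>i\<in>Basis. mW i (mW i F) (x \<bullet> \<omega> + t, \<omega>)) \<partial>sphere_measure)"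
    unfolding Phi_def
    by (rule Bochner_Integration.integral_sum[symmetric])
       (rule Phi_integrable[OF profile_mW[OF profile_mW[OF F]]])
  also have "\<dots> = Phi F x t"
    unfolding Phi_def
  proof (intro Bochner_Integration.integral_cong refl)
    fix \<omega> :: 'a assume "\<omega> \<in> space sphere_measure"
    then have w: "norm \<omega> = 1" by simp
    have "(\<Sum>i\<in>Basis. mW i (mW i F) (x \<bullet> \<omega> + t, \<omega>)) = (\<omega> \<bullet> \<omega>) * F (x \<bullet> \<omega> + t, \<omega>)"
      unfolding euclidean_inner[of \<omega> \<omega>] using w by (simp add: mW_def sum_distrib_right mult.assoc)
    then show "(\<Sum>i\<in>Basis. mW i (mW i F) (x \<bullet> \<omega> + t, \<omega>)) = F (x \<bullet> \<omega> + t, \<omega>)"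
      using w by (simp add: norm_eq_1)
  qed
  finally show ?thesis .
qed

text \<open>The Lorentz boosts and the scaling vector field act on the profile of a plane wave
  superposition as first order operators along the sphere; solving for the time derivative gains a
  factor \<open>1 / (|x| - |t|)\<close>.\<close>

lemma Phi_boost_identity:
  fixes F :: "real \<times> 'a::euclidean_space \<Rightarrow> real"
  assumes F: "profile R F" and dim: "DIM('a) \<ge> 2"
  shows "((norm x)\<^sup>2 - t\<^sup>2) * Phi (dS F) x t =
    (\<Sum>i\<in>Basis. (x \<bullet> i) * Phi (\<lambda>p. mW i (mS (dS F)) p + (- 1 * dX i F p + (real DIM('a) - 1) * mW i F p)) x t)
    - t * Phi (mS (dS F)) x t"
proof -
  let ?d = "real DIM('a)"
  \<comment> \<open>\<open>F (q y)\<close> extends the plane wave integrand from the sphere as a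
    function of degree 0, as \<open>sphere_integration_by_parts\<close> demands; the direction of
    differentiation will be \<open>x\<close> itself.\<close>
  define q where "q y = (x \<bullet> y / norm y + t, y)" for y
  define q' where "q' y h = ((x \<bullet> h * norm y - (x \<bullet> y) * (h \<bullet> sgn y)) / (norm y * norm y), h)" for y h
  define D where "D y h = frechet_derivative F (at (q y)) (q' y h)" for y h
  have q: "(q has_derivative q' y) (at y)" if "y \<noteq> 0" for y
  proof -
    have "((\<lambda>y. x \<bullet> y / norm y) has_derivative
        (\<lambda>h. (x \<bullet> h * norm y - (x \<bullet> y) * (h \<bullet> sgn y)) / (norm y * norm y))) (at y)"
      using that by (intro has_derivative_divide' has_derivative_norm derivative_intros) auto
    from has_derivative_Pair[OF has_derivative_add_const[OF this] has_derivative_ident, of t]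
    show ?thesis unfolding q_def[abs_def] q'_def[abs_def] .
  qed
  have D: "((\<lambda>y. F (q y)) has_derivative D y) (at y)" if "y \<noteq> 0" for y
    using has_derivative_compose[OF q[OF that], of F] profile_has_derivative[OF F that]
    unfolding D_def[abs_def] q_def by blast
  have hom: "F (q (c *\<^sub>R y)) = F (q y)" if "c > 0" "y \<noteq> 0" for c y
    using that profile_hom[OF F, of y c] by (simp add: q_def)
  have Dform: "D y h = dS F (q y) * fst (q' y h) + (\<Sum>i\<in>Basis. (h \<bullet> i) * dX i F (q y) / norm y)"
    if "y \<noteq> 0" for y h
  proof -
    interpret linear "frechet_derivative F (at (q y))"
      using profile_has_derivative[OF F that] has_derivative_linear unfolding q_def by blast
    have qe: "q' y h = fst (q' y h) *\<^sub>R (1, 0) + (\<Sum>i\<in>Basis. (h \<bullet> i) *\<^sub>R (0, i))"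
      by (simp add: q'_def prod_eq_iff fst_sum snd_sum euclidean_representation)
    have "frechet_derivative F (at (q y)) (fst (q' y h) *\<^sub>R (1, 0) + (\<Sum>i\<in>Basis. (h \<bullet> i) *\<^sub>R (0, i))) =
        fst (q' y h) * frechet_derivative F (at (q y)) (1, 0) +
        (\<Sum>i\<in>Basis. (h \<bullet> i) * frechet_derivative F (at (q y)) (0, i))"
      by (simp only: add scaleR sum real_scaleR_def)
    with arg_cong[OF qe, of "frechet_derivative F (at (q y))"]
    have "D y h = fst (q' y h) * frechet_derivative F (at (q y)) (1, 0) +
        (\<Sum>i\<in>Basis. (h \<bullet> i) * frechet_derivative F (at (q y)) (0, i))"
      unfolding D_def by (rule trans)
    then show ?thesis using that by (simp add: dS_def dX_def q_def)
  qed
  have contq: "continuous_on (- {0}) (\<lambda>y. G (q y))" if "profile R G" for G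
    unfolding q_def by (intro continuous_on_compose2[OF profile_continuous_on[OF that]] continuous_intros) auto
  have "continuous_on (- {0}) (\<lambda>y. dS F (q y) * fst (q' y x) + (\<Sum>i\<in>Basis. (x \<bullet> i) * dX i F (q y) / norm y))"
    unfolding q'_def fst_conv by (intro continuous_intros contq profile_dS profile_dX F) auto
  then have cont: "continuous_on (- {0}) (\<lambda>y. D y x)"
    by (rule continuous_on_eq) (simp add: Dform)
  have ibp: "(\<integral>\<omega>. D \<omega> x \<partial>sphere_measure) = (?d - 1) * (\<integral>\<omega>. (\<omega> \<bullet> x) * F (q \<omega>) \<partial>sphere_measure)"
    by (rule sphere_integration_by_parts[OF dim D _ cont]) (use hom in auto)
  note prof = F profile_dS[OF F] profile_dX[OF F] profile_mW[OF F] profile_mS[OF profile_dS[OF F]]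
    profile_mW[OF profile_mS[OF profile_dS[OF F]]]
  note int = prof[THEN Phi_integrable]
  have w1: "(\<omega> \<bullet> x) * F (q \<omega>) = (\<Sum>i\<in>Basis. (x \<bullet> i) * mW i F (x \<bullet> \<omega> + t, \<omega>))" if "norm \<omega> = 1" for \<omega>
    unfolding euclidean_inner[of \<omega> x] using that by (simp add: mW_def q_def sum_distrib_left mult_ac)
  \<comment> \<open>With \<open>s = x \<bullet> \<omega> + t\<close> one has \<open>|x|^2 - (x
    \<bullet> \<omega>)^2 = |x|^2 - t^2 + t s - (x \<bullet> \<omega>) s\<close>; the last two terms
    become multiplications of the profile by \<open>s\<close>.\<close>
  have w2: "D \<omega> x = ((norm x)\<^sup>2 - t\<^sup>2) * dS F (x \<bullet> \<omega> + t, \<omega>) + t * mS (dS F) (x \<bullet> \<omega> + t, \<omega>)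
      - (\<Sum>i\<in>Basis. (x \<bullet> i) * mW i (mS (dS F)) (x \<bullet> \<omega> + t, \<omega>))
      + (\<Sum>i\<in>Basis. (x \<bullet> i) * dX i F (x \<bullet> \<omega> + t, \<omega>))" if w: "norm \<omega> = 1" for \<omega>
  proof -
    have w0: "\<omega> \<noteq> 0" using w by auto
    have e: "(\<Sum>i\<in>Basis. (x \<bullet> i) * mW i (mS (dS F)) (x \<bullet> \<omega> + t, \<omega>)) =
        (x \<bullet> \<omega>) * ((x \<bullet> \<omega> + t) * dS F (x \<bullet> \<omega> + t, \<omega>))"
      unfolding euclidean_inner[of x \<omega>] using w
      by (simp add: mW_def mS_def sum_distrib_right mult.assoc)
    have f1: "fst (q' \<omega> x) = (norm x)\<^sup>2 - (x \<bullet> \<omega>)\<^sup>2"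
      using w by (simp add: q'_def sgn_div_norm power2_norm_eq_inner) (simp add: power2_eq_square)
    show ?thesis unfolding Dform[OF w0] e f1 using w
      by (simp add: q_def mS_def algebra_simps power2_eq_square)
  qed
  have e1: "(\<integral>\<omega>. D \<omega> x \<partial>sphere_measure) = ((norm x)\<^sup>2 - t\<^sup>2) * Phi (dS F) x t + t * Phi (mS (dS F)) x t
      - (\<Sum>i\<in>Basis. (x \<bullet> i) * Phi (mW i (mS (dS F))) x t) + (\<Sum>i\<in>Basis. (x \<bullet> i) * Phi (dX i F) x t)"
  proof -
    have "(\<integral>\<omega>. D \<omega> x \<partial>sphere_measure) = (\<integral>\<omega>. ((norm x)\<^sup>2 - t\<^sup>2) * dS F (x \<bullet> \<omega> + t, \<omega>) + t * mS (dS F) (x \<bullet> \<omega> + t, \<omega>)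
      - (\<Sum>i\<in>Basis. (x \<bullet> i) * mW i (mS (dS F)) (x \<bullet> \<omega> + t, \<omega>))
      + (\<Sum>i\<in>Basis. (x \<bullet> i) * dX i F (x \<bullet> \<omega> + t, \<omega>)) \<partial>sphere_measure)"
      by (intro Bochner_Integration.integral_cong refl) (use w2 in simp)
    then show ?thesis unfolding Phi_def using int by simp
  qed
  have e2: "(\<integral>\<omega>. (\<omega> \<bullet> x) * F (q \<omega>) \<partial>sphere_measure) = (\<Sum>i\<in>Basis. (x \<bullet> i) * Phi (mW i F) x t)"
  proof -
    have "(\<integral>\<omega>. (\<omega> \<bullet> x) * F (q \<omega>) \<partial>sphere_measure) = (\<integral>\<omega>. (\<Sum>i\<in>Basis. (x \<bullet> i) * mW i F (x \<bullet> \<omega> + t, \<omega>)) \<partial>sphere_measure)"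
      by (intro Bochner_Integration.integral_cong refl) (use w1 in simp)
    then show ?thesis unfolding Phi_def using int by simp
  qed
  have e3: "Phi (\<lambda>p. mW i (mS (dS F)) p + (- 1 * dX i F p + (?d - 1) * mW i F p)) x t =
      Phi (mW i (mS (dS F))) x t - Phi (dX i F) x t + (?d - 1) * Phi (mW i F) x t" for i
    using int unfolding Phi_def by (simp add: mult.commute)
  have "(\<Sum>i\<in>Basis. (x \<bullet> i) * (Phi (mW i (mS (dS F))) x t - Phi (dX i F) x t + (?d - 1) * Phi (mW i F) x t)) =
      (\<Sum>i\<in>Basis. (x \<bullet> i) * Phi (mW i (mS (dS F))) x t) - (\<Sum>i\<in>Basis. (x \<bullet> i) * Phi (dX i F) x t)
      + (?d - 1) * (\<Sum>i\<in>Basis. (x \<bullet> i) * Phi (mW i F) x t)"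
    by (simp add: sum.distrib sum_subtractf distrib_left right_diff_distrib sum_distrib_left mult.left_commute)
  then show ?thesis unfolding e3 using ibp[unfolded e1 e2] by linarith
qed

section \<open>Decay away from the cone\<close>

text \<open>The support of \<open>f\<close> has length at most \<open>2 w / r\<close>, and by
  \<open>pole\<close> the weight \<open>(1 - s^2) ^ m\<close> is at most
  \<open>(2 \<rho> / r) ^ m\<close> on it; together they cancel \<open>r ^ Suc m\<close>.\<close>

lemma zonal_integral_bound:
  fixes \<theta> :: "'a::euclidean_space"
  assumes dim: "DIM('a) = 2 * m + 3" and \<theta>: "norm \<theta> = 1" and r: "r > 0" and w: "w \<ge> 0"
    and f: "continuous_on UNIV f" "\<And>s. 0 \<le> f s" "\<And>s. f s \<le> 2"
    and supp: "\<And>s. f s \<noteq> 0 \<Longrightarrow> \<bar>s - c\<bar> \<le> w / r"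
    and \<rho>: "\<rho> \<ge> 0"
    and pole: "\<And>s. f s \<noteq> 0 \<Longrightarrow> \<bar>s\<bar> \<le> 1 \<Longrightarrow> 1 - \<bar>s\<bar> \<le> \<rho> / r"
  shows "r ^ Suc m * (\<integral>\<omega>. f (\<theta> \<bullet> \<omega>) \<partial>sphere_measure) \<le> zonal_const m * ((2 * \<rho>) ^ m * (4 * w))"
proof -
  define K where "K = \<bar>2 * \<rho> / r\<bar> ^ m"
  define a where "a = c - w / r"
  define b where "b = c + w / r"
  have K: "K \<ge> 0" by (simp add: K_def)
  have ab: "a \<le> b" using w r by (simp add: a_def b_def)
  have le: "f s * (1 - s\<^sup>2) ^ m \<le> K * f s" if s: "s \<in> {-1..1}" for s
  proof (cases "f s = 0")
    case False
    have "1 - s\<^sup>2 = (1 - \<bar>s\<bar>) * (1 + \<bar>s\<bar>)" by (simp add: algebra_simps power2_eq_square)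
    also have "\<dots> \<le> (1 - \<bar>s\<bar>) * 2" using s by (intro mult_left_mono) auto
    also have "\<dots> \<le> 2 * (\<rho> / r)" using pole[OF False] s by (simp add: abs_le_iff)
    also have "\<dots> = \<bar>2 * \<rho> / r\<bar>" using \<rho> r by simp
    finally have 1: "1 - s\<^sup>2 \<le> \<bar>2 * \<rho> / r\<bar>" .
    have "0 \<le> 1 - s\<^sup>2" using s by (simp add: abs_square_le_1 abs_le_iff)
    with 1 have "(1 - s\<^sup>2) ^ m \<le> K" unfolding K_def by (rule power_mono)
    then have "f s * (1 - s\<^sup>2) ^ m \<le> f s * K" using f(2)[of s] by (rule mult_left_mono)
    then show ?thesis by (simp only: mult.commute[of K])
  qed simp
  have int: "f integrable_on {u..v}" for u v
    by (intro integrable_continuous_interval continuous_on_subset[OF f(1)]) auto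
  have "integral {-1..1} (\<lambda>s. f s * (1 - s\<^sup>2) ^ m) \<le> integral {-1..1} (\<lambda>s. K * f s)"
    by (intro integral_le integrable_continuous_interval continuous_intros continuous_on_subset[OF f(1)])
       (use le in auto)
  also have "\<dots> = K * integral {-1..1} f" by simp
  also have "integral {-1..1} f \<le> integral {min (-1) a..max 1 b} f"
    by (rule integral_subset_le) (use f(2) int in auto)
  also have "integral {min (-1) a..max 1 b} f = integral {a..b} f"
  proof (rule integral_unique)
    have "(f has_integral integral {a..b} f) {a..b}" using int by (rule integrable_integral)
    then show "(f has_integral integral {a..b} f) {min (-1) a..max 1 b}"
    proof (rule has_integral_on_superset)
      show "f s = 0" if "s \<notin> {a..b}" for s
      proof (rule ccontr)
        assume "f s \<noteq> 0"
        from supp[OF this] that show False unfolding a_def b_def by auto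
      qed
    qed auto
  qed
  also have "integral {a..b} f \<le> 2 * (b - a)"
  proof -
    have "norm (integral {a..b} f) \<le> 2 * (b - a)"
      by (rule integral_bound[OF ab continuous_on_subset[OF f(1)]]) (use f in auto)
    then show ?thesis by simp
  qed
  also have "b - a = 2 * w / r" by (simp add: a_def b_def)
  finally have "integral {-1..1} (\<lambda>s. f s * (1 - s\<^sup>2) ^ m) \<le> K * (2 * (2 * w / r))"
    using K by (simp add: mult_left_mono)
  then have "r ^ Suc m * (zonal_const m * integral {-1..1} (\<lambda>s. f s * (1 - s\<^sup>2) ^ m)) \<le>
      r ^ Suc m * (zonal_const m * (K * (2 * (2 * w / r))))"
    using r zonal_const_pos[of m] by (intro mult_left_mono) auto
  also have "\<dots> = zonal_const m * (\<bar>2 * \<rho>\<bar> ^ m * (4 * w))"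
    using r by (simp add: K_def power_divide abs_mult)
  also have "\<bar>2 * \<rho>\<bar> = 2 * \<rho>" using \<rho> by simp
  finally show ?thesis
    unfolding integral_sphere_zonal[OF \<theta> dim continuous_on_subset[OF f(1) subset_UNIV]] .
qed

text \<open>A tent function majorises the indicator of
  \<open>|x \<bullet> \<omega> + t| \<le> R\<close> by a continuous function, as the zonal formula
  demands, at the price of doubling \<open>R\<close>. With
  \<open>s = \<theta> \<bullet> \<omega>\<close>, on its support
  \<open>|x| (1 - |s|) \<le> |x| - |t| + 2 R \<le> \<rho>\<close>, which is closeness to a
  pole.\<close>

lemma Phi_cap_bound:
  fixes F :: "real \<times> 'a::euclidean_space \<Rightarrow> real"
  assumes dim: "DIM('a) = 2 * m + 3" and R: "R > 0" and F: "profile R F"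
  shows "\<exists>C\<ge>0. \<forall>x t \<rho>. x \<noteq> 0 \<longrightarrow> \<rho> \<ge> 0 \<longrightarrow> norm x - \<bar>t\<bar> + 2 * R \<le> \<rho> \<longrightarrow>
    norm x ^ Suc m * \<bar>Phi F x t\<bar> \<le> C * \<rho> ^ m"
proof -
  obtain M where M: "M \<ge> 0" "\<And>s x. x \<noteq> 0 \<Longrightarrow> \<bar>F (s, x)\<bar> \<le> M"
    using profile_bounded[OF F] by blast
  define C where "C = M * (zonal_const m * (2 ^ m * (8 * R)))"
  have "norm x ^ Suc m * \<bar>Phi F x t\<bar> \<le> C * \<rho> ^ m"
    if x0: "x \<noteq> 0" and \<rho>: "\<rho> \<ge> 0" and xt: "norm x - \<bar>t\<bar> + 2 * R \<le> \<rho>" for x t \<rho>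
  proof -
    define r where "r = norm x"
    have r: "r > 0" and \<rho>r: "r - \<bar>t\<bar> + 2 * R \<le> \<rho>" using x0 xt by (auto simp: r_def)
    define \<theta> where "\<theta> = x /\<^sub>R r"
    have \<theta>: "norm \<theta> = 1" "x = r *\<^sub>R \<theta>" using r by (auto simp: \<theta>_def r_def)
    define f where "f s = max 0 (2 - \<bar>r * s + t\<bar> / R)" for s
    have f0: "\<bar>r * s + t\<bar> \<le> 2 * R" if "f s \<noteq> 0" for s
      using that R by (auto simp: f_def max_def field_simps split: if_splits)
    have "\<bar>Phi F x t\<bar> \<le> (\<integral>\<omega>. \<bar>F (x \<bullet> \<omega> + t, \<omega>)\<bar> \<partial>sphere_measure)"
      unfolding Phi_def by (rule integral_abs_bound)
    also have "\<dots> \<le> (\<integral>\<omega>. M * f (\<theta> \<bullet> \<omega>) \<partial>sphere_measure)"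
    proof (rule integral_mono)
      show "integrable sphere_measure (\<lambda>\<omega>. \<bar>F (x \<bullet> \<omega> + t, \<omega>)\<bar>)"
        using Phi_integrable[OF F] by (rule integrable_abs)
      show "integrable sphere_measure (\<lambda>\<omega>. M * f (\<theta> \<bullet> \<omega>))"
        unfolding f_def by (intro integrable_continuous_sphere_measure continuous_intros) (use R in auto)
      fix \<omega> :: 'a assume "\<omega> \<in> space sphere_measure"
      then have w: "\<omega> \<noteq> 0" by auto
      show "\<bar>F (x \<bullet> \<omega> + t, \<omega>)\<bar> \<le> M * f (\<theta> \<bullet> \<omega>)"
      proof (cases "\<bar>x \<bullet> \<omega> + t\<bar> \<le> R")
        case True
        then have "f (\<theta> \<bullet> \<omega>) \<ge> 1" using R \<theta>(2) by (simp add: f_def field_simps)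
        then have "M * 1 \<le> M * f (\<theta> \<bullet> \<omega>)" using M(1) by (intro mult_left_mono)
        with M(2)[OF w, of "x \<bullet> \<omega> + t"] show ?thesis by linarith
      next
        case False
        then show ?thesis using profile_support[OF F w] M(1) by (simp add: f_def)
      qed
    qed
    finally have b0: "norm x ^ Suc m * \<bar>Phi F x t\<bar> \<le> M * (r ^ Suc m * (\<integral>\<omega>. f (\<theta> \<bullet> \<omega>) \<partial>sphere_measure))"
      using r by (simp add: r_def mult.left_commute mult_left_mono)
    have b1: "r ^ Suc m * (\<integral>\<omega>. f (\<theta> \<bullet> \<omega>) \<partial>sphere_measure) \<le> zonal_const m * ((2 * \<rho>) ^ m * (4 * (2 * R)))"
    proof (rule zonal_integral_bound[OF dim \<theta>(1) r, where c="- t / r"])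
      show "continuous_on UNIV f" unfolding f_def by (intro continuous_intros) (use R in auto)
      show "\<bar>s - - t / r\<bar> \<le> 2 * R / r" if "f s \<noteq> 0" for s
      proof -
        have "s - - t / r = (r * s + t) / r" using r by (simp add: field_simps)
        then show ?thesis using f0[OF that] r by (simp add: abs_divide divide_right_mono)
      qed
      show "1 - \<bar>s\<bar> \<le> \<rho> / r" if "f s \<noteq> 0" "\<bar>s\<bar> \<le> 1" for s
      proof -
        have "\<bar>t\<bar> \<le> \<bar>r * s\<bar> + 2 * R" using f0[OF that(1)] by linarith
        then have "r * (1 - \<bar>s\<bar>) \<le> \<rho>" using r \<rho>r by (simp add: abs_mult algebra_simps)
        then show ?thesis using r by (simp add: field_simps)
      qed
    qed (use R \<rho> in \<open>auto simp: f_def\<close>)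
    have b2: "(2 * \<rho>) ^ m = 2 ^ m * \<rho> ^ m" by (rule power_mult_distrib)
    have b3: "M * (zonal_const m * ((2 * \<rho>) ^ m * (4 * (2 * R)))) = C * \<rho> ^ m"
      unfolding b2 C_def by (simp add: mult_ac)
    show ?thesis using order_trans[OF b0 mult_left_mono[OF b1 M(1)]] unfolding b3 .
  qed
  moreover have "C \<ge> 0" using M(1) R zonal_const_pos[of m] by (simp add: C_def)
  ultimately show ?thesis by blast
qed

text \<open>Each use of \<open>Phi_boost_identity\<close> trades one derivative for one factor
  \<open>\<delta> = |x| - |t|\<close>: the coefficients \<open>x \<bullet> i\<close> and
  \<open>t\<close> are at most \<open>|x|\<close>, while
  \<open>|x|^2 - t^2 \<ge> \<delta> |x|\<close>. The powers are kept on both sides so that no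
  negative exponent of \<open>\<delta>\<close> appears when \<open>j > m\<close>.\<close>

theorem Phi_decay:
  fixes F :: "real \<times> 'a::euclidean_space \<Rightarrow> real"
  assumes dim: "DIM('a) = 2 * m + 3" and R: "R > 0" and F: "profile R F"
  shows "\<exists>C\<ge>0. \<forall>x t. norm x - \<bar>t\<bar> \<ge> 2 * R \<longrightarrow>
    norm x ^ Suc m * ((norm x - \<bar>t\<bar>) ^ j * \<bar>Phi ((dS ^^ j) F) x t\<bar>) \<le> C * (norm x - \<bar>t\<bar>) ^ m"
  using F
proof (induction j arbitrary: F)
  case 0
  obtain C where C: "C \<ge> 0" "\<And>x t \<rho>. x \<noteq> 0 \<Longrightarrow> \<rho> \<ge> 0 \<Longrightarrow> norm x - \<bar>t\<bar> + 2 * R \<le> \<rho> \<Longrightarrow>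
    norm x ^ Suc m * \<bar>Phi F x t\<bar> \<le> C * \<rho> ^ m"
    using Phi_cap_bound[OF dim R 0] by blast
  have "norm x ^ Suc m * \<bar>Phi F x t\<bar> \<le> C * 2 ^ m * (norm x - \<bar>t\<bar>) ^ m" if "norm x - \<bar>t\<bar> \<ge> 2 * R" for x t
  proof -
    have "x \<noteq> 0" using that R by auto
    \<comment> \<open>The distance \<open>2 R\<close> from the cone absorbs the slack
      \<open>2 R\<close> of \<open>Phi_cap_bound\<close>, so \<open>\<rho> = 2 (|x| - |t|)\<close>
      is admissible.\<close>
    moreover have "0 \<le> 2 * (norm x - \<bar>t\<bar>)" "norm x - \<bar>t\<bar> + 2 * R \<le> 2 * (norm x - \<bar>t\<bar>)"
      using that R by auto
    ultimately have "norm x ^ Suc m * \<bar>Phi F x t\<bar> \<le> C * (2 * (norm x - \<bar>t\<bar>)) ^ m" by (rule C(2))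
    then show ?thesis by (simp only: power_mult_distrib mult.assoc)
  qed
  with C(1) show ?case by (intro exI[of _ "C * 2 ^ m"]) simp
next
  case (Suc j)
  note F = Suc.prems
  \<comment> \<open>\<open>N\<close> and the \<open>A i\<close> are the profiles whose
    \<open>j\<close>-th derivatives make up the boost identity for \<open>(dS ^^ j) F\<close>; they
    differ from \<open>F\<close>, so the induction has to quantify over all profiles.\<close>
  define N where "N = (\<lambda>p. mS (dS F) p + - real j * F p)"
  define A where "A i = (\<lambda>p. mW i N p + (- 1 * dX i F p + (real DIM('a) - 1) * mW i F p))" for i
  have N: "profile R N" unfolding N_def by (intro profile_add profile_scale profile_mS profile_dS F)
  have A: "profile R (A i)" for i
    unfolding A_def by (intro profile_add profile_scale profile_mW profile_dX N F)
  have "\<forall>i. \<exists>C\<ge>0. \<forall>x t. norm x - \<bar>t\<bar> \<ge> 2 * R \<longrightarrow>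
    norm x ^ Suc m * ((norm x - \<bar>t\<bar>) ^ j * \<bar>Phi ((dS ^^ j) (A i)) x t\<bar>) \<le> C * (norm x - \<bar>t\<bar>) ^ m"
    using Suc.IH[OF A] by blast
  then obtain CA where CA: "\<And>i. CA i \<ge> 0" "\<And>i x t. norm x - \<bar>t\<bar> \<ge> 2 * R \<Longrightarrow>
    norm x ^ Suc m * ((norm x - \<bar>t\<bar>) ^ j * \<bar>Phi ((dS ^^ j) (A i)) x t\<bar>) \<le> CA i * (norm x - \<bar>t\<bar>) ^ m"
    by metis
  obtain CN where CN: "CN \<ge> 0" "\<And>x t. norm x - \<bar>t\<bar> \<ge> 2 * R \<Longrightarrow>
    norm x ^ Suc m * ((norm x - \<bar>t\<bar>) ^ j * \<bar>Phi ((dS ^^ j) N) x t\<bar>) \<le> CN * (norm x - \<bar>t\<bar>) ^ m"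
    using Suc.IH[OF N] by blast
  define C where "C = (\<Sum>i\<in>Basis. CA i) + CN"
  let ?F = "(dS ^^ j) F"
  have eqN: "mS (dS ?F) p = (dS ^^ j) N p" if "p \<in> cyl" for p
    using mS_funpow_dS[OF F that, of j] by (simp add: N_def)
  have eqA: "mW i (mS (dS ?F)) p + (- 1 * dX i ?F p + (real DIM('a) - 1) * mW i ?F p) = (dS ^^ j) (A i) p"
    if "p \<in> cyl" for i p
  proof -
    have "(dS ^^ j) (A i) p = (dS ^^ j) (mW i N) p + (dS ^^ j) (\<lambda>p. - 1 * dX i F p + (real DIM('a) - 1) * mW i F p) p"
      unfolding A_def
      by (rule funpow_dS_add[OF profile_mW[OF N] profile_add[OF profile_scale[OF profile_dX[OF F]] profile_scale[OF profile_mW[OF F]]] that])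
    also have "(dS ^^ j) (\<lambda>p. - 1 * dX i F p + (real DIM('a) - 1) * mW i F p) p =
       (dS ^^ j) (\<lambda>p. - 1 * dX i F p) p + (dS ^^ j) (\<lambda>p. (real DIM('a) - 1) * mW i F p) p"
      by (rule funpow_dS_add[OF profile_scale[OF profile_dX[OF F]] profile_scale[OF profile_mW[OF F]] that])
    finally show ?thesis
      unfolding funpow_dS_scale[OF profile_dX[OF F] that] funpow_dS_scale[OF profile_mW[OF F] that]
        funpow_dS_mW[OF N that] funpow_dS_mW[OF F that] funpow_dS_dX[OF F that]
      using eqN[OF that] by (simp add: mW_def)
  qed
  have "norm x ^ Suc m * ((norm x - \<bar>t\<bar>) ^ Suc j * \<bar>Phi (dS ?F) x t\<bar>) \<le> C * (norm x - \<bar>t\<bar>) ^ m"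
    if xt: "norm x - \<bar>t\<bar> \<ge> 2 * R" for x t
  proof -
    define \<delta> where "\<delta> = norm x - \<bar>t\<bar>"
    have \<delta>: "\<delta> > 0" "norm x > 0" "\<bar>t\<bar> \<le> norm x" using xt R by (auto simp: \<delta>_def)
    have id: "((norm x)\<^sup>2 - t\<^sup>2) * Phi (dS ?F) x t =
        (\<Sum>i\<in>Basis. (x \<bullet> i) * Phi ((dS ^^ j) (A i)) x t) - t * Phi ((dS ^^ j) N) x t"
      using Phi_boost_identity[OF profile_funpow_dS[OF F, of j], where x=x and t=t] dim
        Phi_cong[OF eqA, where x=x and t=t] Phi_cong[OF eqN, where x=x and t=t] by simp
    have "norm x * (\<delta> * \<bar>Phi (dS ?F) x t\<bar>) \<le> ((norm x)\<^sup>2 - t\<^sup>2) * \<bar>Phi (dS ?F) x t\<bar>"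
    proof -
      have "(norm x)\<^sup>2 - t\<^sup>2 = \<delta> * (norm x + \<bar>t\<bar>)"
        by (simp add: \<delta>_def algebra_simps power2_eq_square)
      moreover have "\<delta> * norm x \<le> \<delta> * (norm x + \<bar>t\<bar>)" using \<delta> by (intro mult_left_mono) auto
      ultimately have "\<delta> * norm x \<le> (norm x)\<^sup>2 - t\<^sup>2" by simp
      then have "(\<delta> * norm x) * \<bar>Phi (dS ?F) x t\<bar> \<le> ((norm x)\<^sup>2 - t\<^sup>2) * \<bar>Phi (dS ?F) x t\<bar>"
        by (rule mult_right_mono) simp
      then show ?thesis by (simp add: mult_ac)
    qed
    also have "\<dots> = \<bar>((norm x)\<^sup>2 - t\<^sup>2) * Phi (dS ?F) x t\<bar>"
    proof -
      have "t\<^sup>2 \<le> (norm x)\<^sup>2" using \<delta>(3) abs_le_square_iff[of t "norm x"] by simp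
      then show ?thesis by (simp add: abs_mult)
    qed
    also have "\<dots> \<le> (\<Sum>i\<in>Basis. norm x * \<bar>Phi ((dS ^^ j) (A i)) x t\<bar>) + norm x * \<bar>Phi ((dS ^^ j) N) x t\<bar>"
      unfolding id
    proof (rule order_trans[OF abs_triangle_ineq4 add_mono])
      show "\<bar>\<Sum>i\<in>Basis. (x \<bullet> i) * Phi ((dS ^^ j) (A i)) x t\<bar> \<le> (\<Sum>i\<in>Basis. norm x * \<bar>Phi ((dS ^^ j) (A i)) x t\<bar>)"
        by (rule order_trans[OF sum_abs sum_mono]) (auto simp: abs_mult intro!: mult_right_mono Basis_le_norm)
      show "\<bar>t * Phi ((dS ^^ j) N) x t\<bar> \<le> norm x * \<bar>Phi ((dS ^^ j) N) x t\<bar>"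
        using \<delta>(3) by (simp add: abs_mult mult_right_mono)
    qed
    also have "\<dots> = norm x * ((\<Sum>i\<in>Basis. \<bar>Phi ((dS ^^ j) (A i)) x t\<bar>) + \<bar>Phi ((dS ^^ j) N) x t\<bar>)"
      by (simp add: sum_distrib_left algebra_simps)
    finally have "\<delta> * \<bar>Phi (dS ?F) x t\<bar> \<le> (\<Sum>i\<in>Basis. \<bar>Phi ((dS ^^ j) (A i)) x t\<bar>) + \<bar>Phi ((dS ^^ j) N) x t\<bar>"
      using \<delta>(2) by (simp add: mult_le_cancel_left)
    then have "norm x ^ Suc m * (\<delta> ^ j * (\<delta> * \<bar>Phi (dS ?F) x t\<bar>)) \<le>
        norm x ^ Suc m * (\<delta> ^ j * ((\<Sum>i\<in>Basis. \<bar>Phi ((dS ^^ j) (A i)) x t\<bar>) + \<bar>Phi ((dS ^^ j) N) x t\<bar>))"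
      using \<delta> by (intro mult_left_mono) auto
    also have "\<dots> = (\<Sum>i\<in>Basis. norm x ^ Suc m * (\<delta> ^ j * \<bar>Phi ((dS ^^ j) (A i)) x t\<bar>)) +
        norm x ^ Suc m * (\<delta> ^ j * \<bar>Phi ((dS ^^ j) N) x t\<bar>)"
      by (simp add: sum_distrib_left distrib_left)
    also have "\<dots> \<le> (\<Sum>i\<in>Basis. CA i * \<delta> ^ m) + CN * \<delta> ^ m"
      unfolding \<delta>_def by (intro add_mono sum_mono CA(2) CN(2) xt)
    also have "\<dots> = C * \<delta> ^ m" by (simp add: C_def sum_distrib_right distrib_right)
    finally show ?thesis by (simp add: \<delta>_def mult_ac)
  qed
  moreover have "C \<ge> 0" unfolding C_def using CA(1) CN(1) by (intro add_nonneg_nonneg sum_nonneg) auto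
  ultimately show ?case by (intro exI[of _ C]) simp
qed


section \<open>Asymptotics near the cone\<close>

text \<open>Integration by parts in \<open>s\<close>; the profile vanishes at the far pole \<open>s = -1\<close>.\<close>

lemma profile_weighted_integral:
  fixes F :: "real \<times> 'a::euclidean_space \<Rightarrow> real"
  assumes F: "profile R F" and \<theta>: "\<theta> \<noteq> 0" and t: "t - r < - R"
  shows "((\<lambda>s. r * ((dS ^^ Suc k) F (r * s + t, \<theta>) * (r * (1 - s)) ^ k)) has_integral
    fact k * F (r + t, \<theta>)) {-1..1}"
proof (induction k)
  case 0
  have "((\<lambda>s. r * dS F (r * s + t, \<theta>)) has_integral F (r * 1 + t, \<theta>) - F (r * - 1 + t, \<theta>)) {-1..1}"
  proof (rule fundamental_theorem_of_calculus)
    fix s :: real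
    have "((\<lambda>s. F (r * s + t, \<theta>)) has_real_derivative dS F (r * s + t, \<theta>) * r) (at s)"
      by (rule DERIV_chain2[OF profile_has_real_derivative[OF F \<theta>]]) (auto intro!: derivative_eq_intros)
    then show "((\<lambda>s. F (r * s + t, \<theta>)) has_vector_derivative r * dS F (r * s + t, \<theta>)) (at s within {-1..1})"
      by (simp add: has_real_derivative_iff_has_vector_derivative[symmetric] has_field_derivative_at_within mult.commute)
  qed simp
  moreover have "F (r * - 1 + t, \<theta>) = 0" using t by (intro profile_support[OF F \<theta>]) auto
  ultimately show ?case by simp
next
  case (Suc k)
  let ?H = "(dS ^^ Suc k) F"
  have H: "profile R ?H" by (rule profile_funpow_dS[OF F])
  let ?g = "\<lambda>s. r * (dS ?H (r * s + t, \<theta>) * (r * (1 - s)) ^ Suc k)"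
  let ?h = "\<lambda>s. r * (?H (r * s + t, \<theta>) * (r * (1 - s)) ^ k)"
  have "((\<lambda>s. ?g s - real (Suc k) * ?h s) has_integral
      ?H (r * 1 + t, \<theta>) * (r * (1 - 1)) ^ Suc k - ?H (r * - 1 + t, \<theta>) * (r * (1 - - 1)) ^ Suc k) {-1..1}"
  proof (rule fundamental_theorem_of_calculus)
    fix s :: real
    have 1: "((\<lambda>s. ?H (r * s + t, \<theta>)) has_real_derivative dS ?H (r * s + t, \<theta>) * r) (at s)"
      by (rule DERIV_chain2[OF profile_has_real_derivative[OF H \<theta>]]) (auto intro!: derivative_eq_intros)
    have 2: "((\<lambda>s. (r * (1 - s)) ^ Suc k) has_real_derivative real (Suc k) * (r * (1 - s)) ^ k * (- r)) (at s)"
      by (rule derivative_eq_intros refl | simp)+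
    have "((\<lambda>s. ?H (r * s + t, \<theta>) * (r * (1 - s)) ^ Suc k) has_real_derivative ?g s - real (Suc k) * ?h s) (at s)"
      by (rule DERIV_cong[OF DERIV_mult[OF 1 2]]) (simp add: algebra_simps)
    then show "((\<lambda>s. ?H (r * s + t, \<theta>) * (r * (1 - s)) ^ Suc k) has_vector_derivative ?g s - real (Suc k) * ?h s) (at s within {-1..1})"
      by (simp only: has_real_derivative_iff_has_vector_derivative[symmetric] has_field_derivative_at_within)
  qed simp
  moreover have "?H (r * - 1 + t, \<theta>) = 0" using t by (intro profile_support[OF H \<theta>]) auto
  ultimately have 3: "((\<lambda>s. ?g s - real (Suc k) * ?h s) has_integral 0) {-1..1}"
    by (simp only: diff_self mult_zero_right power_0_Suc mult_zero_left)
  from has_integral_add[OF this has_integral_mult_right[OF Suc, of "real (Suc k)"]]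
  have "(?g has_integral real (Suc k) * (fact k * F (r + t, \<theta>))) {-1..1}"
    by (simp only: diff_add_cancel add_0)
  then show ?case by (simp add: mult.assoc)
qed

text \<open>Bernoulli's inequality for \<open>u = (1 - s) / 2\<close>. It freezes the factor
  \<open>1 + s\<close> of the weight at its value 2 at the pole \<open>s = 1\<close>.\<close>

lemma power_deficit_bound:
  fixes s :: real
  assumes "-1 \<le> s" "s \<le> 1"
  shows "\<bar>(1 + s) ^ k - 2 ^ k\<bar> \<le> 2 ^ k * real k * (1 - s)"
proof -
  define u where "u = (1 - s) / 2"
  have u: "0 \<le> u" "u \<le> 1" using assms by (auto simp: u_def)
  have e: "(1 + s) ^ k = 2 ^ k * (1 - u) ^ k"
  proof -
    have "1 + s = 2 * (1 - u)" by (simp add: u_def field_simps)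
    then show ?thesis by (simp only: power_mult_distrib)
  qed
  have 1: "1 + real k * (- u) \<le> (1 + - u) ^ k" by (rule Bernoulli_inequality) (use u in simp)
  have 2: "(1 - u) ^ k \<le> 1" using u by (intro power_le_one) auto
  have "\<bar>(1 - u) ^ k - 1\<bar> \<le> real k * u" using 1 2 by simp
  then have "2 ^ k * \<bar>(1 - u) ^ k - 1\<bar> \<le> 2 ^ k * (real k * u)" by simp
  moreover have "real k * u \<le> real k * (1 - s)" using u by (intro mult_left_mono) (auto simp: u_def)
  then have "2 ^ k * (real k * u) \<le> 2 ^ k * (real k * (1 - s))" by simp
  moreover have "\<bar>(1 + s) ^ k - 2 ^ k\<bar> = 2 ^ k * \<bar>(1 - u) ^ k - 1\<bar>"
  proof -
    have "2 ^ k * (1 - u) ^ k - 2 ^ k = 2 ^ k * ((1 - u) ^ k - 1)" by (simp add: algebra_simps)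
    then show ?thesis unfolding e by (simp add: abs_mult)
  qed
  ultimately show ?thesis by (simp add: mult.assoc)
qed

text \<open>The weight \<open>(1 - s^2) ^ m\<close> is split into \<open>2 ^ m (1 - s) ^ m\<close>
  and a remainder. The main part is evaluated exactly by \<open>profile_weighted_integral\<close>,
  and \<open>zonal_const m * 2 ^ m * fact m\<close> is \<open>(2 \<pi>)^(m + 1)\<close>. The
  remainder lives on \<open>1 - s \<le> \<rho> / r\<close> and carries one more factor
  \<open>1 - s\<close>, so its integral is of size \<open>r^-(m + 2)\<close>, which leaves
  \<open>C / r\<close>.\<close>

lemma zonal_near_cone:
  fixes F :: "real \<times> 'a::euclidean_space \<Rightarrow> real"
  assumes dim: "DIM('a) = 2 * m + 3" and F: "profile R F" and B: "B + R > 0"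
  shows "\<exists>C\<ge>0. \<forall>\<theta> r t. norm \<theta> = 1 \<longrightarrow> r > 0 \<longrightarrow> r + t \<le> B \<longrightarrow> t - r < - R \<longrightarrow> 2 * r \<ge> B + R \<longrightarrow>
    \<bar>r ^ Suc m * (\<integral>\<omega>. (dS ^^ Suc m) F (r * (\<theta> \<bullet> \<omega>) + t, \<theta>) \<partial>sphere_measure) - (2 * pi) ^ Suc m * F (r + t, \<theta>)\<bar> \<le> C / r"
proof -
  let ?H = "(dS ^^ Suc m) F"
  have H: "profile R ?H" by (rule profile_funpow_dS[OF F])
  obtain M where M: "M \<ge> 0" "\<And>s x. x \<noteq> 0 \<Longrightarrow> \<bar>?H (s, x)\<bar> \<le> M"
    using profile_bounded[OF H] by blast
  define \<rho> where "\<rho> = B + R"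
  define C where "C = zonal_const m * (M * \<rho> ^ Suc m * (2 ^ m * real m) * \<rho>)"
  have "\<bar>r ^ Suc m * (\<integral>\<omega>. ?H (r * (\<theta> \<bullet> \<omega>) + t, \<theta>) \<partial>sphere_measure) - (2 * pi) ^ Suc m * F (r + t, \<theta>)\<bar> \<le> C / r"
    if a: "norm \<theta> = 1" "r > 0" "r + t \<le> B" "t - r < - R" "2 * r \<ge> B + R" for \<theta> :: 'a and r t
  proof -
    have \<theta>0: "\<theta> \<noteq> 0" using a by auto
    define h where "h s = ?H (r * s + t, \<theta>)" for s
    have ch: "continuous_on A h" for A
      unfolding h_def using \<theta>0
      by (intro continuous_on_compose2[OF profile_continuous_on[OF H]] continuous_intros) auto
    have h0: "h s = 0" if "r * (1 - s) > \<rho>" for s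
      unfolding h_def by (rule profile_support[OF H \<theta>0]) (use that a in \<open>auto simp: \<rho>_def algebra_simps\<close>)
    \<comment> \<open>Lower bound for the support of \<open>h\<close>, since
      \<open>r (1 - s) > B + R\<close> forces \<open>r s + t < - R\<close>; the assumption
      \<open>2 r \<ge> B + R\<close> places it in \<open>[-1, 1]\<close>.\<close>
    define q where "q = 1 - \<rho> / r"
    have q: "-1 \<le> q" "q \<le> 1" using a B by (auto simp: q_def \<rho>_def field_simps)
    let ?d = "\<lambda>s. h s * (1 - s) ^ m * ((1 + s) ^ m - 2 ^ m)"
    have cd: "continuous_on A ?d" for A by (intro continuous_intros ch)
    have "integral {-1..1} ?d = integral {-1..q} ?d + integral {q..1} ?d"
      by (rule Henstock_Kurzweil_Integration.integral_combine[symmetric])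
         (use q in \<open>auto intro!: integrable_continuous_interval cd\<close>)
    also have "integral {-1..q} ?d = integral {-1..q} (\<lambda>s. 0)"
    proof (rule integral_spike[OF negligible_sing[of q]])
      fix s assume "s \<in> {-1..q} - {q}"
      then have "1 - s > \<rho> / r" by (auto simp: q_def)
      then have "r * (1 - s) > \<rho>" using a by (simp add: field_simps)
      then show "0 = ?d s" by (simp add: h0)
    qed
    finally have d1: "integral {-1..1} ?d = integral {q..1} ?d" by simp
    have "norm (integral {q..1} ?d) \<le> (M * (\<rho> / r) ^ m * (2 ^ m * real m * (\<rho> / r))) * (1 - q)"
    proof (rule integral_bound[OF q(2) cd])
      fix s assume s: "s \<in> {q..1}"
      have s1: "0 \<le> 1 - s" "1 - s \<le> \<rho> / r" using s by (auto simp: q_def)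
      have "\<bar>h s\<bar> * (1 - s) ^ m * \<bar>(1 + s) ^ m - 2 ^ m\<bar> \<le> M * (\<rho> / r) ^ m * (2 ^ m * real m * (\<rho> / r))"
      proof (intro mult_mono)
        show "\<bar>h s\<bar> \<le> M" unfolding h_def by (rule M(2)[OF \<theta>0])
        show "(1 - s) ^ m \<le> (\<rho> / r) ^ m" using s1 by (intro power_mono)
        have "\<bar>(1 + s) ^ m - 2 ^ m\<bar> \<le> 2 ^ m * real m * (1 - s)"
          by (rule power_deficit_bound) (use s q in auto)
        also have "\<dots> \<le> 2 ^ m * real m * (\<rho> / r)" using s1 by (intro mult_left_mono) auto
        finally show "\<bar>(1 + s) ^ m - 2 ^ m\<bar> \<le> 2 ^ m * real m * (\<rho> / r)" .
      qed (use s1 M(1) in auto)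
      then show "norm (?d s) \<le> M * (\<rho> / r) ^ m * (2 ^ m * real m * (\<rho> / r))"
        using s1 by (simp add: abs_mult power_abs)
    qed
    then have dle: "\<bar>integral {-1..1} ?d\<bar> \<le> (M * (\<rho> / r) ^ m * (2 ^ m * real m * (\<rho> / r))) * (\<rho> / r)"
      unfolding d1 by (simp add: q_def)
    have main: "integral {-1..1} (\<lambda>s. r * (h s * (r * (1 - s)) ^ m)) = fact m * F (r + t, \<theta>)"
      using profile_weighted_integral[OF F \<theta>0 a(4), of m] unfolding h_def by (rule integral_unique)
    have split: "integral {-1..1} (\<lambda>s. h s * (1 - s\<^sup>2) ^ m) =
        integral {-1..1} ?d + 2 ^ m * integral {-1..1} (\<lambda>s. h s * (1 - s) ^ m)"
    proof -
      have "integral {-1..1} ?d + integral {-1..1} (\<lambda>s. 2 ^ m * (h s * (1 - s) ^ m)) =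
          integral {-1..1} (\<lambda>s. ?d s + 2 ^ m * (h s * (1 - s) ^ m))"
        by (rule integral_add[symmetric]) (intro integrable_continuous_interval continuous_intros ch)+
      also have "(\<lambda>s. ?d s + 2 ^ m * (h s * (1 - s) ^ m)) = (\<lambda>s. h s * (1 - s\<^sup>2) ^ m)"
      proof
        fix s :: real
        have "(1 - s\<^sup>2) ^ m = (1 - s) ^ m * (1 + s) ^ m"
        proof -
          have "1 - s\<^sup>2 = (1 - s) * (1 + s)" by (simp add: algebra_simps power2_eq_square)
          then show ?thesis by (simp only: power_mult_distrib)
        qed
        then show "?d s + 2 ^ m * (h s * (1 - s) ^ m) = h s * (1 - s\<^sup>2) ^ m"
          by (simp add: algebra_simps)
      qed
      finally show ?thesis by simp
    qed
    have "r ^ Suc m * integral {-1..1} (\<lambda>s. h s * (1 - s) ^ m) = fact m * F (r + t, \<theta>)"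
    proof -
      have "integral {-1..1} (\<lambda>s. r ^ Suc m * (h s * (1 - s) ^ m)) = fact m * F (r + t, \<theta>)"
        unfolding main[symmetric] by (simp add: power_mult_distrib mult_ac)
      then show ?thesis by simp
    qed
    moreover have "zonal_const m * 2 ^ m * fact m = (2 * pi) ^ Suc m" by (simp add: zonal_const_def)
    moreover have "zonal_const m * (r ^ Suc m * (2 ^ m * integral {-1..1} (\<lambda>s. h s * (1 - s) ^ m))) =
        zonal_const m * 2 ^ m * (r ^ Suc m * integral {-1..1} (\<lambda>s. h s * (1 - s) ^ m))"
      by (simp only: mult_ac)
    ultimately have "zonal_const m * (r ^ Suc m * (2 ^ m * integral {-1..1} (\<lambda>s. h s * (1 - s) ^ m))) =
        (2 * pi) ^ Suc m * F (r + t, \<theta>)"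
      by (simp only: mult.assoc[symmetric])
    then have "r ^ Suc m * (zonal_const m * integral {-1..1} (\<lambda>s. h s * (1 - s\<^sup>2) ^ m)) - (2 * pi) ^ Suc m * F (r + t, \<theta>)
        = zonal_const m * (r ^ Suc m * integral {-1..1} ?d)"
      unfolding split by (simp add: algebra_simps)
    also have "\<bar>\<dots>\<bar> = zonal_const m * (r ^ Suc m * \<bar>integral {-1..1} ?d\<bar>)"
      using a zonal_const_pos[of m] by (simp add: abs_mult)
    also have "\<dots> \<le> zonal_const m * (r ^ Suc m * ((M * (\<rho> / r) ^ m * (2 ^ m * real m * (\<rho> / r))) * (\<rho> / r)))"
      using a zonal_const_pos[of m] dle by (intro mult_left_mono) auto
    also have "\<dots> = C / r"
      using a by (simp add: C_def power_divide field_simps)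
    finally show ?thesis
      using integral_sphere_zonal[OF a(1) dim ch] by (simp add: h_def)
  qed
  moreover have "C \<ge> 0" using M(1) B zonal_const_pos[of m] by (simp add: C_def \<rho>_def)
  ultimately show ?thesis by blast
qed

text \<open>The direction is frozen by uniform continuity: a contributing \<open>\<omega>\<close>
  satisfies \<open>|\<omega> - \<theta>|^2 = 2 (1 - \<theta> \<bullet> \<omega>) \<le> 2 \<rho> /
  r\<close>. The error \<open>e1\<close> is integrated over this cap only, whose area is of order
  \<open>r^-(m + 1)\<close>; a bound over the whole sphere would not survive the factor
  \<open>r ^ Suc m\<close>.\<close>

theorem Phi_near_cone:
  fixes F :: "real \<times> 'a::euclidean_space \<Rightarrow> real"
  assumes dim: "DIM('a) = 2 * m + 3" and R: "R > 0" and F: "profile R F" and B: "B \<ge> 0" and e: "e > 0"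
  shows "\<exists>T. \<forall>\<theta> r t. t \<le> - T \<longrightarrow> norm \<theta> = 1 \<longrightarrow> r > 0 \<longrightarrow> - R \<le> r + t \<longrightarrow> r + t \<le> B \<longrightarrow>
    \<bar>r ^ Suc m * Phi ((dS ^^ Suc m) F) (r *\<^sub>R \<theta>) t - (2 * pi) ^ Suc m * F (r + t, \<theta>)\<bar> \<le> e"
proof -
  let ?H = "(dS ^^ Suc m) F"
  have H: "profile R ?H" by (rule profile_funpow_dS[OF F])
  define \<rho> where "\<rho> = B + R"
  have \<rho>: "\<rho> > 0" using B R by (simp add: \<rho>_def)
  define K where "K = zonal_const m * ((2 * (2 * \<rho>)) ^ m * (4 * (2 * \<rho>)))"
  have K: "K \<ge> 0" using zonal_const_pos[of m] \<rho> by (simp add: K_def)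
  define e1 where "e1 = e / (2 * (K + 1))"
  have e1: "e1 > 0" "e1 * K \<le> e / 2" using e K by (auto simp: e1_def field_simps)
  obtain C where C: "C \<ge> 0" "\<And>\<theta> r t. norm \<theta> = 1 \<Longrightarrow> r > 0 \<Longrightarrow> r + t \<le> B \<Longrightarrow> t - r < - R \<Longrightarrow> 2 * r \<ge> B + R \<Longrightarrow>
    \<bar>r ^ Suc m * (\<integral>\<omega>. ?H (r * (\<theta> \<bullet> \<omega>) + t, \<theta>) \<partial>sphere_measure) - (2 * pi) ^ Suc m * F (r + t, \<theta>)\<bar> \<le> C / r"
    using zonal_near_cone[OF dim F, of B] \<rho> unfolding \<rho>_def by blast
  have "uniformly_continuous_on ({-R..R} \<times> sphere 0 1) ?H"
    by (intro compact_uniformly_continuous continuous_on_subset[OF profile_continuous_on[OF H]] compact_Times) auto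
  then obtain d where d: "d > 0" "\<And>p q. p \<in> {-R..R} \<times> sphere 0 1 \<Longrightarrow> q \<in> {-R..R} \<times> sphere 0 1 \<Longrightarrow>
      dist q p < d \<Longrightarrow> dist (?H q) (?H p) < e1"
    using e1(1) unfolding uniformly_continuous_on_def by metis
  \<comment> \<open>Since \<open>r \<ge> - R - t \<ge> T - R\<close>, the summands are lower bounds
    on \<open>r\<close>: \<open>2 \<rho> / d^2\<close> puts the cap inside the modulus of
    continuity, \<open>\<rho>\<close> serves the condition \<open>2 r \<ge> B + R\<close>, and
    \<open>2 C / e\<close> makes the error of \<open>zonal_near_cone\<close> at most
    \<open>e / 2\<close>. The part \<open>R + 1\<close> gives \<open>t < - R\<close>, so the profile
    misses the opposite pole.\<close>
  define T where "T = R + 1 + 2 * \<rho> / d\<^sup>2 + \<rho> + 2 * C / e"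
  have "\<bar>r ^ Suc m * Phi ?H (r *\<^sub>R \<theta>) t - (2 * pi) ^ Suc m * F (r + t, \<theta>)\<bar> \<le> e"
    if a: "t \<le> - T" "norm \<theta> = 1" "r > 0" "- R \<le> r + t" "r + t \<le> B" for \<theta> r t
  proof -
    have \<theta>0: "\<theta> \<noteq> 0" using a by auto
    have nn: "0 \<le> 2 * \<rho> / d\<^sup>2" "0 \<le> 2 * C / e" using \<rho> C(1) e d(1) by auto
    have r: "r > 2 * \<rho> / d\<^sup>2" "r \<ge> \<rho>" "r \<ge> 2 * C / e" "t < - R"
      using a(1,4) nn \<rho> unfolding T_def by linarith+
    have rd: "2 * (\<rho> / r) < d\<^sup>2" using r(1) a(3) d(1) by (simp add: field_simps)
    have Cr: "C / r \<le> e / 2" using r(3) a(3) e by (simp add: field_simps)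
    define f where "f s = max 0 (2 - r * \<bar>1 - s\<bar> / \<rho>)" for s
    have f0: "\<bar>s - 1\<bar> \<le> 2 * \<rho> / r" if "f s \<noteq> 0" for s
      using that \<rho> a(3) by (auto simp: f_def max_def field_simps abs_minus_commute split: if_splits)
    have cf: "continuous_on A f" for A unfolding f_def by (intro continuous_intros) (use \<rho> in auto)
    have i1: "integrable sphere_measure (\<lambda>\<omega>. ?H (r * (\<theta> \<bullet> \<omega>) + t, \<omega>))"
      using Phi_integrable[OF H, of "r *\<^sub>R \<theta>" t] by simp
    have i2: "integrable sphere_measure (\<lambda>\<omega>. ?H (r * (\<theta> \<bullet> \<omega>) + t, \<theta>))"
      by (intro integrable_continuous_sphere_measure continuous_on_compose2[OF profile_continuous_on[OF H]] continuous_intros)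
         (use \<theta>0 in auto)
    have if': "integrable sphere_measure (\<lambda>\<omega>. e1 * f (\<theta> \<bullet> \<omega>))"
      by (intro integrable_mult_right integrable_continuous_sphere_measure continuous_on_compose2[OF cf[of UNIV]] continuous_intros) auto
    have "\<bar>Phi ?H (r *\<^sub>R \<theta>) t - (\<integral>\<omega>. ?H (r * (\<theta> \<bullet> \<omega>) + t, \<theta>) \<partial>sphere_measure)\<bar>
        = \<bar>\<integral>\<omega>. ?H (r * (\<theta> \<bullet> \<omega>) + t, \<omega>) - ?H (r * (\<theta> \<bullet> \<omega>) + t, \<theta>) \<partial>sphere_measure\<bar>"
      unfolding Phi_def using i1 i2 by simp
    also have "\<dots> \<le> (\<integral>\<omega>. \<bar>?H (r * (\<theta> \<bullet> \<omega>) + t, \<omega>) - ?H (r * (\<theta> \<bullet> \<omega>) + t, \<theta>)\<bar> \<partial>sphere_measure)"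
      by (rule integral_abs_bound)
    also have "\<dots> \<le> (\<integral>\<omega>. e1 * f (\<theta> \<bullet> \<omega>) \<partial>sphere_measure)"
    proof (rule integral_mono[OF integrable_abs[OF Bochner_Integration.integrable_diff[OF i1 i2]] if'])
      fix \<omega> :: 'a assume "\<omega> \<in> space sphere_measure"
      then have w: "norm \<omega> = 1" "\<omega> \<noteq> 0" by auto
      let ?s = "r * (\<theta> \<bullet> \<omega>) + t"
      have le1: "\<theta> \<bullet> \<omega> \<le> 1" using norm_cauchy_schwarz[of \<theta> \<omega>] a(2) w by simp
      have fnn: "f (\<theta> \<bullet> \<omega>) \<ge> 0" by (simp add: f_def)
      show "\<bar>?H (?s, \<omega>) - ?H (?s, \<theta>)\<bar> \<le> e1 * f (\<theta> \<bullet> \<omega>)"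
      proof (cases "\<bar>?s\<bar> \<le> R")
        case True
        have "r * (1 - \<theta> \<bullet> \<omega>) \<le> \<rho>" using True a(5) by (simp add: \<rho>_def algebra_simps)
        then have 1: "f (\<theta> \<bullet> \<omega>) \<ge> 1" and 2: "1 - \<theta> \<bullet> \<omega> \<le> \<rho> / r"
          using le1 a(3) \<rho> by (auto simp: f_def field_simps)
        have "(norm (\<omega> - \<theta>))\<^sup>2 = 2 * (1 - \<theta> \<bullet> \<omega>)"
          using w(1) a(2) by (simp add: power2_norm_eq_inner inner_diff inner_commute norm_eq_1)
        also have "\<dots> \<le> 2 * (\<rho> / r)" using 2 by (intro mult_left_mono) auto
        also have "\<dots> < d\<^sup>2" by (rule rd)
        finally have "norm (\<omega> - \<theta>) < d" using d(1) by (simp add: power2_less_imp_less)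
        then have "dist (?s, \<omega>) (?s, \<theta>) < d" by (simp add: dist_Pair_Pair dist_norm)
        then have "dist (?H (?s, \<omega>)) (?H (?s, \<theta>)) < e1"
          by (intro d(2)) (use True w a in \<open>auto simp: abs_le_iff\<close>)
        then have "\<bar>?H (?s, \<omega>) - ?H (?s, \<theta>)\<bar> \<le> e1 * 1" by (simp add: dist_real_def)
        also have "\<dots> \<le> e1 * f (\<theta> \<bullet> \<omega>)" using 1 e1 by (intro mult_left_mono) auto
        finally show ?thesis .
      next
        case False
        then have "?H (?s, \<omega>) = 0" "?H (?s, \<theta>) = 0"
          using profile_support[OF H w(2), of ?s] profile_support[OF H \<theta>0, of ?s] by auto
        then show ?thesis using fnn e1 by simp
      qed
    qed
    finally have "r ^ Suc m * \<bar>Phi ?H (r *\<^sub>R \<theta>) t - (\<integral>\<omega>. ?H (r * (\<theta> \<bullet> \<omega>) + t, \<theta>) \<partial>sphere_measure)\<bar>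
        \<le> r ^ Suc m * (e1 * (\<integral>\<omega>. f (\<theta> \<bullet> \<omega>) \<partial>sphere_measure))"
      using a(3) by (simp add: mult_left_mono)
    also have "\<dots> = e1 * (r ^ Suc m * (\<integral>\<omega>. f (\<theta> \<bullet> \<omega>) \<partial>sphere_measure))" by simp
    also have "\<dots> \<le> e1 * K"
      unfolding K_def
    proof (intro mult_left_mono zonal_integral_bound[OF dim a(2,3), where c=1] cf)
      show "\<bar>s - 1\<bar> \<le> 2 * \<rho> / r" if "f s \<noteq> 0" for s by (rule f0[OF that])
      show "1 - \<bar>s\<bar> \<le> 2 * \<rho> / r" if "f s \<noteq> 0" "\<bar>s\<bar> \<le> 1" for s
        using f0[OF that(1)] by linarith
    qed (use \<rho> e1 a(3) in \<open>auto simp: f_def\<close>)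
    finally have "\<bar>r ^ Suc m * Phi ?H (r *\<^sub>R \<theta>) t - r ^ Suc m * (\<integral>\<omega>. ?H (r * (\<theta> \<bullet> \<omega>) + t, \<theta>) \<partial>sphere_measure)\<bar> \<le> e / 2"
      using e1(2) a(3) by (simp add: right_diff_distrib[symmetric] abs_mult)
    moreover have "\<bar>r ^ Suc m * (\<integral>\<omega>. ?H (r * (\<theta> \<bullet> \<omega>) + t, \<theta>) \<partial>sphere_measure) - (2 * pi) ^ Suc m * F (r + t, \<theta>)\<bar> \<le> e / 2"
    proof (rule order_trans[OF C(2) Cr])
      show "t - r < - R" using r(4) a(3) by linarith
      show "B + R \<le> 2 * r" using r(2) a(3) unfolding \<rho>_def by linarith
    qed (use a in auto)
    ultimately show ?thesis by linarith
  qed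
  then show ?thesis by blast
qed

section \<open>Superpositions are finite energy solutions\<close>

text \<open>For bounded \<open>t\<close> the distance to the cone is comparable to
  \<open>|x|\<close>, and the powers in \<open>Phi_decay\<close> combine to
  \<open>|x|^-(j + 1)\<close>; the dependence on \<open>m\<close> cancels. For small
  \<open>|x|\<close> boundedness suffices.\<close>

lemma Phi_decay_power:
  fixes F :: "real \<times> 'a::euclidean_space \<Rightarrow> real"
  assumes dim: "DIM('a) = 2 * m + 3" and R: "R > 0" and F: "profile R F" and T: "T \<ge> 0"
  shows "\<exists>C\<ge>0. \<forall>x t. \<bar>t\<bar> \<le> T \<longrightarrow> \<bar>Phi ((dS ^^ j) F) x t\<bar> \<le> C / (1 + norm x) ^ Suc j"
proof -
  obtain C where C: "C \<ge> 0" "\<And>x t. norm x - \<bar>t\<bar> \<ge> 2 * R \<Longrightarrow>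
    norm x ^ Suc m * ((norm x - \<bar>t\<bar>) ^ j * \<bar>Phi ((dS ^^ j) F) x t\<bar>) \<le> C * (norm x - \<bar>t\<bar>) ^ m"
    using Phi_decay[OF dim R F, of j] by blast
  obtain M where M: "M \<ge> 0" "\<And>x t. \<bar>Phi ((dS ^^ j) F) x t\<bar> \<le> M"
    using Phi_bounded[OF profile_funpow_dS[OF F, of j]] by blast
  \<comment> \<open>Beyond \<open>L\<close> one has
    \<open>|x| - |t| \<ge> |x| / 2 \<ge> 2 R\<close>.\<close>
  define L where "L = 2 * T + 4 * R + 1"
  define C' where "C' = C * (2 ^ j * 2 ^ Suc j) + M * (1 + L) ^ Suc j"
  have "\<bar>Phi ((dS ^^ j) F) x t\<bar> \<le> C' / (1 + norm x) ^ Suc j" if t: "\<bar>t\<bar> \<le> T" for x t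
  proof (cases "norm x \<ge> L")
    case True
    define r where "r = norm x"
    define \<delta> where "\<delta> = r - \<bar>t\<bar>"
    define P where "P = \<bar>Phi ((dS ^^ j) F) x t\<bar>"
    have r: "r \<ge> 1" "\<delta> \<ge> 2 * R" "\<delta> \<ge> r / 2" "\<delta> \<le> r" "\<delta> > 0"
      using True t R T by (auto simp: r_def \<delta>_def L_def)
    have "r ^ Suc m * ((r / 2) ^ j * P) \<le> r ^ Suc m * (\<delta> ^ j * P)"
      using r by (intro mult_left_mono mult_right_mono power_mono) (auto simp: P_def)
    also have "\<dots> \<le> C * \<delta> ^ m"
      using C(2)[of x t] r(2) by (simp add: r_def \<delta>_def P_def)
    also have "\<dots> \<le> C * r ^ m" using r C(1) by (intro mult_left_mono power_mono) auto
    finally have "r ^ m * (r * ((r / 2) ^ j * P)) \<le> r ^ m * C" by (simp add: mult_ac)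
    then have "r * ((r / 2) ^ j * P) \<le> C" using r by (simp add: mult_le_cancel_left)
    then have 1: "P * r ^ Suc j \<le> C * 2 ^ j" by (simp add: power_divide field_simps)
    have "P * (1 + r) ^ Suc j \<le> P * (2 * r) ^ Suc j"
      using r by (intro mult_left_mono power_mono) (auto simp: P_def)
    also have "\<dots> = (P * r ^ Suc j) * 2 ^ Suc j" by (simp add: power_mult_distrib)
    also have "\<dots> \<le> (C * 2 ^ j) * 2 ^ Suc j" by (rule mult_right_mono[OF 1]) simp
    also have "\<dots> \<le> C'" using M(1) R T by (simp add: C'_def L_def mult.assoc)
    finally show ?thesis using r by (simp add: P_def r_def pos_le_divide_eq)
  next
    case False
    have "\<bar>Phi ((dS ^^ j) F) x t\<bar> * (1 + norm x) ^ Suc j \<le> M * (1 + L) ^ Suc j"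
      using False M by (intro mult_mono power_mono) auto
    also have "\<dots> \<le> C'" using C(1) by (simp add: C'_def)
    finally show ?thesis by (simp add: pos_le_divide_eq add_pos_nonneg)
  qed
  moreover have "C' \<ge> 0" using C(1) M(1) R T by (simp add: C'_def L_def)
  ultimately show ?thesis by blast
qed

lemma integrable_inverse_powr:
  assumes q: "q > real DIM('a)"
  shows "integrable lborel (\<lambda>x::'a::euclidean_space. (1 + norm x) powr - q)"
proof (rule integrableI_nonneg)
  let ?d = "DIM('a)"
  define a where "a = real ?d - q"
  have a: "a < 0" using q by (simp add: a_def)
  have d: "real (?d - 1) = real ?d - 1" using DIM_positive[where 'a='a] by linarith
  have fin: "(\<integral>\<^sup>+r. ennreal ((1 + r) powr (a - 1)) * indicator {0..} r \<partial>lborel) = ennreal (0 - (1 + 0) powr a / a)"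
  proof (rule nn_integral_FTC_atLeast[where F="\<lambda>r. (1 + r) powr a / a"])
    show "((\<lambda>r. (1 + r) powr a / a) has_real_derivative (1 + r) powr (a - 1)) (at r)" if "0 \<le> r" for r
      using that a by (auto intro!: derivative_eq_intros)
    have "((\<lambda>r::real. (1 + r) powr a) \<longlongrightarrow> 0) at_top"
      by (rule tendsto_neg_powr[OF a]) (rule filterlim_tendsto_add_at_top[OF tendsto_const filterlim_ident])
    then show "((\<lambda>r. (1 + r) powr a / a) \<longlongrightarrow> 0) at_top" using tendsto_divide[OF _ tendsto_const, of _ 0 at_top a] a by fastforce
  qed simp_all
  have "(\<integral>\<^sup>+x. ennreal ((1 + norm (x::'a)) powr - q) \<partial>lborel) =
     (\<integral>\<^sup>+r. indicator {0<..} r * ennreal (r ^ (?d - 1)) * (\<integral>\<^sup>+\<omega>. ennreal ((1 + norm (r *\<^sub>R (\<omega>::'a))) powr - q) \<partial>sphere_measure) \<partial>lborel)"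
    by (rule nn_integral_polar) measurable
  also have "\<dots> \<le> (\<integral>\<^sup>+r. ennreal ((1 + r) powr (a - 1)) * indicator {0..} r * emeasure (sphere_measure :: 'a measure) (sphere 0 1) \<partial>lborel)"
  proof (rule nn_integral_mono)
    fix r :: real
    show "indicator {0<..} r * ennreal (r ^ (?d - 1)) * (\<integral>\<^sup>+\<omega>. ennreal ((1 + norm (r *\<^sub>R (\<omega>::'a))) powr - q) \<partial>sphere_measure)
      \<le> ennreal ((1 + r) powr (a - 1)) * indicator {0..} r * emeasure (sphere_measure :: 'a measure) (sphere 0 1)"
    proof (cases "r > 0")
      case True
      have "(\<integral>\<^sup>+\<omega>. ennreal ((1 + norm (r *\<^sub>R (\<omega>::'a))) powr - q) \<partial>sphere_measure) =
          (\<integral>\<^sup>+\<omega>. ennreal ((1 + r) powr - q) \<partial>(sphere_measure :: 'a measure))"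
        by (rule nn_integral_cong) (use True in simp)
      also have "\<dots> = ennreal ((1 + r) powr - q) * emeasure (sphere_measure :: 'a measure) (sphere 0 1)" by simp
      finally have 1: "(\<integral>\<^sup>+\<omega>. ennreal ((1 + norm (r *\<^sub>R (\<omega>::'a))) powr - q) \<partial>sphere_measure) =
         ennreal ((1 + r) powr - q) * emeasure (sphere_measure :: 'a measure) (sphere 0 1)" .
      have "r ^ (?d - 1) \<le> (1 + r) ^ (?d - 1)" using True by (intro power_mono) auto
      also have "\<dots> = (1 + r) powr (real ?d - 1)" using True by (simp add: powr_realpow[symmetric] d)
      finally have "r ^ (?d - 1) * (1 + r) powr - q \<le> (1 + r) powr (real ?d - 1) * (1 + r) powr - q"
        by (rule mult_right_mono) simp
      also have "\<dots> = (1 + r) powr (a - 1)" by (simp add: powr_add[symmetric] a_def algebra_simps)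
      finally have "ennreal (r ^ (?d - 1)) * ennreal ((1 + r) powr - q) \<le> ennreal ((1 + r) powr (a - 1))"
        using True by (subst ennreal_mult'[symmetric]) (auto intro: ennreal_leI)
      then show ?thesis unfolding 1 using True by (simp add: mult.assoc[symmetric] mult_right_mono)
    qed simp
  qed
  also have "\<dots> = ennreal (0 - (1 + 0) powr a / a) * emeasure (sphere_measure :: 'a measure) (sphere 0 1)"
    by (subst nn_integral_multc) (simp_all only: fin, measurable)
  also have "\<dots> < \<infinity>"
    by (simp add: emeasure_sphere_measure_space ennreal_mult_less_top)
  finally show "(\<integral>\<^sup>+x. ennreal ((1 + norm (x::'a)) powr - q) \<partial>lborel) < \<infinity>" .
qed auto

lemma mem_Lp_decay:
  fixes h :: "'a::euclidean_space \<Rightarrow> 'c::euclidean_space"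
  assumes [measurable]: "h \<in> borel_measurable borel" and p: "p > 0" and C: "C \<ge> 0"
    and le: "\<And>x. norm (h x) \<le> C / (1 + norm x) ^ n" and n: "real n * p > real DIM('a)"
  shows "mem_Lp p lborel h"
proof -
  have "integrable lborel (\<lambda>x. norm (h x) powr p)"
  proof (rule Bochner_Integration.integrable_bound)
    show "integrable lborel (\<lambda>x::'a. C powr p * (1 + norm x) powr - (real n * p))"
      by (intro integrable_mult_right integrable_inverse_powr n)
    show "AE x in lborel. norm (norm (h x) powr p) \<le> norm (C powr p * (1 + norm x) powr - (real n * p))"
    proof (rule AE_I2)
      fix x :: 'a
      have pos: "1 + norm x > 0" by (simp add: add_pos_nonneg)
      have "norm (h x) powr p \<le> (C / (1 + norm x) ^ n) powr p"
        using le p by (intro powr_mono2) auto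
      also have "\<dots> = C powr p / ((1 + norm x) powr real n) powr p"
        using pos C by (simp add: powr_divide powr_realpow)
      also have "\<dots> = C powr p * (1 + norm x) powr - (real n * p)"
        by (simp add: powr_powr powr_minus divide_inverse)
      finally show "norm (norm (h x) powr p) \<le> norm (C powr p * (1 + norm x) powr - (real n * p))" by simp
    qed
  qed measurable
  then show ?thesis by (simp add: mem_Lp_def)
qed

lemma mem_Lp_2_iff: "mem_Lp 2 M f \<longleftrightarrow> f \<in> borel_measurable M \<and> integrable M (\<lambda>x. (norm (f x))\<^sup>2)"
  by (simp add: mem_Lp_def powr_numeral cong: conj_cong)

text \<open>Mean value theorem in time: the time derivative is of order
  \<open>(1 + |x|)^-(m + 3)\<close> locally uniformly in time, and its square is integrable as
  \<open>2 * m + 6 > d\<close>. So the \<open>L^2\<close> distance is of order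
  \<open>|s - t|\<close> for \<open>s\<close> near \<open>t\<close>.\<close>

lemma Phi_L2_continuous:
  fixes F :: "real \<times> 'a::euclidean_space \<Rightarrow> real"
  assumes dim: "DIM('a) = 2 * m + 3" and R: "R > 0" and F: "profile R F"
  shows "((\<lambda>s. \<integral>x. (Phi ((dS ^^ Suc m) F) x s - Phi ((dS ^^ Suc m) F) x t)\<^sup>2 \<partial>lborel) \<longlongrightarrow> 0) (at t)"
    and "integrable lborel (\<lambda>x. (Phi ((dS ^^ Suc m) F) x s - Phi ((dS ^^ Suc m) F) x t)\<^sup>2)"
proof -
  let ?P = "Phi ((dS ^^ Suc m) F)"
  have P: "profile R ((dS ^^ Suc m) F)" by (rule profile_funpow_dS[OF F])
  note [measurable] = Phi_borel_measurable[OF P]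
  have int: "\<exists>J\<ge>0. \<forall>s. \<bar>s - t\<bar> \<le> L \<longrightarrow> integrable lborel (\<lambda>x. (?P x s - ?P x t)\<^sup>2) \<and>
      (\<integral>x. (?P x s - ?P x t)\<^sup>2 \<partial>lborel) \<le> (s - t)\<^sup>2 * J" if "L \<ge> 0" for L
  proof -
    have "\<bar>t\<bar> + L \<ge> 0" using that by simp
    from Phi_decay_power[OF dim R F this, of "Suc (Suc m)"]
    obtain C where C: "C \<ge> 0" "\<And>x s. \<bar>s\<bar> \<le> \<bar>t\<bar> + L \<Longrightarrow> \<bar>Phi ((dS ^^ Suc (Suc m)) F) x s\<bar> \<le> C / (1 + norm x) ^ Suc (Suc (Suc m))"
      by blast
    let ?w = "\<lambda>x::'a. C\<^sup>2 * (1 + norm x) powr - real (2 * m + 6)"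
    have w: "integrable lborel ?w"
      by (intro integrable_mult_right integrable_inverse_powr) (simp add: dim)
    have le: "(?P x s - ?P x t)\<^sup>2 \<le> (s - t)\<^sup>2 * ?w x" if s: "\<bar>s - t\<bar> \<le> L" for s x
    proof -
      let ?c = "C / (1 + norm x) ^ Suc (Suc (Suc m))"
      have "norm (?P x s - ?P x t) \<le> ?c * norm (s - t)"
      proof (rule field_differentiable_bound[where S="cball t L" and f'="\<lambda>s. Phi (dS ((dS ^^ Suc m) F)) x s"])
        show "((\<lambda>s. ?P x s) has_field_derivative Phi (dS ((dS ^^ Suc m) F)) x s) (at s within cball t L)" for s
          by (rule has_field_derivative_at_within[OF Phi_has_real_derivative[OF P]])
        show "norm (Phi (dS ((dS ^^ Suc m) F)) x s) \<le> ?c" if "s \<in> cball t L" for s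
          using C(2)[of s x] that by (simp add: dist_real_def)
      qed (use s that \<open>L \<ge> 0\<close> in \<open>auto simp: dist_real_def\<close>)
      then have "\<bar>?P x s - ?P x t\<bar>\<^sup>2 \<le> (?c * \<bar>s - t\<bar>)\<^sup>2" by (intro power_mono) auto
      also have "(?c * \<bar>s - t\<bar>)\<^sup>2 = (s - t)\<^sup>2 * (C\<^sup>2 / ((1 + norm x) ^ Suc (Suc (Suc m)))\<^sup>2)"
        unfolding power_mult_distrib power_divide power2_abs by (rule mult.commute)
      also have "((1 + norm x) ^ Suc (Suc (Suc m)))\<^sup>2 = (1 + norm x) ^ (Suc (Suc (Suc m)) * 2)"
        by (rule power_mult[symmetric])
      also have "Suc (Suc (Suc m)) * 2 = 2 * m + 6" by simp
      also have "(1 + norm x) ^ (2 * m + 6) = (1 + norm x) powr real (2 * m + 6)"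
        by (rule powr_realpow[symmetric]) (simp add: add_pos_nonneg)
      also have "C\<^sup>2 / (1 + norm x) powr real (2 * m + 6) = ?w x"
        by (simp only: powr_minus divide_inverse)
      finally show ?thesis by simp
    qed
    have "integrable lborel (\<lambda>x. (?P x s - ?P x t)\<^sup>2) \<and>
      (\<integral>x. (?P x s - ?P x t)\<^sup>2 \<partial>lborel) \<le> (s - t)\<^sup>2 * (\<integral>x. ?w x \<partial>lborel)" if s: "\<bar>s - t\<bar> \<le> L" for s
    proof
      show i: "integrable lborel (\<lambda>x. (?P x s - ?P x t)\<^sup>2)"
        by (rule Bochner_Integration.integrable_bound[OF integrable_mult_right[OF w, of "(s - t)\<^sup>2"]])
           (use le[OF s] borel_measurable_power[OF borel_measurable_diff[OF Phi_borel_measurable[OF P] Phi_borel_measurable[OF P]]] in auto)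
      have "(\<integral>x. (?P x s - ?P x t)\<^sup>2 \<partial>lborel) \<le> (\<integral>x. (s - t)\<^sup>2 * ?w x \<partial>lborel)"
        by (rule integral_mono[OF i integrable_mult_right[OF w]]) (use le[OF s] in auto)
      then show "(\<integral>x. (?P x s - ?P x t)\<^sup>2 \<partial>lborel) \<le> (s - t)\<^sup>2 * (\<integral>x. ?w x \<partial>lborel)"
        using w by simp
    qed
    moreover have "(\<integral>x. ?w x \<partial>lborel) \<ge> 0" by (rule integral_nonneg_AE) simp
    ultimately show ?thesis by blast
  qed
  show "integrable lborel (\<lambda>x. (?P x s - ?P x t)\<^sup>2)"
    using int[of "\<bar>s - t\<bar>"] by auto
  obtain J where J: "\<And>s. \<bar>s - t\<bar> \<le> 1 \<Longrightarrow> (\<integral>x. (?P x s - ?P x t)\<^sup>2 \<partial>lborel) \<le> (s - t)\<^sup>2 * J"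
    using int[of 1] by auto
  have lim: "((\<lambda>s. (s - t)\<^sup>2 * J) \<longlongrightarrow> (t - t)\<^sup>2 * J) (at t)" by (intro tendsto_intros)
  show "((\<lambda>s. \<integral>x. (?P x s - ?P x t)\<^sup>2 \<partial>lborel) \<longlongrightarrow> 0) (at t)"
  proof (rule tendsto_sandwich[OF _ _ tendsto_const])
    show "\<forall>\<^sub>F s in at t. 0 \<le> (\<integral>x. (?P x s - ?P x t)\<^sup>2 \<partial>lborel)"
      by (rule always_eventually) (auto intro: integral_nonneg_AE)
    show "\<forall>\<^sub>F s in at t. (\<integral>x. (?P x s - ?P x t)\<^sup>2 \<partial>lborel) \<le> (s - t)\<^sup>2 * J"
    proof -
      have "\<forall>\<^sub>F s in at t. \<bar>s - t\<bar> \<le> 1"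
        unfolding eventually_at by (intro exI[of _ 1]) (auto simp: dist_real_def)
      then show ?thesis by (rule eventually_mono) (rule J)
    qed
    show "((\<lambda>s. (s - t)\<^sup>2 * J) \<longlongrightarrow> 0) (at t)" using lim by simp
  qed
qed

lemma test_function_bounded_support:
  fixes \<phi> :: "'a::euclidean_space \<Rightarrow> real"
  assumes "test_function \<phi>"
  obtains K where "\<And>x. norm x > K \<Longrightarrow> \<phi> x = 0"
proof -
  have "bounded (closure {x. \<phi> x \<noteq> 0})"
    using assms by (simp add: test_function_def compact_imp_bounded)
  then obtain K where K: "\<And>x. x \<in> closure {x. \<phi> x \<noteq> 0} \<Longrightarrow> norm x \<le> K"
    unfolding bounded_iff by blast
  have "\<phi> x = 0" if "norm x > K" for x
  proof (rule ccontr)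
    assume "\<phi> x \<noteq> 0"
    then have "x \<in> closure {x. \<phi> x \<noteq> 0}" using closure_subset[of "{x. \<phi> x \<noteq> 0}"] by blast
    from K[OF this] that show False by simp
  qed
  with that show ?thesis .
qed

lemma test_functionI:
  fixes \<phi> :: "'a::euclidean_space \<Rightarrow> real"
  assumes "smooth_on UNIV \<phi>" "\<And>x. norm x > K \<Longrightarrow> \<phi> x = 0"
  shows "test_function \<phi>"
proof -
  have "{x. \<phi> x \<noteq> 0} \<subseteq> cball 0 K" using assms(2) by (force simp: not_less)
  then have "bounded {x. \<phi> x \<noteq> 0}" using bounded_cball bounded_subset by blast
  then show ?thesis using assms(1)
    by (simp add: test_function_def compact_eq_bounded_closed bounded_closure)
qed

lemma test_function_derivative:
  assumes "test_function \<phi>"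
  shows "(\<phi> has_derivative frechet_derivative \<phi> (at x)) (at x)"
  by (rule smooth_on_has_derivative[of UNIV]) (use assms in \<open>auto simp: test_function_def\<close>)

lemma test_function_smooth_derivative:
  assumes "test_function \<phi>"
  shows "smooth_on UNIV (\<lambda>x. frechet_derivative \<phi> (at x) v)"
  using assms by (simp add: test_function_def smooth_on_frechet_derivative)

lemma test_function_frechet_derivative:
  fixes \<phi> :: "'a::euclidean_space \<Rightarrow> real"
  assumes "test_function \<phi>"
  shows "test_function (\<lambda>x. frechet_derivative \<phi> (at x) v)"
proof -
  obtain K where K: "\<And>x. norm x > K \<Longrightarrow> \<phi> x = 0"
    by (rule test_function_bounded_support[OF assms]) (rule that)
  show ?thesis
  proof (rule test_functionI[where K=K, OF test_function_smooth_derivative[OF assms]])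
    show "frechet_derivative \<phi> (at x) v = 0" if "norm x > K" for x
      using has_derivative_eq_0_outside[OF K test_function_derivative[OF assms] that] by (rule fun_cong)
  qed
qed

lemma test_function_continuous: "test_function \<phi> \<Longrightarrow> continuous_on UNIV \<phi>"
  by (simp add: test_function_def smooth_on_imp_continuous_on)

lemma test_function_integrable:
  fixes \<phi> :: "'a::euclidean_space \<Rightarrow> real"
  assumes "test_function \<phi>" shows "integrable lborel \<phi>"
proof -
  obtain K where K: "\<And>x. norm x > K \<Longrightarrow> \<phi> x = 0"
    by (rule test_function_bounded_support[OF assms]) (rule that)
  show ?thesis by (rule integrable_continuous_bounded_support[OF test_function_continuous[OF assms] K])
qed

lemma Phi_frechet_derivative_Basis:
  fixes F :: "real \<times> 'a::euclidean_space \<Rightarrow> real"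
  assumes "profile R F" "i \<in> Basis"
  shows "(\<Sum>j\<in>Basis. (i \<bullet> j) * Phi (mW j (dS F)) x t) = Phi (mW i (dS F)) x t"
  using assms(2) by (simp add: inner_Basis if_distrib[of "\<lambda>u. u * _"] cong: if_cong)

lemma Phi_mult_integrable:
  fixes F :: "real \<times> 'a::euclidean_space \<Rightarrow> real"
  assumes F: "profile R F" and q: "integrable lborel q"
  shows "integrable lborel (\<lambda>x. Phi F x t * q x)"
proof -
  obtain M where M: "M \<ge> 0" "\<And>x t. \<bar>Phi F x t\<bar> \<le> M" using Phi_bounded[OF F] by blast
  have [measurable]: "q \<in> borel_measurable borel" using q by simp
  note [measurable] = Phi_borel_measurable[OF F]
  show ?thesis
    by (rule Bochner_Integration.integrable_bound[OF integrable_mult_right[OF integrable_norm[OF q], of M]])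
       (use M in \<open>auto simp: abs_mult intro!: mult_right_mono\<close>)
qed

text \<open>The wave need not have compact support, but its product with \<open>\<phi>\<close> does,
  and the directional derivative of the product integrates to 0.\<close>

lemma Phi_integration_by_parts:
  fixes F :: "real \<times> 'a::euclidean_space \<Rightarrow> real"
  assumes F: "profile R F" and \<phi>: "test_function \<phi>" and i: "i \<in> Basis"
  shows "(\<integral>x. Phi F x t * frechet_derivative \<phi> (at x) i \<partial>lborel) = - (\<integral>x. Phi (mW i (dS F)) x t * \<phi> x \<partial>lborel)"
proof -
  obtain K where K: "\<And>x. norm x > K \<Longrightarrow> \<phi> x = 0"
    by (rule test_function_bounded_support[OF \<phi>]) (rule that)
  let ?D = "\<lambda>x h. Phi F x t * frechet_derivative \<phi> (at x) h + (\<Sum>j\<in>Basis. (h \<bullet> j) * Phi (mW j (dS F)) x t) * \<phi> x"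
  have G: "profile R (mW i (dS F))" for i by (intro profile_mW profile_dS F)
  have "((\<lambda>x. Phi F x t * \<phi> x) has_derivative ?D x) (at x)" for x
    by (rule has_derivative_mult[OF Phi_has_derivative[OF F] test_function_derivative[OF \<phi>]])
  moreover have "continuous_on UNIV (\<lambda>x. ?D x i)"
    by (intro continuous_intros Phi_continuous_on[OF F] Phi_continuous_on[OF G] test_function_continuous[OF \<phi>]
      smooth_on_imp_continuous_on[OF test_function_smooth_derivative[OF \<phi>]])
  ultimately have "(\<integral>x. ?D x i \<partial>lborel) = 0"
    by (rule integral_directional_derivative_eq_0(2)) (use K in auto)
  moreover have "(\<integral>x. ?D x i \<partial>lborel) =
      (\<integral>x. Phi F x t * frechet_derivative \<phi> (at x) i \<partial>lborel) + (\<integral>x. Phi (mW i (dS F)) x t * \<phi> x \<partial>lborel)"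
    unfolding Phi_frechet_derivative_Basis[OF F i]
    by (rule Bochner_Integration.integral_add)
       (rule Phi_mult_integrable[OF F test_function_integrable[OF test_function_frechet_derivative[OF \<phi>]]],
        rule Phi_mult_integrable[OF G test_function_integrable[OF \<phi>]])
  ultimately show ?thesis by simp
qed

text \<open>The quadratic remainder of \<open>Phi_taylor\<close> is uniform in \<open>x\<close>, so
  it can be integrated against any integrable \<open>q\<close>.\<close>

lemma Phi_pairing_derivative:
  fixes F :: "real \<times> 'a::euclidean_space \<Rightarrow> real"
  assumes F: "profile R F" and q: "integrable lborel q"
  shows "((\<lambda>s. \<integral>x. Phi F x s * q x \<partial>lborel) has_real_derivative (\<integral>x. Phi (dS F) x t * q x \<partial>lborel)) (at t)"
proof -
  obtain C where "C \<ge> 0" and C: "\<And>x h t \<tau>. \<bar>Phi F (x + h) (t + \<tau>) - Phi F x t -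
       ((\<Sum>i\<in>Basis. (h \<bullet> i) * Phi (mW i (dS F)) x t) + \<tau> * Phi (dS F) x t)\<bar> \<le> C * (norm h + \<bar>\<tau>\<bar>)\<^sup>2"
    by (rule Phi_taylor[OF F]) (rule that)
  note i1 = Phi_mult_integrable[OF F q] and i2 = Phi_mult_integrable[OF profile_dS[OF F] q]
  show ?thesis unfolding has_field_derivative_def
  proof (rule has_derivative_quadratic)
    fix h :: real
    have eq: "(\<integral>x. Phi F x (t + h) * q x \<partial>lborel) - (\<integral>x. Phi F x t * q x \<partial>lborel) - (\<integral>x. Phi (dS F) x t * q x \<partial>lborel) * h
      = (\<integral>x. (Phi F x (t + h) - Phi F x t - h * Phi (dS F) x t) * q x \<partial>lborel)"
      using i1 i2 by (simp add: left_diff_distrib mult.assoc)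
    have "(\<integral>x. \<bar>(Phi F x (t + h) - Phi F x t - h * Phi (dS F) x t) * q x\<bar> \<partial>lborel) \<le> (\<integral>x. C * h\<^sup>2 * \<bar>q x\<bar> \<partial>lborel)"
    proof (rule integral_mono)
      have "integrable lborel (\<lambda>x. Phi F x (t + h) * q x - Phi F x t * q x - h * (Phi (dS F) x t * q x))"
        by (intro Bochner_Integration.integrable_diff integrable_mult_right i1 i2)
      then show "integrable lborel (\<lambda>x. \<bar>(Phi F x (t + h) - Phi F x t - h * Phi (dS F) x t) * q x\<bar>)"
        by (intro integrable_abs) (simp add: left_diff_distrib mult.assoc)
      show "integrable lborel (\<lambda>x. C * h\<^sup>2 * \<bar>q x\<bar>)" using q by (intro integrable_mult_right integrable_abs)
      show "\<bar>(Phi F x (t + h) - Phi F x t - h * Phi (dS F) x t) * q x\<bar> \<le> C * h\<^sup>2 * \<bar>q x\<bar>" for x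
        unfolding abs_mult using C[of x 0 t h] by (intro mult_right_mono) auto
    qed
    with integral_abs_bound have "\<bar>\<integral>x. (Phi F x (t + h) - Phi F x t - h * Phi (dS F) x t) * q x \<partial>lborel\<bar> \<le> (\<integral>x. C * h\<^sup>2 * \<bar>q x\<bar> \<partial>lborel)"
      by (rule order_trans)
    then show "\<bar>(\<integral>x. Phi F x (t + h) * q x \<partial>lborel) - (\<integral>x. Phi F x t * q x \<partial>lborel) - (\<integral>x. Phi (dS F) x t * q x \<partial>lborel) * h\<bar>
      \<le> C * (\<integral>x. \<bar>q x\<bar> \<partial>lborel) * (norm h)\<^sup>2"
      unfolding eq by (simp add: mult_ac)
  qed (rule bounded_linear_mult_right)
qed

definition Phi_grad :: "(real \<times> 'a::euclidean_space \<Rightarrow> real) \<Rightarrow> 'a \<Rightarrow> real \<Rightarrow> 'a" where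
  "Phi_grad F x t = (\<Sum>i\<in>Basis. Phi (mW i F) x t *\<^sub>R i)"

lemma Phi_grad_inner: "i \<in> Basis \<Longrightarrow> Phi_grad F x t \<bullet> i = Phi (mW i F) x t"
  by (simp add: Phi_grad_def)

lemma norm_Phi_grad_le: "norm (Phi_grad F x t) \<le> (\<Sum>i\<in>Basis. \<bar>Phi (mW i F) x t\<bar>)"
  using norm_le_l1[of "Phi_grad F x t"] by (simp add: Phi_grad_inner)

lemma Phi_grad_borel_measurable:
  "profile R F \<Longrightarrow> (\<lambda>x. Phi_grad F x t) \<in> borel_measurable borel"
  unfolding Phi_grad_def
  by (intro borel_measurable_sum borel_measurable_scaleR borel_measurable_const Phi_borel_measurable profile_mW)

lemma Phi_mW_funpow: "profile R F \<Longrightarrow> Phi (mW i ((dS ^^ j) F)) x t = Phi ((dS ^^ j) (mW i F)) x t"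
  by (rule Phi_cong) (simp add: funpow_dS_mW)

text \<open>The numbers of derivatives meet the integrability thresholds: \<open>m\<close> of them
  give decay \<open>|x|^-(m + 1)\<close>, and \<open>(m + 1) p > d\<close> for
  \<open>p = 2 d / (d - 2)\<close>; \<open>Suc m\<close> of them give \<open>|x|^-(m + 2)\<close>,
  and \<open>2 (m + 2) = d + 1 > d\<close>.\<close>

theorem plane_waves_wave_solution:
  fixes F :: "real \<times> 'a::euclidean_space \<Rightarrow> real"
  assumes dim: "DIM('a) = 2 * m + 3" and R: "R > 0" and F: "profile R F"
  shows "wave_solution (\<lambda>t x. Phi ((dS ^^ m) F) x t) (\<lambda>t x. Phi_grad ((dS ^^ Suc m) F) x t)
    (\<lambda>t x. Phi ((dS ^^ Suc m) F) x t)"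
proof -
  let ?U = "(dS ^^ m) F" and ?V = "(dS ^^ Suc m) F"
  have U: "profile R ?U" and V: "profile R ?V" by (rule profile_funpow_dS[OF F])+
  have dU: "dS ?U = ?V" by simp
  have decay: "\<exists>C\<ge>0. \<forall>x. \<bar>Phi ((dS ^^ j) H) x t\<bar> \<le> C / (1 + norm x) ^ Suc j" if "profile R H" for j t and H :: "real \<times> 'a \<Rightarrow> real"
  proof -
    have "\<bar>t\<bar> \<ge> 0" by simp
    from Phi_decay_power[OF dim R that this, of j] show ?thesis by blast
  qed
  have "mem_Lp (2 * real DIM('a) / (real DIM('a) - 2)) lborel (\<lambda>x. Phi ?U x t)" for t
  proof -
    obtain C where C: "C \<ge> 0" "\<And>x. \<bar>Phi ?U x t\<bar> \<le> C / (1 + norm x) ^ Suc m"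
      using decay[OF F, of m t] by blast
    show ?thesis
    proof (rule mem_Lp_decay[OF Phi_borel_measurable[OF U] _ C(1)])
      show "norm (Phi ?U x t) \<le> C / (1 + norm x) ^ Suc m" for x using C(2)[of x] by (simp only: real_norm_def)
    qed (simp_all add: dim field_simps)
  qed
  moreover have "mem_Lp 2 lborel (\<lambda>x. Phi_grad ?V x t)" for t
  proof -
    have "\<forall>i. \<exists>C\<ge>0. \<forall>x. \<bar>Phi (mW i ?V) x t\<bar> \<le> C / (1 + norm x) ^ Suc (Suc m)"
      unfolding Phi_mW_funpow[OF F] using decay[OF profile_mW[OF F]] by blast
    then obtain C where C: "\<And>i. C i \<ge> 0" "\<And>i x. \<bar>Phi (mW i ?V) x t\<bar> \<le> C i / (1 + norm x) ^ Suc (Suc m)"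
      by metis
    show ?thesis
    proof (rule mem_Lp_decay[OF Phi_grad_borel_measurable[OF V], where C="\<Sum>i\<in>Basis. C i" and n="Suc (Suc m)"])
      show "norm (Phi_grad ?V x t) \<le> (\<Sum>i\<in>Basis. C i) / (1 + norm x) ^ Suc (Suc m)" for x
        unfolding sum_divide_distrib by (rule order_trans[OF norm_Phi_grad_le sum_mono[OF C(2)]])
    qed (use C(1) dim in \<open>auto intro: sum_nonneg\<close>)
  qed
  moreover have "mem_Lp 2 lborel (\<lambda>x. Phi ?V x t)" for t
  proof -
    obtain C where C: "C \<ge> 0" "\<And>x. \<bar>Phi ?V x t\<bar> \<le> C / (1 + norm x) ^ Suc (Suc m)"
      using decay[OF F, of "Suc m" t] by blast
    show ?thesis
    proof (rule mem_Lp_decay[OF Phi_borel_measurable[OF V] _ C(1)])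
      show "norm (Phi ?V x t) \<le> C / (1 + norm x) ^ Suc (Suc m)" for x using C(2)[of x] by (simp only: real_norm_def)
    qed (simp_all add: dim)
  qed
  moreover have "weak_gradient (\<lambda>x. Phi ?U x t) (\<lambda>x. Phi_grad ?V x t)" for t
    unfolding weak_gradient_def
    using Phi_integration_by_parts[OF U] by (simp add: Phi_grad_inner)
  moreover have "((\<lambda>s. \<integral>x. (norm (Phi_grad ?V x s - Phi_grad ?V x t))\<^sup>2 \<partial>lborel) \<longlongrightarrow> 0) (at t)" for t
  proof -
    have eq: "(norm (Phi_grad ?V x s - Phi_grad ?V x t))\<^sup>2 =
      (\<Sum>i\<in>Basis. (Phi ((dS ^^ Suc m) (mW i F)) x s - Phi ((dS ^^ Suc m) (mW i F)) x t)\<^sup>2)" for x s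
      unfolding power2_norm_eq_inner euclidean_inner[of "_ - _" "_ - _"]
      by (intro sum.cong refl) (simp only: inner_diff_left Phi_grad_inner Phi_mW_funpow[OF F] power2_eq_square)
    have "(\<integral>x. (norm (Phi_grad ?V x s - Phi_grad ?V x t))\<^sup>2 \<partial>lborel) =
      (\<Sum>i\<in>Basis. \<integral>x. (Phi ((dS ^^ Suc m) (mW i F)) x s - Phi ((dS ^^ Suc m) (mW i F)) x t)\<^sup>2 \<partial>lborel)" for s
      unfolding eq by (rule Bochner_Integration.integral_sum) (rule Phi_L2_continuous(2)[OF dim R profile_mW[OF F]])
    moreover have "((\<lambda>s. \<Sum>i\<in>Basis. \<integral>x. (Phi ((dS ^^ Suc m) (mW i F)) x s - Phi ((dS ^^ Suc m) (mW i F)) x t)\<^sup>2 \<partial>lborel)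
        \<longlongrightarrow> (\<Sum>i\<in>(Basis::'a set). 0)) (at t)"
      by (intro tendsto_sum Phi_L2_continuous(1)[OF dim R profile_mW[OF F]])
    ultimately show ?thesis by simp
  qed
  moreover have "((\<lambda>s. \<integral>x. (Phi ?V x s - Phi ?V x t)\<^sup>2 \<partial>lborel) \<longlongrightarrow> 0) (at t)" for t
    by (rule Phi_L2_continuous(1)[OF dim R F])
  moreover have "((\<lambda>s. \<integral>x. Phi ?U x s * \<phi> x \<partial>lborel) has_real_derivative (\<integral>x. Phi ?V x t * \<phi> x \<partial>lborel)) (at t)"
    if "test_function \<phi>" for \<phi> t
    using Phi_pairing_derivative[OF U test_function_integrable[OF that]] by simp
  moreover have "((\<lambda>s. \<integral>x. Phi ?V x s * \<phi> x \<partial>lborel) has_real_derivative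
      - (\<integral>x. frechet_derivative \<phi> (at x) (Phi_grad ?V x t) \<partial>lborel)) (at t)"
    if \<phi>: "test_function \<phi>" for \<phi> t
  proof -
    \<comment> \<open>Integration by parts moves the derivative from \<open>\<phi>\<close> back onto
      the wave; the sum over the double multiplications by \<open>\<omega> \<bullet> i\<close> then
      collapses to \<open>dS ?V\<close>, the time derivative.\<close>
    have W: "profile R (mW i ?V)" and WW: "profile R (mW i (mW i (dS ?V)))" for i
      by (intro profile_mW profile_dS V)+
    have "frechet_derivative \<phi> (at x) (Phi_grad ?V x t) = (\<Sum>i\<in>Basis. Phi (mW i ?V) x t * frechet_derivative \<phi> (at x) i)" for x
      using frechet_derivative_Basis[OF differentiableI[OF test_function_derivative[OF \<phi>]], of x "Phi_grad ?V x t"]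
      by (simp add: Phi_grad_inner)
    then have "(\<integral>x. frechet_derivative \<phi> (at x) (Phi_grad ?V x t) \<partial>lborel) =
        (\<integral>x. (\<Sum>i\<in>Basis. Phi (mW i ?V) x t * frechet_derivative \<phi> (at x) i) \<partial>lborel)" by simp
    also have "\<dots> = (\<Sum>i\<in>Basis. \<integral>x. Phi (mW i ?V) x t * frechet_derivative \<phi> (at x) i \<partial>lborel)"
      by (intro Bochner_Integration.integral_sum Phi_mult_integrable[OF W] test_function_integrable
        test_function_frechet_derivative \<phi>)
    also have "\<dots> = (\<Sum>i\<in>Basis. - (\<integral>x. Phi (mW i (mW i (dS ?V))) x t * \<phi> x \<partial>lborel))"
    proof (intro sum.cong refl)
      fix i :: 'a assume i: "i \<in> Basis"
      have "Phi (mW i (dS (mW i ?V))) x t = Phi (mW i (mW i (dS ?V))) x t" for x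
      proof (rule Phi_cong)
        show "mW i (dS (mW i ?V)) p = mW i (mW i (dS ?V)) p" if "p \<in> cyl" for p
          unfolding mW_def[of i "dS (mW i ?V)"] mW_def[of i "mW i (dS ?V)"] dS_mW[OF V that] ..
      qed
      then show "(\<integral>x. Phi (mW i ?V) x t * frechet_derivative \<phi> (at x) i \<partial>lborel) =
          - (\<integral>x. Phi (mW i (mW i (dS ?V))) x t * \<phi> x \<partial>lborel)"
        using Phi_integration_by_parts[OF W \<phi> i, of i t] by simp
    qed
    also have "\<dots> = - (\<integral>x. (\<Sum>i\<in>Basis. Phi (mW i (mW i (dS ?V))) x t * \<phi> x) \<partial>lborel)"
      using Bochner_Integration.integral_sum[of Basis lborel "\<lambda>i x. Phi (mW i (mW i (dS ?V))) x t * \<phi> x"]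
        Phi_mult_integrable[OF WW test_function_integrable[OF \<phi>]] by (simp add: sum_negf)
    also have "\<dots> = - (\<integral>x. Phi (dS ?V) x t * \<phi> x \<partial>lborel)"
      using Phi_mW_square_sum[OF profile_dS[OF V]] by (simp add: sum_distrib_right[symmetric])
    finally show ?thesis
      using Phi_pairing_derivative[OF V test_function_integrable[OF \<phi>], of t] by simp
  qed
  ultimately show ?thesis unfolding wave_solution_def H1dot_grad_def by blast
qed

text \<open>Envelope for the pointwise error of the rescaled wave as a function of
  \<open>\<sigma> = r + t\<close>, the signed distance to the cone \<open>|x| = - t\<close>: nothing
  inside, uniformly small near the cone, a square integrable tail outside.\<close>

definition cone_error :: "real \<Rightarrow> real \<Rightarrow> real \<Rightarrow> real \<Rightarrow> real \<Rightarrow> real" where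
  "cone_error R B e C \<sigma> = (if \<sigma> < - R then 0 else if \<sigma> \<le> B then e else C / \<sigma>)"

lemma cone_error_mono:
  "e \<le> e' \<Longrightarrow> C \<le> C' \<Longrightarrow> 0 \<le> B \<Longrightarrow> cone_error R B e C \<sigma> \<le> cone_error R B e' C' \<sigma>"
  by (auto simp: cone_error_def divide_right_mono)

lemma cone_error_borel_measurable [measurable]: "cone_error R B e C \<in> borel_measurable borel"
  unfolding cone_error_def[abs_def] by measurable

text \<open>The order of quantifiers matters. \<open>C\<close> comes from \<open>Phi_decay\<close>
  with \<open>j = Suc m\<close>, where the rate is \<open>1 / (|x| - |t|)\<close>, and is fixed
  before \<open>B\<close> and \<open>e\<close>; so \<open>B\<close> can later be chosen in terms of
  \<open>C\<close>, \<open>e\<close> in terms of \<open>B\<close>, and only then the time.\<close>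

lemma Phi_radiation:
  fixes F :: "real \<times> 'a::euclidean_space \<Rightarrow> real"
  assumes dim: "DIM('a) = 2 * m + 3" and R: "R > 0" and F: "profile R F"
  shows "\<exists>C\<ge>0. \<forall>B\<ge>2 * R. \<forall>e>0. \<exists>T. \<forall>t\<le>- T. \<forall>\<theta> r. norm \<theta> = 1 \<longrightarrow> r > 0 \<longrightarrow>
    \<bar>r ^ Suc m * (Phi ((dS ^^ Suc m) F) (r *\<^sub>R \<theta>) t / (2 * pi) ^ Suc m) - F (r + t, \<theta>)\<bar> \<le> cone_error R B e C (r + t)"
proof -
  let ?H = "(dS ^^ Suc m) F" and ?c = "(2 * pi) ^ Suc m"
  have H: "profile R ?H" by (rule profile_funpow_dS[OF F])
  have c: "?c > 0" by simp
  obtain C0 where C0: "C0 \<ge> 0" "\<And>x t. norm x - \<bar>t\<bar> \<ge> 2 * R \<Longrightarrow>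
      norm x ^ Suc m * ((norm x - \<bar>t\<bar>) ^ Suc m * \<bar>Phi ?H x t\<bar>) \<le> C0 * (norm x - \<bar>t\<bar>) ^ m"
    using Phi_decay[OF dim R F, of "Suc m"] by blast
  have "\<exists>T. \<forall>t\<le>- T. \<forall>\<theta> r. norm \<theta> = 1 \<longrightarrow> r > 0 \<longrightarrow>
      \<bar>r ^ Suc m * (Phi ?H (r *\<^sub>R \<theta>) t / ?c) - F (r + t, \<theta>)\<bar> \<le> cone_error R B e (C0 / ?c) (r + t)"
    if B: "B \<ge> 2 * R" and e: "e > 0" for B e
  proof -
    have "e * ?c > 0" "B \<ge> 0" using e c B R by auto
    from Phi_near_cone[OF dim R F this(2,1)]
    obtain T0 where T0: "\<And>\<theta> r t. t \<le> - T0 \<Longrightarrow> norm \<theta> = 1 \<Longrightarrow> r > 0 \<Longrightarrow> - R \<le> r + t \<Longrightarrow> r + t \<le> B \<Longrightarrow>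
        \<bar>r ^ Suc m * Phi ?H (r *\<^sub>R \<theta>) t - ?c * F (r + t, \<theta>)\<bar> \<le> e * ?c"
      by blast
    have "\<bar>r ^ Suc m * (Phi ?H (r *\<^sub>R \<theta>) t / ?c) - F (r + t, \<theta>)\<bar> \<le> cone_error R B e (C0 / ?c) (r + t)"
      if t: "t \<le> - max T0 0" and \<theta>: "norm \<theta> = 1" and r: "r > 0" for t \<theta> r
    proof -
      have \<theta>0: "\<theta> \<noteq> 0" using \<theta> by auto
      have n: "norm (r *\<^sub>R \<theta>) = r" using \<theta> r by simp
      consider "r + t < - R" | "- R \<le> r + t" "r + t \<le> B" | "r + t > B" by linarith
      then show ?thesis
      proof cases
        case 1
        have "Phi ?H (r *\<^sub>R \<theta>) t = 0"
          by (rule Phi_eq_0_inside[OF H]) (unfold n, use 1 r in linarith)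
        moreover have "F (r + t, \<theta>) = 0" by (rule profile_support[OF F \<theta>0]) (use 1 in linarith)
        ultimately show ?thesis using 1 by (simp add: cone_error_def)
      next
        case 2
        have "r ^ Suc m * (Phi ?H (r *\<^sub>R \<theta>) t / ?c) - F (r + t, \<theta>) =
            (r ^ Suc m * Phi ?H (r *\<^sub>R \<theta>) t - ?c * F (r + t, \<theta>)) / ?c"
          using c by (simp add: diff_divide_distrib)
        also have "\<bar>\<dots>\<bar> \<le> e * ?c / ?c"
          unfolding abs_divide using T0[of t \<theta> r] t \<theta> r 2 c by (intro divide_mono) auto
        finally show ?thesis using 2 c by (simp add: cone_error_def)
      next
        case 3
        define P where "P = \<bar>Phi ?H (r *\<^sub>R \<theta>) t\<bar>"
        have s: "r - \<bar>t\<bar> = r + t" "r + t \<ge> 2 * R" "r + t > 0" using t 3 B R by auto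
        have "r ^ Suc m * ((r + t) ^ Suc m * P) \<le> C0 * (r + t) ^ m"
          using C0(2)[of "r *\<^sub>R \<theta>" t] unfolding n s(1) P_def using s(2) by blast
        then have "(r + t) ^ m * ((r + t) * (r ^ Suc m * P)) \<le> (r + t) ^ m * C0"
          by (simp add: mult_ac)
        then have "(r + t) * (r ^ Suc m * P) \<le> C0" using s(3) by (simp add: mult_le_cancel_left)
        then have "r ^ Suc m * P \<le> C0 / (r + t)" using s(3) by (simp add: field_simps)
        then have "r ^ Suc m * P / ?c \<le> C0 / (r + t) / ?c" using c by (intro divide_right_mono) auto
        moreover have "F (r + t, \<theta>) = 0" by (rule profile_support[OF F \<theta>0]) (use s R in auto)
        ultimately show ?thesis using 3 R B r
          by (simp add: cone_error_def P_def abs_mult mult.commute)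
      qed
    qed
    then show ?thesis by blast
  qed
  moreover have "C0 / ?c \<ge> 0" using C0(1) c by simp
  ultimately show ?thesis by blast
qed

text \<open>Common constants are needed for the finitely many profiles \<open>F\<close> and
  \<open>mW i F\<close>, which govern the time derivative and the components of the
  gradient.\<close>

lemma Phi_radiation_finite:
  fixes \<H> :: "(real \<times> 'a::euclidean_space \<Rightarrow> real) set"
  assumes dim: "DIM('a) = 2 * m + 3" and R: "R > 0" and "finite \<H>" and "\<And>F. F \<in> \<H> \<Longrightarrow> profile R F"
  shows "\<exists>C\<ge>0. \<forall>B\<ge>2 * R. \<forall>e>0. \<exists>T. \<forall>F\<in>\<H>. \<forall>t\<le>- T. \<forall>\<theta> r. norm \<theta> = 1 \<longrightarrow> r > 0 \<longrightarrow>
    \<bar>r ^ Suc m * (Phi ((dS ^^ Suc m) F) (r *\<^sub>R \<theta>) t / (2 * pi) ^ Suc m) - F (r + t, \<theta>)\<bar> \<le> cone_error R B e C (r + t)"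
  using assms(3,4)
proof (induction \<H>)
  case empty
  then show ?case by auto
next
  case (insert F \<H>)
  let ?E = "\<lambda>F t \<theta> r. \<bar>r ^ Suc m * (Phi ((dS ^^ Suc m) F) (r *\<^sub>R \<theta>) t / (2 * pi) ^ Suc m) - F (r + t, \<theta>)\<bar>"
  obtain C1 where C1: "C1 \<ge> 0" "\<And>B e. B \<ge> 2 * R \<Longrightarrow> e > 0 \<Longrightarrow> \<exists>T. \<forall>F\<in>\<H>. \<forall>t\<le>- T. \<forall>\<theta> r.
      norm \<theta> = 1 \<longrightarrow> r > 0 \<longrightarrow> ?E F t \<theta> r \<le> cone_error R B e C1 (r + t)"
    using insert.IH insert.prems by blast
  obtain C2 where C2: "C2 \<ge> 0" "\<And>B e. B \<ge> 2 * R \<Longrightarrow> e > 0 \<Longrightarrow> \<exists>T. \<forall>t\<le>- T. \<forall>\<theta> r.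
      norm \<theta> = 1 \<longrightarrow> r > 0 \<longrightarrow> ?E F t \<theta> r \<le> cone_error R B e C2 (r + t)"
    using Phi_radiation[OF dim R insert.prems[of F]] by blast
  have "\<exists>T. \<forall>F\<in>insert F \<H>. \<forall>t\<le>- T. \<forall>\<theta> r. norm \<theta> = 1 \<longrightarrow> r > 0 \<longrightarrow>
      ?E F t \<theta> r \<le> cone_error R B e (max C1 C2) (r + t)" if B: "B \<ge> 2 * R" and e: "e > 0" for B e
  proof -
    obtain T1 where T1: "\<And>F t \<theta> r. F \<in> \<H> \<Longrightarrow> t \<le> - T1 \<Longrightarrow> norm \<theta> = 1 \<Longrightarrow> r > 0 \<Longrightarrow> ?E F t \<theta> r \<le> cone_error R B e C1 (r + t)"
      using C1(2)[OF B e] by blast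
    obtain T2 where T2: "\<And>t \<theta> r. t \<le> - T2 \<Longrightarrow> norm \<theta> = 1 \<Longrightarrow> r > 0 \<Longrightarrow> ?E F t \<theta> r \<le> cone_error R B e C2 (r + t)"
      using C2(2)[OF B e] by blast
    have m1: "cone_error R B e C1 s \<le> cone_error R B e (max C1 C2) s"
      and m2: "cone_error R B e C2 s \<le> cone_error R B e (max C1 C2) s" for s
      using B R by (auto intro!: cone_error_mono)
    show ?thesis
    proof (intro exI[of _ "max T1 T2"] ballI allI impI)
      fix F' t \<theta> and r :: real assume a: "F' \<in> insert F \<H>" "t \<le> - max T1 T2" "norm (\<theta>::'a) = 1" "r > 0"
      then have t: "t \<le> - T1" "t \<le> - T2" by auto
      show "?E F' t \<theta> r \<le> cone_error R B e (max C1 C2) (r + t)"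
      proof (cases "F' = F")
        case True
        show ?thesis unfolding True by (rule order_trans[OF T2[OF t(2) a(3,4)] m2])
      next
        case False
        then have "F' \<in> \<H>" using a(1) by simp
        from order_trans[OF T1[OF this t(1) a(3,4)] m1] show ?thesis .
      qed
    qed
  qed
  moreover have "max C1 C2 \<ge> 0" using C1(1) by simp
  ultimately show ?case by blast
qed

section \<open>Convergence to the radiation profile\<close>

definition radiation_defect ::
  "('a::euclidean_space \<Rightarrow> real) \<Rightarrow> ('a \<Rightarrow> 'a) \<Rightarrow> (real \<times> 'a \<Rightarrow> real) \<Rightarrow> real \<Rightarrow> ennreal" where
  "radiation_defect v g G t = (\<integral>\<^sup>+ r\<in>{0<..}. (\<integral>\<^sup>+ \<theta>. ennreal (
     \<bar>r powr ((real DIM('a) - 1) / 2) * v (r *\<^sub>R \<theta>) - G (r + t, \<theta>)\<bar>\<^sup>2 +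
     \<bar>r powr ((real DIM('a) - 1) / 2) * (\<theta> \<bullet> g (r *\<^sub>R \<theta>)) - G (r + t, \<theta>)\<bar>\<^sup>2)
     \<partial>sphere_measure) \<partial>lborel)"

lemma powr_half_dim:
  assumes "DIM('a::euclidean_space) = 2 * m + 3" "r > 0"
  shows "r powr ((real DIM('a) - 1) / 2) = r ^ Suc m"
proof -
  have "(real DIM('a) - 1) / 2 = real (Suc m)" using assms(1) by simp
  then show ?thesis using assms(2) by (simp only: powr_realpow)
qed

lemma radiation_defect_cong:
  assumes "\<And>s \<theta>. norm \<theta> = 1 \<Longrightarrow> G (s, \<theta>) = F (s, \<theta>)"
  shows "radiation_defect v g G t = radiation_defect v g F t"
  unfolding radiation_defect_def
  by (intro nn_integral_cong arg_cong2[where f="(*)"] refl) (use assms in simp)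

lemma nn_integral_cone_error:
  assumes R: "R > 0" and B: "B > 0" and e: "e \<ge> 0" and C: "C \<ge> 0"
  shows "(\<integral>\<^sup>+\<sigma>. ennreal ((cone_error R B e C \<sigma>)\<^sup>2) \<partial>lborel) \<le> ennreal (e\<^sup>2 * (B + R) + C\<^sup>2 / B)"
proof -
  have tail: "(\<integral>\<^sup>+\<sigma>. ennreal (C\<^sup>2 / \<sigma>\<^sup>2) * indicator {B..} \<sigma> \<partial>lborel) = ennreal (0 - (- (C\<^sup>2) / B))"
  proof (rule nn_integral_FTC_atLeast[where F="\<lambda>\<sigma>. - (C\<^sup>2) / \<sigma>"])
    show "((\<lambda>\<sigma>. - (C\<^sup>2) / \<sigma>) has_real_derivative C\<^sup>2 / \<sigma>\<^sup>2) (at \<sigma>)" if "B \<le> \<sigma>" for \<sigma>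
      using that B by (auto intro!: derivative_eq_intros simp: power2_eq_square)
    show "((\<lambda>\<sigma>. - (C\<^sup>2) / \<sigma>) \<longlongrightarrow> 0) at_top"
      by (intro tendsto_divide_0[OF tendsto_const] filterlim_at_top_imp_at_infinity filterlim_ident)
  qed simp_all
  have "(\<integral>\<^sup>+\<sigma>. ennreal ((cone_error R B e C \<sigma>)\<^sup>2) \<partial>lborel) \<le>
      (\<integral>\<^sup>+\<sigma>. ennreal (e\<^sup>2) * indicator {-R..B} \<sigma> + ennreal (C\<^sup>2 / \<sigma>\<^sup>2) * indicator {B..} \<sigma> \<partial>lborel)"
    by (rule nn_integral_mono) (auto simp: cone_error_def indicator_def power_divide)
  also have "\<dots> = (\<integral>\<^sup>+\<sigma>. ennreal (e\<^sup>2) * indicator {-R..B} \<sigma> \<partial>lborel) + ennreal (0 - (- (C\<^sup>2) / B))"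
    by (subst nn_integral_add) (simp_all only: tail, measurable)
  also have "(\<integral>\<^sup>+\<sigma>. ennreal (e\<^sup>2) * indicator {-R..B} \<sigma> \<partial>lborel) = ennreal (e\<^sup>2) * ennreal (B + R)"
    using R B by (subst nn_integral_cmult_indicator) auto
  finally show ?thesis
    using R B e C by (simp add: ennreal_mult[symmetric] ennreal_plus[symmetric] del: ennreal_plus)
qed

lemma tendsto_0_ennreal_iff_le:
  assumes "\<And>e. e > 0 \<Longrightarrow> \<forall>\<^sub>F x in A. f x \<le> ennreal e"
  shows "(f \<longlongrightarrow> 0) A"
proof (rule order_tendstoI)
  fix y :: ennreal assume "0 < y"
  then obtain z where z: "0 < z" "z < y" using dense by blast
  then obtain e where e: "z = ennreal e" "e \<ge> 0" by (cases z) auto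
  with z(1) have "e > 0" by (simp add: less_le)
  from assms[OF this] show "\<forall>\<^sub>F x in A. f x < y"
    by (rule eventually_mono) (use z e in auto)
qed simp

text \<open>The gradient component along \<open>i\<close> has the rescaled limit
  \<open>(\<theta> \<bullet> i) F\<close>; contracting with \<open>\<theta>\<close> returns
  \<open>F\<close> because \<open>\<theta> \<bullet> \<theta> = 1\<close>. So the radial and the
  time derivative share the limit.\<close>

theorem plane_waves_radiation:
  fixes F :: "real \<times> 'a::euclidean_space \<Rightarrow> real"
  assumes dim: "DIM('a) = 2 * m + 3" and R: "R > 0" and F: "profile R F"
  shows "((\<lambda>t. radiation_defect (\<lambda>x. Phi ((dS ^^ Suc m) F) x t / (2 * pi) ^ Suc m)
     (\<lambda>x. Phi_grad ((dS ^^ Suc m) F) x t /\<^sub>R (2 * pi) ^ Suc m) F t) \<longlongrightarrow> 0) at_bot"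
proof (rule tendsto_0_ennreal_iff_le)
  let ?c = "(2 * pi) ^ Suc m" and ?V = "(dS ^^ Suc m) F"
  let ?E = "\<lambda>F t \<theta> r. \<bar>r ^ Suc m * (Phi ((dS ^^ Suc m) F) (r *\<^sub>R \<theta>) t / ?c) - F (r + t, \<theta>)\<bar>"
  fix \<epsilon> :: real assume \<epsilon>: "\<epsilon> > 0"
  define \<H> where "\<H> = insert F ((\<lambda>i. mW i F) ` Basis)"
  have "finite \<H>" "\<And>H. H \<in> \<H> \<Longrightarrow> profile R H" using F profile_mW by (auto simp: \<H>_def)
  from Phi_radiation_finite[OF dim R this]
  obtain C where C: "C \<ge> 0" "\<And>B e. B \<ge> 2 * R \<Longrightarrow> e > 0 \<Longrightarrow> \<exists>T. \<forall>F\<in>\<H>. \<forall>t\<le>- T. \<forall>\<theta> r.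
      norm \<theta> = 1 \<longrightarrow> r > 0 \<longrightarrow> ?E F t \<theta> r \<le> cone_error R B e C (r + t)"
    by blast
  define d where "d = real DIM('a)"
  \<comment> \<open>\<open>1 + d^2\<close> collects the squared errors: at most \<open>E\<close> for
    the time derivative and at most \<open>d E\<close> for the radial one, a sum over
    \<open>d\<close> components.\<close>
  define K where "K = (1 + d\<^sup>2) * measure (sphere_measure :: 'a measure) (sphere 0 1)"
  have K: "K \<ge> 0" by (simp add: K_def)
  \<comment> \<open>\<open>B\<close> makes the tail of the error at most
    \<open>\<epsilon> / 2\<close>; \<open>e\<close> is chosen afterwards because the strip near the
    cone has length \<open>B + R\<close>.\<close>
  define B where "B = 2 * R + 2 * K * C\<^sup>2 / \<epsilon>"
  have B: "B \<ge> 2 * R" "B > 0" "K * (C\<^sup>2 / B) \<le> \<epsilon> / 2"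
  proof -
    show "B \<ge> 2 * R" using K \<epsilon> by (simp add: B_def)
    then show B0: "B > 0" using R by linarith
    have "2 * K * C\<^sup>2 / \<epsilon> \<le> B" using R by (simp add: B_def)
    then show "K * (C\<^sup>2 / B) \<le> \<epsilon> / 2" using B0 \<epsilon> by (simp add: field_simps)
  qed
  define e where "e = sqrt (\<epsilon> / (2 * (K + 1) * (B + R)))"
  have e: "e > 0" "K * (e\<^sup>2 * (B + R)) \<le> \<epsilon> / 2"
  proof -
    have p: "\<epsilon> / (2 * (K + 1) * (B + R)) > 0" using \<epsilon> K B R by (simp add: add_pos_pos)
    then show "e > 0" by (simp add: e_def)
    have cancel: "\<epsilon> / (X * Y) * Y = \<epsilon> / X" if "Y \<noteq> 0" for X Y :: real using that by simp
    have "e\<^sup>2 = \<epsilon> / (2 * (K + 1) * (B + R))" using p by (simp only: e_def real_sqrt_pow2 less_imp_le)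
    then have "e\<^sup>2 * (B + R) = \<epsilon> / (2 * (K + 1))" using B R by (simp only:) (rule cancel, linarith)
    then have "K * (e\<^sup>2 * (B + R)) = K / (K + 1) * (\<epsilon> / 2)" by simp
    also have "\<dots> \<le> 1 * (\<epsilon> / 2)" using K \<epsilon> by (intro mult_right_mono) auto
    finally show "K * (e\<^sup>2 * (B + R)) \<le> \<epsilon> / 2" by simp
  qed
  obtain T where T: "\<And>F t \<theta> r. F \<in> \<H> \<Longrightarrow> t \<le> - T \<Longrightarrow> norm \<theta> = 1 \<Longrightarrow> r > 0 \<Longrightarrow> ?E F t \<theta> r \<le> cone_error R B e C (r + t)"
    using C(2)[OF B(1) e(1)] by blast
  have "radiation_defect (\<lambda>x. Phi ?V x t / ?c) (\<lambda>x. Phi_grad ?V x t /\<^sub>R ?c) F t \<le> ennreal \<epsilon>" if t: "t \<le> - T" for t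
  proof -
    let ?S = "sphere_measure :: 'a measure"
    have point: "\<bar>r ^ Suc m * (Phi ?V (r *\<^sub>R \<theta>) t / ?c) - F (r + t, \<theta>)\<bar>\<^sup>2 +
        \<bar>r ^ Suc m * (\<theta> \<bullet> (Phi_grad ?V (r *\<^sub>R \<theta>) t /\<^sub>R ?c)) - F (r + t, \<theta>)\<bar>\<^sup>2
        \<le> (1 + d\<^sup>2) * (cone_error R B e C (r + t))\<^sup>2" if r: "r > 0" and \<theta>: "norm \<theta> = 1" for r \<theta>
    proof -
      define E where "E = cone_error R B e C (r + t)"
      have 1: "\<bar>r ^ Suc m * (Phi ?V (r *\<^sub>R \<theta>) t / ?c) - F (r + t, \<theta>)\<bar> \<le> E"
        unfolding E_def by (rule T[OF _ t \<theta> r]) (simp add: \<H>_def)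
      have 2: "\<bar>r ^ Suc m * (Phi (mW i ?V) (r *\<^sub>R \<theta>) t / ?c) - (\<theta> \<bullet> i) * F (r + t, \<theta>)\<bar> \<le> E" if "i \<in> Basis" for i
        unfolding E_def Phi_mW_funpow[OF F] using T[OF _ t \<theta> r, of "mW i F"] that \<theta> by (simp add: \<H>_def mW_def)
      have "r ^ Suc m * (\<theta> \<bullet> (Phi_grad ?V (r *\<^sub>R \<theta>) t /\<^sub>R ?c)) - F (r + t, \<theta>) =
          (\<Sum>i\<in>Basis. (\<theta> \<bullet> i) * (r ^ Suc m * (Phi (mW i ?V) (r *\<^sub>R \<theta>) t / ?c) - (\<theta> \<bullet> i) * F (r + t, \<theta>)))"
      proof -
        have "(\<Sum>i\<in>Basis. (\<theta> \<bullet> i) * ((\<theta> \<bullet> i) * F (r + t, \<theta>))) = (\<theta> \<bullet> \<theta>) * F (r + t, \<theta>)"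
          unfolding euclidean_inner[of \<theta> \<theta>] by (simp add: sum_distrib_right mult.assoc)
        then have 3: "(\<Sum>i\<in>Basis. (\<theta> \<bullet> i) * ((\<theta> \<bullet> i) * F (r + t, \<theta>))) = F (r + t, \<theta>)"
          using \<theta> by (simp add: norm_eq_1)
        have "\<theta> \<bullet> Phi_grad ?V (r *\<^sub>R \<theta>) t = (\<Sum>i\<in>Basis. (\<theta> \<bullet> i) * Phi (mW i ?V) (r *\<^sub>R \<theta>) t)"
          unfolding euclidean_inner[of \<theta> "Phi_grad ?V (r *\<^sub>R \<theta>) t"] by (intro sum.cong refl) (simp only: Phi_grad_inner)
        then show ?thesis
          by (simp only: right_diff_distrib sum_subtractf 3)
             (simp add: sum_distrib_left divide_inverse mult_ac del: power_Suc)
      qed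
      also have "\<bar>\<dots>\<bar> \<le> (\<Sum>i\<in>(Basis::'a set). E)"
      proof (rule order_trans[OF sum_abs sum_mono])
        fix i :: 'a assume i: "i \<in> Basis"
        have "\<bar>\<theta> \<bullet> i\<bar> \<le> 1" using Basis_le_norm[OF i, of \<theta>] \<theta> by simp
        then show "\<bar>(\<theta> \<bullet> i) * (r ^ Suc m * (Phi (mW i ?V) (r *\<^sub>R \<theta>) t / ?c) - (\<theta> \<bullet> i) * F (r + t, \<theta>))\<bar> \<le> E"
          unfolding abs_mult using 2[OF i] mult_mono[of "\<bar>\<theta> \<bullet> i\<bar>" 1 _ E] by simp
      qed
      also have "\<dots> = d * E" by (simp add: d_def)
      finally have 3: "\<bar>r ^ Suc m * (\<theta> \<bullet> (Phi_grad ?V (r *\<^sub>R \<theta>) t /\<^sub>R ?c)) - F (r + t, \<theta>)\<bar> \<le> d * E" .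
      from power_mono[OF 1, of 2] power_mono[OF 3, of 2] show ?thesis
        by (simp add: E_def power_mult_distrib algebra_simps)
    qed
    have "radiation_defect (\<lambda>x. Phi ?V x t / ?c) (\<lambda>x. Phi_grad ?V x t /\<^sub>R ?c) F t \<le>
       (\<integral>\<^sup>+r. (\<integral>\<^sup>+\<theta>. ennreal ((1 + d\<^sup>2) * (cone_error R B e C (r + t))\<^sup>2) \<partial>?S) \<partial>lborel)"
      unfolding radiation_defect_def
    proof (rule nn_integral_mono)
      fix r :: real
      show "(\<integral>\<^sup>+ \<theta>. ennreal (\<bar>r powr ((real DIM('a) - 1) / 2) * (Phi ?V (r *\<^sub>R \<theta>) t / ?c) - F (r + t, \<theta>)\<bar>\<^sup>2 +
          \<bar>r powr ((real DIM('a) - 1) / 2) * (\<theta> \<bullet> (Phi_grad ?V (r *\<^sub>R \<theta>) t /\<^sub>R ?c)) - F (r + t, \<theta>)\<bar>\<^sup>2) \<partial>?S) * indicator {0<..} r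
        \<le> (\<integral>\<^sup>+\<theta>. ennreal ((1 + d\<^sup>2) * (cone_error R B e C (r + t))\<^sup>2) \<partial>?S)"
      proof (cases "r > 0")
        case True
        then have ind: "indicator {0<..} r = (1::ennreal)" by simp
        show ?thesis
          unfolding powr_half_dim[OF dim True] ind mult_1_right
          by (intro nn_integral_mono ennreal_leI point True) simp
      qed simp
    qed
    also have "\<dots> = (\<integral>\<^sup>+r. ennreal K * ennreal ((cone_error R B e C (r + t))\<^sup>2) \<partial>lborel)"
    proof (rule nn_integral_cong)
      fix r :: real
      have "emeasure ?S (sphere 0 1) = ennreal (measure ?S (sphere 0 1))"
        by (rule sphere_measure.emeasure_eq_measure)
      then show "(\<integral>\<^sup>+\<theta>. ennreal ((1 + d\<^sup>2) * (cone_error R B e C (r + t))\<^sup>2) \<partial>?S) =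
          ennreal K * ennreal ((cone_error R B e C (r + t))\<^sup>2)"
        by (simp add: K_def ennreal_mult'[symmetric] mult_ac)
    qed
    also have "\<dots> = ennreal K * (\<integral>\<^sup>+r. ennreal ((cone_error R B e C (t + 1 * r))\<^sup>2) \<partial>lborel)"
      by (subst nn_integral_cmult) (simp_all add: add.commute[of _ t])
    also have "(\<integral>\<^sup>+r. ennreal ((cone_error R B e C (t + 1 * r))\<^sup>2) \<partial>lborel) = (\<integral>\<^sup>+\<sigma>. ennreal ((cone_error R B e C \<sigma>)\<^sup>2) \<partial>lborel)"
      by (subst (2) nn_integral_real_affine[of _ 1 t]) simp_all
    also have "ennreal K * \<dots> \<le> ennreal K * ennreal (e\<^sup>2 * (B + R) + C\<^sup>2 / B)"
      using e(1) by (intro mult_left_mono nn_integral_cone_error R B C(1)) auto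
    also have "\<dots> = ennreal (K * (e\<^sup>2 * (B + R)) + K * (C\<^sup>2 / B))"
      using K by (simp add: ennreal_mult'[symmetric] distrib_left)
    also have "\<dots> \<le> ennreal \<epsilon>" using e(2) B(3) by (intro ennreal_leI) linarith
    finally show ?thesis .
  qed
  then show "\<forall>\<^sub>F t in at_bot. radiation_defect (\<lambda>x. Phi ?V x t / ?c) (\<lambda>x. Phi_grad ?V x t /\<^sub>R ?c) F t \<le> ennreal \<epsilon>"
    by (auto simp: eventually_at_bot_linorder)
qed

section \<open>Criteria for a function to vanish almost everywhere\<close>

text \<open>The positive and the negative part of \<open>z\<close> are densities of two measures
  that agree on boxes, an intersection-stable generator, and hence everywhere.\<close>

lemma AE_eq_0_if_box_integrals_eq_0:
  fixes z :: "'a::euclidean_space \<Rightarrow> real"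
  assumes [measurable]: "z \<in> borel_measurable borel"
    and int: "\<And>a b. integrable lborel (\<lambda>x. z x * indicator (box a b) x)"
    and zero: "\<And>a b. (\<integral>x. z x * indicator (box a b) x \<partial>lborel) = 0"
  shows "AE x in lborel. z x = 0"
proof -
  let ?M = "\<lambda>f::'a \<Rightarrow> real. density lborel (\<lambda>x. ennreal (f x))"
  define p where "p x = max 0 (z x)" for x
  define q where "q x = max 0 (- z x)" for x
  have [measurable]: "p \<in> borel_measurable borel" "q \<in> borel_measurable borel"
    unfolding p_def q_def by measurable
  have em: "emeasure (?M p) (box a b) = emeasure (?M q) (box a b) \<and> emeasure (?M p) (box a b) \<noteq> \<infinity>" for a b
  proof -
    have ip: "integrable lborel (\<lambda>x. p x * indicator (box a b) x)"
      by (rule Bochner_Integration.integrable_bound[OF int[of a b]]) (auto simp: p_def indicator_def)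
    have iq: "integrable lborel (\<lambda>x. q x * indicator (box a b) x)"
      by (rule Bochner_Integration.integrable_bound[OF int[of a b]]) (auto simp: q_def indicator_def)
    have "(\<integral>x. p x * indicator (box a b) x \<partial>lborel) - (\<integral>x. q x * indicator (box a b) x \<partial>lborel) =
        (\<integral>x. z x * indicator (box a b) x \<partial>lborel)"
      unfolding Bochner_Integration.integral_diff[OF ip iq, symmetric]
      by (intro Bochner_Integration.integral_cong refl) (auto simp: p_def q_def indicator_def)
    then have eq: "(\<integral>x. p x * indicator (box a b) x \<partial>lborel) = (\<integral>x. q x * indicator (box a b) x \<partial>lborel)"
      using zero[of a b] by simp
    have m: "emeasure (?M f) (box a b) = ennreal (\<integral>x. f x * indicator (box a b) x \<partial>lborel)"
      if [measurable]: "f \<in> borel_measurable borel" and i: "integrable lborel (\<lambda>x. f x * indicator (box a b) x)"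
        and nn: "\<And>x. f x \<ge> 0" for f
    proof -
      have "emeasure (?M f) (box a b) = (\<integral>\<^sup>+x. ennreal (f x * indicator (box a b) x) \<partial>lborel)"
        by (subst emeasure_density) (auto intro!: nn_integral_cong simp: indicator_def)
      also have "\<dots> = ennreal (\<integral>x. f x * indicator (box a b) x \<partial>lborel)"
        by (rule nn_integral_eq_integral[OF i]) (use nn in auto)
      finally show ?thesis .
    qed
    have pq: "p x \<ge> 0" "q x \<ge> 0" for x by (simp_all add: p_def q_def)
    show ?thesis using m[OF _ ip pq(1)] m[OF _ iq pq(2)] eq by simp
  qed
  have "?M p = ?M q"
  proof (rule measure_eqI_generator_eq)
    let ?E = "range (\<lambda>(a, b). box a b :: 'a set)"
    show "Int_stable ?E" by (auto simp: Int_stable_def box_Int_box)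
    show "?E \<subseteq> Pow UNIV" "sets (?M p) = sigma_sets UNIV ?E" "sets (?M q) = sigma_sets UNIV ?E"
      by (simp_all add: borel_eq_box)
    let ?A = "\<lambda>n::nat. box (- (real n *\<^sub>R One)) (real n *\<^sub>R One) :: 'a set"
    show "range ?A \<subseteq> ?E" "(\<Union>i. ?A i) = UNIV" unfolding UN_box_eq_UNIV by auto
    show "emeasure (?M p) (?A i) \<noteq> \<infinity>" for i using em by blast
    show "emeasure (?M p) X = emeasure (?M q) X" if "X \<in> ?E" for X using that em by auto
  qed
  then have "AE x in lborel. ennreal (p x) = ennreal (q x)"
    by (subst (asm) sigma_finite_measure.density_unique_iff[OF sigma_finite_lborel]) auto
  then show ?thesis
  proof eventually_elim
    case (elim x)
    then have "p x = q x" by (simp add: p_def q_def)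
    then show ?case by (auto simp: p_def q_def max_def split: if_splits)
  qed
qed

text \<open>An approximate identity need not be nonnegative: it suffices that its integral is nonzero.\<close>

theorem AE_eq_0_if_mollified_eq_0:
  fixes z \<psi> :: "'a::euclidean_space \<Rightarrow> real"
  assumes z[measurable]: "z \<in> borel_measurable borel"
    and loc: "\<And>\<rho>. integrable lborel (\<lambda>x. z x * indicator (ball 0 \<rho>) x)"
    and \<psi>: "continuous_on UNIV \<psi>" "\<And>x. norm x > 1 \<Longrightarrow> \<psi> x = 0"
    and nz: "(\<integral>x. \<psi> x \<partial>lborel) \<noteq> 0"
    and zero: "\<And>\<epsilon> y. 0 < \<epsilon> \<Longrightarrow> \<epsilon> \<le> 1 \<Longrightarrow> (\<integral>x. z x * \<psi> ((x - y) /\<^sub>R \<epsilon>) \<partial>lborel) = 0"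
  shows "AE x in lborel. z x = 0"
proof (rule AE_eq_0_if_box_integrals_eq_0[OF z])
  fix a b :: 'a
  have [measurable]: "\<psi> \<in> borel_measurable borel" using \<psi>(1) by (rule borel_measurable_continuous_onI)
  obtain M where M: "M \<ge> 0" "\<And>x. \<bar>\<psi> x\<bar> \<le> M" using bounded_continuous_bounded_support[OF \<psi>] by blast
  have i\<psi>: "integrable lborel \<psi>" by (rule integrable_continuous_bounded_support[OF \<psi>])
  have "bounded (box a b)" by (rule bounded_box)
  then obtain \<rho>0 where \<rho>0: "\<And>x. x \<in> box a b \<Longrightarrow> norm x \<le> \<rho>0" unfolding bounded_iff by blast
  \<comment> \<open>The margin 2 exceeds the radius of the support of the rescaled
    \<open>\<psi>\<close>, so for centres in the box \<open>z\<close> may be replaced by its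
    integrable cutoff \<open>w\<close>.\<close>
  define \<rho> where "\<rho> = \<rho>0 + 2"
  define w where "w x = z x * indicator (ball 0 \<rho>) x" for x
  have w: "integrable lborel w" unfolding w_def by (rule loc)
  have [measurable]: "w \<in> borel_measurable borel" using borel_measurable_integrable[OF w] by simp
  let ?f = "indicator (box a b) :: 'a \<Rightarrow> real"
  have "integrable lborel (\<lambda>x. w x * ?f x)"
    by (rule Bochner_Integration.integrable_bound[OF w]) (auto simp: indicator_def)
  moreover have wf: "w x * ?f x = z x * ?f x" for x
    using \<rho>0[of x] by (auto simp: w_def \<rho>_def indicator_def)
  ultimately show int: "integrable lborel (\<lambda>x. z x * ?f x)" by simp
  have fin: "emeasure lborel (box a b) < \<infinity>" by (rule emeasure_bounded_finite[OF bounded_box])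
  \<comment> \<open>Fubini exchanges the integral over the centres \<open>y\<close> in the box with
    the one over \<open>x\<close>; substituting \<open>y = x - \<epsilon> v\<close> then shifts the
    mollification from \<open>z\<close> to the indicator of the box.\<close>
  have key: "(\<integral>x. w x * (\<integral>v. ?f (x - \<epsilon> *\<^sub>R v) * \<psi> v \<partial>lborel) \<partial>lborel) = 0" if \<epsilon>: "0 < \<epsilon>" "\<epsilon> \<le> 1" for \<epsilon>
  proof -
    let ?h = "\<lambda>x y. w x * (?f y * \<psi> ((x - y) /\<^sub>R \<epsilon>))"
    have "integrable (lborel \<Otimes>\<^sub>M lborel) (case_prod ?h)"
    proof (rule lborel_pair.Fubini_integrable)
      have iy: "integrable lborel (\<lambda>y. ?h x y)" for x
      proof (rule Bochner_Integration.integrable_bound)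
        show "integrable lborel (\<lambda>y. \<bar>w x\<bar> * M * ?f y)"
          by (intro integrable_mult_right integrable_real_indicator fin) simp
        show "AE y in lborel. norm (?h x y) \<le> norm (\<bar>w x\<bar> * M * ?f y)"
          using M by (auto simp: abs_mult indicator_def intro!: mult_left_mono)
      qed measurable
      then show "AE x in lborel. integrable lborel (\<lambda>y. case_prod ?h (x, y))" by simp
      show "integrable lborel (\<lambda>x. \<integral>y. norm (case_prod ?h (x, y)) \<partial>lborel)"
      proof (rule Bochner_Integration.integrable_bound)
        show "integrable lborel (\<lambda>x. \<bar>w x\<bar> * (M * measure lborel (box a b)))"
          using w by (intro integrable_mult_left integrable_abs)
        show "AE x in lborel. norm (\<integral>y. norm (case_prod ?h (x, y)) \<partial>lborel) \<le> norm (\<bar>w x\<bar> * (M * measure lborel (box a b)))"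
        proof (rule AE_I2)
          fix x
          have "(\<integral>y. norm (?h x y) \<partial>lborel) \<le> (\<integral>y. \<bar>w x\<bar> * M * ?f y \<partial>lborel)"
          proof (rule integral_mono)
            show "integrable lborel (\<lambda>y. norm (?h x y))" using iy by (rule integrable_norm)
            show "integrable lborel (\<lambda>y. \<bar>w x\<bar> * M * ?f y)"
              by (intro integrable_mult_right integrable_real_indicator fin) simp
            show "norm (?h x y) \<le> \<bar>w x\<bar> * M * ?f y" for y
              using M by (auto simp: abs_mult indicator_def intro!: mult_left_mono)
          qed
          also have "\<dots> = \<bar>w x\<bar> * (M * measure lborel (box a b))" by (simp add: mult.assoc)
          finally show "norm (\<integral>y. norm (case_prod ?h (x, y)) \<partial>lborel) \<le> norm (\<bar>w x\<bar> * (M * measure lborel (box a b)))"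
            using M(1) by simp
        qed
      qed measurable
    qed measurable
    from lborel_pair.Fubini_integral[OF this]
    have fub: "(\<integral>y. (\<integral>x. ?h x y \<partial>lborel) \<partial>lborel) = (\<integral>x. (\<integral>y. ?h x y \<partial>lborel) \<partial>lborel)" .
    have "(\<integral>x. ?h x y \<partial>lborel) = 0" for y
    proof (cases "y \<in> box a b")
      case True
      have "(\<integral>x. ?h x y \<partial>lborel) = (\<integral>x. z x * \<psi> ((x - y) /\<^sub>R \<epsilon>) \<partial>lborel)"
      proof (intro Bochner_Integration.integral_cong refl)
        fix x
        show "?h x y = z x * \<psi> ((x - y) /\<^sub>R \<epsilon>)"
        proof (cases "norm x < \<rho>")
          case False
          then have "norm (x - y) > 1" using \<rho>0[OF True] norm_triangle_ineq2[of x y] by (simp add: \<rho>_def)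
          also have "norm (x - y) \<le> norm ((x - y) /\<^sub>R \<epsilon>)"
          proof -
            have "1 \<le> \<bar>inverse \<epsilon>\<bar>" using one_le_inverse[OF \<epsilon>] \<epsilon> by simp
            from mult_right_mono[OF this norm_ge_zero[of "x - y"]] show ?thesis by simp
          qed
          finally have "\<psi> ((x - y) /\<^sub>R \<epsilon>) = 0" by (rule \<psi>(2))
          then show ?thesis by simp
        qed (use True in \<open>simp add: w_def\<close>)
      qed
      then show ?thesis using zero[OF \<epsilon>] by simp
    qed simp
    then have h0: "(\<integral>x. (\<integral>y. ?h x y \<partial>lborel) \<partial>lborel) = 0" using fub by simp
    have hx: "(\<integral>y. ?h x y \<partial>lborel) = \<epsilon> ^ DIM('a) * (w x * (\<integral>v. ?f (x - \<epsilon> *\<^sub>R v) * \<psi> v \<partial>lborel))" for x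
    proof -
      have sub: "(\<integral>y. g y \<partial>lborel) = \<epsilon> ^ DIM('a) * (\<integral>v. g (x - \<epsilon> *\<^sub>R v) \<partial>lborel)"
        if [measurable]: "g \<in> borel_measurable borel" for g :: "'a \<Rightarrow> real"
        by (subst lborel_affine[of "- \<epsilon>" x]) (use \<epsilon> in \<open>simp_all add: integral_density integral_distr\<close>)
      have "(\<integral>y. ?f y * \<psi> ((x - y) /\<^sub>R \<epsilon>) \<partial>lborel) = \<epsilon> ^ DIM('a) * (\<integral>v. ?f (x - \<epsilon> *\<^sub>R v) * \<psi> v \<partial>lborel)"
        by (subst sub) (use \<epsilon> in simp_all)
      then show ?thesis by simp
    qed
    from h0 show ?thesis unfolding hx using \<epsilon> by simp
  qed
  define \<epsilon> where "\<epsilon> n = inverse (real (Suc n))" for n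
  have \<epsilon>: "0 < \<epsilon> n" "\<epsilon> n \<le> 1" for n by (auto simp: \<epsilon>_def field_simps)
  have \<epsilon>0: "\<epsilon> \<longlonglongrightarrow> 0" unfolding \<epsilon>_def by (rule LIMSEQ_inverse_real_of_nat)
  define L where "L n x = (\<integral>v. ?f (x - \<epsilon> n *\<^sub>R v) * \<psi> v \<partial>lborel)" for n x
  have [measurable]: "L n \<in> borel_measurable borel" for n unfolding L_def by measurable
  have Lb: "\<bar>L n x\<bar> \<le> (\<integral>v. \<bar>\<psi> v\<bar> \<partial>lborel)" for n x
  proof -
    have i: "integrable lborel (\<lambda>v. ?f (x - \<epsilon> n *\<^sub>R v) * \<psi> v)"
      by (rule Bochner_Integration.integrable_bound[OF i\<psi>]) (auto simp: indicator_def)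
    have "\<bar>L n x\<bar> \<le> (\<integral>v. \<bar>?f (x - \<epsilon> n *\<^sub>R v) * \<psi> v\<bar> \<partial>lborel)" unfolding L_def by (rule integral_abs_bound)
    also have "\<dots> \<le> (\<integral>v. \<bar>\<psi> v\<bar> \<partial>lborel)"
      by (rule integral_mono[OF integrable_abs[OF i] integrable_abs[OF i\<psi>]]) (auto simp: indicator_def)
    finally show ?thesis .
  qed
  \<comment> \<open>The mollified indicator converges at its points of continuity, that is off the
    frontier, which is a null set because the box is convex.\<close>
  have "frontier (box a b) \<in> null_sets lborel"
  proof -
    have "negligible (frontier (box a b))" by (rule negligible_convex_frontier[OF convex_box(2)])
    then show ?thesis
      by (simp add: negligible_iff_null_sets null_sets_completion_iff)
  qed
  then have front: "AE x in lborel. x \<notin> frontier (box a b)" by (rule AE_not_in)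
  have "(\<lambda>n. \<integral>x. w x * L n x \<partial>lborel) \<longlonglongrightarrow> (\<integral>x. w x * (?f x * (\<integral>v. \<psi> v \<partial>lborel)) \<partial>lborel)"
  proof (rule integral_dominated_convergence[where w="\<lambda>x. \<bar>w x\<bar> * (\<integral>v. \<bar>\<psi> v\<bar> \<partial>lborel)"])
    show "AE x in lborel. (\<lambda>n. w x * L n x) \<longlonglongrightarrow> w x * (?f x * (\<integral>v. \<psi> v \<partial>lborel))"
      using front
    proof eventually_elim
      case (elim x)
      have "L \<longlonglongrightarrow> L'" if "L = (\<lambda>n. \<integral>v. ?f (x - \<epsilon> n *\<^sub>R v) * \<psi> v \<partial>lborel)" "L' = (\<integral>v. ?f x * \<psi> v \<partial>lborel)" for L L'
        unfolding that
      proof (rule integral_dominated_convergence[where w="\<lambda>v. \<bar>\<psi> v\<bar>"])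
        show "AE v in lborel. (\<lambda>n. ?f (x - \<epsilon> n *\<^sub>R v) * \<psi> v) \<longlonglongrightarrow> ?f x * \<psi> v"
        proof (rule AE_I2)
          fix v
          have "(\<lambda>n. x - \<epsilon> n *\<^sub>R v) \<longlonglongrightarrow> x - 0 *\<^sub>R v" by (intro tendsto_intros \<epsilon>0)
          moreover have "isCont ?f x" using elim by (simp add: isCont_indicator)
          ultimately have "(\<lambda>n. ?f (x - \<epsilon> n *\<^sub>R v)) \<longlonglongrightarrow> ?f x"
            using isCont_tendsto_compose by fastforce
          then show "(\<lambda>n. ?f (x - \<epsilon> n *\<^sub>R v) * \<psi> v) \<longlonglongrightarrow> ?f x * \<psi> v" by (intro tendsto_intros)
        qed
        show "AE v in lborel. norm (?f (x - \<epsilon> n *\<^sub>R v) * \<psi> v) \<le> \<bar>\<psi> v\<bar>" for n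
          by (auto simp: indicator_def)
        show "integrable lborel (\<lambda>v. \<bar>\<psi> v\<bar>)" by (rule integrable_abs[OF i\<psi>])
      qed measurable
      then have "(\<lambda>n. L n x) \<longlonglongrightarrow> (\<integral>v. ?f x * \<psi> v \<partial>lborel)" unfolding L_def by blast
      then show ?case by (intro tendsto_intros) simp
    qed
    show "AE x in lborel. norm (w x * L n x) \<le> \<bar>w x\<bar> * (\<integral>v. \<bar>\<psi> v\<bar> \<partial>lborel)" for n
      using Lb by (auto simp: abs_mult intro!: mult_left_mono)
    show "integrable lborel (\<lambda>x. \<bar>w x\<bar> * (\<integral>v. \<bar>\<psi> v\<bar> \<partial>lborel))"
      by (intro integrable_mult_left integrable_abs w)
  qed measurable
  moreover have "(\<integral>x. w x * L n x \<partial>lborel) = 0" for n unfolding L_def by (rule key[OF \<epsilon>])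
  ultimately have "(\<integral>x. w x * (?f x * (\<integral>v. \<psi> v \<partial>lborel)) \<partial>lborel) = 0"
    by (simp add: LIMSEQ_const_iff)
  then have "(\<integral>x. w x * ?f x \<partial>lborel) * (\<integral>v. \<psi> v \<partial>lborel) = 0"
    by (simp add: mult.assoc[symmetric])
  then show "(\<integral>x. z x * ?f x \<partial>lborel) = 0" using nz wf by simp
qed

text \<open>\<open>|f| \<le> 1 + |f|^p\<close> takes the place of Hoelder's inequality when
  \<open>q\<close> is bounded with bounded support.\<close>

lemma mem_Lp_mult_integrable:
  fixes f q :: "'a::euclidean_space \<Rightarrow> real"
  assumes f: "mem_Lp p lborel f" and p: "p \<ge> 1"
    and q: "q \<in> borel_measurable borel" "\<And>x. \<bar>q x\<bar> \<le> M" "\<And>x. norm x > K \<Longrightarrow> q x = 0"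
  shows "integrable lborel (\<lambda>x. f x * q x)"
proof (rule Bochner_Integration.integrable_bound)
  have [measurable]: "f \<in> borel_measurable borel" using f by (simp add: mem_Lp_def)
  note [measurable] = q(1)
  have M: "M \<ge> 0" using q(2)[of 0] by linarith
  show "integrable lborel (\<lambda>x. M * (indicator (cball 0 K) x + norm (f x) powr p))"
  proof (intro integrable_mult_right Bochner_Integration.integrable_add)
    show "integrable lborel (indicator (cball (0::'a) K) :: 'a \<Rightarrow> real)"
      by (rule integrable_real_indicator) (use emeasure_bounded_finite[OF bounded_cball[of "0::'a" K]] in simp_all)
    show "integrable lborel (\<lambda>x. norm (f x) powr p)" using f by (simp add: mem_Lp_def)
  qed
  show "AE x in lborel. norm (f x * q x) \<le> norm (M * (indicator (cball 0 K) x + norm (f x) powr p))"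
  proof (rule AE_I2)
    fix x
    show "norm (f x * q x) \<le> norm (M * (indicator (cball 0 K) x + norm (f x) powr p))"
    proof (cases "norm x \<le> K")
      case True
      have "\<bar>f x\<bar> \<le> 1 + \<bar>f x\<bar> powr p"
      proof (cases "\<bar>f x\<bar> \<le> 1")
        case False
        then have "\<bar>f x\<bar> powr 1 \<le> \<bar>f x\<bar> powr p" using p by (intro powr_mono) auto
        then show ?thesis using False by simp
      qed (simp add: add_increasing2)
      then have "\<bar>q x\<bar> * \<bar>f x\<bar> \<le> M * (1 + \<bar>f x\<bar> powr p)" using q(2) M by (intro mult_mono) auto
      then show ?thesis using True M by (simp add: abs_mult mult.commute)
    qed (use q(3) M in simp)
  qed
qed (intro borel_measurable_times, use f q(1) in \<open>simp_all add: mem_Lp_def\<close>)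

lemma L2_Cauchy_Schwarz:
  fixes f g :: "'b \<Rightarrow> real"
  assumes f: "mem_Lp 2 M f" and g: "mem_Lp 2 M g"
  shows "\<bar>\<integral>x. f x * g x \<partial>M\<bar> \<le> sqrt (\<integral>x. (f x)\<^sup>2 \<partial>M) * sqrt (\<integral>x. (g x)\<^sup>2 \<partial>M)"
proof -
  have [measurable]: "f \<in> borel_measurable M" "g \<in> borel_measurable M"
    and i: "integrable M (\<lambda>x. (f x)\<^sup>2)" "integrable M (\<lambda>x. (g x)\<^sup>2)"
    using f g by (auto simp: mem_Lp_2_iff)
  have fg: "integrable M (\<lambda>x. f x * g x)"
  proof (rule Bochner_Integration.integrable_bound[OF Bochner_Integration.integrable_add[OF i]])
    show "AE x in M. norm (f x * g x) \<le> norm ((f x)\<^sup>2 + (g x)\<^sup>2)"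
    proof (rule AE_I2)
      fix x
      have "0 \<le> (\<bar>f x\<bar> - \<bar>g x\<bar>)\<^sup>2" by simp
      then have "2 * (\<bar>f x\<bar> * \<bar>g x\<bar>) \<le> (f x)\<^sup>2 + (g x)\<^sup>2" by (simp add: power2_diff)
      moreover have "0 \<le> \<bar>f x\<bar> * \<bar>g x\<bar>" by simp
      ultimately have "\<bar>f x\<bar> * \<bar>g x\<bar> \<le> (f x)\<^sup>2 + (g x)\<^sup>2" by linarith
      then show "norm (f x * g x) \<le> norm ((f x)\<^sup>2 + (g x)\<^sup>2)" by (simp add: abs_mult)
    qed
  qed measurable
  define J where "J = (\<integral>x. \<bar>f x * g x\<bar> \<partial>M)"
  define A where "A = (\<integral>x. (f x)\<^sup>2 \<partial>M)"
  define B where "B = (\<integral>x. (g x)\<^sup>2 \<partial>M)"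
  have nn: "J \<ge> 0" "A \<ge> 0" "B \<ge> 0" by (simp_all add: J_def A_def B_def)
  have "(\<integral>\<^sup>+x. ennreal \<bar>f x\<bar> * ennreal \<bar>g x\<bar> \<partial>M)\<^sup>2 \<le> (\<integral>\<^sup>+x. (ennreal \<bar>f x\<bar>)\<^sup>2 \<partial>M) * (\<integral>\<^sup>+x. (ennreal \<bar>g x\<bar>)\<^sup>2 \<partial>M)"
    by (rule Cauchy_Schwarz_nn_integral) measurable
  moreover have "(\<integral>\<^sup>+x. ennreal \<bar>f x\<bar> * ennreal \<bar>g x\<bar> \<partial>M) = ennreal J"
    using nn_integral_eq_integral[OF integrable_abs[OF fg]] by (simp add: J_def abs_mult ennreal_mult)
  moreover have "(\<integral>\<^sup>+x. (ennreal \<bar>f x\<bar>)\<^sup>2 \<partial>M) = ennreal A" "(\<integral>\<^sup>+x. (ennreal \<bar>g x\<bar>)\<^sup>2 \<partial>M) = ennreal B"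
    using nn_integral_eq_integral[OF i(1)] nn_integral_eq_integral[OF i(2)] by (simp_all add: A_def B_def ennreal_power)
  ultimately have "J\<^sup>2 \<le> A * B"
    using nn by (simp add: ennreal_power ennreal_mult[symmetric])
  then have "J \<le> sqrt (A * B)" by (rule real_le_rsqrt)
  then have "J \<le> sqrt A * sqrt B" by (simp add: real_sqrt_mult)
  moreover have "\<bar>\<integral>x. f x * g x \<partial>M\<bar> \<le> J" unfolding J_def by (rule integral_abs_bound)
  ultimately show ?thesis by (simp add: A_def B_def)
qed

text \<open>A chain rule under weak hypotheses: the \<open>t\<close> derivative is known only at the
  base point, the \<open>s\<close> derivative everywhere and continuous at that point. The increment
  is split at \<open>(t0 + h, t0 - c)\<close>, and its \<open>s\<close> part goes through the mean
  value theorem. It serves to differentiate pairings along lines on which solution time minus test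
  wave time is constant.\<close>

lemma DERIV_diagonal:
  fixes a e :: "real \<Rightarrow> real \<Rightarrow> real"
  assumes s: "\<And>t s. ((\<lambda>s. a t s) has_real_derivative e t s) (at s)"
    and t: "((\<lambda>t. a t (t0 - c)) has_real_derivative d) (at t0)"
    and cont: "isCont (\<lambda>(t, s). e t s) (t0, t0 - c)"
  shows "((\<lambda>t. a t (t - c)) has_real_derivative d + e t0 (t0 - c)) (at t0)"
proof -
  let ?s = "t0 - c"
  have "\<exists>\<xi>. \<bar>\<xi> - ?s\<bar> \<le> \<bar>h\<bar> \<and> a (t0 + h) (?s + h) - a (t0 + h) ?s = h * e (t0 + h) \<xi>" for h
  proof (cases h "0::real" rule: linorder_cases)
    case less
    obtain \<xi> where "?s + h < \<xi>" "\<xi> < ?s" "a (t0 + h) ?s - a (t0 + h) (?s + h) = (?s - (?s + h)) * e (t0 + h) \<xi>"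
      using MVT2[of "?s + h" ?s "a (t0 + h)" "e (t0 + h)"] s less by auto
    then show ?thesis using less by (intro exI[of _ \<xi>]) (auto simp: algebra_simps)
  next
    case greater
    obtain \<xi> where "?s < \<xi>" "\<xi> < ?s + h" "a (t0 + h) (?s + h) - a (t0 + h) ?s = (?s + h - ?s) * e (t0 + h) \<xi>"
      using MVT2[of ?s "?s + h" "a (t0 + h)" "e (t0 + h)"] s greater by auto
    then show ?thesis using greater by (intro exI[of _ \<xi>]) auto
  qed auto
  then obtain \<xi> where \<xi>: "\<And>h. \<bar>\<xi> h - ?s\<bar> \<le> \<bar>h\<bar>" "\<And>h. a (t0 + h) (?s + h) - a (t0 + h) ?s = h * e (t0 + h) (\<xi> h)"
    by metis
  have "((\<lambda>h. \<xi> h - ?s) \<longlongrightarrow> 0) (at 0)"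
    by (rule tendsto_0_le[where K=1, OF tendsto_ident_at]) (use \<xi>(1) in simp)
  then have "(\<xi> \<longlongrightarrow> ?s) (at 0)" by (simp add: LIM_zero_iff)
  moreover have "((\<lambda>h. t0 + h) \<longlongrightarrow> t0 + 0) (at 0)" by (intro tendsto_intros)
  ultimately have "((\<lambda>h. (t0 + h, \<xi> h)) \<longlongrightarrow> (t0, ?s)) (at 0)" by (intro tendsto_Pair) simp_all
  from isCont_tendsto_compose[OF cont this]
  have "((\<lambda>h. e (t0 + h) (\<xi> h)) \<longlongrightarrow> e t0 ?s) (at 0)" by simp
  moreover have "((\<lambda>h. (a (t0 + h) ?s - a t0 ?s) / h) \<longlongrightarrow> d) (at 0)" using t by (simp add: DERIV_def)
  ultimately have "((\<lambda>h. (a (t0 + h) ?s - a t0 ?s) / h + e (t0 + h) (\<xi> h)) \<longlongrightarrow> d + e t0 ?s) (at 0)"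
    by (intro tendsto_add)
  then have "((\<lambda>h. (a (t0 + h) (t0 + h - c) - a t0 ?s) / h) \<longlongrightarrow> d + e t0 ?s) (at 0)"
  proof (rule Lim_transform_eventually)
    show "\<forall>\<^sub>F h in at 0. (a (t0 + h) ?s - a t0 ?s) / h + e (t0 + h) (\<xi> h) = (a (t0 + h) (t0 + h - c) - a t0 ?s) / h"
      unfolding eventually_at_filter
    proof (rule always_eventually, safe)
      fix h :: real assume "h \<noteq> 0"
      moreover have "t0 + h - c = ?s + h" by simp
      ultimately show "(a (t0 + h) ?s - a t0 ?s) / h + e (t0 + h) (\<xi> h) = (a (t0 + h) (t0 + h - c) - a t0 ?s) / h"
        using \<xi>(2)[of h] by (simp only:) (simp add: field_simps)
    qed
  qed
  then show ?thesis by (simp add: DERIV_def)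
qed

section \<open>Spherical waves and their supports\<close>

text \<open>The powers of \<open>u\<close> in the denominator make the family closed under
  differentiation (\<open>DERIV_flat\<close>), so the smoothness of \<open>exp (- 1 / u)\<close> at
  0 requires only a first derivative for every \<open>n\<close>.\<close>

definition flat :: "nat \<Rightarrow> real \<Rightarrow> real" where
  "flat n u = (if u > 0 then exp (- 1 / u) / u ^ n else 0)"

lemma power_div_fact_le_exp: "0 \<le> x \<Longrightarrow> x ^ k / fact k \<le> exp (x::real)"
proof -
  assume x: "0 \<le> x"
  have "(\<Sum>n\<in>{k}. x ^ n / fact n) \<le> (\<Sum>n. x ^ n / fact n)"
    by (rule sum_le_suminf) (use x summable_exp[of x] in \<open>auto simp: divide_inverse mult.commute\<close>)
  then show ?thesis by (simp add: exp_def divide_inverse mult.commute)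
qed

text \<open>The term of order \<open>n + 2\<close> of the exponential series at \<open>1 / u\<close>
  beats \<open>u ^ n\<close> and leaves a quadratic zero; hence the derivative at 0 exists and is
  0.\<close>

lemma flat_le: "\<bar>flat n u\<bar> \<le> fact (n + 2) * u\<^sup>2"
proof (cases "u > 0")
  case True
  have "(1 / u) ^ (n + 2) / fact (n + 2) \<le> exp (1 / u)"
    by (rule power_div_fact_le_exp) (use True in simp)
  then have "exp (- (1 / u)) \<le> fact (n + 2) * u ^ (n + 2)"
    using True by (simp add: exp_minus power_divide field_simps del: fact_Suc)
  then have "exp (- 1 / u) / u ^ n \<le> fact (n + 2) * u ^ (n + 2) / u ^ n"
    using True by (intro divide_right_mono) auto
  also have "\<dots> = fact (n + 2) * u\<^sup>2" using True by (simp add: power_add power2_eq_square)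
  finally show ?thesis using True by (simp add: flat_def)
qed (simp add: flat_def)

lemma DERIV_flat: "(flat n has_real_derivative flat (n + 2) u - real n * flat (n + 1) u) (at u)"
proof -
  consider "u > 0" | "u < 0" | "u = 0" by linarith
  then show ?thesis
  proof cases
    case 1
    let ?i = "inverse u"
    have "((\<lambda>u. exp (- inverse u) * inverse u ^ n) has_real_derivative
        exp (- ?i) * ?i\<^sup>2 * ?i ^ n + real n * ?i ^ (n - 1) * - ?i\<^sup>2 * exp (- ?i)) (at u)"
      using 1 by (auto intro!: derivative_eq_intros simp: power2_eq_square)
    moreover have "exp (- ?i) * ?i\<^sup>2 * ?i ^ n + real n * ?i ^ (n - 1) * - ?i\<^sup>2 * exp (- ?i) =
        flat (n + 2) u - real n * flat (n + 1) u"
      using 1 by (cases n) (simp_all add: flat_def divide_inverse power_inverse power2_eq_square mult_ac)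
    ultimately have "((\<lambda>u. exp (- inverse u) * inverse u ^ n) has_real_derivative
        flat (n + 2) u - real n * flat (n + 1) u) (at u)" by simp
    then show ?thesis
      by (rule has_field_derivative_transform_within_open[where S="{0<..}"])
         (use 1 in \<open>auto simp: flat_def divide_inverse power_inverse\<close>)
  next
    case 2
    have "((\<lambda>u. 0) has_real_derivative flat (n + 2) u - real n * flat (n + 1) u) (at u)"
      using 2 by (simp add: flat_def)
    then show ?thesis
      by (rule has_field_derivative_transform_within_open[where S="{..<0}"]) (use 2 in \<open>auto simp: flat_def\<close>)
  next
    case 3
    have "(flat n has_derivative (\<lambda>h. 0)) (at 0)"
      by (rule has_derivative_quadratic[where C="fact (n + 2)"]) (use flat_le[of n] in \<open>auto simp: flat_def\<close>)
    moreover have "(*) (0::real) = (\<lambda>h. 0)" by auto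
    ultimately show ?thesis using 3 by (simp add: has_field_derivative_def flat_def)
  qed
qed

lemma smooth_flat: "smooth_on UNIV (flat n)"
  unfolding smooth_on_def
proof
  fix k show "Ck_on k UNIV (flat n)"
  proof (induction k arbitrary: n)
    case 0
    show ?case using DERIV_flat by (auto intro!: continuous_at_imp_continuous_on DERIV_isCont)
  next
    case (Suc k)
    let ?d = "\<lambda>u. flat (n + 2) u + - real n * flat (n + 1) u"
    have "(flat n has_derivative (\<lambda>h. ?d u * h)) (at u)" for u
      using DERIV_flat[of n u] by (simp add: has_field_derivative_def)
    moreover have "Ck_on k UNIV (\<lambda>u. ?d u * 1)"
      by (simp only: mult_1_right) (intro Ck_on_add Ck_on_mult Ck_on_const Suc)
    ultimately show ?case unfolding Ck_on.simps(2) by (intro exI[of _ "\<lambda>u h. ?d u * h"]) simp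
  qed
qed

text \<open>Independent of the direction, so its wave is radial, and even in \<open>s\<close>, which
  fixes the parity in time of the waves of its derivatives.\<close>

definition bump :: "real \<Rightarrow> real \<times> 'a::euclidean_space \<Rightarrow> real" where
  "bump \<epsilon> p = flat 0 (1 - (fst p / \<epsilon>)\<^sup>2)"

lemma profile_bump:
  assumes \<epsilon>: "\<epsilon> > 0" shows "profile \<epsilon> (bump \<epsilon> :: real \<times> 'a::euclidean_space \<Rightarrow> real)"
  unfolding profile_def
proof (intro conjI allI impI)
  have f: "smooth_on cyl (\<lambda>p::real \<times> 'a. fst p)"
    by (rule smooth_on_bounded_linear[OF bounded_linear_fst])
  have g: "smooth_on cyl (\<lambda>p::real \<times> 'a. 1 + (- inverse (\<epsilon>\<^sup>2)) * (fst p * fst p))"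
    by (intro smooth_on_add smooth_on_mult smooth_on_const f)
  have "smooth_on cyl (\<lambda>p::real \<times> 'a. flat 0 (1 + (- inverse (\<epsilon>\<^sup>2)) * (fst p * fst p)))"
    by (rule smooth_on_compose[OF open_cyl _ _ smooth_flat]) (use g in auto)
  moreover have "(\<lambda>p::real \<times> 'a. flat 0 (1 + (- inverse (\<epsilon>\<^sup>2)) * (fst p * fst p))) = bump \<epsilon>"
    by (simp add: bump_def[abs_def] power_divide power2_eq_square divide_inverse mult_ac)
  ultimately show "smooth_on cyl (bump \<epsilon> :: real \<times> 'a \<Rightarrow> real)" by simp
  show "bump \<epsilon> (s, x) = 0" if "\<bar>s\<bar> > \<epsilon>" for s and x :: 'a
  proof -
    have "1 \<le> \<bar>s / \<epsilon>\<bar>" using that \<epsilon> by (simp add: abs_divide)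
    then have "1 \<le> \<bar>s / \<epsilon>\<bar>\<^sup>2" by (rule one_le_power)
    then have "1 \<le> (s / \<epsilon>)\<^sup>2" by (simp only: power2_abs)
    then show ?thesis by (simp add: bump_def flat_def)
  qed
qed (simp add: bump_def)

definition uniform_profile :: "(real \<times> 'a::euclidean_space \<Rightarrow> real) \<Rightarrow> bool" where
  "uniform_profile F \<longleftrightarrow> (\<forall>s x y. x \<noteq> 0 \<longrightarrow> y \<noteq> 0 \<longrightarrow> F (s, x) = F (s, y))"

lemma uniform_profile_dS:
  assumes F: "profile R F" and u: "uniform_profile F"
  shows "uniform_profile (dS F)"
  unfolding uniform_profile_def
proof (intro allI impI)
  fix s and x y :: 'a assume x: "x \<noteq> 0" and y: "y \<noteq> 0"
  have eq: "(\<lambda>s. F (s, x)) = (\<lambda>s. F (s, y))" 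
    using u x y unfolding uniform_profile_def by blast
  have "((\<lambda>s. F (s, y)) has_real_derivative dS F (s, x)) (at s)"
    using profile_has_real_derivative[OF F x, of s] unfolding eq .
  then show "dS F (s, x) = dS F (s, y)" by (rule DERIV_unique[OF _ profile_has_real_derivative[OF F y]])
qed

lemma uniform_profile_bump: "uniform_profile (bump \<epsilon>)"
  by (simp add: uniform_profile_def bump_def)

lemma uniform_profile_funpow_dS: "profile R F \<Longrightarrow> uniform_profile F \<Longrightarrow> uniform_profile ((dS ^^ j) F)"
  by (induction j) (auto intro: uniform_profile_dS[OF profile_funpow_dS])

text \<open>Any nonzero \<open>e\<close> may fill the second slot of the profile; the zonal formula
  then leaves a one-dimensional integral against a polynomial.\<close>

lemma Phi_uniform:
  fixes F :: "real \<times> 'a::euclidean_space \<Rightarrow> real"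
  assumes dim: "DIM('a) = 2 * m + 3" and F: "profile R F" and u: "uniform_profile F"
    and \<theta>: "norm \<theta> = 1" and e: "e \<noteq> 0"
  shows "Phi F (r *\<^sub>R \<theta>) t = zonal_const m * integral {-1..1} (\<lambda>s. F (r * s + t, e) * (1 - s\<^sup>2) ^ m)"
proof -
  have c: "continuous_on {-1..1} (\<lambda>s. F (r * s + t, e))"
    by (intro continuous_on_compose2[OF profile_continuous_on[OF F]] continuous_intros) (use e in auto)
  have "Phi F (r *\<^sub>R \<theta>) t = (\<integral>\<omega>. F (r * (\<theta> \<bullet> \<omega>) + t, e) \<partial>sphere_measure)"
    unfolding Phi_def
  proof (intro Bochner_Integration.integral_cong refl)
    fix \<omega> :: 'a assume "\<omega> \<in> space sphere_measure"
    then have "\<omega> \<noteq> 0" by auto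
    then have "F (r * (\<theta> \<bullet> \<omega>) + t, \<omega>) = F (r * (\<theta> \<bullet> \<omega>) + t, e)"
      using u e unfolding uniform_profile_def by blast
    then show "F (r *\<^sub>R \<theta> \<bullet> \<omega> + t, \<omega>) = F (r * (\<theta> \<bullet> \<omega>) + t, e)" by simp
  qed
  then show ?thesis using integral_sphere_zonal[OF \<theta> dim c] by simp
qed

lemma funpow_dS_parity:
  fixes F :: "real \<times> 'a::euclidean_space \<Rightarrow> real"
  assumes F: "profile R F" and even: "\<And>s. F (- s, x) = F (s, x)" and x: "x \<noteq> 0"
  shows "(dS ^^ j) F (- s, x) = (- 1) ^ j * (dS ^^ j) F (s, x)"
proof (induction j arbitrary: s)
  case (Suc j)
  let ?G = "(dS ^^ j) F"
  note D = profile_has_real_derivative[OF profile_funpow_dS[OF F, of j] x]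
  have "((\<lambda>s. ?G (- s, x)) has_real_derivative dS ?G (- s, x) * - 1) (at s)"
    by (rule DERIV_chain2[OF D]) (auto intro!: derivative_eq_intros)
  moreover have "((\<lambda>s. ?G (- s, x)) has_real_derivative (- 1) ^ j * dS ?G (s, x)) (at s)"
    unfolding Suc by (rule DERIV_cmult[OF D])
  ultimately have "dS ?G (- s, x) * - 1 = (- 1) ^ j * dS ?G (s, x)" by (rule DERIV_unique)
  then show ?case by simp
qed (simp add: even)

lemma funpow_dS_bump_scale:
  assumes \<epsilon>: "\<epsilon> > 0" and x: "x \<noteq> 0"
  shows "(dS ^^ j) (bump \<epsilon>) (s, x::'a::euclidean_space) = (dS ^^ j) (bump 1) (s / \<epsilon>, x) / \<epsilon> ^ j"
proof (induction j arbitrary: s)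
  case (Suc j)
  let ?G = "(dS ^^ j) (bump 1) :: real \<times> 'a \<Rightarrow> real"
  have "profile 1 ?G" by (intro profile_funpow_dS profile_bump) simp
  note D = profile_has_real_derivative[OF this x]
  have "profile \<epsilon> ((dS ^^ j) (bump \<epsilon>) :: real \<times> 'a \<Rightarrow> real)" by (intro profile_funpow_dS profile_bump \<epsilon>)
  note D' = profile_has_real_derivative[OF this x, of s]
  have "((\<lambda>s. ?G (s / \<epsilon>, x) / \<epsilon> ^ j) has_real_derivative dS ?G (s / \<epsilon>, x) * (1 / \<epsilon>) / \<epsilon> ^ j) (at s)"
    by (intro DERIV_cdivide DERIV_chain2[OF D]) (auto intro!: derivative_eq_intros)
  then have "dS ((dS ^^ j) (bump \<epsilon>)) (s, x) = dS ?G (s / \<epsilon>, x) * (1 / \<epsilon>) / \<epsilon> ^ j"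
    using D' unfolding Suc by (rule DERIV_unique[rotated])
  then show ?case by (simp add: field_simps)
qed (simp add: bump_def)

text \<open>Repeated integration by parts moves all derivatives onto the polynomial.\<close>

lemma profile_poly_integral:
  fixes F :: "real \<times> 'a::euclidean_space \<Rightarrow> real"
  assumes F: "profile R F" and r: "r > \<bar>t\<bar> + R" and x: "x \<noteq> 0" and "degree q \<le> n"
  shows "((\<lambda>s. r ^ n * (dS ^^ n) F (r * s + t, x) * poly q s) has_integral
    (- 1) ^ n * fact n * coeff q n * integral {-1..1} (\<lambda>s. F (r * s + t, x))) {-1..1}"
  using assms(4)
proof (induction n arbitrary: q)
  case 0
  have c: "continuous_on {-1..1} (\<lambda>s. F (r * s + t, x))"
    by (intro continuous_on_compose2[OF profile_continuous_on[OF F]] continuous_intros) (use x in auto)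
  from 0 obtain a where q: "q = [:a:]" using degree_eq_zeroE by blast
  have "((\<lambda>s. F (r * s + t, x) * a) has_integral integral {-1..1} (\<lambda>s. F (r * s + t, x)) * a) {-1..1}"
    by (intro has_integral_mult_left integrable_integral integrable_continuous_interval c)
  then show ?case by (simp add: q mult.commute)
next
  case (Suc n)
  let ?G = "(dS ^^ n) F"
  have G: "profile R ?G" by (rule profile_funpow_dS[OF F])
  define a where "a s = r ^ Suc n * dS ?G (r * s + t, x) * poly q s" for s
  define b where "b s = r ^ n * ?G (r * s + t, x) * poly (pderiv q) s" for s
  define c where "c s = r ^ n * ?G (r * s + t, x) * poly q s" for s
  have "((\<lambda>s. a s + b s) has_integral c 1 - c (- 1)) {-1..1}"
  proof (rule fundamental_theorem_of_calculus)
    fix s :: real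
    have 1: "((\<lambda>s. ?G (r * s + t, x)) has_real_derivative dS ?G (r * s + t, x) * r) (at s)"
      by (rule DERIV_chain2[OF profile_has_real_derivative[OF G x]]) (auto intro!: derivative_eq_intros)
    have "(c has_real_derivative a s + b s) (at s)"
      unfolding c_def
      by (rule DERIV_cong[OF DERIV_mult[OF DERIV_cmult[OF 1] poly_DERIV]]) (simp add: a_def b_def algebra_simps)
    then show "(c has_vector_derivative a s + b s) (at s within {-1..1})"
      by (simp add: has_real_derivative_iff_has_vector_derivative[symmetric] has_field_derivative_at_within)
  qed simp
  \<comment> \<open>Both end points lie outside the support of the profile because
    \<open>r > |t| + R\<close>.\<close>
  moreover have "c 1 = 0" "c (- 1) = 0"
    using profile_support[OF G x, of "r * 1 + t"] profile_support[OF G x, of "r * - 1 + t"] r by (auto simp: c_def)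
  ultimately have "((\<lambda>s. a s + b s) has_integral 0) {-1..1}" by simp
  moreover have "(b has_integral (- 1) ^ n * fact n * coeff (pderiv q) n * integral {-1..1} (\<lambda>s. F (r * s + t, x))) {-1..1}"
    unfolding b_def by (rule Suc.IH) (use Suc.prems in \<open>simp add: degree_pderiv\<close>)
  ultimately have "((\<lambda>s. (a s + b s) - b s) has_integral
      0 - (- 1) ^ n * fact n * coeff (pderiv q) n * integral {-1..1} (\<lambda>s. F (r * s + t, x))) {-1..1}"
    by (rule has_integral_diff)
  moreover have "0 - (- 1) ^ n * fact n * coeff (pderiv q) n * integral {-1..1} (\<lambda>s. F (r * s + t, x)) =
      (- 1) ^ Suc n * fact (Suc n) * coeff q (Suc n) * integral {-1..1} (\<lambda>s. F (r * s + t, x))"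
    by (simp add: coeff_pderiv algebra_simps)
  ultimately show ?case by (simp only: a_def add_diff_cancel_right' funpow.simps o_apply)
qed

text \<open>The degree decides how many derivatives annihilate the weight after integration by
  parts, and the leading coefficient what is left at the threshold.\<close>

lemma poly_weight:
  fixes k :: nat
  defines "q \<equiv> [:1, 0, -1:: real:] ^ k"
  shows "poly q s = (1 - s\<^sup>2) ^ k" "degree q = 2 * k" "coeff q (2 * k) = (- 1) ^ k"
proof -
  show "poly q s = (1 - s\<^sup>2) ^ k" by (simp add: q_def power2_eq_square)
  show d: "degree q = 2 * k" unfolding q_def by (subst degree_power_eq) auto
  have "lead_coeff q = (- 1) ^ k" unfolding q_def by (simp add: lead_coeff_power)
  then show "coeff q (2 * k) = (- 1) ^ k" by (simp only: d)
qed

text \<open>The strong Huygens principle for spherical waves.\<close>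

lemma Phi_uniform_eq_0_outside:
  fixes F :: "real \<times> 'a::euclidean_space \<Rightarrow> real"
  assumes dim: "DIM('a) = 2 * m + 3" and R: "R > 0" and F: "profile R F" and u: "uniform_profile F"
    and x: "norm x > \<bar>t\<bar> + R" and n: "n > 2 * m"
  shows "Phi ((dS ^^ n) F) x t = 0"
proof -
  define r where "r = norm x"
  define \<theta> where "\<theta> = x /\<^sub>R r"
  have r: "r > \<bar>t\<bar> + R" "r > 0" using x R by (auto simp: r_def)
  then have \<theta>: "norm \<theta> = 1" "x = r *\<^sub>R \<theta>" by (auto simp: \<theta>_def r_def)
  then have \<theta>0: "\<theta> \<noteq> 0" by auto
  let ?q = "[:1, 0, -1:: real:] ^ m"
  have "((\<lambda>s. r ^ n * (dS ^^ n) F (r * s + t, \<theta>) * poly ?q s) has_integral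
    (- 1) ^ n * fact n * coeff ?q n * integral {-1..1} (\<lambda>s. F (r * s + t, \<theta>))) {-1..1}"
    by (rule profile_poly_integral[OF F r(1) \<theta>0]) (use poly_weight(2)[of m] n in simp)
  \<comment> \<open>There are more derivatives than the degree \<open>2 * m\<close> of the
    weight.\<close>
  moreover have "coeff ?q n = 0" by (rule coeff_eq_0) (use poly_weight(2)[of m] n in simp)
  ultimately have "((\<lambda>s. r ^ n * ((dS ^^ n) F (r * s + t, \<theta>) * (1 - s\<^sup>2) ^ m)) has_integral 0) {-1..1}"
    by (simp add: poly_weight(1) mult.assoc del: poly_power)
  then have "integral {-1..1} (\<lambda>s. r ^ n * ((dS ^^ n) F (r * s + t, \<theta>) * (1 - s\<^sup>2) ^ m)) = 0"
    by (rule integral_unique)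
  then have "integral {-1..1} (\<lambda>s. (dS ^^ n) F (r * s + t, \<theta>) * (1 - s\<^sup>2) ^ m) = 0"
    using r(2) by simp
  then show ?thesis
    unfolding \<theta>(2) using Phi_uniform[OF dim profile_funpow_dS[OF F] uniform_profile_funpow_dS[OF F u] \<theta>(1) \<theta>0] by simp
qed

text \<open>Under \<open>y = r s\<close> the moment becomes the integral of
  \<open>F(y) (r^2 - y^2)^(m + 1)\<close>, whose derivative in \<open>r\<close> is
  \<open>2 (m + 1) r\<close> times the integral of \<open>F(y) (r^2 - y^2)^m\<close>; the proof does
  this in the variable \<open>s\<close>, by the Leibniz rule and one integration by parts. The
  result is a primitive of \<open>r ^ (d - 1)\<close> times a spherical wave.\<close>

lemma weighted_moment_DERIV:
  fixes F :: "real \<times> 'a::euclidean_space \<Rightarrow> real"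
  assumes F: "profile R F" and x: "x \<noteq> 0"
  shows "((\<lambda>r. r ^ (2 * m + 3) * integral {-1..1} (\<lambda>s. F (r * s, x) * (1 - s\<^sup>2) ^ Suc m)) has_real_derivative
    2 * real (Suc m) * (r ^ (2 * m + 2) * integral {-1..1} (\<lambda>s. F (r * s, x) * (1 - s\<^sup>2) ^ m))) (at r)"
proof -
  let ?I = "\<lambda>r k. integral {-1..1} (\<lambda>s. F (r * s, x) * (1 - s\<^sup>2) ^ k)"
  let ?w = "\<lambda>s::real. (1 - s\<^sup>2) ^ Suc m"
  have cont: "continuous_on A (\<lambda>s. G (g s, x))" if "profile R G" "continuous_on A g"
    for A :: "'b::topological_space set" and G :: "real \<times> 'a \<Rightarrow> real" and g
    by (intro continuous_on_compose2[OF profile_continuous_on[OF that(1)]] continuous_intros that) (use x in auto)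
  have "((\<lambda>r. integral (cbox (-1) 1) (\<lambda>s. F (r * s, x) * ?w s)) has_field_derivative
      integral (cbox (-1) 1) (\<lambda>s. dS F (r * s, x) * s * ?w s)) (at r within UNIV)"
  proof (rule leibniz_rule_field_derivative)
    show "((\<lambda>r. F (r * s, x) * ?w s) has_field_derivative dS F (r * s, x) * s * ?w s) (at r within UNIV)" for r s
      by (rule DERIV_cmult_right DERIV_chain2[OF profile_has_real_derivative[OF F x]])+
         (auto intro!: derivative_eq_intros)
    show "(\<lambda>s. F (r * s, x) * ?w s) integrable_on cbox (-1) 1" for r
      by (intro integrable_continuous continuous_intros cont F)
    show "continuous_on (UNIV \<times> cbox (-1) 1) (\<lambda>(r, s). dS F (r * s, x) * s * ?w s)"
      unfolding split_beta by (intro continuous_intros cont profile_dS F)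
  qed auto
  then have 1: "((\<lambda>r. ?I r (Suc m)) has_real_derivative integral {-1..1} (\<lambda>s. dS F (r * s, x) * s * ?w s)) (at r)" by simp
  have "((\<lambda>s. r * (dS F (r * s, x) * s * ?w s) + (F (r * s, x) * ?w s - 2 * real (Suc m) * (F (r * s, x) * (s\<^sup>2 * (1 - s\<^sup>2) ^ m))))
      has_integral F (r * 1, x) * (1 * ?w 1) - F (r * - 1, x) * ((- 1) * ?w (- 1))) {-1..1}"
  proof (rule fundamental_theorem_of_calculus)
    fix s :: real
    have a: "((\<lambda>s. F (r * s, x)) has_real_derivative dS F (r * s, x) * r) (at s)"
      by (rule DERIV_chain2[OF profile_has_real_derivative[OF F x]]) (auto intro!: derivative_eq_intros)
    have b: "((\<lambda>s. s * ?w s) has_real_derivative ?w s + s * (real (Suc m) * (1 - s\<^sup>2) ^ m * (- 2 * s))) (at s)"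
      by (rule derivative_eq_intros refl | simp)+
    have "((\<lambda>s. F (r * s, x) * (s * ?w s)) has_real_derivative
        r * (dS F (r * s, x) * s * ?w s) + (F (r * s, x) * ?w s - 2 * real (Suc m) * (F (r * s, x) * (s\<^sup>2 * (1 - s\<^sup>2) ^ m)))) (at s)"
      by (rule DERIV_cong[OF DERIV_mult[OF a b]]) (simp add: algebra_simps power2_eq_square)
    then show "((\<lambda>s. F (r * s, x) * (s * ?w s)) has_vector_derivative
        r * (dS F (r * s, x) * s * ?w s) + (F (r * s, x) * ?w s - 2 * real (Suc m) * (F (r * s, x) * (s\<^sup>2 * (1 - s\<^sup>2) ^ m)))) (at s within {-1..1})"
      by (simp only: has_real_derivative_iff_has_vector_derivative[symmetric] has_field_derivative_at_within)
  qed simp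
  then have 2: "integral {-1..1} (\<lambda>s. r * (dS F (r * s, x) * s * ?w s) + (F (r * s, x) * ?w s - 2 * real (Suc m) * (F (r * s, x) * (s\<^sup>2 * (1 - s\<^sup>2) ^ m)))) = 0"
    by (subst integral_unique) (assumption, simp)
  have ii: "(\<lambda>s. dS F (r * s, x) * s * ?w s) integrable_on {-1..1}"
    "(\<lambda>s. F (r * s, x) * (1 - s\<^sup>2) ^ k) integrable_on {-1..1}" "(\<lambda>s. F (r * s, x) * (s\<^sup>2 * (1 - s\<^sup>2) ^ m)) integrable_on {-1..1}" for k
    by (intro integrable_continuous_interval continuous_intros cont profile_dS F)+
  define A where "A = integral {-1..1} (\<lambda>s. dS F (r * s, x) * s * ?w s)"
  define B where "B = integral {-1..1} (\<lambda>s. F (r * s, x) * (s\<^sup>2 * (1 - s\<^sup>2) ^ m))"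
  have "((\<lambda>s. r * (dS F (r * s, x) * s * ?w s) + (F (r * s, x) * ?w s - 2 * real (Suc m) * (F (r * s, x) * (s\<^sup>2 * (1 - s\<^sup>2) ^ m))))
      has_integral r * A + (?I r (Suc m) - 2 * real (Suc m) * B)) {-1..1}"
    unfolding A_def B_def by (intro has_integral_add has_integral_diff has_integral_mult_right integrable_integral ii)
  with 2 have rA: "r * A = 2 * real (Suc m) * B - ?I r (Suc m)" by (simp only: integral_unique)
  have "((\<lambda>s. F (r * s, x) * ?w s + F (r * s, x) * (s\<^sup>2 * (1 - s\<^sup>2) ^ m)) has_integral ?I r (Suc m) + B) {-1..1}"
    unfolding B_def by (intro has_integral_add integrable_integral ii)
  moreover have "F (r * s, x) * ?w s + F (r * s, x) * (s\<^sup>2 * (1 - s\<^sup>2) ^ m) = F (r * s, x) * (1 - s\<^sup>2) ^ m" for s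
    by (simp add: algebra_simps)
  ultimately have I: "?I r m = ?I r (Suc m) + B" by (simp only: integral_unique)
  have p: "r ^ (2 * m + 3) = r ^ (2 * m + 2) * r" by (simp add: numeral_3_eq_3)
  have "((\<lambda>r. r ^ (2 * m + 3) * ?I r (Suc m)) has_real_derivative real (2 * m + 3) * r ^ (2 * m + 2) * ?I r (Suc m) + A * r ^ (2 * m + 3)) (at r)"
    unfolding A_def by (rule DERIV_mult[OF _ 1]) (use DERIV_pow[of "2 * m + 3" r] in simp)
  moreover have "real (2 * m + 3) * r ^ (2 * m + 2) * ?I r (Suc m) + A * r ^ (2 * m + 3) = 2 * real (Suc m) * (r ^ (2 * m + 2) * ?I r m)"
  proof -
    have "A * r ^ (2 * m + 3) = r ^ (2 * m + 2) * (r * A)" unfolding p by (simp only: mult_ac)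
    then show ?thesis unfolding rA I by (simp add: algebra_simps)
  qed
  ultimately show ?thesis by simp
qed

text \<open>By \<open>weighted_moment_DERIV\<close> the radial integral equals, up to a positive
  factor, the moment with exponent \<open>Suc m\<close> at a radius beyond the support. There
  \<open>2 * m + 2\<close> derivatives meet a weight of degree exactly \<open>2 * m + 2\<close>, so
  its leading coefficient times the integral of the nonnegative bump survives.\<close>

lemma integral_Phi_bump_nonzero:
  assumes dim: "DIM('a::euclidean_space) = 2 * m + 3"
  shows "(\<integral>x. Phi ((dS ^^ (2 * m + 2)) (bump 1)) (x::'a) 0 \<partial>lborel) \<noteq> 0"
proof -
  let ?b = "bump 1 :: real \<times> 'a \<Rightarrow> real"
  have b: "profile 1 ?b" by (rule profile_bump) simp
  let ?H = "(dS ^^ (2 * m + 2)) ?b"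
  have H: "profile 1 ?H" by (rule profile_funpow_dS[OF b])
  define e where "e = (SOME i::'a. i \<in> Basis)"
  have e1: "norm e = 1" using norm_Basis[OF SOME_Basis] by (simp add: e_def)
  then have "e \<noteq> 0" by auto
  note e = e1 this
  have out: "Phi ?H x 0 = 0" if "norm x > 1" for x
    by (rule Phi_uniform_eq_0_outside[OF dim _ b uniform_profile_bump]) (use that in auto)
  define p where "p r k = integral {-1..1} (\<lambda>s. ?H (r * s, e) * (1 - s\<^sup>2) ^ k)" for r k
  have Phi: "Phi ?H (r *\<^sub>R \<theta>) 0 = zonal_const m * p r m" if "norm \<theta> = 1" for r and \<theta> :: 'a
    using Phi_uniform[OF dim H uniform_profile_funpow_dS[OF b uniform_profile_bump] that e(2), of r 0] by (simp add: p_def)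
  have p0: "p r m = 0" if "r > 1" for r
    using Phi[OF e(1), of r] out[of "r *\<^sub>R e"] that e(1) zonal_const_pos[of m] by simp
  have D: "((\<lambda>r. r ^ (2 * m + 3) * p r (Suc m)) has_real_derivative 2 * real (Suc m) * (r ^ (2 * m + 2) * p r m)) (at r)" for r
    unfolding p_def by (rule weighted_moment_DERIV[OF H e(2)])
  have cp: "continuous_on UNIV (\<lambda>r. p r m)"
  proof -
    have "continuous_on UNIV (\<lambda>r. Phi ?H (r *\<^sub>R e) 0)"
      by (intro continuous_on_compose2[OF Phi_continuous_on[OF H]] continuous_intros) auto
    then have "continuous_on UNIV (\<lambda>r. Phi ?H (r *\<^sub>R e) 0 / zonal_const m)"
      by (intro continuous_intros) (use zonal_const_pos[of m] in auto)
    moreover have "p r m = Phi ?H (r *\<^sub>R e) 0 / zonal_const m" for r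
      unfolding Phi[OF e(1)] using zonal_const_pos[of m] by simp
    ultimately show ?thesis by simp
  qed
  \<comment> \<open>The radius 2 stands for any radius above 1: the wave vanishes from there on, and
    \<open>profile_poly_integral\<close> applies.\<close>
  have fin: "(\<integral>r. indicator {0..2} r *\<^sub>R (2 * real (Suc m) * (r ^ (2 * m + 2) * p r m)) \<partial>lborel) =
      2 ^ (2 * m + 3) * p 2 (Suc m) - 0 ^ (2 * m + 3) * p 0 (Suc m)"
  proof (rule integral_FTC_atLeastAtMost)
    show "((\<lambda>r. r ^ (2 * m + 3) * p r (Suc m)) has_vector_derivative 2 * real (Suc m) * (r ^ (2 * m + 2) * p r m)) (at r within {0..2})" for r
      by (simp only: has_real_derivative_iff_has_vector_derivative[symmetric] has_field_derivative_at_within[OF D])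
    show "continuous_on {0..2} (\<lambda>r. 2 * real (Suc m) * (r ^ (2 * m + 2) * p r m))"
      by (intro continuous_intros continuous_on_subset[OF cp]) auto
  qed simp
  have int: "integrable lborel (\<lambda>x. Phi ?H x 0)"
    by (rule integrable_continuous_bounded_support[OF Phi_continuous_on[OF H], of 1]) (rule out)
  let ?S = "measure (sphere_measure :: 'a measure) (sphere 0 1)"
  have "(\<integral>x. Phi ?H x 0 \<partial>lborel) =
     (\<integral>r. indicator {0<..} r * r ^ (DIM('a) - 1) * (\<integral>\<omega>. Phi ?H (r *\<^sub>R \<omega>) 0 \<partial>sphere_measure) \<partial>lborel)"
    by (rule integral_polar[OF int])
  also have "\<dots> = (\<integral>r. (?S * zonal_const m / (2 * real (Suc m))) * (indicator {0..2} r *\<^sub>R (2 * real (Suc m) * (r ^ (2 * m + 2) * p r m))) \<partial>lborel)"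
  proof (rule Bochner_Integration.integral_cong[OF refl])
    fix r :: real
    have "(\<integral>\<omega>. Phi ?H (r *\<^sub>R \<omega>) 0 \<partial>(sphere_measure :: 'a measure)) = (\<integral>\<omega>. zonal_const m * p r m \<partial>(sphere_measure :: 'a measure))"
      by (intro Bochner_Integration.integral_cong refl Phi) simp
    then have 1: "(\<integral>\<omega>. Phi ?H (r *\<^sub>R \<omega>) 0 \<partial>(sphere_measure :: 'a measure)) = ?S * (zonal_const m * p r m)" by simp
    have 2: "DIM('a) - 1 = 2 * m + 2" using dim by simp
    show "indicator {0<..} r * r ^ (DIM('a) - 1) * (\<integral>\<omega>. Phi ?H (r *\<^sub>R \<omega>) 0 \<partial>sphere_measure) =
      (?S * zonal_const m / (2 * real (Suc m))) * (indicator {0..2} r *\<^sub>R (2 * real (Suc m) * (r ^ (2 * m + 2) * p r m)))"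
      unfolding 1 2 using p0[of r] by (cases "r = 0"; cases "r > 2") (auto simp: indicator_def field_simps)
  qed
  also have "\<dots> = ?S * zonal_const m / (2 * real (Suc m)) * (2 ^ (2 * m + 3) * p 2 (Suc m) - 0 ^ (2 * m + 3) * p 0 (Suc m))"
    unfolding fin[symmetric] by (rule Bochner_Integration.integral_mult_right_zero)
  also have "\<dots> = ?S * zonal_const m / (2 * real (Suc m)) * (2 ^ (2 * m + 3) * p 2 (Suc m))"
    by simp
  finally have eq: "(\<integral>x. Phi ?H x 0 \<partial>lborel) = ?S * zonal_const m / (2 * real (Suc m)) * (2 ^ (2 * m + 3) * p 2 (Suc m))" .
  have S: "?S > 0"
    unfolding measure_sphere_eq[OF dim] zonal_moment_0 using zonal_const_pos[of m] by simp
  have "p 2 (Suc m) \<noteq> 0"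
  proof
    assume p2: "p 2 (Suc m) = 0"
    let ?q = "[:1, 0, -1:: real:] ^ Suc m"
    have "((\<lambda>s. 2 ^ (2 * m + 2) * ?H (2 * s + 0, e) * poly ?q s) has_integral
      (- 1) ^ (2 * m + 2) * fact (2 * m + 2) * coeff ?q (2 * m + 2) * integral {-1..1} (\<lambda>s. ?b (2 * s + 0, e))) {-1..1}"
      by (rule profile_poly_integral[OF b _ e(2)]) (use poly_weight(2)[of "Suc m"] in simp_all)
    moreover have "(\<lambda>s. 2 ^ (2 * m + 2) * ?H (2 * s + 0, e) * poly ?q s) = (\<lambda>s. 2 ^ (2 * m + 2) * (?H (2 * s, e) * (1 - s\<^sup>2) ^ Suc m))"
      unfolding poly_weight(1) by (simp only: add_0_right mult.assoc)
    moreover have "coeff ?q (2 * m + 2) = (- 1) ^ Suc m" using poly_weight(3)[of "Suc m"] by (simp only: mult_Suc_right add.commute)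
    ultimately have "integral {-1..1} (\<lambda>s. 2 ^ (2 * m + 2) * (?H (2 * s, e) * (1 - s\<^sup>2) ^ Suc m)) =
        (- 1) ^ (2 * m + 2) * fact (2 * m + 2) * (- 1) ^ Suc m * integral {-1..1} (\<lambda>s. ?b (2 * s + 0, e))"
      by (simp only: integral_unique)
    moreover have "integral {-1..1} (\<lambda>s. 2 ^ (2 * m + 2) * (?H (2 * s, e) * (1 - s\<^sup>2) ^ Suc m)) = 2 ^ (2 * m + 2) * p 2 (Suc m)"
      unfolding p_def by (rule integral_mult_right)
    ultimately have "integral {-1..1} (\<lambda>s. ?b (2 * s + 0, e)) = 0"
      using p2 by (simp only: mult_zero_right) (metis (no_types, lifting) fact_nonzero mult_eq_0_iff power_not_zero neg_equal_0_iff_equal one_neq_zero)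
    moreover have "continuous_on {-1..1} (\<lambda>s. ?b (2 * s + 0, e))"
      by (intro continuous_on_compose2[OF profile_continuous_on[OF b]] continuous_intros) (use e in auto)
    moreover have "?b (2 * s + 0, e) \<ge> 0" for s by (simp add: bump_def flat_def)
    ultimately have "\<forall>s\<in>{-1..1}. ?b (2 * s + 0, e) = 0"
      by (subst (asm) integral_eq_0_iff) auto
    from bspec[OF this, of 0] show False by (simp add: bump_def flat_def)
  qed
  then show ?thesis unfolding eq using S zonal_const_pos[of m] by simp
qed

section \<open>Uniqueness of the solution with a given profile\<close>

text \<open>On the sphere this is \<open>F (s - y \<bullet> \<omega>, \<omega>)\<close>, the profile
  of the wave translated by \<open>y\<close> (\<open>Phi_tr\<close>); the inner product is
  normalised to keep degree 0.\<close>

definition tr :: "'a \<Rightarrow> (real \<times> 'a::euclidean_space \<Rightarrow> real) \<Rightarrow> real \<times> 'a \<Rightarrow> real" where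
  "tr y F p = F (fst p + - ((y \<bullet> snd p) * inverse (norm (snd p))), snd p)"

lemma abs_inner_div_norm_le: "\<bar>(y \<bullet> x) * inverse (norm x)\<bar> \<le> norm (y::'a::euclidean_space)"
proof (cases "x = 0")
  case False
  have "\<bar>y \<bullet> x\<bar> \<le> norm y * norm x" by (rule Cauchy_Schwarz_ineq2)
  then show ?thesis using False by (simp add: abs_mult field_simps)
qed simp

lemma profile_tr:
  fixes F :: "real \<times> 'a::euclidean_space \<Rightarrow> real"
  assumes F: "profile R F" shows "profile (R + norm y) (tr y F)"
  unfolding profile_def
proof (intro conjI allI impI)
  let ?g = "\<lambda>p::real \<times> 'a. fst p + - 1 * ((y \<bullet> snd p) * inverse (norm (snd p)))"
  have g: "smooth_on cyl ?g"
    by (intro smooth_on_add smooth_on_mult smooth_on_const smooth_on_bounded_linear[OF bounded_linear_fst]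
      smooth_on_cyl_compose_snd[OF smooth_on_inverse_norm]
      smooth_on_cyl_compose_snd[OF smooth_on_bounded_linear[OF bounded_linear_inner_right]])
  have "smooth_on cyl (\<lambda>p. F (?g p, snd p))"
  proof (rule smooth_on_compose[OF open_cyl _ _ profile_smooth[OF F]])
    fix b :: "real \<times> 'a"
    have "smooth_on cyl (\<lambda>p. ?g p * fst b + snd p \<bullet> snd b)"
      by (intro smooth_on_add[OF smooth_on_mult[OF g smooth_on_const]]
        smooth_on_cyl_compose_snd[OF smooth_on_bounded_linear[OF bounded_linear_inner_left]])
    then show "smooth_on cyl (\<lambda>p. (?g p, snd p) \<bullet> b)" by (simp only: inner_prod_def fst_conv snd_conv inner_real_def)
  qed auto
  then show "smooth_on cyl (tr y F)" by (simp add: tr_def[abs_def])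
  show "tr y F (s, c *\<^sub>R x) = tr y F (s, x)" if "x \<noteq> 0" "c > 0" for s c x
  proof -
    have eq: "(y \<bullet> c *\<^sub>R x) * inverse (norm (c *\<^sub>R x)) = (y \<bullet> x) * inverse (norm x)"
      using that by (simp add: field_simps)
    show ?thesis unfolding tr_def fst_conv snd_conv eq by (rule profile_hom[OF F that])
  qed
  show "tr y F (s, x) = 0" if "x \<noteq> 0" "\<bar>s\<bar> > R + norm y" for s x
    unfolding tr_def using abs_inner_div_norm_le[of y x] that
    by (intro profile_support[OF F]) auto
qed

lemma dS_tr:
  fixes F :: "real \<times> 'a::euclidean_space \<Rightarrow> real"
  assumes F: "profile R F" and p: "p \<in> cyl"
  shows "dS (tr y F) p = tr y (dS F) p"
proof -
  obtain s x where p: "p = (s, x)" "x \<noteq> 0" using p by auto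
  have "((\<lambda>s. tr y F (s, x)) has_real_derivative dS F (s + - ((y \<bullet> x) * inverse (norm x)), x) * 1) (at s)"
    unfolding tr_def fst_conv snd_conv
    by (rule DERIV_chain2[OF profile_has_real_derivative[OF F p(2)]]) (auto intro!: derivative_eq_intros)
  from DERIV_unique[OF profile_has_real_derivative[OF profile_tr[OF F] p(2)] this]
  show ?thesis by (simp add: p tr_def)
qed

lemma Phi_tr:
  fixes F :: "real \<times> 'a::euclidean_space \<Rightarrow> real"
  shows "Phi (tr y F) x t = Phi F (x - y) t"
  unfolding Phi_def by (intro Bochner_Integration.integral_cong refl) (simp add: tr_def inner_diff_left algebra_simps)

section \<open>Test waves and the weak formulation\<close>

text \<open>Compact support in \<open>x\<close> at every time makes the wave admissible in the weak
  formulation. A general profile does not have this property; the examples come from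
  \<open>Phi_uniform_eq_0_outside\<close>.\<close>

definition vanishing :: "real \<Rightarrow> (real \<times> 'a::euclidean_space \<Rightarrow> real) \<Rightarrow> bool" where
  "vanishing \<rho> F \<longleftrightarrow> profile \<rho> F \<and> (\<forall>x t. norm x > \<bar>t\<bar> + \<rho> \<longrightarrow> Phi F x t = 0)"

lemma vanishing_profile: "vanishing \<rho> F \<Longrightarrow> profile \<rho> F"
  by (simp add: vanishing_def)

lemma vanishing_eq_0: "vanishing \<rho> F \<Longrightarrow> norm x > \<bar>t\<bar> + \<rho> \<Longrightarrow> Phi F x t = 0"
  by (simp add: vanishing_def)

lemma vanishing_dS:
  fixes F :: "real \<times> 'a::euclidean_space \<Rightarrow> real"
  assumes F: "vanishing \<rho> F" shows "vanishing \<rho> (dS F)"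
  unfolding vanishing_def
proof (intro conjI allI impI)
  fix x :: 'a and t assume x: "norm x > \<bar>t\<bar> + \<rho>"
  have "open {t::real. norm x > \<bar>t\<bar> + \<rho>}" by (intro open_Collect_less continuous_intros)
  then have "((\<lambda>t. 0) has_real_derivative Phi (dS F) x t) (at t)"
    by (rule has_field_derivative_transform_within_open[OF Phi_has_real_derivative[OF vanishing_profile[OF F]]])
       (use x vanishing_eq_0[OF F] in auto)
  from DERIV_unique[OF this DERIV_const] show "Phi (dS F) x t = 0" .
qed (rule profile_dS[OF vanishing_profile[OF F]])

text \<open>Stated for \<open>mW i (dS F)\<close> rather than \<open>mW i F\<close>: it is the
  profile of a spatial derivative of the wave, and so inherits the open region of vanishing.\<close>

lemma vanishing_mW:
  fixes F :: "real \<times> 'a::euclidean_space \<Rightarrow> real"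
  assumes F: "vanishing \<rho> F" and i: "i \<in> Basis" shows "vanishing \<rho> (mW i (dS F))"
  unfolding vanishing_def
proof (intro conjI allI impI)
  fix x :: 'a and t assume x: "norm x > \<bar>t\<bar> + \<rho>"
  have "norm z > \<bar>t\<bar> + \<rho> \<Longrightarrow> Phi F z t = 0" for z by (rule vanishing_eq_0[OF F])
  from fun_cong[OF has_derivative_eq_0_outside[OF this Phi_has_derivative[OF vanishing_profile[OF F]] x], of i]
  show "Phi (mW i (dS F)) x t = 0"
    unfolding Phi_frechet_derivative_Basis[OF vanishing_profile[OF F] i] .
qed (rule profile_mW[OF profile_dS[OF vanishing_profile[OF F]]])

lemma vanishing_test_function: "vanishing \<rho> F \<Longrightarrow> test_function (\<lambda>x. Phi F x s)"
  by (rule test_functionI[OF Phi_smooth[OF vanishing_profile] vanishing_eq_0])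

lemma vanishing_integrable:
  fixes q :: "'a::euclidean_space \<Rightarrow> real"
  assumes F: "vanishing \<rho> F" and q: "mem_Lp p lborel q" "p \<ge> 1"
  shows "integrable lborel (\<lambda>x. q x * Phi F x s)"
proof -
  note P = vanishing_profile[OF F]
  obtain M where "M \<ge> 0" "\<And>x t. \<bar>Phi F x t\<bar> \<le> M" by (rule Phi_bounded[OF P]) (rule that)
  then show ?thesis
    by (intro mem_Lp_mult_integrable[OF q Phi_borel_measurable[OF P] _ vanishing_eq_0[OF F]])
qed

text \<open>\<open>q\<close> is integrable only locally, so it is cut off at a radius that contains
  the supports of the test waves for all times within 1 of \<open>s\<close>.\<close>

lemma vanishing_pairing_derivative:
  fixes q :: "'a::euclidean_space \<Rightarrow> real"
  assumes F: "vanishing \<rho> F" and q: "mem_Lp p lborel q" "p \<ge> 1"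
  shows "((\<lambda>s. \<integral>x. q x * Phi F x s \<partial>lborel) has_real_derivative (\<integral>x. q x * Phi (dS F) x s \<partial>lborel)) (at s)"
proof -
  define K where "K = \<bar>s\<bar> + 1 + \<rho>"
  let ?q = "\<lambda>x. q x * indicator (cball 0 K) x"
  have iq: "integrable lborel ?q"
    by (rule mem_Lp_mult_integrable[OF q, where M=1 and K=K]) (auto simp: indicator_def)
  have eq: "Phi G x t * ?q x = q x * Phi G x t" if "vanishing \<rho> G" "\<bar>t - s\<bar> < 1" for G x t
  proof (cases "norm x \<le> K")
    case False
    then have "norm x > \<bar>t\<bar> + \<rho>" using that(2) unfolding K_def by linarith
    from vanishing_eq_0[OF that(1) this] show ?thesis by simp
  qed simp
  have "((\<lambda>t. \<integral>x. Phi F x t * ?q x \<partial>lborel) has_real_derivative (\<integral>x. Phi (dS F) x s * ?q x \<partial>lborel)) (at s)"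
    by (rule Phi_pairing_derivative[OF vanishing_profile[OF F] iq])
  then have "((\<lambda>t. \<integral>x. Phi F x t * ?q x \<partial>lborel) has_real_derivative (\<integral>x. q x * Phi (dS F) x s \<partial>lborel)) (at s)"
    by (simp only: eq[OF vanishing_dS[OF F], of s] diff_self abs_zero zero_less_one)
  then show ?thesis
  proof (rule has_field_derivative_transform_within_open[where S="ball s 1"])
    fix t assume "t \<in> ball s 1"
    then have "\<bar>t - s\<bar> < 1" by (simp add: dist_real_def abs_minus_commute)
    then show "(\<integral>x. Phi F x t * ?q x \<partial>lborel) = (\<integral>x. q x * Phi F x t \<partial>lborel)"
      by (simp only: eq[OF F])
  qed auto
qed

lemma vanishing_L2_bound:
  fixes F :: "real \<times> 'a::euclidean_space \<Rightarrow> real"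
  assumes F: "vanishing \<rho> F"
  shows "mem_Lp 2 lborel (\<lambda>x. Phi F x s)"
    and "\<exists>C. \<forall>s. \<bar>s\<bar> \<le> T \<longrightarrow> (\<integral>x. (Phi F x s)\<^sup>2 \<partial>lborel) \<le> C"
proof -
  note P = vanishing_profile[OF F]
  obtain M where M: "M \<ge> 0" "\<And>x t. \<bar>Phi F x t\<bar> \<le> M" by (rule Phi_bounded[OF P]) (rule that)
  have int: "integrable lborel (\<lambda>x. (Phi F x s)\<^sup>2)" for s
    by (rule integrable_continuous_bounded_support[where K="\<bar>s\<bar> + \<rho>"])
       (use vanishing_eq_0[OF F] in \<open>auto intro!: continuous_intros Phi_continuous_on[OF P]\<close>)
  then show "mem_Lp 2 lborel (\<lambda>x. Phi F x s)"
    using Phi_borel_measurable[OF P] by (simp add: mem_Lp_2_iff)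
  let ?B = "cball (0::'a) (T + \<rho>)"
  have iB: "integrable lborel (\<lambda>x. M\<^sup>2 * indicator ?B x)"
    by (intro integrable_mult_right integrable_real_indicator)
       (use emeasure_bounded_finite[OF bounded_cball[of "0::'a" "T + \<rho>"]] in simp_all)
  have "(\<integral>x. (Phi F x s)\<^sup>2 \<partial>lborel) \<le> (\<integral>x. M\<^sup>2 * indicator ?B x \<partial>lborel)" if "\<bar>s\<bar> \<le> T" for s
  proof (rule integral_mono[OF int iB])
    show "(Phi F x s)\<^sup>2 \<le> M\<^sup>2 * indicator ?B x" for x
    proof (cases "x \<in> ?B")
      case True
      then show ?thesis using power_mono[OF M(2)[of x s], of 2] by simp
    next
      case False
      then have "norm x > \<bar>s\<bar> + \<rho>" using that by auto
      from vanishing_eq_0[OF F this] show ?thesis by simp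
    qed
  qed
  then show "\<exists>C. \<forall>s. \<bar>s\<bar> \<le> T \<longrightarrow> (\<integral>x. (Phi F x s)\<^sup>2 \<partial>lborel) \<le> C" by blast
qed

lemma mem_Lp_2_diff:
  fixes f g :: "'b \<Rightarrow> real"
  assumes "mem_Lp 2 M f" "mem_Lp 2 M g" shows "mem_Lp 2 M (\<lambda>x. f x - g x)"
proof -
  have [measurable]: "f \<in> borel_measurable M" "g \<in> borel_measurable M"
    and i: "integrable M (\<lambda>x. (f x)\<^sup>2)" "integrable M (\<lambda>x. (g x)\<^sup>2)"
    using assms by (auto simp: mem_Lp_2_iff)
  have "integrable M (\<lambda>x. (f x - g x)\<^sup>2)"
  proof (rule Bochner_Integration.integrable_bound)
    show "integrable M (\<lambda>x. 2 * (f x)\<^sup>2 + 2 * (g x)\<^sup>2)" using i by simp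
    show "AE x in M. norm ((f x - g x)\<^sup>2) \<le> norm (2 * (f x)\<^sup>2 + 2 * (g x)\<^sup>2)"
    proof (rule AE_I2)
      fix x
      have "0 \<le> (f x + g x)\<^sup>2" by simp
      then have "(f x - g x)\<^sup>2 \<le> 2 * (f x)\<^sup>2 + 2 * (g x)\<^sup>2" by (simp add: power2_sum power2_diff)
      then show "norm ((f x - g x)\<^sup>2) \<le> norm (2 * (f x)\<^sup>2 + 2 * (g x)\<^sup>2)" by simp
    qed
  qed measurable
  then show ?thesis by (simp add: mem_Lp_2_iff)
qed

text \<open>A change of \<open>t\<close> is controlled by Cauchy-Schwarz with an \<open>L^2\<close>
  bound on the test wave that is uniform for \<open>s\<close> near \<open>s0\<close>, a change of
  \<open>s\<close> at fixed \<open>q t0\<close> by differentiability. Joint continuity is a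
  hypothesis of \<open>DERIV_diagonal\<close>.\<close>

lemma pairing_isCont:
  fixes q :: "real \<Rightarrow> 'a::euclidean_space \<Rightarrow> real"
  assumes F: "vanishing \<rho> F" and q: "\<And>t. mem_Lp 2 lborel (q t)"
    and cont: "((\<lambda>t. \<integral>x. (q t x - q t0 x)\<^sup>2 \<partial>lborel) \<longlongrightarrow> 0) (at t0)"
  shows "isCont (\<lambda>(t, s). \<integral>x. q t x * Phi F x s \<partial>lborel) (t0, s0)"
proof -
  define D where "D t = (\<integral>x. (q t x - q t0 x)\<^sup>2 \<partial>lborel)" for t
  define G where "G s = (\<integral>x. q t0 x * Phi F x s \<partial>lborel)" for s
  have "isCont D t0" using cont by (simp add: isCont_def D_def[abs_def])
  have "isCont G s0"
    unfolding G_def by (rule DERIV_isCont[OF vanishing_pairing_derivative[OF F q]]) simp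
  obtain C where C: "\<And>s. \<bar>s\<bar> \<le> \<bar>s0\<bar> + 1 \<Longrightarrow> (\<integral>x. (Phi F x s)\<^sup>2 \<partial>lborel) \<le> C"
    using vanishing_L2_bound(2)[OF F] by blast
  let ?h = "\<lambda>p. sqrt (D (fst p)) * sqrt C + \<bar>G (snd p) - G s0\<bar>"
  have int: "integrable lborel (\<lambda>x. q t x * Phi F x s)" for t s
    by (rule vanishing_integrable[OF F q]) simp
  have le: "\<bar>(\<integral>x. q t x * Phi F x s \<partial>lborel) - (\<integral>x. q t0 x * Phi F x s0 \<partial>lborel)\<bar> \<le> ?h (t, s)"
    if s: "\<bar>s - s0\<bar> < 1" for t s
  proof -
    have "(\<integral>x. q t x * Phi F x s \<partial>lborel) - (\<integral>x. q t0 x * Phi F x s \<partial>lborel) = (\<integral>x. (q t x - q t0 x) * Phi F x s \<partial>lborel)"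
      using int by (simp add: left_diff_distrib)
    also have "\<bar>\<dots>\<bar> \<le> sqrt (D t) * sqrt (\<integral>x. (Phi F x s)\<^sup>2 \<partial>lborel)"
      unfolding D_def by (rule L2_Cauchy_Schwarz[OF mem_Lp_2_diff[OF q q] vanishing_L2_bound(1)[OF F]])
    also have "\<dots> \<le> sqrt (D t) * sqrt C"
      using s by (intro mult_left_mono real_sqrt_le_mono C) (auto simp: D_def)
    finally show ?thesis unfolding G_def by simp
  qed
  have 0: "D t0 = 0" by (simp add: D_def)
  have "isCont ?h (t0, s0)"
    by (intro continuous_intros isCont_o2[where g=D and f=fst] isCont_o2[where g=G and f=snd])
       (use \<open>isCont D t0\<close> \<open>isCont G s0\<close> in auto)
  then have lim: "(?h \<longlongrightarrow> 0) (at (t0, s0))" by (simp add: isCont_def 0)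
  show ?thesis
    unfolding isCont_def
  proof (rule LIM_zero_cancel, rule Lim_null_comparison[OF _ lim])
    have "open (UNIV \<times> ball s0 1 :: (real \<times> real) set)" "(t0, s0) \<in> UNIV \<times> ball s0 1"
      by (auto intro: open_Times)
    then have "\<forall>\<^sub>F p in at (t0, s0). p \<in> UNIV \<times> ball s0 1" by (rule eventually_at_in_open')
    then show "\<forall>\<^sub>F p in at (t0, s0). norm ((case p of (t, s) \<Rightarrow> \<integral>x. q t x * Phi F x s \<partial>lborel) -
        (case (t0, s0) of (t, s) \<Rightarrow> \<integral>x. q t x * Phi F x s \<partial>lborel)) \<le> ?h p"
    proof (rule eventually_mono)
      fix p :: "real \<times> real" assume p: "p \<in> UNIV \<times> ball s0 1"
      obtain t s where ts: "p = (t, s)" by (cases p)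
      with p have "\<bar>s - s0\<bar> < 1" by (auto simp: dist_real_def)
      from le[OF this, of t] show "norm ((case p of (t, s) \<Rightarrow> \<integral>x. q t x * Phi F x s \<partial>lborel) -
        (case (t0, s0) of (t, s) \<Rightarrow> \<integral>x. q t x * Phi F x s \<partial>lborel)) \<le> ?h p" by (simp add: ts)
    qed
  qed
qed

text \<open>The weak gradient is tested against the components of the gradient of the test wave. The
  divergence of the latter is \<open>Phi (dS (dS F))\<close>, because the test wave solves the wave
  equation.\<close>

lemma weak_gradient_pairing:
  fixes u :: "'a::euclidean_space \<Rightarrow> real"
  assumes wg: "weak_gradient u g" and F: "vanishing \<rho> F" and u: "mem_Lp p lborel u" "p \<ge> 1"
    and g: "mem_Lp 2 lborel g"
  shows "(\<Sum>i\<in>Basis. \<integral>x. (g x \<bullet> i) * Phi (mW i (dS F)) x s \<partial>lborel) = - (\<integral>x. u x * Phi (dS (dS F)) x s \<partial>lborel)"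
    and "(\<integral>x. frechet_derivative (\<lambda>x. Phi F x s) (at x) (g x) \<partial>lborel) = - (\<integral>x. u x * Phi (dS (dS F)) x s \<partial>lborel)"
proof -
  note P = vanishing_profile[OF F]
  note P2 = profile_dS[OF profile_dS[OF P]]
  have fd: "frechet_derivative (\<lambda>x. Phi G x s) (at x) h = (\<Sum>j\<in>Basis. (h \<bullet> j) * Phi (mW j (dS G)) x s)"
    if "profile R G" for R and G :: "real \<times> 'a \<Rightarrow> real" and x h
    using fun_cong[OF frechet_derivative_at[OF Phi_has_derivative[OF that]]] by simp
  have one: "(\<integral>x. (g x \<bullet> i) * Phi (mW i (dS F)) x s \<partial>lborel) = - (\<integral>x. u x * Phi (mW i (mW i (dS (dS F)))) x s \<partial>lborel)"
    if i: "i \<in> Basis" for i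
  proof -
    note Pi = profile_mW[OF profile_dS[OF P], of i]
    have "frechet_derivative (\<lambda>x. Phi (mW i (dS F)) x s) (at x) i = Phi (mW i (mW i (dS (dS F)))) x s" for x
    proof -
      have "frechet_derivative (\<lambda>x. Phi (mW i (dS F)) x s) (at x) i = Phi (mW i (dS (mW i (dS F)))) x s"
        unfolding fd[OF Pi] by (rule Phi_frechet_derivative_Basis[OF Pi i])
      also have "\<dots> = Phi (mW i (mW i (dS (dS F)))) x s"
      proof (rule Phi_cong)
        show "mW i (dS (mW i (dS F))) p = mW i (mW i (dS (dS F))) p" if "p \<in> cyl" for p
          unfolding mW_def[of i "dS (mW i (dS F))"] mW_def[of i "mW i (dS (dS F))"] dS_mW[OF profile_dS[OF P] that] ..
      qed
      finally show ?thesis .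
    qed
    moreover have "(\<integral>x. u x * frechet_derivative (\<lambda>x. Phi (mW i (dS F)) x s) (at x) i \<partial>lborel) =
        - (\<integral>x. (g x \<bullet> i) * Phi (mW i (dS F)) x s \<partial>lborel)"
      using wg vanishing_test_function[OF vanishing_mW[OF F i]] i unfolding weak_gradient_def by blast
    ultimately show ?thesis by simp
  qed
  have intu: "integrable lborel (\<lambda>x. u x * Phi (mW i (mW i (dS (dS F)))) x s)" if i: "i \<in> Basis" for i
  proof -
    have eq: "Phi (mW i (mW i (dS (dS F)))) x s = Phi (mW i (dS (mW i (dS F)))) x s" for x
    proof (rule Phi_cong)
      show "mW i (mW i (dS (dS F))) p = mW i (dS (mW i (dS F))) p" if "p \<in> cyl" for p
        unfolding mW_def[of i "dS (mW i (dS F))"] mW_def[of i "mW i (dS (dS F))"] dS_mW[OF profile_dS[OF P] that] ..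
    qed
    show ?thesis unfolding eq by (rule vanishing_integrable[OF vanishing_mW[OF vanishing_mW[OF F i] i] u])
  qed
  have "(\<Sum>i\<in>Basis. \<integral>x. (g x \<bullet> i) * Phi (mW i (dS F)) x s \<partial>lborel) =
      - (\<Sum>i\<in>Basis. \<integral>x. u x * Phi (mW i (mW i (dS (dS F)))) x s \<partial>lborel)"
    by (simp add: one sum_negf)
  also have "(\<Sum>i\<in>Basis. \<integral>x. u x * Phi (mW i (mW i (dS (dS F)))) x s \<partial>lborel) =
      (\<integral>x. (\<Sum>i\<in>Basis. u x * Phi (mW i (mW i (dS (dS F)))) x s) \<partial>lborel)"
    by (rule Bochner_Integration.integral_sum[symmetric]) (rule intu)
  also have "\<dots> = (\<integral>x. u x * Phi (dS (dS F)) x s \<partial>lborel)"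
    unfolding sum_distrib_left[symmetric] Phi_mW_square_sum[OF P2] ..
  finally show 1: "(\<Sum>i\<in>Basis. \<integral>x. (g x \<bullet> i) * Phi (mW i (dS F)) x s \<partial>lborel) = - (\<integral>x. u x * Phi (dS (dS F)) x s \<partial>lborel)" .
  have gi: "mem_Lp 2 lborel (\<lambda>x. g x \<bullet> i)" if "i \<in> Basis" for i
  proof -
    have [measurable]: "g \<in> borel_measurable borel" and ig: "integrable lborel (\<lambda>x. (norm (g x))\<^sup>2)"
      using g by (auto simp: mem_Lp_2_iff)
    have "integrable lborel (\<lambda>x. (g x \<bullet> i)\<^sup>2)"
    proof (rule Bochner_Integration.integrable_bound[OF ig])
      show "AE x in lborel. norm ((g x \<bullet> i)\<^sup>2) \<le> norm ((norm (g x))\<^sup>2)"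
        using Basis_le_norm[OF that] by (auto intro!: AE_I2 simp: abs_le_square_iff[symmetric])
    qed measurable
    then show ?thesis by (simp add: mem_Lp_2_iff)
  qed
  have "(\<integral>x. frechet_derivative (\<lambda>x. Phi F x s) (at x) (g x) \<partial>lborel) =
      (\<integral>x. (\<Sum>i\<in>Basis. (g x \<bullet> i) * Phi (mW i (dS F)) x s) \<partial>lborel)"
    unfolding fd[OF P] ..
  also have "\<dots> = (\<Sum>i\<in>Basis. \<integral>x. (g x \<bullet> i) * Phi (mW i (dS F)) x s \<partial>lborel)"
    by (rule Bochner_Integration.integral_sum) (rule vanishing_integrable[OF vanishing_mW[OF F] gi], auto)
  finally show "(\<integral>x. frechet_derivative (\<lambda>x. Phi F x s) (at x) (g x) \<partial>lborel) = - (\<integral>x. u x * Phi (dS (dS F)) x s \<partial>lborel)"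
    using 1 by simp
qed

text \<open>The spherical test wave itself is \<open>Phi (dS X)\<close>, which is even in time. The
  odd primitive \<open>X\<close> supplies the gradient pairing that completes the conserved energy
  and vanishes at \<open>s = 0\<close>.\<close>

definition odd_wave :: "real \<Rightarrow> (real \<times> 'a::euclidean_space \<Rightarrow> real) \<Rightarrow> bool" where
  "odd_wave \<rho> X \<longleftrightarrow> vanishing \<rho> X \<and> (\<forall>x t. Phi X x (- t) = - Phi X x t)"

lemma Phi_parity_dS:
  fixes F :: "real \<times> 'a::euclidean_space \<Rightarrow> real"
  assumes F: "profile R F" and par: "\<And>x t. Phi F x (- t) = c * Phi F x t"
  shows "Phi (dS F) x (- t) = - c * Phi (dS F) x t"
proof -
  have "((\<lambda>t. Phi F x (- t)) has_real_derivative Phi (dS F) x (- t) * - 1) (at t)"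
    by (rule DERIV_chain2[OF Phi_has_real_derivative[OF F]]) (auto intro!: derivative_eq_intros)
  moreover have "((\<lambda>t. Phi F x (- t)) has_real_derivative c * Phi (dS F) x t) (at t)"
    unfolding par by (rule DERIV_cmult[OF Phi_has_real_derivative[OF F]])
  ultimately have "Phi (dS F) x (- t) * - 1 = c * Phi (dS F) x t" by (rule DERIV_unique)
  then show ?thesis by simp
qed

lemma odd_wave_parity:
  assumes "odd_wave \<rho> X"
  shows "Phi (dS X) x (- t) = Phi (dS X) x t" "Phi (dS (dS X)) x (- t) = - Phi (dS (dS X)) x t"
proof -
  have X: "profile \<rho> X" "\<And>x t. Phi X x (- t) = - 1 * Phi X x t" using assms by (auto simp: odd_wave_def vanishing_def)
  show 1: "Phi (dS X) x (- t) = Phi (dS X) x t" for x t using Phi_parity_dS[OF X] by simp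
  show "Phi (dS (dS X)) x (- t) = - Phi (dS (dS X)) x t"
    using Phi_parity_dS[OF profile_dS[OF X(1)], of 1] 1 by simp
qed

text \<open>d'Alembert's formula in the time variables: the energy pairing of the solution with a test
  wave is conserved, and the gradient terms cancel by parity.\<close>

theorem wave_solution_dAlembert:
  fixes u v :: "real \<Rightarrow> 'a::euclidean_space \<Rightarrow> real"
  assumes sol: "wave_solution u g v" and X: "odd_wave \<rho> X" and dim: "DIM('a) \<ge> 3"
  shows "(\<integral>x. v (t0 + s) x * Phi (dS X) x 0 \<partial>lborel) + (\<integral>x. v (t0 - s) x * Phi (dS X) x 0 \<partial>lborel) =
    2 * (\<integral>x. v t0 x * Phi (dS X) x s \<partial>lborel)"
proof -
  let ?p = "2 * real DIM('a) / (real DIM('a) - 2)"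
  have p: "?p \<ge> 1" using dim by (simp add: field_simps)
  have V: "vanishing \<rho> X" using X by (simp add: odd_wave_def)
  note V1 = vanishing_dS[OF V] note V2 = vanishing_dS[OF V1]
  note P1 = vanishing_profile[OF V1]
  have u: "mem_Lp ?p lborel (u t)" and g: "mem_Lp 2 lborel (g t)" and wg: "weak_gradient (u t) (g t)"
    and v: "mem_Lp 2 lborel (v t)" for t
    using sol by (auto simp: wave_solution_def H1dot_grad_def)
  have gc: "((\<lambda>s. \<integral>x. (norm (g s x - g t x))\<^sup>2 \<partial>lborel) \<longlongrightarrow> 0) (at t)"
    and vc: "((\<lambda>s. \<integral>x. (v s x - v t x)\<^sup>2 \<partial>lborel) \<longlongrightarrow> 0) (at t)" for t
    using sol by (auto simp: wave_solution_def)
  have du: "((\<lambda>s. \<integral>x. u s x * \<phi> x \<partial>lborel) has_real_derivative (\<integral>x. v t x * \<phi> x \<partial>lborel)) (at t)"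
    and dv: "((\<lambda>s. \<integral>x. v s x * \<phi> x \<partial>lborel) has_real_derivative
            - (\<integral>x. frechet_derivative \<phi> (at x) (g t x) \<partial>lborel)) (at t)" if "test_function \<phi>" for \<phi> t
    using sol that by (auto simp: wave_solution_def)
  \<comment> \<open>\<open>a\<close> pairs the time derivatives and \<open>b\<close> the gradients
    of the solution at time \<open>t\<close> and of \<open>Phi X\<close> at time \<open>s\<close>;
    \<open>e\<close> and \<open>c\<close> are their \<open>s\<close> derivatives. The weak equations
    give \<open>- c\<close> and \<open>- e\<close> as the \<open>t\<close> derivatives of
    \<open>a\<close> and \<open>b\<close>, so \<open>a + b\<close> is constant where
    \<open>t - s\<close> is constant.\<close>
  define a where "a t s = (\<integral>x. v t x * Phi (dS X) x s \<partial>lborel)" for t s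
  define e where "e t s = (\<integral>x. v t x * Phi (dS (dS X)) x s \<partial>lborel)" for t s
  define b where "b t s = (\<Sum>i\<in>Basis. \<integral>x. (g t x \<bullet> i) * Phi (mW i (dS X)) x s \<partial>lborel)" for t s
  define c where "c t s = (\<Sum>i\<in>Basis. \<integral>x. (g t x \<bullet> i) * Phi (mW i (dS (dS X))) x s \<partial>lborel)" for t s
  have b: "b t s = - (\<integral>x. u t x * Phi (dS (dS X)) x s \<partial>lborel)" for t s
    unfolding b_def by (rule weak_gradient_pairing(1)[OF wg V u p g])
  have c: "c t s = (\<integral>x. frechet_derivative (\<lambda>x. Phi (dS X) x s) (at x) (g t x) \<partial>lborel)" for t s
    unfolding c_def weak_gradient_pairing(1)[OF wg V1 u p g] weak_gradient_pairing(2)[OF wg V1 u p g] ..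
  have gi: "mem_Lp 2 lborel (\<lambda>x. g t x \<bullet> i)"
    and gci: "((\<lambda>s. \<integral>x. (g s x \<bullet> i - g t x \<bullet> i)\<^sup>2 \<partial>lborel) \<longlongrightarrow> 0) (at t)" if i: "i \<in> Basis" for i t
  proof -
    have [measurable]: "g t \<in> borel_measurable borel" for t using g[of t] by (simp add: mem_Lp_def)
    have sq: "(h \<bullet> i)\<^sup>2 \<le> (norm h)\<^sup>2" for h
      using Basis_le_norm[OF i, of h] by (simp add: abs_le_square_iff[symmetric])
    have "integrable lborel (\<lambda>x. (g t x \<bullet> i)\<^sup>2)"
      by (rule Bochner_Integration.integrable_bound[of _ "\<lambda>x. (norm (g t x))\<^sup>2"])
         (use g[of t] sq in \<open>auto simp: mem_Lp_2_iff\<close>)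
    then show gi: "mem_Lp 2 lborel (\<lambda>x. g t x \<bullet> i)" by (simp add: mem_Lp_2_iff)
    have ig: "integrable lborel (\<lambda>x. (norm (g s x - g t x))\<^sup>2)" for s
    proof (rule Bochner_Integration.integrable_bound)
      show "integrable lborel (\<lambda>x. 2 * (norm (g s x))\<^sup>2 + 2 * (norm (g t x))\<^sup>2)"
        using g[of s] g[of t] by (simp add: mem_Lp_2_iff)
      show "AE x in lborel. norm ((norm (g s x - g t x))\<^sup>2) \<le> norm (2 * (norm (g s x))\<^sup>2 + 2 * (norm (g t x))\<^sup>2)"
      proof (rule AE_I2)
        fix x
        have "(norm (g s x - g t x))\<^sup>2 \<le> (norm (g s x) + norm (g t x))\<^sup>2"
          by (intro power_mono norm_triangle_ineq4) simp
        also have "\<dots> \<le> 2 * (norm (g s x))\<^sup>2 + 2 * (norm (g t x))\<^sup>2"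
          using zero_le_power2[of "norm (g s x) - norm (g t x)"] by (simp add: power2_sum power2_diff)
        finally show "norm ((norm (g s x - g t x))\<^sup>2) \<le> norm (2 * (norm (g s x))\<^sup>2 + 2 * (norm (g t x))\<^sup>2)" by simp
      qed
    qed measurable
    show "((\<lambda>s. \<integral>x. (g s x \<bullet> i - g t x \<bullet> i)\<^sup>2 \<partial>lborel) \<longlongrightarrow> 0) (at t)"
    proof (rule tendsto_sandwich[OF _ _ tendsto_const gc[of t]])
      show "\<forall>\<^sub>F s in at t. 0 \<le> (\<integral>x. (g s x \<bullet> i - g t x \<bullet> i)\<^sup>2 \<partial>lborel)"
        by (rule always_eventually) (auto intro: integral_nonneg_AE)
      have le: "(g s x \<bullet> i - g t x \<bullet> i)\<^sup>2 \<le> (norm (g s x - g t x))\<^sup>2" for s x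
        using sq[of "g s x - g t x"] by (simp add: inner_diff_left)
      have "(\<integral>x. (g s x \<bullet> i - g t x \<bullet> i)\<^sup>2 \<partial>lborel) \<le> (\<integral>x. (norm (g s x - g t x))\<^sup>2 \<partial>lborel)" for s
      proof (rule integral_mono[OF _ ig le])
        show "integrable lborel (\<lambda>x. (g s x \<bullet> i - g t x \<bullet> i)\<^sup>2)"
          by (rule Bochner_Integration.integrable_bound[OF ig]) (use le in auto)
      qed
      then show "\<forall>\<^sub>F s in at t. (\<integral>x. (g s x \<bullet> i - g t x \<bullet> i)\<^sup>2 \<partial>lborel) \<le> (\<integral>x. (norm (g s x - g t x))\<^sup>2 \<partial>lborel)"
        by (intro always_eventually allI)
    qed
  qed
  have two: "(2::real) \<ge> 1" by simp
  have a_s: "((\<lambda>s. a t s) has_real_derivative e t s) (at s)" for t s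
    unfolding a_def e_def by (rule vanishing_pairing_derivative[OF V1 v two])
  have b_s: "((\<lambda>s. b t s) has_real_derivative c t s) (at s)" for t s
    unfolding b_def c_def
  proof (rule DERIV_sum)
    fix i :: 'a assume i: "i \<in> Basis"
    have "Phi (dS (mW i (dS X))) x s = Phi (mW i (dS (dS X))) x s" for x
      by (rule Phi_cong) (rule dS_mW[OF P1])
    then show "((\<lambda>s. \<integral>x. (g t x \<bullet> i) * Phi (mW i (dS X)) x s \<partial>lborel) has_real_derivative
        (\<integral>x. (g t x \<bullet> i) * Phi (mW i (dS (dS X))) x s \<partial>lborel)) (at s)"
      using vanishing_pairing_derivative[OF vanishing_mW[OF V i] gi[OF i] two, of t s] by simp
  qed
  have e_cont: "isCont (\<lambda>(t, s). e t s) q" for q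
    using pairing_isCont[OF V2 v vc, of "fst q" "snd q"] by (simp add: e_def)
  have c_cont: "isCont (\<lambda>(t, s). c t s) q" for q
  proof -
    have "isCont (\<lambda>p. \<Sum>i\<in>Basis. (\<lambda>(t, s). \<integral>x. (g t x \<bullet> i) * Phi (mW i (dS (dS X))) x s \<partial>lborel) p) (fst q, snd q)"
      by (intro continuous_sum pairing_isCont[OF vanishing_mW[OF V1] gi gci])
    then show ?thesis by (simp add: c_def case_prod_unfold)
  qed
  \<comment> \<open>The conserved quantity is evaluated at \<open>t = k\<close>, where the test wave
    is at time 0, and at \<open>t = t0\<close>; later \<open>k\<close> is \<open>t0 + s\<close> and
    \<open>t0 - s\<close>.\<close>
  have const: "a k 0 + b k 0 = a t0 (t0 - k) + b t0 (t0 - k)" for k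
  proof -
    have "((\<lambda>t. a t (t - k) + b t (t - k)) has_real_derivative 0) (at t)" for t
    proof -
      have "((\<lambda>t. a t (t - k)) has_real_derivative - c t (t - k) + e t (t - k)) (at t)"
        by (rule DERIV_diagonal[OF a_s _ e_cont])
           (unfold a_def c, rule dv[OF vanishing_test_function[OF V1]])
      moreover have "((\<lambda>t. b t (t - k)) has_real_derivative - e t (t - k) + c t (t - k)) (at t)"
        by (rule DERIV_diagonal[OF b_s _ c_cont])
           (unfold b e_def, rule DERIV_minus[OF du[OF vanishing_test_function[OF V2]]])
      ultimately have "((\<lambda>t. a t (t - k) + b t (t - k)) has_real_derivative
          (- c t (t - k) + e t (t - k)) + (- e t (t - k) + c t (t - k))) (at t)" by (rule DERIV_add)
      then show ?thesis by simp
    qed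
    from DERIV_isconst_all[OF allI, OF this, of k t0] show ?thesis by simp
  qed
  have a_even: "a t (- s) = a t s" and b_odd: "b t (- s) = - b t s" for t s
    unfolding a_def b odd_wave_parity[OF X] by simp_all
  have b0: "b t 0 = 0" for t using b_odd[of t 0] by simp
  have "a (t0 + s) 0 = a t0 s - b t0 s" using const[of "t0 + s"] a_even[of t0 s] b_odd[of t0 s] b0 by simp
  moreover have "a (t0 - s) 0 = a t0 s + b t0 s" using const[of "t0 - s"] b0 by simp
  ultimately show ?thesis by (simp add: a_def)
qed

section \<open>Test waves at late times and orthogonality\<close>

lemma power_diff_le:
  fixes a b :: real
  assumes "0 \<le> b" "b \<le> a"
  shows "a ^ n - b ^ n \<le> (a - b) * (real n * a ^ (n - 1))"
proof (induction n)
  case (Suc n)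
  have "a ^ Suc n - b ^ Suc n = a * (a ^ n - b ^ n) + (a - b) * b ^ n" by (simp add: algebra_simps)
  also have "\<dots> \<le> a * ((a - b) * (real n * a ^ (n - 1))) + (a - b) * a ^ n"
    using Suc assms by (intro add_mono mult_left_mono power_mono) auto
  also have "\<dots> = (a - b) * (real (Suc n) * a ^ (Suc n - 1))"
    by (cases n) (simp_all add: algebra_simps)
  finally show ?case .
qed simp

text \<open>A difference of two ball volumes: at fixed width the shell has volume of order
  \<open>s ^ (d - 1)\<close>, by \<open>power_diff_le\<close>.\<close>

lemma measure_shell_le:
  fixes \<rho> :: real
  assumes dim: "DIM('a::euclidean_space) = 2 * m + 3" and \<rho>: "\<rho> > 0"
  shows "\<exists>C\<ge>0. \<forall>s\<ge>2 * \<rho>. integrable lborel (indicator (ball (0::'a) (s + 2 * \<rho>) - ball 0 (s - 2 * \<rho>)) :: 'a \<Rightarrow> real) \<and>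
    (\<integral>x. indicator (ball (0::'a) (s + 2 * \<rho>) - ball 0 (s - 2 * \<rho>)) x \<partial>lborel) \<le> C * s ^ (2 * m + 2)"
proof -
  define U where "U = unit_ball_vol (real DIM('a))"
  have U: "U \<ge> 0" by (simp add: U_def)
  define C where "C = U * (4 * \<rho> * (real (2 * m + 3) * 2 ^ (2 * m + 2)))"
  have "integrable lborel (indicator (ball (0::'a) (s + 2 * \<rho>) - ball 0 (s - 2 * \<rho>)) :: 'a \<Rightarrow> real) \<and>
    (\<integral>x. indicator (ball (0::'a) (s + 2 * \<rho>) - ball 0 (s - 2 * \<rho>)) x \<partial>lborel) \<le> C * s ^ (2 * m + 2)"
    if s: "s \<ge> 2 * \<rho>" for s
  proof
    let ?A = "ball (0::'a) (s + 2 * \<rho>)" and ?B = "ball (0::'a) (s - 2 * \<rho>)"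
    have fin: "emeasure lborel ?A \<noteq> \<infinity>" "emeasure lborel ?B \<noteq> \<infinity>"
      using emeasure_bounded_finite[OF bounded_ball[of "0::'a"]] by (auto simp: less_top)
    have "emeasure lborel (?A - ?B) \<le> emeasure lborel ?A" by (intro emeasure_mono) auto
    then have "emeasure lborel (?A - ?B) < \<infinity>" using fin(1) by (auto simp: less_top[symmetric] top_unique)
    then show "integrable lborel (indicator (?A - ?B) :: 'a \<Rightarrow> real)"
      by (intro integrable_real_indicator) auto
    have "(\<integral>x. indicator (?A - ?B) x \<partial>lborel) = measure lborel (?A - ?B)" by simp
    also have "\<dots> = measure lborel ?A - measure lborel ?B"
      by (rule measure_Diff[OF fin(1)]) (use \<rho> in auto)
    also have "\<dots> = U * ((s + 2 * \<rho>) ^ (2 * m + 3) - (s - 2 * \<rho>) ^ (2 * m + 3))"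
      using content_ball[of "s + 2 * \<rho>" "0::'a"] content_ball[of "s - 2 * \<rho>" "0::'a"] s \<rho> dim
      by (simp add: U_def right_diff_distrib)
    also have "\<dots> \<le> U * (4 * \<rho> * (real (2 * m + 3) * (s + 2 * \<rho>) ^ (2 * m + 2)))"
      using power_diff_le[of "s - 2 * \<rho>" "s + 2 * \<rho>" "2 * m + 3"] s \<rho> by (intro mult_left_mono U) simp
    also have "\<dots> \<le> U * (4 * \<rho> * (real (2 * m + 3) * (2 * s) ^ (2 * m + 2)))"
      using s \<rho> by (intro mult_left_mono U power_mono) auto
    also have "\<dots> = C * s ^ (2 * m + 2)" unfolding C_def power_mult_distrib by (simp only: mult.assoc)
    finally show "(\<integral>x. indicator (?A - ?B) x \<partial>lborel) \<le> C * s ^ (2 * m + 2)" .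
  qed
  moreover have "C \<ge> 0" using U \<rho> by (simp add: C_def)
  ultimately show ?thesis by blast
qed

text \<open>The wave vanishes outside by assumption and inside by \<open>Phi_eq_0_inside\<close>. In
  between, \<open>|x| \<ge> s / 2\<close> and \<open>|x| - s + 2 \<rho> \<le> 3 \<rho>\<close>, so
  \<open>Phi_cap_bound\<close> gives the amplitude \<open>s^-(m + 1)\<close>.\<close>

lemma vanishing_shell_bound:
  fixes F :: "real \<times> 'a::euclidean_space \<Rightarrow> real"
  assumes dim: "DIM('a) = 2 * m + 3" and \<rho>: "\<rho> > 0" and F: "vanishing \<rho> F"
  shows "\<exists>C\<ge>0. \<forall>s\<ge>2 * \<rho>. \<forall>x. \<bar>Phi F x s\<bar> \<le> C / s ^ Suc m * indicator (ball 0 (s + 2 * \<rho>) - ball 0 (s - 2 * \<rho>)) x"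
proof -
  note P = vanishing_profile[OF F]
  obtain C where C: "C \<ge> 0" "\<And>x t \<delta>. x \<noteq> 0 \<Longrightarrow> \<delta> \<ge> 0 \<Longrightarrow> norm x - \<bar>t\<bar> + 2 * \<rho> \<le> \<delta> \<Longrightarrow>
      norm x ^ Suc m * \<bar>Phi F x t\<bar> \<le> C * \<delta> ^ m"
    using Phi_cap_bound[OF dim \<rho> P] by blast
  define C' where "C' = 2 ^ Suc m * (C * (3 * \<rho>) ^ m)"
  have "\<bar>Phi F x s\<bar> \<le> C' / s ^ Suc m * indicator (ball 0 (s + 2 * \<rho>) - ball 0 (s - 2 * \<rho>)) x"
    if s: "s \<ge> 2 * \<rho>" for s x
  proof -
    have s0: "s > 0" using s \<rho> by linarith
    consider "norm x > s + \<rho>" | "norm x < s - \<rho>" | "s - \<rho> \<le> norm x" "norm x \<le> s + \<rho>" by linarith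
    then show ?thesis
    proof cases
      case 1
      then have "Phi F x s = 0" using vanishing_eq_0[OF F, of s x] s0 by simp
      then show ?thesis using C(1) \<rho> s0 by (simp add: C'_def)
    next
      case 2
      then have "Phi F x s = 0" using Phi_eq_0_inside[OF P, where x=x and t=s] s0 by simp
      then show ?thesis using C(1) \<rho> s0 by (simp add: C'_def)
    next
      case 3
      have x: "x \<noteq> 0" "norm x \<ge> s / 2" using 3 s \<rho> by auto
      have "(s / 2) ^ Suc m * \<bar>Phi F x s\<bar> \<le> norm x ^ Suc m * \<bar>Phi F x s\<bar>"
        using x s0 by (intro mult_right_mono power_mono) auto
      also have "\<dots> \<le> C * (3 * \<rho>) ^ m"
        using C(2)[OF x(1), of "3 * \<rho>" s] 3 \<rho> s0 by simp
      finally have "s ^ Suc m * \<bar>Phi F x s\<bar> \<le> C'"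
        unfolding C'_def power_divide by (simp add: field_simps)
      then have "\<bar>Phi F x s\<bar> \<le> C' / s ^ Suc m" using s0 by (simp add: pos_le_divide_eq mult.commute)
      moreover have "x \<in> ball 0 (s + 2 * \<rho>) - ball 0 (s - 2 * \<rho>)" using 3 \<rho> by auto
      ultimately show ?thesis by simp
    qed
  qed
  moreover have "C' \<ge> 0" using C(1) \<rho> by (simp add: C'_def)
  ultimately show ?thesis by blast
qed

text \<open>The squared amplitude \<open>s^-(2 m + 2)\<close> balances the shell volume
  \<open>s ^ (2 * m + 2)\<close> exactly.\<close>

lemma vanishing_L2_bounded:
  fixes F :: "real \<times> 'a::euclidean_space \<Rightarrow> real"
  assumes dim: "DIM('a) = 2 * m + 3" and \<rho>: "\<rho> > 0" and F: "vanishing \<rho> F"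
  shows "\<exists>C. \<forall>s\<ge>2 * \<rho>. (\<integral>x. (Phi F x s)\<^sup>2 \<partial>lborel) \<le> C"
proof -
  obtain C where C: "C \<ge> 0" "\<And>s x. s \<ge> 2 * \<rho> \<Longrightarrow>
      \<bar>Phi F x s\<bar> \<le> C / s ^ Suc m * indicator (ball 0 (s + 2 * \<rho>) - ball 0 (s - 2 * \<rho>)) x"
    using vanishing_shell_bound[OF dim \<rho> F] by blast
  obtain K where K: "K \<ge> 0"
    "\<And>s. s \<ge> 2 * \<rho> \<Longrightarrow> integrable lborel (indicator (ball (0::'a) (s + 2 * \<rho>) - ball 0 (s - 2 * \<rho>)) :: 'a \<Rightarrow> real)"
    "\<And>s. s \<ge> 2 * \<rho> \<Longrightarrow> (\<integral>x. indicator (ball (0::'a) (s + 2 * \<rho>) - ball 0 (s - 2 * \<rho>)) x \<partial>lborel) \<le> K * s ^ (2 * m + 2)"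
    using measure_shell_le[OF dim \<rho>] by blast
  have "(\<integral>x. (Phi F x s)\<^sup>2 \<partial>lborel) \<le> C\<^sup>2 * K" if s: "s \<ge> 2 * \<rho>" for s
  proof -
    let ?I = "indicator (ball (0::'a) (s + 2 * \<rho>) - ball 0 (s - 2 * \<rho>)) :: 'a \<Rightarrow> real"
    have s0: "s > 0" using s \<rho> by linarith
    have "(\<integral>x. (Phi F x s)\<^sup>2 \<partial>lborel) \<le> (\<integral>x. (C / s ^ Suc m)\<^sup>2 * ?I x \<partial>lborel)"
    proof (rule integral_mono)
      show "integrable lborel (\<lambda>x. (Phi F x s)\<^sup>2)" using vanishing_L2_bound(1)[OF F] by (simp add: mem_Lp_2_iff)
      show "integrable lborel (\<lambda>x. (C / s ^ Suc m)\<^sup>2 * ?I x)" by (intro integrable_mult_right K(2) s)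
      show "(Phi F x s)\<^sup>2 \<le> (C / s ^ Suc m)\<^sup>2 * ?I x" for x
        using power_mono[OF C(2)[OF s, of x], of 2]
        by (cases "x \<in> ball 0 (s + 2 * \<rho>) - ball 0 (s - 2 * \<rho>)") (simp_all only: indicator_simps power2_abs power_mult_distrib abs_ge_zero, simp_all)
    qed
    also have "\<dots> = (C / s ^ Suc m)\<^sup>2 * (\<integral>x. ?I x \<partial>lborel)" by (rule Bochner_Integration.integral_mult_right_zero)
    also have "\<dots> \<le> (C / s ^ Suc m)\<^sup>2 * (K * s ^ (2 * m + 2))"
      by (rule mult_left_mono[OF K(3)[OF s]]) simp
    also have "\<dots> = C\<^sup>2 * K"
    proof -
      have "(s ^ Suc m)\<^sup>2 = s ^ (2 * m + 2)" by (simp add: power_mult[symmetric] power_add[symmetric] power2_eq_square mult_2)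
      then show ?thesis using s0 by (simp add: power_divide)
    qed
    finally show ?thesis .
  qed
  then show ?thesis by blast
qed

text \<open>\<open>2 * m + 1\<close> is the least number of derivatives above the degree
  \<open>2 * m\<close> of the weight, which confines the support, and it is odd, so the even bump
  yields a wave odd in time.\<close>

lemma odd_wave_tr_bump:
  fixes y :: "'a::euclidean_space"
  assumes dim: "DIM('a) = 2 * m + 3" and \<epsilon>: "\<epsilon> > 0"
  shows "odd_wave (\<epsilon> + norm y) (tr y ((dS ^^ (2 * m + 1)) (bump \<epsilon>)))"
proof -
  let ?b = "bump \<epsilon> :: real \<times> 'a \<Rightarrow> real"
  let ?X = "(dS ^^ (2 * m + 1)) ?b"
  have b: "profile \<epsilon> ?b" by (rule profile_bump[OF \<epsilon>])
  have X: "profile \<epsilon> ?X" by (rule profile_funpow_dS[OF b])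
  have uX: "uniform_profile ?X" by (rule uniform_profile_funpow_dS[OF b uniform_profile_bump])
  have out: "Phi ?X x t = 0" if "norm x > \<bar>t\<bar> + \<epsilon>" for x t
    by (rule Phi_uniform_eq_0_outside[OF dim \<epsilon> b uniform_profile_bump that]) simp
  define e where "e = (SOME i::'a. i \<in> Basis)"
  have e1: "norm e = 1" using norm_Basis[OF SOME_Basis] by (simp add: e_def)
  then have e0: "e \<noteq> 0" by auto
  have odd: "Phi ?X x (- t) = - Phi ?X x t" for x t
  proof -
    define \<theta> where "\<theta> = (if x = 0 then e else x /\<^sub>R norm x)"
    have \<theta>: "norm \<theta> = 1" "x = norm x *\<^sub>R \<theta>" using e1 by (auto simp: \<theta>_def)
    let ?f = "\<lambda>s. ?X (norm x * s + - t, e) * (1 - s\<^sup>2) ^ m"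
    have "integral {-1..1} ?f = integral {-1..1} (\<lambda>s. ?f (- s))"
      using Henstock_Kurzweil_Integration.integral_reflect_real[of 1 "- 1" ?f, symmetric] by (simp only: minus_minus)
    also have "(\<lambda>s. ?f (- s)) = (\<lambda>s. - (?X (norm x * s + t, e) * (1 - s\<^sup>2) ^ m))"
    proof
      fix s
      have "?X (norm x * - s + - t, e) = ?X (- (norm x * s + t), e)" by (simp only: mult_minus_right minus_add_distrib)
      also have "\<dots> = (- 1) ^ (2 * m + 1) * ?X (norm x * s + t, e)"
        by (rule funpow_dS_parity[OF b _ e0]) (simp add: bump_def)
      finally have "?X (norm x * - s + - t, e) = - ?X (norm x * s + t, e)" by simp
      then show "?f (- s) = - (?X (norm x * s + t, e) * (1 - s\<^sup>2) ^ m)" by (simp only: power2_minus mult_minus_left)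
    qed
    finally have "integral {-1..1} ?f = - integral {-1..1} (\<lambda>s. ?X (norm x * s + t, e) * (1 - s\<^sup>2) ^ m)"
      by (simp only: integral_neg)
    then show ?thesis
      using Phi_uniform[OF dim X uX \<theta>(1) e0, of "norm x" "- t"] Phi_uniform[OF dim X uX \<theta>(1) e0, of "norm x" t]
      unfolding \<theta>(2)[symmetric] by (simp only: mult_minus_right)
  qed
  have "Phi (tr y ?X) x t = 0" if "norm x > \<bar>t\<bar> + (\<epsilon> + norm y)" for x t
    unfolding Phi_tr by (rule out) (use that norm_triangle_ineq2[of x y] in linarith)
  then show ?thesis
    unfolding odd_wave_def vanishing_def using profile_tr[OF X, of y] odd by (simp only: Phi_tr) blast
qed

lemma Phi_dS_tr_bump:
  fixes x y :: "'a::euclidean_space"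
  assumes \<epsilon>: "\<epsilon> > 0"
  shows "Phi (dS (tr y ((dS ^^ k) (bump \<epsilon>)))) x 0 = Phi ((dS ^^ Suc k) (bump 1)) ((x - y) /\<^sub>R \<epsilon>) 0 / \<epsilon> ^ Suc k"
proof -
  have X: "profile \<epsilon> ((dS ^^ k) (bump \<epsilon>) :: real \<times> 'a \<Rightarrow> real)" by (rule profile_funpow_dS[OF profile_bump[OF \<epsilon>]])
  have "Phi (dS (tr y ((dS ^^ k) (bump \<epsilon>)))) x 0 = Phi (tr y (dS ((dS ^^ k) (bump \<epsilon>)))) x 0"
    by (rule Phi_cong) (rule dS_tr[OF X])
  also have "\<dots> = Phi ((dS ^^ Suc k) (bump \<epsilon>)) (x - y) 0" by (simp add: Phi_tr)
  also have "\<dots> = (\<integral>\<omega>. (dS ^^ Suc k) (bump 1) (((x - y) /\<^sub>R \<epsilon>) \<bullet> \<omega> + 0, \<omega>) / \<epsilon> ^ Suc k \<partial>sphere_measure)"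
    unfolding Phi_def
  proof (intro Bochner_Integration.integral_cong refl)
    fix \<omega> :: 'a assume "\<omega> \<in> space sphere_measure"
    then have w: "\<omega> \<noteq> 0" by auto
    have "((x - y) \<bullet> \<omega> + 0) / \<epsilon> = ((x - y) /\<^sub>R \<epsilon>) \<bullet> \<omega> + 0" by (simp add: divide_inverse mult.commute)
    then show "(dS ^^ Suc k) (bump \<epsilon>) ((x - y) \<bullet> \<omega> + 0, \<omega>) = (dS ^^ Suc k) (bump 1) (((x - y) /\<^sub>R \<epsilon>) \<bullet> \<omega> + 0, \<omega>) / \<epsilon> ^ Suc k"
      using funpow_dS_bump_scale[OF \<epsilon> w, of "Suc k" "(x - y) \<bullet> \<omega> + 0"] by (simp only:)
  qed
  also have "\<dots> = Phi ((dS ^^ Suc k) (bump 1)) ((x - y) /\<^sub>R \<epsilon>) 0 / \<epsilon> ^ Suc k"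
    unfolding Phi_def by (rule Bochner_Integration.integral_divide_zero)
  finally show ?thesis .
qed

text \<open>At time 0 the waves \<open>Phi (dS X)\<close> built from translated and dilated bumps
  are rescaled copies of one function with nonzero integral, which is what
  \<open>AE_eq_0_if_mollified_eq_0\<close> asks for.\<close>

lemma AE_eq_0_if_odd_waves_orthogonal:
  fixes z :: "'a::euclidean_space \<Rightarrow> real"
  assumes dim: "DIM('a) = 2 * m + 3" and z: "z \<in> borel_measurable borel"
    and loc: "\<And>\<rho>. integrable lborel (\<lambda>x. z x * indicator (ball 0 \<rho>) x)"
    and orth: "\<And>\<rho> X. \<rho> > 0 \<Longrightarrow> odd_wave \<rho> X \<Longrightarrow> (\<integral>x. z x * Phi (dS X) x 0 \<partial>lborel) = 0"
  shows "AE x in lborel. z x = 0"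
proof -
  let ?\<psi> = "\<lambda>x::'a. Phi ((dS ^^ (2 * m + 2)) (bump 1)) x 0"
  have b: "profile 1 (bump 1 :: real \<times> 'a \<Rightarrow> real)" by (rule profile_bump) simp
  show ?thesis
  proof (rule AE_eq_0_if_mollified_eq_0[OF z loc, of ?\<psi>])
    show "continuous_on UNIV ?\<psi>" by (rule Phi_continuous_on[OF profile_funpow_dS[OF b]])
    show "?\<psi> x = 0" if "norm x > 1" for x
      by (rule Phi_uniform_eq_0_outside[OF dim _ b uniform_profile_bump]) (use that in auto)
    show "(\<integral>x. ?\<psi> x \<partial>lborel) \<noteq> 0" by (rule integral_Phi_bump_nonzero[OF dim])
    fix \<epsilon> :: real and y :: 'a assume \<epsilon>: "0 < \<epsilon>" "\<epsilon> \<le> 1"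
    have pos: "\<epsilon> + norm y > 0" using \<epsilon> by (simp add: add_pos_nonneg)
    have 22: "Suc (2 * m + 1) = 2 * m + 2" by simp
    have "(\<integral>x. z x * (?\<psi> ((x - y) /\<^sub>R \<epsilon>) / \<epsilon> ^ (2 * m + 2)) \<partial>lborel) = 0"
      using orth[OF pos odd_wave_tr_bump[OF dim \<epsilon>(1), of y]]
      unfolding Phi_dS_tr_bump[OF \<epsilon>(1)] 22 .
    then show "(\<integral>x. z x * ?\<psi> ((x - y) /\<^sub>R \<epsilon>) \<partial>lborel) = 0"
      using \<epsilon> by (simp add: times_divide_eq_right)
  qed
qed

lemma mem_Lp_locally_integrable:
  fixes f :: "'a::euclidean_space \<Rightarrow> real"
  assumes "mem_Lp p lborel f" "p \<ge> 1"
  shows "integrable lborel (\<lambda>x. f x * indicator (ball 0 \<rho>) x)"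
  by (rule mem_Lp_mult_integrable[OF assms, where M=1 and K=\<rho>]) (auto simp: indicator_def)

text \<open>Hoelder's inequality by hand: \<open>w\<close> is split at a level \<open>L\<close>, and
  \<open>L = \<eta> / s ^ m\<close> bounds the part below the level by a multiple of
  \<open>\<eta> s\<close> and the part above it by a multiple of \<open>s\<close> to the power
  \<open>1 - 2 / (2 m + 1)\<close>. Dividing by \<open>s\<close> and letting \<open>s\<close> tend
  to infinity, then \<open>\<eta>\<close> to 0, leaves \<open>a = 0\<close>.\<close>

lemma odd_wave_pairing_bound:
  fixes w :: "'a::euclidean_space \<Rightarrow> real"
  assumes dim: "DIM('a) = 2 * m + 3" and \<rho>: "\<rho> > 0" and X: "odd_wave \<rho> X"
    and w: "w \<in> borel_measurable borel" "integrable lborel (\<lambda>x. \<bar>w x\<bar> powr (2 * real DIM('a) / (real DIM('a) - 2)))"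
    and iw: "\<And>s. integrable lborel (\<lambda>x. w x * Phi X x s)"
    and lin: "\<And>s. (\<integral>x. w x * Phi X x s \<partial>lborel) = a * s"
  shows "a = 0"
proof -
  define p where "p = 2 * real DIM('a) / (real DIM('a) - 2)"
  have p1: "p - 1 = (2 * real m + 5) / (2 * real m + 1)" by (simp add: p_def dim field_simps)
  have p: "p > 1" using p1 by (smt (verit) divide_pos_pos of_nat_0_le_iff)
  define J where "J = (\<integral>x. \<bar>w x\<bar> powr p \<partial>lborel)"
  have J: "J \<ge> 0" by (simp add: J_def)
  have V: "vanishing \<rho> X" using X by (simp add: odd_wave_def)
  obtain C where C: "C \<ge> 0" "\<And>s x. s \<ge> 2 * \<rho> \<Longrightarrow>
      \<bar>Phi X x s\<bar> \<le> C / s ^ Suc m * indicator (ball 0 (s + 2 * \<rho>) - ball 0 (s - 2 * \<rho>)) x"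
    using vanishing_shell_bound[OF dim \<rho> V] by blast
  obtain K where K: "K \<ge> 0"
    "\<And>s. s \<ge> 2 * \<rho> \<Longrightarrow> integrable lborel (indicator (ball (0::'a) (s + 2 * \<rho>) - ball 0 (s - 2 * \<rho>)) :: 'a \<Rightarrow> real)"
    "\<And>s. s \<ge> 2 * \<rho> \<Longrightarrow> (\<integral>x. indicator (ball (0::'a) (s + 2 * \<rho>) - ball 0 (s - 2 * \<rho>)) x \<partial>lborel) \<le> K * s ^ (2 * m + 2)"
    using measure_shell_le[OF dim \<rho>] by blast
  have main: "\<bar>a\<bar> \<le> C * (\<eta> * K + \<eta> powr (1 - p) * J * s powr (- 2 / (2 * real m + 1)))"
    if s: "s \<ge> 2 * \<rho>" and \<eta>: "\<eta> > 0" for s \<eta>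
  proof -
    let ?I = "indicator (ball (0::'a) (s + 2 * \<rho>) - ball 0 (s - 2 * \<rho>)) :: 'a \<Rightarrow> real"
    have s0: "s > 0" using s \<rho> by linarith
    define L where "L = \<eta> / s ^ m"
    have L: "L > 0" using \<eta> s0 by (simp add: L_def)
    have "\<bar>a * s\<bar> \<le> (\<integral>x. \<bar>w x * Phi X x s\<bar> \<partial>lborel)" unfolding lin[symmetric] by (rule integral_abs_bound)
    also have "\<dots> \<le> (\<integral>x. C / s ^ Suc m * (L * ?I x + L powr (1 - p) * \<bar>w x\<bar> powr p) \<partial>lborel)"
    proof (rule integral_mono[OF integrable_abs[OF iw]])
      show "integrable lborel (\<lambda>x. C / s ^ Suc m * (L * ?I x + L powr (1 - p) * \<bar>w x\<bar> powr p))"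
        using w(2) K(2)[OF s] unfolding p_def by (intro integrable_mult_right Bochner_Integration.integrable_add)
      fix x
      have "\<bar>w x\<bar> * ?I x \<le> L * ?I x + L powr (1 - p) * \<bar>w x\<bar> powr p"
      proof (cases "\<bar>w x\<bar> \<le> L")
        case True
        then have "\<bar>w x\<bar> * ?I x \<le> L * ?I x" by (rule mult_right_mono) simp
        then show ?thesis by (rule order_trans) simp
      next
        case False
        then have "\<bar>w x\<bar> powr (1 - p) \<le> L powr (1 - p)" using L p by (intro powr_mono2') auto
        then have "\<bar>w x\<bar> powr (1 - p) * \<bar>w x\<bar> powr p \<le> L powr (1 - p) * \<bar>w x\<bar> powr p" by (rule mult_right_mono) simp
        moreover have "\<bar>w x\<bar> powr (1 - p) * \<bar>w x\<bar> powr p = \<bar>w x\<bar>"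
          using False L by (simp add: powr_add[symmetric])
        moreover have "\<bar>w x\<bar> * ?I x \<le> \<bar>w x\<bar>" "0 \<le> L * ?I x" using L by (auto simp: indicator_def)
        ultimately show ?thesis by linarith
      qed
      then have "C / s ^ Suc m * (\<bar>w x\<bar> * ?I x) \<le> C / s ^ Suc m * (L * ?I x + L powr (1 - p) * \<bar>w x\<bar> powr p)"
        using C(1) s0 by (intro mult_left_mono) auto
      moreover have "\<bar>w x * Phi X x s\<bar> \<le> \<bar>w x\<bar> * (C / s ^ Suc m * ?I x)"
        unfolding abs_mult by (rule mult_left_mono[OF C(2)[OF s]]) simp
      ultimately show "\<bar>w x * Phi X x s\<bar> \<le> C / s ^ Suc m * (L * ?I x + L powr (1 - p) * \<bar>w x\<bar> powr p)"
        by (simp only: mult.left_commute)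
    qed
    also have "\<dots> = C / s ^ Suc m * (L * (\<integral>x. ?I x \<partial>lborel) + L powr (1 - p) * J)"
    proof -
      have "integrable lborel (\<lambda>x. L * ?I x)" "integrable lborel (\<lambda>x. L powr (1 - p) * \<bar>w x\<bar> powr p)"
        using w(2) K(2)[OF s] unfolding p_def by (auto intro!: integrable_mult_right)
      from Bochner_Integration.integral_add[OF this] show ?thesis
        unfolding J_def Bochner_Integration.integral_mult_right_zero by (simp only: Bochner_Integration.integral_mult_right_zero)
    qed
    also have "\<dots> \<le> C / s ^ Suc m * (L * (K * s ^ (2 * m + 2)) + L powr (1 - p) * J)"
      using C(1) s0 L by (intro mult_left_mono add_right_mono K(3) s) auto
    finally have 1: "\<bar>a\<bar> * s \<le> C / s ^ Suc m * (L * (K * s ^ (2 * m + 2)) + L powr (1 - p) * J)"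
      using s0 by (simp add: abs_mult)
    have 2: "L * (K * s ^ (2 * m + 2)) = s ^ (m + 2) * (\<eta> * K)"
    proof -
      have "s ^ (2 * m + 2) = s ^ m * s ^ (m + 2)" by (simp add: power_add[symmetric] mult_2)
      then show ?thesis using s0 by (simp add: L_def)
    qed
    have 3: "L powr (1 - p) = s ^ (m + 2) * (\<eta> powr (1 - p) * s powr (- 2 / (2 * real m + 1)))"
    proof -
      \<comment> \<open>Here the value of \<open>p\<close> decides: \<open>m (p - 1)\<close> falls
        short of \<open>m + 2\<close> by \<open>2 / (2 m + 1)\<close>, which makes the growth
        sublinear.\<close>
      have ex: "real m * (p - 1) = real (m + 2) + - 2 / (2 * real m + 1)"
        unfolding p1 by (simp add: divide_simps) (simp add: algebra_simps)
      have "L powr (1 - p) = \<eta> powr (1 - p) * (s powr real m) powr (p - 1)"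
        using \<eta> s0 by (simp add: L_def powr_divide powr_realpow powr_diff divide_simps powr_minus)
      also have "(s powr real m) powr (p - 1) = s powr (real (m + 2)) * s powr (- 2 / (2 * real m + 1))"
        unfolding powr_powr ex powr_add ..
      also have "s powr (real (m + 2)) = s ^ (m + 2)" using s0 by (rule powr_realpow)
      finally show ?thesis by (simp only: mult_ac)
    qed
    have "s ^ (m + 2) = s ^ Suc m * s" by simp
    then have "C / s ^ Suc m * (L * (K * s ^ (2 * m + 2)) + L powr (1 - p) * J) =
        C * (\<eta> * K + \<eta> powr (1 - p) * J * s powr (- 2 / (2 * real m + 1))) * s"
      unfolding 2 3 using s0 by (simp add: field_simps)
    with 1 show ?thesis using s0 by simp
  qed
  have lim: "((\<lambda>s. C * (\<eta> * K + \<eta> powr (1 - p) * J * s powr (- 2 / (2 * real m + 1)))) \<longlongrightarrow> C * (\<eta> * K)) at_top" for \<eta>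
  proof -
    have "((\<lambda>s::real. s powr (- 2 / (2 * real m + 1))) \<longlongrightarrow> 0) at_top"
      by (rule tendsto_neg_powr[OF _ filterlim_ident]) (simp add: divide_neg_pos add_nonneg_pos)
    then have "((\<lambda>s. C * (\<eta> * K + \<eta> powr (1 - p) * J * s powr (- 2 / (2 * real m + 1)))) \<longlongrightarrow>
        C * (\<eta> * K + \<eta> powr (1 - p) * J * 0)) at_top"
      by (intro tendsto_intros)
    then show ?thesis by simp
  qed
  have le: "\<bar>a\<bar> \<le> C * (\<eta> * K)" if "\<eta> > 0" for \<eta>
    by (rule tendsto_lowerbound[OF lim[of \<eta>]])
       (use main[OF _ that] in \<open>auto simp: eventually_at_top_linorder\<close>)
  have lim0: "((\<lambda>\<eta>. C * (\<eta> * K)) \<longlongrightarrow> C * (0 * K)) (at_right 0)" by (intro tendsto_intros)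
  have "\<bar>a\<bar> \<le> C * (0 * K)"
    by (rule tendsto_lowerbound[OF lim0]) (use le in \<open>auto simp: eventually_at_right_field intro!: exI[of _ 1]\<close>)
  then show ?thesis by simp
qed

theorem wave_solution_unique:
  fixes u U v V :: "real \<Rightarrow> 'a::euclidean_space \<Rightarrow> real"
  assumes dim: "DIM('a) = 2 * m + 3" and s1: "wave_solution u g v" and s2: "wave_solution U \<Gamma> V"
    and decay: "((\<lambda>t. \<integral>x. (v t x - V t x)\<^sup>2 \<partial>lborel) \<longlongrightarrow> 0) at_bot"
  shows "AE x in lborel. v t x = V t x" and "AE x in lborel. u t x = U t x"
proof -
  let ?p = "2 * real DIM('a) / (real DIM('a) - 2)"
  have p: "?p \<ge> 1" and d3: "DIM('a) \<ge> 3" using dim by (simp_all add: field_simps)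
  have two: "(2::real) \<ge> 1" by simp
  have sol: "mem_Lp ?p lborel (u t)" "mem_Lp 2 lborel (g t)" "weak_gradient (u t) (g t)" "mem_Lp 2 lborel (v t)"
    "mem_Lp ?p lborel (U t)" "mem_Lp 2 lborel (\<Gamma> t)" "weak_gradient (U t) (\<Gamma> t)" "mem_Lp 2 lborel (V t)" for t
    using s1 s2 by (auto simp: wave_solution_def H1dot_grad_def)
  have bm: "u t \<in> borel_measurable borel" "U t \<in> borel_measurable borel"
    "v t \<in> borel_measurable borel" "V t \<in> borel_measurable borel" for t
    using sol[of t] by (auto simp: mem_Lp_def)
  define z where "z t x = v t x - V t x" for t x
  have z2: "mem_Lp 2 lborel (z t)" for t unfolding z_def by (rule mem_Lp_2_diff[OF sol(4,8)])
  define N where "N t = (\<integral>x. (z t x)\<^sup>2 \<partial>lborel)" for t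
  have N: "(N \<longlongrightarrow> 0) at_bot" using decay by (simp add: N_def[abs_def] z_def)
  have orth: "(\<integral>x. z t x * Phi (dS X) x 0 \<partial>lborel) = 0" if \<rho>: "\<rho> > 0" and X: "odd_wave \<rho> X" for \<rho> X t
  proof -
    have W: "vanishing \<rho> (dS X)" using X vanishing_dS by (auto simp: odd_wave_def)
    define A where "A t s = (\<integral>x. z t x * Phi (dS X) x s \<partial>lborel)" for t s
    have A: "A t s = (\<integral>x. v t x * Phi (dS X) x s \<partial>lborel) - (\<integral>x. V t x * Phi (dS X) x s \<partial>lborel)" for t s
      unfolding A_def z_def left_diff_distrib
      by (rule Bochner_Integration.integral_diff) (rule vanishing_integrable[OF W _ two], rule sol)+
    have dal: "A (t0 + s) 0 + A (t0 - s) 0 = 2 * A t0 s" for t0 s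
      using wave_solution_dAlembert[OF s1 X d3, of t0 s] wave_solution_dAlembert[OF s2 X d3, of t0 s] unfolding A by simp
    obtain C where C: "\<And>s. s \<ge> 2 * \<rho> \<Longrightarrow> (\<integral>x. (Phi (dS X) x s)\<^sup>2 \<partial>lborel) \<le> C"
      using vanishing_L2_bounded[OF dim \<rho> W] by blast
    define C0 where "C0 = (\<integral>x. (Phi (dS X) x 0)\<^sup>2 \<partial>lborel)"
    have bound: "\<bar>A t s\<bar> \<le> sqrt (N t) * sqrt (\<integral>x. (Phi (dS X) x s)\<^sup>2 \<partial>lborel)" for t s
      unfolding A_def N_def by (rule L2_Cauchy_Schwarz[OF z2 vanishing_L2_bound(1)[OF W]])
    have Nn: "N t \<ge> 0" for t by (simp add: N_def)
    \<comment> \<open>d'Alembert's identity centred at \<open>t - s\<close>: all solution times on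
      the right tend to \<open>- \<infinity>\<close> as \<open>s\<close> grows, where
      \<open>N\<close> tends to 0, while the test wave stays bounded in \<open>L^2\<close>.\<close>
    have le: "\<bar>A t 0\<bar> \<le> 2 * (sqrt (N (t - s)) * sqrt C) + sqrt (N (t - 2 * s)) * sqrt C0" if s: "s \<ge> 2 * \<rho>" for s
    proof -
      have "A t 0 = 2 * A (t - s) s - A (t - 2 * s) 0" using dal[of "t - s" s] by simp
      moreover have "\<bar>A (t - s) s\<bar> \<le> sqrt (N (t - s)) * sqrt C"
        by (rule order_trans[OF bound mult_left_mono[OF real_sqrt_le_mono[OF C[OF s]]]]) (simp add: Nn)
      moreover have "\<bar>A (t - 2 * s) 0\<bar> \<le> sqrt (N (t - 2 * s)) * sqrt C0"
        unfolding C0_def by (rule bound)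
      ultimately show ?thesis by linarith
    qed
    have f1: "filterlim (\<lambda>s. t - s) at_bot at_top"
      unfolding filterlim_at_bot eventually_at_top_linorder
    proof (intro allI)
      fix Z show "\<exists>n. \<forall>s\<ge>n. t - s \<le> Z" by (intro exI[of _ "t - Z"]) auto
    qed
    have f2: "filterlim (\<lambda>s. t - 2 * s) at_bot at_top"
      unfolding filterlim_at_bot eventually_at_top_linorder
    proof (intro allI)
      fix Z show "\<exists>n. \<forall>s\<ge>n. t - 2 * s \<le> Z" by (intro exI[of _ "(t - Z) / 2"]) auto
    qed
    have "((\<lambda>s. 2 * (sqrt (N (t - s)) * sqrt C) + sqrt (N (t - 2 * s)) * sqrt C0) \<longlongrightarrow>
        2 * (sqrt 0 * sqrt C) + sqrt 0 * sqrt C0) at_top"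
      by (intro tendsto_intros filterlim_compose[OF N f1] filterlim_compose[OF N f2])
    then have "\<bar>A t 0\<bar> \<le> 2 * (sqrt 0 * sqrt C) + sqrt 0 * sqrt C0"
      by (rule tendsto_lowerbound) (use le in \<open>auto simp: eventually_at_top_linorder\<close>)
    then show ?thesis by (simp add: A_def)
  qed
  have z0: "AE x in lborel. z t x = 0" for t
  proof (rule AE_eq_0_if_odd_waves_orthogonal[OF dim _ _ orth])
    show "z t \<in> borel_measurable borel" using z2[of t] by (simp add: mem_Lp_def)
    show "integrable lborel (\<lambda>x. z t x * indicator (ball 0 \<rho>) x)" for \<rho>
      by (rule mem_Lp_locally_integrable[OF z2 two])
  qed
  then show "AE x in lborel. v t x = V t x" by (auto simp: z_def)
  define w where "w x = u t x - U t x" for x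
  have wq: "(\<integral>x. w x * Phi G x s \<partial>lborel) = (\<integral>x. u t x * Phi G x s \<partial>lborel) - (\<integral>x. U t x * Phi G x s \<partial>lborel)"
    and iw: "integrable lborel (\<lambda>x. w x * Phi G x s)" if "vanishing \<rho> G" for \<rho> G s
    unfolding w_def left_diff_distrib
    by (rule Bochner_Integration.integral_diff Bochner_Integration.integrable_diff,
        (rule vanishing_integrable[OF that _ p], rule sol)+)+
  have dw: "((\<lambda>s. \<integral>x. w x * Phi G x s \<partial>lborel) has_real_derivative (\<integral>x. w x * Phi (dS G) x s \<partial>lborel)) (at s)"
    if "vanishing \<rho> G" for \<rho> G s
    unfolding wq[OF that] wq[OF vanishing_dS[OF that]]
    by (intro DERIV_diff vanishing_pairing_derivative[OF that _ p] sol)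
  \<comment> \<open>As \<open>v\<close> and \<open>V\<close> agree at all times, so do the time
    derivatives of their pairings, hence the gradient pairings of \<open>u\<close> and
    \<open>U\<close>: tested on odd waves, \<open>w\<close> is weakly harmonic.\<close>
  have lap: "(\<integral>x. w x * Phi (dS (dS X)) x s \<partial>lborel) = 0" if X: "odd_wave \<rho> X" for \<rho> X s
  proof -
    have Vn: "vanishing \<rho> X" using X by (simp add: odd_wave_def)
    let ?\<phi> = "\<lambda>x. Phi X x s"
    have "(\<integral>x. v r x * ?\<phi> x \<partial>lborel) = (\<integral>x. V r x * ?\<phi> x \<partial>lborel)" for r
    proof (rule integral_cong_AE)
      show "AE x in lborel. v r x * ?\<phi> x = V r x * ?\<phi> x" using z0[of r] by (auto simp: z_def)
    qed (use bm Phi_borel_measurable[OF vanishing_profile[OF Vn]] in \<open>auto intro!: borel_measurable_times\<close>)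
    moreover have "((\<lambda>r. \<integral>x. v r x * ?\<phi> x \<partial>lborel) has_real_derivative
        - (\<integral>x. frechet_derivative ?\<phi> (at x) (g t x) \<partial>lborel)) (at t)"
      using s1 vanishing_test_function[OF Vn] unfolding wave_solution_def by blast
    moreover have "((\<lambda>r. \<integral>x. V r x * ?\<phi> x \<partial>lborel) has_real_derivative
        - (\<integral>x. frechet_derivative ?\<phi> (at x) (\<Gamma> t x) \<partial>lborel)) (at t)"
      using s2 vanishing_test_function[OF Vn] unfolding wave_solution_def by blast
    ultimately have "- (\<integral>x. frechet_derivative ?\<phi> (at x) (g t x) \<partial>lborel) = - (\<integral>x. frechet_derivative ?\<phi> (at x) (\<Gamma> t x) \<partial>lborel)"
      using DERIV_unique by (simp only:)
    then show ?thesis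
      unfolding weak_gradient_pairing(2)[OF sol(3) Vn sol(1) p sol(2)] weak_gradient_pairing(2)[OF sol(7) Vn sol(5) p sol(6)]
        wq[OF vanishing_dS[OF vanishing_dS[OF Vn]]] by simp
  qed
  have wbm: "w \<in> borel_measurable borel" unfolding w_def using bm by (intro borel_measurable_diff)
  have wp: "integrable lborel (\<lambda>x. \<bar>w x\<bar> powr ?p)"
  proof (rule Bochner_Integration.integrable_bound)
    show "integrable lborel (\<lambda>x. 2 powr ?p * (\<bar>u t x\<bar> powr ?p + \<bar>U t x\<bar> powr ?p))"
      using sol(1,5)[of t] unfolding mem_Lp_def real_norm_def
      by (intro integrable_mult_right Bochner_Integration.integrable_add) auto
    show "AE x in lborel. norm (\<bar>w x\<bar> powr ?p) \<le> norm (2 powr ?p * (\<bar>u t x\<bar> powr ?p + \<bar>U t x\<bar> powr ?p))"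
    proof (rule AE_I2)
      fix x
      define M where "M = max \<bar>u t x\<bar> \<bar>U t x\<bar>"
      have "\<bar>w x\<bar> powr ?p \<le> (2 * M) powr ?p"
        using p by (intro powr_mono2) (auto simp: w_def M_def)
      also have "\<dots> = 2 powr ?p * M powr ?p" by (simp only: powr_mult)
      also have "\<dots> \<le> 2 powr ?p * (\<bar>u t x\<bar> powr ?p + \<bar>U t x\<bar> powr ?p)"
        by (intro mult_left_mono) (simp_all add: M_def max_def)
      finally show "norm (\<bar>w x\<bar> powr ?p) \<le> norm (2 powr ?p * (\<bar>u t x\<bar> powr ?p + \<bar>U t x\<bar> powr ?p))" by simp
    qed
  qed (use wbm in measurable)
  have "AE x in lborel. w x = 0"
  proof (rule AE_eq_0_if_odd_waves_orthogonal[OF dim wbm])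
    show "integrable lborel (\<lambda>x. w x * indicator (ball 0 \<rho>) x)" for \<rho>
      unfolding w_def left_diff_distrib
      by (intro Bochner_Integration.integrable_diff mem_Lp_locally_integrable[OF _ p] sol)
    fix \<rho> and X :: "real \<times> 'a \<Rightarrow> real" assume \<rho>: "\<rho> > 0" and X: "odd_wave \<rho> X"
    have Vn: "vanishing \<rho> X" using X by (simp add: odd_wave_def)
    \<comment> \<open>By \<open>lap\<close> the second derivative of \<open>f\<close> is 0, and
      oddness of the wave removes the constant term; the slope \<open>f' 0\<close> is the pairing
      that has to vanish.\<close>
    define f where "f s = (\<integral>x. w x * Phi X x s \<partial>lborel)" for s
    define f' where "f' s = (\<integral>x. w x * Phi (dS X) x s \<partial>lborel)" for s
    have f: "(f has_real_derivative f' s) (at s)" for s unfolding f_def f'_def by (rule dw[OF Vn])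
    have "(f' has_real_derivative 0) (at s)" for s
      using dw[OF vanishing_dS[OF Vn], of s] lap[OF X] by (simp add: f'_def[abs_def])
    then have f'c: "f' s = f' 0" for s using DERIV_isconst_all by blast
    have D: "((\<lambda>s. f s - f' 0 * s) has_real_derivative f' s - f' 0 * 1) (at s)" for s
      by (intro DERIV_diff f DERIV_cmult DERIV_ident)
    have "((\<lambda>s. f s - f' 0 * s) has_real_derivative 0) (at s)" for s using D[of s] f'c[of s] by simp
    then have "f s - f' 0 * s = f 0 - f' 0 * 0" for s using DERIV_isconst_all[of "\<lambda>s. f s - f' 0 * s"] by blast
    moreover have "f 0 = 0"
    proof -
      have "Phi X x 0 = 0" for x using X minus_zero unfolding odd_wave_def by (metis add.inverse_neutral equal_neg_zero)
      then show ?thesis by (simp add: f_def)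
    qed
    ultimately have "f s = f' 0 * s" for s by (metis diff_0_right eq_iff_diff_eq_0 mult_zero_right)
    then have "f' 0 = 0"
      by (intro odd_wave_pairing_bound[OF dim \<rho> X wbm wp iw[OF Vn]]) (simp add: f_def)
    then show "(\<integral>x. w x * Phi (dS X) x 0 \<partial>lborel) = 0" by (simp add: f'_def)
  qed
  then show "AE x in lborel. u t x = U t x" by (auto simp: w_def)
qed

section \<open>From the radiation integral to the formula for the data\<close>

text \<open>A profile is arbitrary at \<open>x = 0\<close>, so its value there is fixed to obtain
  measurability; integrals over the sphere do not see the change.\<close>

lemma cyl_cutoff_borel:
  fixes F :: "real \<times> 'a::euclidean_space \<Rightarrow> real"
  assumes "profile R F"
  shows "(\<lambda>p. if p \<in> cyl then F p else 0) \<in> borel_measurable borel"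
  by (rule borel_measurable_continuous_on_if[OF _ profile_continuous_on[OF assms]]) (auto intro: borel_open open_cyl)

lemma nn_integral_polar_square:
  fixes z :: "'a::euclidean_space \<Rightarrow> real"
  assumes dim: "DIM('a) = 2 * m + 3" and [measurable]: "z \<in> borel_measurable borel"
  shows "(\<integral>\<^sup>+x. ennreal ((z x)\<^sup>2) \<partial>lborel) =
    (\<integral>\<^sup>+r\<in>{0<..}. (\<integral>\<^sup>+\<theta>. ennreal ((r ^ Suc m * z (r *\<^sub>R \<theta>))\<^sup>2) \<partial>sphere_measure) \<partial>lborel)"
proof -
  have "(\<integral>\<^sup>+x. ennreal ((z x)\<^sup>2) \<partial>lborel) = (\<integral>\<^sup>+r. indicator {0<..} r * ennreal (r ^ (DIM('a) - 1)) *
      (\<integral>\<^sup>+\<theta>. ennreal ((z (r *\<^sub>R \<theta>))\<^sup>2) \<partial>sphere_measure) \<partial>lborel)"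
    by (rule nn_integral_polar) measurable
  also have "\<dots> = (\<integral>\<^sup>+r\<in>{0<..}. (\<integral>\<^sup>+\<theta>. ennreal ((r ^ Suc m * z (r *\<^sub>R \<theta>))\<^sup>2) \<partial>sphere_measure) \<partial>lborel)"
  proof (rule nn_integral_cong)
    fix r :: real
    have [measurable]: "(\<lambda>\<theta>. z (r *\<^sub>R \<theta>)) \<in> borel_measurable (sphere_measure :: 'a measure)"
      by (rule borel_measurable_sphere_measureI) measurable
    have sq: "ennreal ((r ^ Suc m * z (r *\<^sub>R \<theta>))\<^sup>2) = ennreal (r ^ (DIM('a) - 1)) * ennreal ((z (r *\<^sub>R \<theta>))\<^sup>2)"
      if "r > 0" for \<theta>
    proof -
      have "DIM('a) - 1 = 2 * Suc m" using dim by simp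
      then have "r ^ (DIM('a) - 1) = (r ^ Suc m)\<^sup>2" by (simp only: power_mult[symmetric] mult.commute)
      then show ?thesis using that by (simp only: power_mult_distrib ennreal_mult'' zero_le_power2)
    qed
    show "indicator {0<..} r * ennreal (r ^ (DIM('a) - 1)) * (\<integral>\<^sup>+\<theta>. ennreal ((z (r *\<^sub>R \<theta>))\<^sup>2) \<partial>sphere_measure) =
        (\<integral>\<^sup>+\<theta>. ennreal ((r ^ Suc m * z (r *\<^sub>R \<theta>))\<^sup>2) \<partial>sphere_measure) * indicator {0<..} r"
      by (cases "r > 0") (simp_all only: sq nn_integral_cmult[symmetric], simp_all add: nn_integral_cmult mult.commute)
  qed
  finally show ?thesis .
qed

text \<open>The triangle inequality through the common profile in polar coordinates, where
  \<open>r ^ (d - 1)\<close> is the square of the amplitude factor \<open>r ^ Suc m\<close>. The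
  gradient terms only enlarge the upper bound.\<close>

lemma nn_integral_diff_le_radiation_defect:
  fixes F :: "real \<times> 'a::euclidean_space \<Rightarrow> real"
  assumes dim: "DIM('a) = 2 * m + 3" and F: "profile R F"
    and [measurable]: "v \<in> borel_measurable borel" "V \<in> borel_measurable borel"
      "g \<in> borel_measurable borel" "\<Gamma> \<in> borel_measurable borel"
  shows "(\<integral>\<^sup>+x. ennreal ((v x - V x)\<^sup>2) \<partial>lborel) \<le> 2 * (radiation_defect v g F t + radiation_defect V \<Gamma> F t)"
proof -
  define H where "H p = (if p \<in> cyl then F p else 0)" for p
  have [measurable]: "H \<in> borel_measurable borel" unfolding H_def by (rule cyl_cutoff_borel[OF F])
  define J where "J w h r \<theta> = ennreal ((r ^ Suc m * w (r *\<^sub>R \<theta>) - H (r + t, \<theta>))\<^sup>2 + (r ^ Suc m * (\<theta> \<bullet> h (r *\<^sub>R \<theta>)) - H (r + t, \<theta>))\<^sup>2)"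
    for w and h :: "'a \<Rightarrow> 'a" and r \<theta>
  have [measurable]: "(\<lambda>\<omega>. \<omega>) \<in> (sphere_measure :: 'a measure) \<rightarrow>\<^sub>M borel" by (rule measurable_ident_sphere_measure)
  have Jm: "(\<lambda>(r, \<theta>). J w h r \<theta>) \<in> borel_measurable (lborel \<Otimes>\<^sub>M (sphere_measure :: 'a measure))"
    if [measurable]: "w \<in> borel_measurable borel" "h \<in> borel_measurable borel" for w h
  proof -
    have [measurable]: "(\<lambda>p. snd p) \<in> (lborel \<Otimes>\<^sub>M (sphere_measure :: 'a measure)) \<rightarrow>\<^sub>M borel"
      by (rule measurable_compose[OF measurable_snd measurable_ident_sphere_measure])
    have [measurable]: "(\<lambda>p. fst p) \<in> (lborel \<Otimes>\<^sub>M (sphere_measure :: 'a measure)) \<rightarrow>\<^sub>M borel"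
      by (rule measurable_compose[OF measurable_fst]) simp
    show ?thesis unfolding J_def case_prod_beta by measurable
  qed
  have Jr: "J w h r \<in> borel_measurable (sphere_measure :: 'a measure)"
    if "w \<in> borel_measurable borel" "h \<in> borel_measurable borel" for w h r
    using measurable_compose_Pair1[OF _ Jm[OF that], of r] by simp
  have Ji: "(\<lambda>r. (\<integral>\<^sup>+\<theta>. J w h r \<theta> \<partial>sphere_measure) * indicator {0<..} r) \<in> borel_measurable lborel"
    if "w \<in> borel_measurable borel" "h \<in> borel_measurable borel" for w h
    using sphere_measure.borel_measurable_nn_integral_fst[OF Jm[OF that]] by simp
  have rd: "radiation_defect w h F t = (\<integral>\<^sup>+r\<in>{0<..}. (\<integral>\<^sup>+\<theta>. J w h r \<theta> \<partial>sphere_measure) \<partial>lborel)" for w h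
    unfolding radiation_defect_def
  proof (intro nn_integral_cong)
    fix r :: real
    show "(\<integral>\<^sup>+\<theta>. ennreal (\<bar>r powr ((real DIM('a) - 1) / 2) * w (r *\<^sub>R \<theta>) - F (r + t, \<theta>)\<bar>\<^sup>2 +
          \<bar>r powr ((real DIM('a) - 1) / 2) * (\<theta> \<bullet> h (r *\<^sub>R \<theta>)) - F (r + t, \<theta>)\<bar>\<^sup>2) \<partial>sphere_measure) * indicator {0<..} r =
        (\<integral>\<^sup>+\<theta>. J w h r \<theta> \<partial>sphere_measure) * indicator {0<..} r"
    proof (cases "r > 0")
      case True
      have "F (r + t, \<theta>) = H (r + t, \<theta>)" if "\<theta> \<in> space sphere_measure" for \<theta> :: 'a
        using that by (auto simp: H_def)
      then show ?thesis
        unfolding powr_half_dim[OF dim True] J_def power2_abs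
        by (intro arg_cong2[where f="(*)"] nn_integral_cong refl) simp
    qed simp
  qed
  have "(\<integral>\<^sup>+x. ennreal ((v x - V x)\<^sup>2) \<partial>lborel) =
      (\<integral>\<^sup>+r\<in>{0<..}. (\<integral>\<^sup>+\<theta>. ennreal ((r ^ Suc m * (v (r *\<^sub>R \<theta>) - V (r *\<^sub>R \<theta>)))\<^sup>2) \<partial>sphere_measure) \<partial>lborel)"
    by (rule nn_integral_polar_square[OF dim]) measurable
  also have "\<dots> \<le> (\<integral>\<^sup>+r\<in>{0<..}. (\<integral>\<^sup>+\<theta>. 2 * (J v g r \<theta> + J V \<Gamma> r \<theta>) \<partial>sphere_measure) \<partial>lborel)"
  proof (intro nn_integral_mono mult_right_mono)
    fix r :: real and \<theta> :: 'a
    define a b c a' b' where "a = r ^ Suc m * v (r *\<^sub>R \<theta>)" and "b = r ^ Suc m * V (r *\<^sub>R \<theta>)" and "c = H (r + t, \<theta>)"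
      and "a' = r ^ Suc m * (\<theta> \<bullet> g (r *\<^sub>R \<theta>))" and "b' = r ^ Suc m * (\<theta> \<bullet> \<Gamma> (r *\<^sub>R \<theta>))"
    have "(a - b)\<^sup>2 \<le> 2 * (((a - c)\<^sup>2 + (a' - c)\<^sup>2) + ((b - c)\<^sup>2 + (b' - c)\<^sup>2))"
      using zero_le_power2[of "(a - c) + (b - c)"] zero_le_power2[of "a' - c"] zero_le_power2[of "b' - c"]
      by (simp add: power2_eq_square algebra_simps)
    then have "ennreal ((a - b)\<^sup>2) \<le> ennreal (2 * (((a - c)\<^sup>2 + (a' - c)\<^sup>2) + ((b - c)\<^sup>2 + (b' - c)\<^sup>2)))"
      by (rule ennreal_leI)
    also have "\<dots> = 2 * (J v g r \<theta> + J V \<Gamma> r \<theta>)"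
      unfolding J_def a_def[symmetric] b_def[symmetric] c_def[symmetric] a'_def[symmetric] b'_def[symmetric]
      by (simp add: ennreal_mult'' ennreal_plus)
    finally show "ennreal ((r ^ Suc m * (v (r *\<^sub>R \<theta>) - V (r *\<^sub>R \<theta>)))\<^sup>2) \<le> 2 * (J v g r \<theta> + J V \<Gamma> r \<theta>)"
      by (simp only: a_def b_def right_diff_distrib)
  qed simp
  also have "\<dots> = (\<integral>\<^sup>+r. 2 * ((\<integral>\<^sup>+\<theta>. J v g r \<theta> \<partial>sphere_measure) * indicator {0<..} r +
      (\<integral>\<^sup>+\<theta>. J V \<Gamma> r \<theta> \<partial>sphere_measure) * indicator {0<..} r) \<partial>lborel)"
  proof (rule nn_integral_cong)
    fix r :: real
    have "(\<integral>\<^sup>+\<theta>. 2 * (J v g r \<theta> + J V \<Gamma> r \<theta>) \<partial>sphere_measure) = 2 * (\<integral>\<^sup>+\<theta>. J v g r \<theta> + J V \<Gamma> r \<theta> \<partial>sphere_measure)"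
      by (rule nn_integral_cmult) (intro borel_measurable_add Jr; measurable)
    also have "(\<integral>\<^sup>+\<theta>. J v g r \<theta> + J V \<Gamma> r \<theta> \<partial>sphere_measure) = (\<integral>\<^sup>+\<theta>. J v g r \<theta> \<partial>sphere_measure) + (\<integral>\<^sup>+\<theta>. J V \<Gamma> r \<theta> \<partial>sphere_measure)"
      by (rule nn_integral_add; rule Jr; measurable)
    finally show "(\<integral>\<^sup>+\<theta>. 2 * (J v g r \<theta> + J V \<Gamma> r \<theta>) \<partial>sphere_measure) * indicator {0<..} r =
      2 * ((\<integral>\<^sup>+\<theta>. J v g r \<theta> \<partial>sphere_measure) * indicator {0<..} r + (\<integral>\<^sup>+\<theta>. J V \<Gamma> r \<theta> \<partial>sphere_measure) * indicator {0<..} r)"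
      by (simp only: distrib_right mult.assoc)
  qed
  also have "\<dots> = 2 * (\<integral>\<^sup>+r. ((\<integral>\<^sup>+\<theta>. J v g r \<theta> \<partial>sphere_measure) * indicator {0<..} r +
      (\<integral>\<^sup>+\<theta>. J V \<Gamma> r \<theta> \<partial>sphere_measure) * indicator {0<..} r) \<partial>lborel)"
    by (rule nn_integral_cmult) (intro borel_measurable_add Ji; measurable)
  also have "\<dots> = 2 * (radiation_defect v g F t + radiation_defect V \<Gamma> F t)"
    unfolding rd by (subst nn_integral_add) (rule Ji refl; measurable)+
  finally show ?thesis .
qed

lemma wave_solution_L2_diff_tendsto_0:
  fixes F :: "real \<times> 'a::euclidean_space \<Rightarrow> real"
  assumes dim: "DIM('a) = 2 * m + 3" and F: "profile R F"
    and s1: "wave_solution u g v" and s2: "wave_solution U \<Gamma> V"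
    and r1: "((\<lambda>t. radiation_defect (v t) (g t) F t) \<longlongrightarrow> 0) at_bot"
    and r2: "((\<lambda>t. radiation_defect (V t) (\<Gamma> t) F t) \<longlongrightarrow> 0) at_bot"
  shows "((\<lambda>t. \<integral>x. (v t x - V t x)\<^sup>2 \<partial>lborel) \<longlongrightarrow> 0) at_bot"
proof -
  have sol: "mem_Lp 2 lborel (g t)" "mem_Lp 2 lborel (v t)" "mem_Lp 2 lborel (\<Gamma> t)" "mem_Lp 2 lborel (V t)" for t
    using s1 s2 by (auto simp: wave_solution_def H1dot_grad_def)
  have bm: "g t \<in> borel_measurable borel" "v t \<in> borel_measurable borel"
    "\<Gamma> t \<in> borel_measurable borel" "V t \<in> borel_measurable borel" for t
    using sol[of t] by (auto simp: mem_Lp_def)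
  have "((\<lambda>t. 2 * (radiation_defect (v t) (g t) F t + radiation_defect (V t) (\<Gamma> t) F t)) \<longlongrightarrow> 2 * (0 + 0)) at_bot"
    by (intro ennreal_tendsto_cmult tendsto_add r1 r2) simp
  then have up: "((\<lambda>t. 2 * (radiation_defect (v t) (g t) F t + radiation_defect (V t) (\<Gamma> t) F t)) \<longlongrightarrow> 0) at_bot" by simp
  have eq: "(\<integral>\<^sup>+x. ennreal ((v t x - V t x)\<^sup>2) \<partial>lborel) = ennreal (\<integral>x. (v t x - V t x)\<^sup>2 \<partial>lborel)" for t
    by (rule nn_integral_eq_integral) (use mem_Lp_2_diff[OF sol(2,4)] in \<open>auto simp: mem_Lp_2_iff\<close>)
  have "((\<lambda>t. ennreal (\<integral>x. (v t x - V t x)\<^sup>2 \<partial>lborel)) \<longlongrightarrow> ennreal 0) at_bot"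
    unfolding ennreal_0
  proof (rule tendsto_sandwich[OF _ _ tendsto_const up])
    show "\<forall>\<^sub>F t in at_bot. ennreal (\<integral>x. (v t x - V t x)\<^sup>2 \<partial>lborel) \<le> 2 * (radiation_defect (v t) (g t) F t + radiation_defect (V t) (\<Gamma> t) F t)"
      unfolding eq[symmetric]
      by (intro always_eventually allI nn_integral_diff_le_radiation_defect[OF dim F] bm)
  qed simp
  then show ?thesis by (subst (asm) tendsto_ennreal_iff) simp_all
qed

text \<open>Local extensions of \<open>G\<close> are composed with the projection of
  \<open>x\<close> to \<open>x / |x|\<close>. The projected point lies on the cylinder, where every
  extension equals \<open>G\<close>, so the local pieces agree without a partition of unity.\<close>

lemma profile_of_smooth_on_cylinder:
  fixes G :: "real \<times> 'a::euclidean_space \<Rightarrow> real"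
  assumes G: "smooth_on_cylinder G" and supp: "closure {p \<in> UNIV \<times> sphere 0 1. G p \<noteq> 0} \<subseteq> {-R..R} \<times> sphere 0 1"
  shows "profile R (\<lambda>(s, x). G (s, x /\<^sub>R norm x))"
  unfolding profile_def
proof (intro conjI allI impI)
  let ?N = "\<lambda>p :: real \<times> 'a. (fst p, snd p /\<^sub>R norm (snd p))"
  have contN: "continuous_on cyl ?N" by (intro continuous_intros) auto
  have smN: "smooth_on cyl (\<lambda>p. ?N p \<bullet> b)" for b :: "real \<times> 'a"
  proof -
    have "smooth_on cyl (\<lambda>p. fst p * fst b + inverse (norm (snd p)) * (snd p \<bullet> snd b))"
      by (intro smooth_on_add smooth_on_mult smooth_on_const smooth_on_cyl_compose_snd[OF smooth_on_inverse_norm]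
        smooth_on_cyl_compose_snd[OF smooth_on_bounded_linear[OF bounded_linear_inner_left]]
        smooth_on_bounded_linear[OF bounded_linear_fst])
    then show ?thesis by (simp add: inner_prod_def)
  qed
  show "smooth_on cyl (\<lambda>(s, x). G (s, x /\<^sub>R norm x))"
  proof (rule smooth_on_local[OF open_cyl])
    fix p :: "real \<times> 'a" assume p: "p \<in> cyl"
    then have "?N p \<in> UNIV \<times> sphere 0 1" by (auto simp: mem_Times_iff)
    with G obtain U E where U: "open U" "?N p \<in> U" "smooth_on U E" "\<And>q. q \<in> U \<inter> (UNIV \<times> sphere 0 1) \<Longrightarrow> E q = G q"
      unfolding smooth_on_cylinder_def by metis
    let ?M = "cyl \<inter> ?N -` U"
    have M: "open ?M" using continuous_openin_preimage_gen[OF contN U(1)] unfolding openin_open_eq[OF open_cyl] by (rule conjunct1)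
    have "smooth_on ?M (\<lambda>q. E (?N q))"
      by (rule smooth_on_compose[OF M smooth_on_subset[OF smN Int_lower1] _ U(3)]) blast
    then have "smooth_on ?M (\<lambda>(s, x). G (s, x /\<^sub>R norm x))"
      by (rule smooth_on_cong[OF M, rotated]) (auto intro!: U(4))
    with M p U(2) show "\<exists>N. open N \<and> p \<in> N \<and> smooth_on N (\<lambda>(s, x). G (s, x /\<^sub>R norm x))" by blast
  qed
next
  fix s :: real and x :: 'a and c :: real assume "x \<noteq> 0" "c > 0"
  then show "(case (s, c *\<^sub>R x) of (s, x) \<Rightarrow> G (s, x /\<^sub>R norm x)) = (case (s, x) of (s, x) \<Rightarrow> G (s, x /\<^sub>R norm x))"
    by (simp add: mult.commute[of "inverse c * _"] mult.assoc[symmetric])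
next
  fix s :: real and x :: 'a assume x: "x \<noteq> 0" and s: "\<bar>s\<bar> > R"
  have "(s, x /\<^sub>R norm x) \<notin> {p \<in> UNIV \<times> sphere 0 1. G p \<noteq> 0}"
    using supp closure_subset[of "{p \<in> UNIV \<times> sphere 0 1. G p \<noteq> 0}"] s by fastforce
  then show "(case (s, x) of (s, x) \<Rightarrow> G (s, x /\<^sub>R norm x)) = 0" using x by simp
qed

lemma funpow_deriv_eq_funpow_dS:
  fixes F :: "real \<times> 'a::euclidean_space \<Rightarrow> real"
  assumes F: "profile R F" and x: "x \<noteq> 0"
  shows "(deriv ^^ k) (\<lambda>s. F (s, x)) = (\<lambda>s. (dS ^^ k) F (s, x))"
proof (induction k)
  case (Suc k)
  show ?case
    using DERIV_imp_deriv[OF profile_has_real_derivative[OF profile_funpow_dS[OF F] x]] by (simp add: Suc fun_eq_iff)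
qed simp

lemma mem_Lp_2_of_profile:
  fixes F :: "real \<times> 'a::euclidean_space \<Rightarrow> real"
  assumes F: "profile R F" and eq: "\<And>s \<theta>. norm \<theta> = 1 \<Longrightarrow> G (s, \<theta>) = F (s, \<theta>)"
  shows "mem_Lp 2 (lborel \<Otimes>\<^sub>M (sphere_measure :: 'a measure)) G"
proof -
  let ?M = "lborel \<Otimes>\<^sub>M (sphere_measure :: 'a measure)"
  interpret S: pair_sigma_finite lborel "sphere_measure :: 'a measure" ..
  have "(\<lambda>p. (fst p, snd p)) \<in> ?M \<rightarrow>\<^sub>M borel \<Otimes>\<^sub>M borel"
    by (intro measurable_Pair measurable_compose[OF measurable_snd measurable_ident_sphere_measure]
      measurable_compose[OF measurable_fst]) simp
  then have id: "(\<lambda>p. p) \<in> ?M \<rightarrow>\<^sub>M (borel :: (real \<times> 'a) measure)" by (simp add: borel_prod)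
  have "(\<lambda>p. if p \<in> cyl then F p else 0) \<in> borel_measurable ?M"
    using measurable_compose[OF id cyl_cutoff_borel[OF F]] .
  then have G: "G \<in> borel_measurable ?M"
    by (rule measurable_cong[THEN iffD1, rotated]) (auto simp: space_pair_measure eq)
  obtain M where M: "M \<ge> 0" "\<And>s x. x \<noteq> 0 \<Longrightarrow> \<bar>F (s, x)\<bar> \<le> M" using profile_bounded[OF F] by blast
  have S: "sphere 0 1 \<in> sets (sphere_measure :: 'a measure)" using sets.top[of "sphere_measure :: 'a measure"] by simp
  let ?A = "{-R..R} \<times> (sphere 0 1 :: 'a set)"
  have A: "?A \<in> sets ?M" using S by (intro pair_measureI) auto
  have "emeasure ?M ?A = emeasure lborel {-R..R} * emeasure sphere_measure (sphere 0 1 :: 'a set)"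
    using S by (intro sphere_measure.emeasure_pair_measure_Times) auto
  also have "\<dots> < \<infinity>"
    by (simp add: ennreal_mult_less_top emeasure_sphere_measure_space emeasure_lborel_Icc_eq)
  finally have fin: "emeasure ?M ?A < \<infinity>" .
  have "integrable ?M (\<lambda>p. (norm (G p))\<^sup>2)"
  proof (rule Bochner_Integration.integrable_bound)
    show "integrable ?M (\<lambda>p. M\<^sup>2 * indicator ?A p)"
      by (intro integrable_mult_right integrable_real_indicator A fin)
    show "(\<lambda>p. (norm (G p))\<^sup>2) \<in> borel_measurable ?M" using G by measurable
    show "AE p in ?M. norm ((norm (G p))\<^sup>2) \<le> norm (M\<^sup>2 * indicator ?A p)"
    proof (rule AE_I2)
      fix p :: "real \<times> 'a" assume "p \<in> space ?M"
      then obtain s \<theta> where p: "p = (s, \<theta>)" "norm \<theta> = 1" by (auto simp: space_pair_measure)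
      then have t: "\<theta> \<noteq> 0" by auto
      show "norm ((norm (G p))\<^sup>2) \<le> norm (M\<^sup>2 * indicator ?A p)"
      proof (cases "\<bar>s\<bar> > R")
        case True
        then show ?thesis using p profile_support[OF F t] by (simp add: eq)
      next
        case False
        then have "p \<in> ?A" using p by (auto simp: abs_le_iff)
        moreover have "(norm (G p))\<^sup>2 \<le> M\<^sup>2" using M(2)[OF t, of s] p by (intro power_mono) (auto simp: eq)
        ultimately show ?thesis by simp
      qed
    qed
  qed
  with G show ?thesis by (simp add: mem_Lp_2_iff)
qed

text \<open>The factor \<open>c\<close> goes into the profile for the wave equation:
  \<open>c F\<close> generates the solution, and by \<open>plane_waves_radiation\<close> its
  radiation profile is \<open>F\<close>. Two solutions with this profile have time derivatives that
  approach each other in \<open>L^2\<close>, and \<open>wave_solution_unique\<close> identifies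
  their data.\<close>

lemma T_minus_plane_waves:
  fixes F :: "real \<times> 'a::euclidean_space \<Rightarrow> real"
  assumes dim: "DIM('a) = 2 * m + 3" and R: "R > 0" and F: "profile R F"
    and eq: "\<And>s \<theta>. norm \<theta> = 1 \<Longrightarrow> G (s, \<theta>) = F (s, \<theta>)"
  defines "u0 \<equiv> \<lambda>x. 1 / (2 * pi) ^ Suc m * Phi ((dS ^^ m) F) x 0"
    and "u1 \<equiv> \<lambda>x. 1 / (2 * pi) ^ Suc m * Phi ((dS ^^ Suc m) F) x 0"
  shows "T_minus u0 u1 G"
    and "T_minus w0 w1 G \<Longrightarrow> AE x in lborel. w0 x = u0 x"
    and "T_minus w0 w1 G \<Longrightarrow> AE x in lborel. w1 x = u1 x"
proof -
  define c where "c = 1 / (2 * pi) ^ Suc m"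
  define U where "U t x = c * Phi ((dS ^^ m) F) x t" for t x
  define V where "V t x = c * Phi ((dS ^^ Suc m) F) x t" for t x
  define \<Gamma> where "\<Gamma> t x = c *\<^sub>R Phi_grad ((dS ^^ Suc m) F) x t" for t x
  have cF: "profile R (\<lambda>p. c * F p)" by (rule profile_scale[OF F])
  have Phi_c: "Phi ((dS ^^ k) (\<lambda>p. c * F p)) x t = c * Phi ((dS ^^ k) F) x t" for k x t
    unfolding Phi_scale[symmetric] by (rule Phi_cong) (rule funpow_dS_scale[OF F])
  have grad_c: "Phi_grad ((dS ^^ k) (\<lambda>p. c * F p)) x t = c *\<^sub>R Phi_grad ((dS ^^ k) F) x t" for k x t
  proof -
    have "Phi (mW i ((dS ^^ k) (\<lambda>p. c * F p))) x t = c * Phi (mW i ((dS ^^ k) F)) x t" for i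
      unfolding Phi_scale[symmetric]
      by (rule Phi_cong) (simp only: mW_def funpow_dS_scale[OF F] mult.left_commute)
    then show ?thesis by (simp add: Phi_grad_def scaleR_sum_right)
  qed
  have sol: "wave_solution U \<Gamma> V"
    using plane_waves_wave_solution[OF dim R cF] unfolding Phi_c grad_c U_def[abs_def] V_def[abs_def] \<Gamma>_def[abs_def] .
  have cd: "x / (2 * pi) ^ Suc m = c * x" "y /\<^sub>R (2 * pi) ^ Suc m = c *\<^sub>R y" for x and y :: 'a
    by (simp_all only: c_def divide_inverse mult.commute mult_1_left)
  have rad: "((\<lambda>t. radiation_defect (V t) (\<Gamma> t) F t) \<longlongrightarrow> 0) at_bot"
    using plane_waves_radiation[OF dim R F] unfolding cd V_def[abs_def] \<Gamma>_def[abs_def] .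
  have u: "u0 = U 0" "u1 = V 0" unfolding u0_def u1_def U_def V_def c_def by (rule refl)+
  have rc: "radiation_defect v g G t = radiation_defect v g F t" for v g t by (rule radiation_defect_cong) (rule eq)
  \<comment> \<open>The radiation integral sees \<open>G\<close> only on the sphere, so there
    \<open>G\<close> may be exchanged for its homogeneous extension \<open>F\<close>; the condition
    that \<open>G\<close> lies in \<open>L^2\<close> stays as it is.\<close>
  have T: "T_minus a0 a1 G \<longleftrightarrow> mem_H1dot a0 \<and> mem_Lp 2 lborel a1 \<and> mem_Lp 2 (lborel \<Otimes>\<^sub>M sphere_measure) G \<and>
     (\<exists>u g v. wave_solution u g v \<and> (AE x in lborel. u 0 x = a0 x) \<and> (AE x in lborel. v 0 x = a1 x) \<and>
        ((\<lambda>t. radiation_defect (v t) (g t) F t) \<longlongrightarrow> 0) at_bot)" for a0 a1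
    unfolding T_minus_def radiation_defect_def[symmetric] rc ..
  have "mem_H1dot (U 0)" "mem_Lp 2 lborel (V 0)"
    using sol by (auto simp: wave_solution_def mem_H1dot_def)
  moreover have "mem_Lp 2 (lborel \<Otimes>\<^sub>M sphere_measure) G" by (rule mem_Lp_2_of_profile[OF F eq])
  ultimately show "T_minus u0 u1 G" unfolding T u using sol rad by (intro conjI exI[of _ U] exI[of _ \<Gamma>] exI[of _ V]) auto
  assume "T_minus w0 w1 G"
  then obtain a g b where a: "wave_solution a g b" "AE x in lborel. a 0 x = w0 x" "AE x in lborel. b 0 x = w1 x"
    "((\<lambda>t. radiation_defect (b t) (g t) F t) \<longlongrightarrow> 0) at_bot"
    unfolding T by blast
  note lim = wave_solution_L2_diff_tendsto_0[OF dim F a(1) sol a(4) rad]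
  show "AE x in lborel. w0 x = u0 x"
    using a(2) wave_solution_unique(2)[OF dim a(1) sol lim, of 0] unfolding u by eventually_elim simp
  show "AE x in lborel. w1 x = u1 x"
    using a(3) wave_solution_unique(1)[OF dim a(1) sol lim, of 0] unfolding u by eventually_elim simp
qed

theorem lemma2p1:
  fixes G :: "real \<times> (real ^ 'n) \<Rightarrow> real" and R :: real and \<mu> :: nat
  assumes "CARD('n) \<ge> 3" and "odd CARD('n)"
    and "real \<mu> = (real CARD('n) - 1) / 2"
    and "smooth_on_cylinder G"
    and "R > 0"
    and "closure {p \<in> UNIV \<times> sphere 0 1. G p \<noteq> 0} \<subseteq> {-R..R} \<times> sphere 0 1"
  shows "(\<exists>u0 u1. T_minus u0 u1 G) \<and>
    (\<forall>u0 u1. T_minus u0 u1 G \<longrightarrow>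
      (AE x in lborel. u0 x = 1 / (2 * pi) ^ \<mu> *
         (\<integral>\<omega>. (deriv ^^ (\<mu> - 1)) (\<lambda>s. G (s, \<omega>)) (x \<bullet> \<omega>) \<partial>sphere_measure)) \<and>
      (AE x in lborel. u1 x = 1 / (2 * pi) ^ \<mu> *
         (\<integral>\<omega>. (deriv ^^ \<mu>) (\<lambda>s. G (s, \<omega>)) (x \<bullet> \<omega>) \<partial>sphere_measure)))"
proof -
  \<comment> \<open>Odd \<open>d \<ge> 3\<close> is \<open>2 * m + 3\<close>, so
    \<open>\<mu> - 1 = m\<close> involves no truncation.\<close>
  obtain m where m: "CARD('n) = 2 * m + 3"
  proof -
    obtain k where k: "CARD('n) = 2 * k + 1" using assms(2) by (elim oddE)
    then have "CARD('n) = 2 * (k - 1) + 3" using assms(1) by simp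
    then show thesis by (rule that)
  qed
  have \<mu>: "\<mu> = Suc m" "\<mu> - 1 = m"
    using assms(3) m by simp_all
  have dim: "DIM(real ^ 'n) = 2 * m + 3" using m by simp
  define F where "F = (\<lambda>(s, x). G (s, x /\<^sub>R norm x))"
  have F: "profile R F" unfolding F_def by (rule profile_of_smooth_on_cylinder[OF assms(4,6)])
  have eq: "G (s, \<theta>) = F (s, \<theta>)" if "norm \<theta> = 1" for s \<theta>
    using that by (simp add: F_def)
  \<comment> \<open>The data are the waves at \<open>t = 0\<close>; on the sphere the slices of
    \<open>G\<close> and \<open>F\<close> in \<open>s\<close> coincide, so iterated
    \<open>deriv\<close> becomes iterated \<open>dS\<close>.\<close>
  have int: "(\<integral>\<omega>. (deriv ^^ k) (\<lambda>s. G (s, \<omega>)) (x \<bullet> \<omega>) \<partial>sphere_measure) = Phi ((dS ^^ k) F) x 0" for k x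
    unfolding Phi_def
  proof (intro Bochner_Integration.integral_cong refl)
    fix \<omega> :: "real ^ 'n" assume "\<omega> \<in> space sphere_measure"
    then have \<omega>: "norm \<omega> = 1" "\<omega> \<noteq> 0" by auto
    show "(deriv ^^ k) (\<lambda>s. G (s, \<omega>)) (x \<bullet> \<omega>) = (dS ^^ k) F (x \<bullet> \<omega> + 0, \<omega>)"
      using funpow_deriv_eq_funpow_dS[OF F \<omega>(2), of k] eq[OF \<omega>(1)] by simp
  qed
  show ?thesis
    unfolding \<mu>(2) int unfolding \<mu>(1)
  proof (intro conjI allI impI exI)
    show "T_minus (\<lambda>x. 1 / (2 * pi) ^ Suc m * Phi ((dS ^^ m) F) x 0)
        (\<lambda>x. 1 / (2 * pi) ^ Suc m * Phi ((dS ^^ Suc m) F) x 0) G"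
      by (rule T_minus_plane_waves(1)[OF dim assms(5) F]) (rule eq)
    fix u0 u1 assume T: "T_minus u0 u1 G"
    show "AE x in lborel. u0 x = 1 / (2 * pi) ^ Suc m * Phi ((dS ^^ m) F) x 0"
      by (rule T_minus_plane_waves(2)[OF dim assms(5) F _ T]) (rule eq)
    show "AE x in lborel. u1 x = 1 / (2 * pi) ^ Suc m * Phi ((dS ^^ Suc m) F) x 0"
      by (rule T_minus_plane_waves(3)[OF dim assms(5) F _ T]) (rule eq)
  qed
qed

end
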